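(* The projective class ring $r_p(\mathcal D)$ of $\mathcal D$ is isomorphic, as a ring, to $\mathbb Z[y_0,y_1,\dots,y_5]/J$, where $J$ is the ideal generated by the relations $$y_0^6=1,\qquad y_iy_3^2=2y_iy_0+y_iy_0^2+y_i,\qquad y_jy_{6-j}=y_3^2,\qquad y_ky_l=y_{k+l}+y_{k+l}y_0,$$ for all $i,j,k,l\in\{1,\dots,5\}$ with $k+l\not\equiv 0\bmod 6$, where the index $k+l$ is reduced modulo $6$ to an element of $\{1,\dots,5\}$.
   Context: $\Bbbk$ is an algebraically closed field of characteristic zero, $\xi\in\Bbbk$ a primitive $6$-th root of unity, $\lambda=(\xi-1)(\xi+1)^{-1}$, and $\theta\in\Bbbk$ with $\theta^2=\xi^2$. $\mathcal C$ is the $12$-dimensional Hopf algebra generated as an algebra by $a,b$ with $a^6=1$, $b^2=0$, $ba=\xi ab$, and $\Delta(a)=a\otimes a+(\xi^4+\xi^5)\,b\otimes ba^3$, $\Delta(b)=b\otimes a^4+a\otimes b$, $\epsilon(a)=1$, $\epsilon(b)=0$, $S(a)=a^5$, $S(b)=\xi^{-2}ba$. $\mathcal D=\mathcal D(\mathcal C^{cop})$ is the Drinfeld double of $\mathcal C^{cop}$; it is a $144$-dimensional Hopf algebra. Explicitly, it is generated as an algebra by $a,b,g,x$ with relations $a^6=1$, $b^2=0$, $ba=\xi ab$, $g^6=1$, $x^2=1-g^2$, $gx=-xg$, $ag=ga$, $bg=-gb$, $ax+\xi^{-2}xa=\lambda^{-1}\theta\xi^{-2}(ba^3-gb)$, $bx+\xi^{-2}xb=\theta\xi^{-2}(a^4-ga)$,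 and comultiplication $\Delta(a)=a\otimes a+(\xi^4+\xi^5)\,ba^3\otimes b$, $\Delta(b)=a^4\otimes b+b\otimes a$, $\Delta(g)=g\otimes g$, $\Delta(x)=1\otimes x+x\otimes g$. The Green ring $r(\mathcal D)$ is the abelian group generated by isomorphism classes $[V]$ of finite-dimensional left $\mathcal D$-modules modulo $[V\oplus W]=[V]+[W]$, with multiplication $[V][W]=[V\otimes W]$. The projective class ring $r_p(\mathcal D)$ is the subring of $r(\mathcal D)$ generated by the classes of simple modules and projective modules. *)

theory Defs
  imports
    "HOL-Algebra.Algebra"
    "HOL-Algebra.Algebraic_Closure_Type"
    "HOL-Library.Poly_Mapping"
    "HOL-Library.Product_Plus"
    "HOL-Library.Numeral_Type"
    "HOL-Computational_Algebra.Polynomial"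
    "Jordan_Normal_Form.Matrix"
begin

section \<open>The free algebra on four generators\<close>

datatype gen = Gen_a | Gen_b | Gen_g | Gen_x

text \<open>
  Words form the free monoid, written additively: with this instance the convolution product of
  \<^theory>\<open>HOL-Library.Poly_Mapping\<close> makes finitely supported functions on words the free
  associative algebra. The tensor square of the free algebra is the monoid algebra of
  pairs of words (with componentwise concatenation).
\<close>

datatype word = Word (letters: "gen list")

instantiation word :: monoid_add
begin

definition zero_word :: word where "0 = Word []"

definition plus_word :: "word \<Rightarrow> word \<Rightarrow> word" where
  "u + v = Word (letters u @ letters v)"

instance
  by standard (simp_all add: zero_word_def plus_word_def)

end

type_synonym 'k free_algebra = "word \<Rightarrow>\<^sub>0 'k"
type_synonym 'k free_algebra2 = "(word \<times> word) \<Rightarrow>\<^sub>0 'k"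

definition gen :: "gen \<Rightarrow> 'k::field free_algebra" where
  "gen s = Poly_Mapping.single (Word [s]) 1"

definition scal :: "'k::field \<Rightarrow> 'k free_algebra" where
  "scal c = Poly_Mapping.single 0 c"

definition scal2 :: "'k::field \<Rightarrow> 'k free_algebra2" where
  "scal2 c = Poly_Mapping.single 0 c"

definition tens :: "'k::field free_algebra \<Rightarrow> 'k free_algebra \<Rightarrow> 'k free_algebra2" where
  "tens f g = (\<Sum>u\<in>Poly_Mapping.keys f. \<Sum>v\<in>Poly_Mapping.keys g.
     Poly_Mapping.single (u, v) (Poly_Mapping.lookup f u * Poly_Mapping.lookup g v))"

text \<open>
  The extension of a map \<open>\<phi>\<close> on generators to an algebra homomorphism into an algebra whose
  scalars are embedded by \<open>\<iota>\<close>.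
\<close>

definition free_extend ::
    "('k::field \<Rightarrow> 'b::ring_1) \<Rightarrow> (gen \<Rightarrow> 'b) \<Rightarrow> 'k free_algebra \<Rightarrow> 'b" where
  "free_extend \<iota> \<phi> f =
     (\<Sum>w\<in>Poly_Mapping.keys f. \<iota> (Poly_Mapping.lookup f w) * prod_list (map \<phi> (letters w)))"


section \<open>The Drinfeld double as a bialgebra\<close>

text \<open>
  The algebra \<open>\<D>\<close> is given by generators and relations, a relation \<open>l = r\<close> being recorded
  as the element \<open>l - r\<close> of the free algebra.
\<close>

definition relations :: "'k::field \<Rightarrow> 'k \<Rightarrow> 'k free_algebra set" where
  "relations \<xi> \<theta> =
    (let a = gen Gen_a; b = gen Gen_b; g = gen Gen_g; x = gen Gen_x;
         lam = (\<xi> - 1) / (\<xi> + 1);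
         \<zeta> = inverse (\<xi> ^ 2)
     in {a ^ 6 - 1,
         b ^ 2,
         b * a - scal \<xi> * a * b,
         g ^ 6 - 1,
         x ^ 2 - (1 - g ^ 2),
         g * x + x * g,
         a * g - g * a,
         b * g + g * b,
         a * x + scal \<zeta> * x * a - scal (inverse lam * \<theta> * \<zeta>) * (b * a ^ 3 - g * b),
         b * x + scal \<zeta> * x * b - scal (\<theta> * \<zeta>) * (a ^ 4 - g * a)})"

definition rel_ideal :: "'k::field \<Rightarrow> 'k \<Rightarrow> 'k free_algebra set" where
  "rel_ideal \<xi> \<theta> = genideal ring_of_type_algebra (relations \<xi> \<theta>)"

definition D_alg :: "'k::field \<Rightarrow> 'k \<Rightarrow> 'k free_algebra set ring" where
  "D_alg \<xi> \<theta> = ring_of_type_algebra Quot rel_ideal \<xi> \<theta>"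

definition D_class :: "'k::field \<Rightarrow> 'k \<Rightarrow> 'k free_algebra \<Rightarrow> 'k free_algebra set" where
  "D_class \<xi> \<theta> f = rel_ideal \<xi> \<theta> +>\<^bsub>ring_of_type_algebra\<^esub> f"

text \<open>
  The comultiplication is lifted to the free algebra; it maps the ideal of relations \<open>I\<close> into
  \<open>I \<otimes> F + F \<otimes> I\<close> and so descends to \<open>\<D>\<close>.
\<close>

fun comult_gen :: "'k::field \<Rightarrow> gen \<Rightarrow> 'k free_algebra2" where
  "comult_gen \<xi> Gen_a = tens (gen Gen_a) (gen Gen_a)
     + scal2 (\<xi> ^ 4 + \<xi> ^ 5) * tens (gen Gen_b * gen Gen_a ^ 3) (gen Gen_b)"
| "comult_gen \<xi> Gen_b = tens (gen Gen_a ^ 4) (gen Gen_b) + tens (gen Gen_b) (gen Gen_a)"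
| "comult_gen \<xi> Gen_g = tens (gen Gen_g) (gen Gen_g)"
| "comult_gen \<xi> Gen_x = tens 1 (gen Gen_x) + tens (gen Gen_x) (gen Gen_g)"

definition comult :: "'k::field \<Rightarrow> 'k free_algebra \<Rightarrow> 'k free_algebra2" where
  "comult \<xi> = free_extend scal2 (comult_gen \<xi>)"

fun counit_gen :: "gen \<Rightarrow> 'k::field" where
  "counit_gen Gen_a = 1"
| "counit_gen Gen_b = 0"
| "counit_gen Gen_g = 1"
| "counit_gen Gen_x = 0"

definition counit :: "'k::field free_algebra \<Rightarrow> 'k" where
  "counit = free_extend (\<lambda>c. c) counit_gen"


section \<open>Finite-dimensional modules\<close>

text \<open>
  A finite-dimensional left \<open>\<D>\<close>-module is a pair \<open>(n, \<rho>)\<close> of a dimension and a unital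
  \<open>\<k>\<close>-algebra homomorphism \<open>\<rho>\<close> from \<open>\<D>\<close> to the \<open>n \<times> n\<close> matrices, i.e. a module structure
  on \<open>\<k>\<^sup>n\<close>; every finite-dimensional module is isomorphic to one of this form.
\<close>

type_synonym 'k rep = "nat \<times> ('k free_algebra set \<Rightarrow> 'k mat)"

definition is_module :: "'k::field \<Rightarrow> 'k \<Rightarrow> 'k rep \<Rightarrow> bool" where
  "is_module \<xi> \<theta> V \<longleftrightarrow>
     snd V \<in> Ring.ring_hom (D_alg \<xi> \<theta>) (ring_mat TYPE('k) (fst V) ()) \<and>
     (\<forall>c. snd V (D_class \<xi> \<theta> (scal c)) = c \<cdot>\<^sub>m 1\<^sub>m (fst V))"

definition module_hom :: "'k::field \<Rightarrow> 'k \<Rightarrow> 'k rep \<Rightarrow> 'k rep \<Rightarrow> 'k mat set" where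
  "module_hom \<xi> \<theta> V W =
     {T \<in> carrier_mat (fst W) (fst V).
        \<forall>d\<in>carrier (D_alg \<xi> \<theta>). T * snd V d = snd W d * T}"

definition module_iso :: "'k::field \<Rightarrow> 'k \<Rightarrow> 'k rep \<Rightarrow> 'k rep \<Rightarrow> bool" where
  "module_iso \<xi> \<theta> V W \<longleftrightarrow>
     (\<exists>T\<in>module_hom \<xi> \<theta> V W. \<exists>S\<in>module_hom \<xi> \<theta> W V.
        S * T = 1\<^sub>m (fst V) \<and> T * S = 1\<^sub>m (fst W))"

definition submodule_of :: "'k::field \<Rightarrow> 'k \<Rightarrow> 'k vec set \<Rightarrow> 'k rep \<Rightarrow> bool" where
  "submodule_of \<xi> \<theta> U V \<longleftrightarrow>
     U \<subseteq> carrier_vec (fst V) \<and> 0\<^sub>v (fst V) \<in> U \<and>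
     (\<forall>u\<in>U. \<forall>v\<in>U. u + v \<in> U) \<and> (\<forall>c. \<forall>u\<in>U. c \<cdot>\<^sub>v u \<in> U) \<and>
     (\<forall>d\<in>carrier (D_alg \<xi> \<theta>). \<forall>u\<in>U. snd V d *\<^sub>v u \<in> U)"

definition simple_module :: "'k::field \<Rightarrow> 'k \<Rightarrow> 'k rep \<Rightarrow> bool" where
  "simple_module \<xi> \<theta> V \<longleftrightarrow>
     is_module \<xi> \<theta> V \<and> fst V \<noteq> 0 \<and>
     (\<forall>U. submodule_of \<xi> \<theta> U V \<longrightarrow> U = {0\<^sub>v (fst V)} \<or> U = carrier_vec (fst V))"

text \<open>
  Projectivity is the lifting property against surjections of finite-dimensional modules. As
  \<open>\<D>\<close> is finite-dimensional, this category contains the regular module, so for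
  finite-dimensional modules it is the same as projectivity among all modules.
\<close>

definition projective_module :: "'k::field \<Rightarrow> 'k \<Rightarrow> 'k rep \<Rightarrow> bool" where
  "projective_module \<xi> \<theta> P \<longleftrightarrow>
     is_module \<xi> \<theta> P \<and>
     (\<forall>M N f g. is_module \<xi> \<theta> M \<longrightarrow> is_module \<xi> \<theta> N \<longrightarrow>
        f \<in> module_hom \<xi> \<theta> M N \<longrightarrow>
        (\<lambda>v. f *\<^sub>v v) ` carrier_vec (fst M) = carrier_vec (fst N) \<longrightarrow>
        g \<in> module_hom \<xi> \<theta> P N \<longrightarrow>
        (\<exists>h\<in>module_hom \<xi> \<theta> P M. f * h = g))"

definition direct_sum :: "'k::field rep \<Rightarrow> 'k rep \<Rightarrow> 'k rep" where
  "direct_sum V W =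
     (fst V + fst W,
      \<lambda>d. four_block_mat (snd V d) (0\<^sub>m (fst V) (fst W)) (0\<^sub>m (fst W) (fst V)) (snd W d))"

definition kronecker :: "'k::field mat \<Rightarrow> 'k mat \<Rightarrow> 'k mat" where
  "kronecker A B =
     mat (dim_row A * dim_row B) (dim_col A * dim_col B)
       (\<lambda>(i, j). A $$ (i div dim_row B, j div dim_col B) * B $$ (i mod dim_row B, j mod dim_col B))"

text \<open>
  The action of an element of the tensor square of the free algebra on the space \<open>V \<otimes> W\<close>,
  where \<open>u \<otimes> v\<close> acts by the Kronecker product of the actions of \<open>u\<close> and \<open>v\<close>.
\<close>

definition act2 ::
    "'k::field \<Rightarrow> 'k \<Rightarrow> 'k rep \<Rightarrow> 'k rep \<Rightarrow> 'k free_algebra2 \<Rightarrow> 'k mat" where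
  "act2 \<xi> \<theta> V W t =
     mat (fst V * fst W) (fst V * fst W)
       (\<lambda>ij. \<Sum>(u, v)\<in>Poly_Mapping.keys t. Poly_Mapping.lookup t (u, v) *
          kronecker (snd V (D_class \<xi> \<theta> (Poly_Mapping.single u 1)))
                    (snd W (D_class \<xi> \<theta> (Poly_Mapping.single v 1))) $$ ij)"

text \<open>
  An element of \<open>\<D>\<close> is a coset of the ideal of relations, and all its representatives act on
  \<open>V \<otimes> W\<close> (respectively on \<open>\<k>\<close>) in the same way.
\<close>

definition tensor_module :: "'k::field \<Rightarrow> 'k \<Rightarrow> 'k rep \<Rightarrow> 'k rep \<Rightarrow> 'k rep" where
  "tensor_module \<xi> \<theta> V W =
     (fst V * fst W, \<lambda>d. the_elem ((\<lambda>f. act2 \<xi> \<theta> V W (comult \<xi> f)) ` d))"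

definition trivial_module :: "'k::field rep" where
  "trivial_module = (1, \<lambda>d. the_elem ((\<lambda>f. counit f \<cdot>\<^sub>m 1\<^sub>m 1) ` d))"


section \<open>The Green ring and the projective class ring\<close>

definition iso_class :: "'k::field \<Rightarrow> 'k \<Rightarrow> 'k rep \<Rightarrow> 'k rep set" where
  "iso_class \<xi> \<theta> V = {W. is_module \<xi> \<theta> W \<and> module_iso \<xi> \<theta> V W}"

definition tensor_class ::
    "'k::field \<Rightarrow> 'k \<Rightarrow> 'k rep set \<Rightarrow> 'k rep set \<Rightarrow> 'k rep set" where
  "tensor_class \<xi> \<theta> C E = (\<Union>V\<in>C. \<Union>W\<in>E. iso_class \<xi> \<theta> (tensor_module \<xi> \<theta> V W))"

text \<open>
  The free abelian group on the isomorphism classes, with the biadditive extension of the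
  tensor product as multiplication.
\<close>

definition free_green_ring :: "'k::field \<Rightarrow> 'k \<Rightarrow> ('k rep set \<Rightarrow>\<^sub>0 int) ring" where
  "free_green_ring \<xi> \<theta> =
     \<lparr>carrier = {c. Poly_Mapping.keys c \<subseteq> iso_class \<xi> \<theta> ` {V. is_module \<xi> \<theta> V}},
      monoid.mult = (\<lambda>c e. frag_extend (\<lambda>C. frag_extend (\<lambda>E. frag_of (tensor_class \<xi> \<theta> C E)) e) c),
      monoid.one = frag_of (iso_class \<xi> \<theta> trivial_module),
      ring.zero = 0,
      ring.add = (+)\<rparr>"

definition direct_sum_relations :: "'k::field \<Rightarrow> 'k \<Rightarrow> ('k rep set \<Rightarrow>\<^sub>0 int) set" where
  "direct_sum_relations \<xi> \<theta> =
     {frag_of (iso_class \<xi> \<theta> (direct_sum V W))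
        - (frag_of (iso_class \<xi> \<theta> V) + frag_of (iso_class \<xi> \<theta> W)) | V W.
      is_module \<xi> \<theta> V \<and> is_module \<xi> \<theta> W}"

text \<open>
  Only the additive subgroup generated by the relations is divided out; the tensor product
  distributes over direct sums, so it is an ideal and the quotient inherits the multiplication.
\<close>

definition direct_sum_subgroup :: "'k::field \<Rightarrow> 'k \<Rightarrow> ('k rep set \<Rightarrow>\<^sub>0 int) set" where
  "direct_sum_subgroup \<xi> \<theta> =
     generate (add_monoid (free_green_ring \<xi> \<theta>)) (direct_sum_relations \<xi> \<theta>)"

definition green_ring :: "'k::field \<Rightarrow> 'k \<Rightarrow> ('k rep set \<Rightarrow>\<^sub>0 int) set ring" where
  "green_ring \<xi> \<theta> = free_green_ring \<xi> \<theta> Quot direct_sum_subgroup \<xi> \<theta>"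

definition green_class :: "'k::field \<Rightarrow> 'k \<Rightarrow> 'k rep \<Rightarrow> ('k rep set \<Rightarrow>\<^sub>0 int) set" where
  "green_class \<xi> \<theta> V =
     direct_sum_subgroup \<xi> \<theta> +>\<^bsub>free_green_ring \<xi> \<theta>\<^esub> frag_of (iso_class \<xi> \<theta> V)"

definition projective_class_ring ::
    "'k::field \<Rightarrow> 'k \<Rightarrow> ('k rep set \<Rightarrow>\<^sub>0 int) set ring" where
  "projective_class_ring \<xi> \<theta> =
     (green_ring \<xi> \<theta>)
       \<lparr>carrier := generate_ring (green_ring \<xi> \<theta>)
          (green_class \<xi> \<theta> ` {V. simple_module \<xi> \<theta> V \<or> projective_module \<xi> \<theta> V})\<rparr>"


section \<open>The polynomial ring and its ideal\<close>

text \<open>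
  Integer polynomials in six variables; an exponent vector is a function on the six-element
  type \<^typ>\<open>6\<close>, whose elements are the images of \<open>0, \<dots>, 5\<close>.
\<close>

type_synonym poly6 = "(6 \<Rightarrow>\<^sub>0 nat) \<Rightarrow>\<^sub>0 int"

definition Y_var :: "nat \<Rightarrow> poly6" where
  "Y_var i = Poly_Mapping.single (Poly_Mapping.single (of_nat i) 1) 1"

definition J_relations :: "poly6 set" where
  "J_relations =
     {Y_var 0 ^ 6 - 1}
     \<union> {Y_var i * Y_var 3 ^ 2 - (2 * Y_var i * Y_var 0 + Y_var i * Y_var 0 ^ 2 + Y_var i) | i. i \<in> {1..5}}
     \<union> {Y_var j * Y_var (6 - j) - Y_var 3 ^ 2 | j. j \<in> {1..5}}
     \<union> {Y_var k * Y_var l - (Y_var ((k + l) mod 6) + Y_var ((k + l) mod 6) * Y_var 0) | k l.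
          k \<in> {1..5} \<and> l \<in> {1..5} \<and> (k + l) mod 6 \<noteq> 0}"

definition J_ideal :: "poly6 set" where
  "J_ideal = genideal ring_of_type_algebra J_relations"

end

theory Submission
  imports "Jordan_Normal_Form.Matrix_Kernel" Defs
begin

text \<open>
  The proof determines the simple modules and the indecomposable projective modules of \<open>\<D>\<close>, decomposes the tensor
  products of simple modules, and compares the resulting multiplication table with the presentation.

  Weights. The generators \<open>a\<close> and \<open>g\<close> commute and have order six, so every module is a direct sum of weight
  spaces, indexed by pairs \<open>(\<alpha>, \<gamma>)\<close> of sixth roots of unity. The generators \<open>b\<close> and \<open>x\<close> move weight spaces to weight
  spaces, up to a correction in the case of \<open>x\<close>. The last relation says \<open>b x = \<xi> x b + t\<close> with
  \<open>t = - \<xi> \<theta> (a^4 - g a)\<close>. On the weight \<open>(\<alpha>, \<gamma>)\<close> the element \<open>t\<close> acts by the scalar \<open>twist \<alpha> \<gamma>\<close>, which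
  vanishes exactly if \<open>\<gamma> = \<alpha>^3\<close>; these are the weights on which the central element \<open>a^3 g\<close> is trivial.

  Summands. If \<open>t \<noteq> 0\<close> on the weight of a vector \<open>u\<close> with \<open>b u = 0\<close>, then \<open>u\<close> and \<open>x u\<close> span a copy of a simple module
  \<open>V2 \<alpha> \<gamma>\<close>, and a weight functional dual to \<open>u\<close> gives a retraction, because \<open>b x u = t u\<close> (\<open>V2_summand\<close>). If \<open>t = 0\<close> on
  the weight of \<open>p\<close> and \<open>x b p \<noteq> 0\<close>, then \<open>p, x p, b p, x b p\<close> span a copy of a module \<open>P4 \<alpha>\<close>, and a functional dual to
  \<open>x b p\<close> gives a retraction (\<open>P4_summand\<close>). The remaining simple modules are the one-dimensional modules
  \<open>chi \<alpha>\<close> of weight \<open>(\<alpha>, \<alpha>^3)\<close> (\<open>simple_module_classification\<close>). A projective module on which \<open>t\<close> and \<open>x b\<close> vanish is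
  zero: otherwise it maps onto some \<open>chi \<beta>\<close>, and this map cannot be lifted to \<open>P4 \<beta>\<close>. Hence projective
  modules are direct sums of modules \<open>V2\<close> and \<open>P4\<close> (\<open>projective_module_induct\<close>).

  Products. The product of \<open>V2 \<alpha> \<gamma>\<close> and \<open>V2 \<beta> \<delta>\<close> is a direct sum of two modules \<open>V2\<close> or is a module \<open>P4\<close>,
  depending on whether \<open>t\<close> vanishes on the product of the weights (\<open>tensor_V2_V2\<close>); multiplication by \<open>chi \<alpha>\<close>
  only shifts the weight (\<open>tensor_chi_V2\<close>).

  Comparison. The classes \<open>y_0 = [chi \<xi>]\<close> and \<open>y_i = [V2 1 (\<xi>^i)]\<close> commute, so polynomials can be evaluated at
  them (\<open>poly6_evaluation\<close>). By the product formulas the evaluation kills the ideal of relations; the cubic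
  relation is a consequence of the others. Modulo the ideal, every polynomial is an integral combination of
  the monomials \<open>y_0^a\<close>, \<open>y_0^a y_k\<close> and \<open>y_0^a y_3^2\<close> with \<open>a < 6\<close> and \<open>1 \<le> k \<le> 5\<close> (\<open>all_normalizable\<close>), which are
  sent to the classes of the modules \<open>chi\<close>, \<open>V2\<close> and \<open>P4\<close>. These \<open>42\<close> classes are linearly independent
  (\<open>normal_form_unique\<close>): the rank of the action of a fixed element of \<open>\<D>\<close> is additive on direct sums,
  so it is a function on the Green ring, and suitable elements detect the modules one at a time. Hence
  the kernel of the evaluation is the ideal of relations. Its image contains the classes of all simple and
  all projective modules, and it is generated by classes of simple modules, so it is the projective class
  ring.
\<close>

section \<open>Homomorphisms from monoid algebras\<close>

lemma ring_ring_of_type_algebra: "ring (ring_of_type_algebra :: 'a :: ring_1 ring)"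
proof -
  have "\<exists>y. x + y = 0" for x :: 'a
    using add.right_inverse by blast
  thus ?thesis
    unfolding ring_of_type_algebra_def using add.right_inverse
    by unfold_locales (auto simp: algebra_simps Units_def)
qed

lemma ring_of_type_simps:
  "carrier ring_of_type_algebra = UNIV"
  "x \<otimes>\<^bsub>ring_of_type_algebra\<^esub> y = x * y"
  "x \<oplus>\<^bsub>ring_of_type_algebra\<^esub> y = x + y"
  "\<one>\<^bsub>ring_of_type_algebra\<^esub> = 1"
  "\<zero>\<^bsub>ring_of_type_algebra\<^esub> = 0"
  by (simp_all add: ring_of_type_algebra_def)

lemma poly_mapping_sum_single:
  "f = (\<Sum>k\<in>Poly_Mapping.keys f. Poly_Mapping.single k (Poly_Mapping.lookup f k))"
  by (rule poly_mapping_eqI)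
    (auto simp: lookup_sum lookup_single when_def in_keys_iff sum.delta if_distrib cong: if_cong)

text \<open>
  Every element is a sum of monomials, so additive properties are checked on monomials.
\<close>

lemma poly_mapping_sum_induct [case_names single add]:
  fixes f :: "'m \<Rightarrow>\<^sub>0 'k :: comm_monoid_add"
  assumes "\<And>w c. P (Poly_Mapping.single w c)" "\<And>f g. P f \<Longrightarrow> P g \<Longrightarrow> P (f + g)"
  shows "P f"
proof -
  have "P (\<Sum>k\<in>I. Poly_Mapping.single k (Poly_Mapping.lookup f k))" if "finite I" for I
    using that
  proof induction
    case empty
    then show ?case using assms(1)[of undefined 0] by simp
  qed (auto intro: assms)
  then show ?thesis
    by (subst poly_mapping_sum_single) simp
qed

text \<open>
  The monoid algebra over \<open>k\<close> maps to every ring in which the image of the monoid commutes with the image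
  of \<open>k\<close>. The homomorphisms that occur below are of this kind: representations of the free algebra (words
  acting by matrices), the comultiplication, the counit, the action of the tensor square, and the
  evaluation of integer polynomials.
\<close>

locale algebra_extension = ring R for R :: "('b, 'c) ring_scheme" (structure) +
  fixes \<iota> :: "'k :: ring_1 \<Rightarrow> 'b" and \<phi> :: "'m :: monoid_add \<Rightarrow> 'b"
  assumes \<iota>_hom: "\<iota> \<in> Ring.ring_hom ring_of_type_algebra R"
    and \<phi>_closed: "\<phi> w \<in> carrier R"
    and \<phi>_zero: "\<phi> 0 = \<one>"
    and \<phi>_add: "\<phi> (u + v) = \<phi> u \<otimes> \<phi> v"
    and \<iota>_\<phi>_commute: "\<phi> w \<otimes> \<iota> c = \<iota> c \<otimes> \<phi> w"
begin

definition ext :: "('m \<Rightarrow>\<^sub>0 'k) \<Rightarrow> 'b" where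
  "ext f = (\<Oplus>w\<in>Poly_Mapping.keys f. \<iota> (Poly_Mapping.lookup f w) \<otimes> \<phi> w)"

lemma \<iota>_simps [simp]: "\<iota> c \<in> carrier R" "\<iota> (c + d) = \<iota> c \<oplus> \<iota> d" "\<iota> (c * d) = \<iota> c \<otimes> \<iota> d"
  "\<iota> 1 = \<one>" "\<iota> 0 = \<zero>"
proof -
  show *: "\<iota> c \<in> carrier R" "\<iota> (c + d) = \<iota> c \<oplus> \<iota> d" "\<iota> (c * d) = \<iota> c \<otimes> \<iota> d" "\<iota> 1 = \<one>" for c d
    using \<iota>_hom by (auto simp: Ring.ring_hom_def ring_of_type_simps)
  show "\<iota> 0 = \<zero>"
    using *(2)[of 0 0] *(1)[of 0] by (metis a_assoc add.r_cancel_one' add.one_closed add.right_cancel add_0 l_zero)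
qed

declare \<phi>_closed [simp]

lemma ext_eq_finsum:
  assumes "finite I" "Poly_Mapping.keys f \<subseteq> I"
  shows "ext f = (\<Oplus>w\<in>I. \<iota> (Poly_Mapping.lookup f w) \<otimes> \<phi> w)"
  unfolding ext_def
  by (rule add.finprod_mono_neutral_cong_left) (use assms in \<open>auto simp: in_keys_iff\<close>)

lemma ext_closed [simp]: "ext f \<in> carrier R"
  unfolding ext_def by (rule finsum_closed) auto

lemma ext_single [simp]: "ext (Poly_Mapping.single w c) = \<iota> c \<otimes> \<phi> w"
  by (subst ext_eq_finsum[of "{w}"]) auto

lemma ext_add [simp]: "ext (f + g) = ext f \<oplus> ext g"
proof -
  let ?I = "Poly_Mapping.keys f \<union> Poly_Mapping.keys g"
  have "ext (f + g) = (\<Oplus>w\<in>?I. \<iota> (Poly_Mapping.lookup (f + g) w) \<otimes> \<phi> w)"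
    by (rule ext_eq_finsum) (auto simp: keys_add)
  also have "\<dots> = (\<Oplus>w\<in>?I. \<iota> (Poly_Mapping.lookup f w) \<otimes> \<phi> w \<oplus> \<iota> (Poly_Mapping.lookup g w) \<otimes> \<phi> w)"
    by (rule finsum_cong') (auto simp: lookup_add l_distr)
  also have "\<dots> = (\<Oplus>w\<in>?I. \<iota> (Poly_Mapping.lookup f w) \<otimes> \<phi> w) \<oplus> (\<Oplus>w\<in>?I. \<iota> (Poly_Mapping.lookup g w) \<otimes> \<phi> w)"
    by (rule finsum_addf) auto
  also have "\<dots> = ext f \<oplus> ext g"
    by (subst (1 2) ext_eq_finsum[symmetric]) auto
  finally show ?thesis .
qed

lemma ext_mult [simp]: "ext (f * g) = ext f \<otimes> ext g"
proof (induction f rule: poly_mapping_sum_induct)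
  case (single u c)
  show ?case
  proof (induction g rule: poly_mapping_sum_induct)
    case (single v d)
    have "\<iota> c \<otimes> \<iota> d \<otimes> (\<phi> u \<otimes> \<phi> v) = \<iota> c \<otimes> (\<iota> d \<otimes> \<phi> u) \<otimes> \<phi> v"
      by (simp add: m_assoc)
    also have "\<dots> = \<iota> c \<otimes> \<phi> u \<otimes> (\<iota> d \<otimes> \<phi> v)"
      unfolding \<iota>_\<phi>_commute[of u d, symmetric] by (simp add: m_assoc)
    finally show ?case by (simp add: mult_single \<phi>_add)
  qed (simp add: distrib_left r_distr)
qed (simp add: distrib_right l_distr)

lemma ext_hom: "ext \<in> Ring.ring_hom ring_of_type_algebra R"
  by (rule ring_hom_memI)
    (auto simp: ring_of_type_simps \<phi>_zero simp flip: single_one)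

end

lemma single_Word: "Poly_Mapping.single (Word l) c = scal c * prod_list (map gen l)"
proof (induction l)
  case Nil
  then show ?case by (simp add: scal_def zero_word_def)
next
  case (Cons s l)
  have c: "scal c * gen s = gen s * (scal c :: 'a free_algebra)"
    by (simp add: scal_def gen_def mult_single)
  have "Poly_Mapping.single (Word (s # l)) c = gen s * Poly_Mapping.single (Word l) c"
    by (simp add: gen_def mult_single plus_word_def)
  also have "\<dots> = scal c * (gen s * prod_list (map gen l))"
    by (simp add: Cons c flip: mult.assoc)
  finally show ?case by simp
qed

text \<open>
  Words are products of generators, so multiplicative properties are checked on scalars and generators.
\<close>

lemma free_algebra_induct [case_names scal gen add mult]:
  fixes f :: "'k :: field free_algebra"
  assumes "\<And>c. P (scal c)" "\<And>s. P (gen s)"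
    "\<And>f g. P f \<Longrightarrow> P g \<Longrightarrow> P (f + g)" "\<And>f g. P f \<Longrightarrow> P g \<Longrightarrow> P (f * g)"
  shows "P f"
proof (induction f rule: poly_mapping_sum_induct)
  case (single w c)
  have 1: "P 1" using assms(1)[of 1] by (simp add: scal_def)
  have "P (prod_list (map gen l))" for l
    by (induction l) (auto intro: 1 assms)
  then show ?case
    by (cases w) (auto simp: single_Word intro: assms)
qed (auto intro: assms)

section \<open>Kronecker products\<close>

lemma kronecker_carrier [simp]:
  "A \<in> carrier_mat r c \<Longrightarrow> B \<in> carrier_mat r' c' \<Longrightarrow> kronecker A B \<in> carrier_mat (r * r') (c * c')"
  by (auto simp: kronecker_def)

lemma kronecker_dim [simp]:
  "dim_row (kronecker A B) = dim_row A * dim_row B" "dim_col (kronecker A B) = dim_col A * dim_col B"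
  by (auto simp: kronecker_def)

lemma div_mod_less [simp]:
  fixes i m n :: nat
  assumes "i < n * m"
  shows "i div m < n" "i mod m < m"
proof -
  show "i div m < n" by (rule less_mult_imp_div_less[OF assms])
  show "i mod m < m" by (rule mod_less_divisor) (use assms in \<open>cases m; simp\<close>)
qed

lemma kronecker_index [simp]:
  "i < dim_row A * dim_row B \<Longrightarrow> j < dim_col A * dim_col B \<Longrightarrow> kronecker A B $$ (i, j) =
     A $$ (i div dim_row B, j div dim_col B) * B $$ (i mod dim_row B, j mod dim_col B)"
  by (auto simp: kronecker_def)

lemma sum_div_mod:
  fixes f :: "nat \<Rightarrow> nat \<Rightarrow> 'a :: comm_monoid_add"
  shows "(\<Sum>k<n * m. f (k div m) (k mod m)) = (\<Sum>i<n. \<Sum>j<m. f i j)"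
proof -
  have "(\<Sum>i<n. \<Sum>j<m. f i j) = (\<Sum>(i, j)\<in>{..<n} \<times> {..<m}. f i j)"
    by (simp add: sum.cartesian_product)
  also have "\<dots> = (\<Sum>k<n * m. f (k div m) (k mod m))"
  proof (rule sum.reindex_bij_witness[of _ "\<lambda>k. (k div m, k mod m)" "\<lambda>(i, j). i * m + j"])
    fix a assume "a \<in> {..<n} \<times> {..<m}"
    then obtain i j where a: "a = (i, j)" "i < n" "j < m" by auto
    have "i * m + j < Suc i * m" using a by simp
    also have "\<dots> \<le> n * m" using a by (intro mult_right_mono) auto
    finally show "(case a of (i, j) \<Rightarrow> i * m + j) \<in> {..<n * m}" using a by simp
  qed auto
  finally show ?thesis ..
qed

text \<open>
  An index below \<open>n * m\<close> is the same as a pair of indices; this turns the sum that defines an entry of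
  the left side into a product of two sums.
\<close>

lemma kronecker_mult:
  assumes "A \<in> carrier_mat r n" "C \<in> carrier_mat n c" "B \<in> carrier_mat r' n'" "D \<in> carrier_mat n' c'"
  shows "kronecker A B * kronecker C D = kronecker (A * C) (B * D)"
proof (rule eq_matI)
  fix i j assume "i < dim_row (kronecker (A * C) (B * D))" "j < dim_col (kronecker (A * C) (B * D))"
  with assms have ij: "i < r * r'" "j < c * c'" by auto
  have "(kronecker A B * kronecker C D) $$ (i, j) =
      (\<Sum>k<n * n'. A $$ (i div r', k div n') * B $$ (i mod r', k mod n') *
                   (C $$ (k div n', j div c') * D $$ (k mod n', j mod c')))"
    using assms ij by (auto simp: scalar_prod_def lessThan_atLeast0 intro!: sum.cong)
  also have "\<dots> = (\<Sum>k<n. \<Sum>l<n'. A $$ (i div r', k) * B $$ (i mod r', l) *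
                   (C $$ (k, j div c') * D $$ (l, j mod c')))"
    by (rule sum_div_mod)
  also have "\<dots> = (\<Sum>k<n. A $$ (i div r', k) * C $$ (k, j div c')) *
                 (\<Sum>l<n'. B $$ (i mod r', l) * D $$ (l, j mod c'))"
    by (simp add: sum_product mult_ac)
  also have "\<dots> = kronecker (A * C) (B * D) $$ (i, j)"
    using assms ij by (auto simp: scalar_prod_def lessThan_atLeast0 intro!: sum.cong)
  finally show "(kronecker A B * kronecker C D) $$ (i, j) = kronecker (A * C) (B * D) $$ (i, j)" .
qed (use assms in auto)

lemma kronecker_add_left:
  assumes "A \<in> carrier_mat r c" "A' \<in> carrier_mat r c"
  shows "kronecker (A + A') B = kronecker A B + kronecker A' B"
  by (rule eq_matI) (use assms in \<open>auto simp: algebra_simps\<close>)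

lemma kronecker_add_right:
  assumes "B \<in> carrier_mat r c" "B' \<in> carrier_mat r c"
  shows "kronecker A (B + B') = kronecker A B + kronecker A B'"
  by (rule eq_matI) (use assms in \<open>auto simp: algebra_simps\<close>)

lemma kronecker_smult_left: "kronecker (k \<cdot>\<^sub>m A) B = k \<cdot>\<^sub>m kronecker A B"
  by (rule eq_matI) auto

lemma kronecker_smult_right: "kronecker A (k \<cdot>\<^sub>m B) = k \<cdot>\<^sub>m kronecker A B"
  by (rule eq_matI) auto

lemma kronecker_zero_left: "kronecker (0\<^sub>m r c) B = 0\<^sub>m (r * dim_row B) (c * dim_col B)"
  by (rule eq_matI) auto

lemma kronecker_zero_right: "kronecker A (0\<^sub>m r c) = 0\<^sub>m (dim_row A * r) (dim_col A * c)"
  by (rule eq_matI) auto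

lemma kronecker_one: "kronecker (1\<^sub>m n) (1\<^sub>m m) = 1\<^sub>m (n * m)"
proof (rule eq_matI)
  fix i j assume ij: "i < dim_row (1\<^sub>m (n * m))" "j < dim_col (1\<^sub>m (n * m))"
  have "i = j" if "i div m = j div m" "i mod m = j mod m"
    using that by (metis div_mult_mod_eq)
  then show "kronecker (1\<^sub>m n) (1\<^sub>m m) $$ (i, j) = 1\<^sub>m (n * m) $$ (i, j)"
    using ij by auto
qed auto

lemma kronecker_one_left: "kronecker (1\<^sub>m 1) A = A"
  by (rule eq_matI) auto

lemma kronecker_one_right: "kronecker A (1\<^sub>m 1) = A"
  by (rule eq_matI) auto

lemma kronecker_assoc: "kronecker (kronecker A B) C = kronecker A (kronecker B C)"
proof (rule eq_matI)
  fix i j assume "i < dim_row (kronecker A (kronecker B C))" "j < dim_col (kronecker A (kronecker B C))"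
  then have ij: "i < dim_row A * dim_row B * dim_row C" "j < dim_col A * dim_col B * dim_col C"
    by (auto simp: mult.assoc)
  note 1 = div_mod_less[OF ij(1)] and 2 = div_mod_less[OF ij(2)]
  have *: "k div (m * n) = k div n div m" "k mod (m * n) div n = k div n mod m" "k mod (m * n) mod n = k mod n"
    for k m n :: nat
  proof -
    show "k div (m * n) = k div n div m"
      by (metis div_mult2_eq mult.commute)
    show "k mod (m * n) div n = k div n mod m"
      using mod_mult2_eq[of k n m] by (cases "n = 0") (simp_all add: mult.commute)
  qed (simp add: mod_mod_cancel)
  have 3: "i < dim_row A * (dim_row B * dim_row C)" "j < dim_col A * (dim_col B * dim_col C)"
    using ij by (simp_all add: mult.assoc)
  show "kronecker (kronecker A B) C $$ (i, j) = kronecker A (kronecker B C) $$ (i, j)"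
    using ij 1 2 3 div_mod_less[OF 3(1)] div_mod_less[OF 3(2)] by (simp add: * mult.assoc)
qed (auto simp: mult.assoc)

section \<open>Modules over an algebra given by generators and relations\<close>

lemma (in ring) genideal_hom_zero:
  assumes "ring S" "h \<in> Ring.ring_hom R S" "A \<subseteq> carrier R" "\<And>r. r \<in> A \<Longrightarrow> h r = \<zero>\<^bsub>S\<^esub>" "x \<in> genideal R A"
  shows "h x = \<zero>\<^bsub>S\<^esub>"
proof -
  interpret h: ring_hom_ring R S h
    by (rule ring_hom_ringI2[OF ring_axioms assms(1,2)])
  have "A \<subseteq> a_kernel R S h"
  proof
    fix r assume "r \<in> A"
    then show "r \<in> a_kernel R S h"
      unfolding a_kernel_def' using assms(3,4) by blast
  qed
  then have "genideal R A \<subseteq> a_kernel R S h"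
    by (rule genideal_minimal[OF h.kernel_is_ideal])
  then have "x \<in> a_kernel R S h"
    using assms(5) by (rule subsetD)
  then show ?thesis
    unfolding a_kernel_def' by (rule CollectE) (rule conjunct2)
qed

context
  fixes \<xi> \<theta> :: "'k :: field"
begin

lemma rel_ideal_ideal: "ideal (rel_ideal \<xi> \<theta>) ring_of_type_algebra"
  unfolding rel_ideal_def
  by (rule ring.genideal_ideal[OF ring_ring_of_type_algebra]) (simp add: ring_of_type_simps)

lemma D_class_hom: "D_class \<xi> \<theta> \<in> Ring.ring_hom ring_of_type_algebra (D_alg \<xi> \<theta>)"
  using ideal.rcos_ring_hom[OF rel_ideal_ideal] by (simp add: D_alg_def D_class_def[abs_def])

lemma carrier_D_alg: "carrier (D_alg \<xi> \<theta>) = range (D_class \<xi> \<theta>)"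
  by (auto simp: D_alg_def FactRing_def A_RCOSETS_def' D_class_def ring_of_type_simps)

lemma D_class_simps:
  "D_class \<xi> \<theta> f \<oplus>\<^bsub>D_alg \<xi> \<theta>\<^esub> D_class \<xi> \<theta> g = D_class \<xi> \<theta> (f + g)"
  "D_class \<xi> \<theta> f \<otimes>\<^bsub>D_alg \<xi> \<theta>\<^esub> D_class \<xi> \<theta> g = D_class \<xi> \<theta> (f * g)"
  "\<one>\<^bsub>D_alg \<xi> \<theta>\<^esub> = D_class \<xi> \<theta> 1"
  using D_class_hom by (auto simp: Ring.ring_hom_def ring_of_type_simps)

lemma relation_in_kernel:
  assumes "r \<in> relations \<xi> \<theta>"
  shows "r \<in> rel_ideal \<xi> \<theta>"
  using assms ring.genideal_self[OF ring_ring_of_type_algebra, of "relations \<xi> \<theta>"]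
  unfolding rel_ideal_def ring_of_type_simps by blast

lemma D_class_relation:
  assumes "r \<in> relations \<xi> \<theta>"
  shows "D_class \<xi> \<theta> r = D_class \<xi> \<theta> 0"
proof -
  interpret ideal "rel_ideal \<xi> \<theta>" "ring_of_type_algebra :: 'k free_algebra ring"
    by (rule rel_ideal_ideal)
  have "D_class \<xi> \<theta> r = rel_ideal \<xi> \<theta>"
    using a_rcos_const[OF relation_in_kernel[OF assms]] by (simp add: D_class_def)
  also have "\<dots> = D_class \<xi> \<theta> 0"
    using a_rcos_const[of 0] additive_subgroup.zero_closed[OF is_additive_subgroup]
    by (simp add: D_class_def ring_of_type_simps)
  finally show ?thesis .
qed

text \<open>
  A homomorphism from the free algebra that kills the relations is constant on cosets of the ideal. Tensor
  products and the trivial module are defined by such an induced map.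
\<close>

lemma descend:
  assumes "ring S" and h: "h \<in> Ring.ring_hom ring_of_type_algebra S"
    and "\<And>r. r \<in> relations \<xi> \<theta> \<Longrightarrow> h r = \<zero>\<^bsub>S\<^esub>"
  shows "the_elem (h ` D_class \<xi> \<theta> f) = h f"
    and "(\<lambda>d. the_elem (h ` d)) \<in> Ring.ring_hom (D_alg \<xi> \<theta>) S"
proof -
  interpret S: ring S by fact
  have h_simps: "h x \<in> carrier S" "h (x + y) = h x \<oplus>\<^bsub>S\<^esub> h y" "h (x * y) = h x \<otimes>\<^bsub>S\<^esub> h y" "h 1 = \<one>\<^bsub>S\<^esub>" for x y
    using h by (auto simp: Ring.ring_hom_def ring_of_type_simps)
  have ker: "h x = \<zero>\<^bsub>S\<^esub>" if "x \<in> rel_ideal \<xi> \<theta>" for x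
    using ring.genideal_hom_zero[OF ring_ring_of_type_algebra assms(1) h _ assms(3)] that
    by (auto simp: rel_ideal_def ring_of_type_simps)
  have 0: "0 \<in> rel_ideal \<xi> \<theta>"
    using additive_subgroup.zero_closed[OF ideal.axioms(1)[OF rel_ideal_ideal]]
    by (simp add: ring_of_type_simps)
  have img: "h ` D_class \<xi> \<theta> f = {h f}" for f
    using 0 by (auto simp: D_class_def a_r_coset_def' ring_of_type_simps h_simps ker intro!: image_eqI[of _ h "0 + f"])
  then show *: "the_elem (h ` D_class \<xi> \<theta> f) = h f" for f
    by simp
  show "(\<lambda>d. the_elem (h ` d)) \<in> Ring.ring_hom (D_alg \<xi> \<theta>) S"
    by (rule ring_hom_memI) (auto simp: carrier_D_alg D_class_simps * h_simps)
qed

lemma module_simps: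
  assumes "is_module \<xi> \<theta> V"
  shows "snd V (D_class \<xi> \<theta> f) \<in> carrier_mat (fst V) (fst V)"
    "snd V (D_class \<xi> \<theta> (f + g)) = snd V (D_class \<xi> \<theta> f) + snd V (D_class \<xi> \<theta> g)"
    "snd V (D_class \<xi> \<theta> (f * g)) = snd V (D_class \<xi> \<theta> f) * snd V (D_class \<xi> \<theta> g)"
    "snd V (D_class \<xi> \<theta> 1) = 1\<^sub>m (fst V)"
    "snd V (D_class \<xi> \<theta> (scal c)) = c \<cdot>\<^sub>m 1\<^sub>m (fst V)"
    "snd V (D_class \<xi> \<theta> 0) = 0\<^sub>m (fst V) (fst V)"
    "r \<in> relations \<xi> \<theta> \<Longrightarrow> snd V (D_class \<xi> \<theta> r) = 0\<^sub>m (fst V) (fst V)"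
proof -
  have *: "snd V \<in> Ring.ring_hom (D_alg \<xi> \<theta>) (ring_mat TYPE('k) (fst V) ())"
    and s: "\<And>c. snd V (D_class \<xi> \<theta> (scal c)) = c \<cdot>\<^sub>m 1\<^sub>m (fst V)"
    using assms by (auto simp: is_module_def)
  note c = carrier_D_alg
  show "snd V (D_class \<xi> \<theta> f) \<in> carrier_mat (fst V) (fst V)"
    using ring_hom_closed[OF *, of "D_class \<xi> \<theta> f"] by (simp add: c ring_mat_simps)
  show "snd V (D_class \<xi> \<theta> (f + g)) = snd V (D_class \<xi> \<theta> f) + snd V (D_class \<xi> \<theta> g)"
    using ring_hom_add[OF *, of "D_class \<xi> \<theta> f" "D_class \<xi> \<theta> g"] by (simp add: c ring_mat_simps D_class_simps)
  show "snd V (D_class \<xi> \<theta> (f * g)) = snd V (D_class \<xi> \<theta> f) * snd V (D_class \<xi> \<theta> g)"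
    using ring_hom_mult[OF *, of "D_class \<xi> \<theta> f" "D_class \<xi> \<theta> g"] by (simp add: c ring_mat_simps D_class_simps)
  show "snd V (D_class \<xi> \<theta> 1) = 1\<^sub>m (fst V)"
    using ring_hom_one[OF *] by (simp add: D_class_simps ring_mat_simps)
  show s: "snd V (D_class \<xi> \<theta> (scal c)) = c \<cdot>\<^sub>m 1\<^sub>m (fst V)" for c
    by (rule s)
  have "(0 :: 'k free_algebra) = scal 0" by (simp add: scal_def)
  then show 0: "snd V (D_class \<xi> \<theta> 0) = 0\<^sub>m (fst V) (fst V)"
    using s[of 0] by (auto intro!: eq_matI)
  show "r \<in> relations \<xi> \<theta> \<Longrightarrow> snd V (D_class \<xi> \<theta> r) = 0\<^sub>m (fst V) (fst V)"
    by (simp add: D_class_relation 0)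
qed

definition act :: "'k rep \<Rightarrow> gen \<Rightarrow> 'k mat" where
  "act V s = snd V (D_class \<xi> \<theta> (gen s))"

lemma act_carrier: "is_module \<xi> \<theta> V \<Longrightarrow> act V s \<in> carrier_mat (fst V) (fst V)"
  by (simp add: act_def module_simps)

text \<open>
  The elements of the free algebra that commute with \<open>T\<close> form a subalgebra, so the generators suffice.
\<close>

lemma module_homI:
  assumes V: "is_module \<xi> \<theta> V" and W: "is_module \<xi> \<theta> W" and T: "T \<in> carrier_mat (fst W) (fst V)"
    and comm: "\<And>s. T * act V s = act W s * T"
  shows "T \<in> module_hom \<xi> \<theta> V W"
proof -
  note [simp] = module_simps(1-6)[OF V] module_simps(1-6)[OF W]
  have "T * snd V (D_class \<xi> \<theta> f) = snd W (D_class \<xi> \<theta> f) * T" for f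
  proof (induction f rule: free_algebra_induct)
    case (scal c)
    then show ?case
      using T by (simp add: mult_smult_distrib[of T "fst W" "fst V" _ "fst V"]
          mult_smult_assoc_mat[of _ "fst W" "fst W" T "fst V"])
  next
    case (gen s)
    then show ?case using comm[of s] by (simp add: act_def)
  next
    case (add f g)
    then show ?case
      using T by (simp add: mult_add_distrib_mat[of T "fst W" "fst V" _ "fst V"]
          add_mult_distrib_mat[of _ "fst W" "fst W" _ T "fst V"])
  next
    case (mult f g)
    then show ?case
      using T assoc_mult_mat[of T "fst W" "fst V" "snd V (D_class \<xi> \<theta> f)" "fst V" "snd V (D_class \<xi> \<theta> g)" "fst V"]
        assoc_mult_mat[of "snd W (D_class \<xi> \<theta> f)" "fst W" "fst W" T "fst V" "snd V (D_class \<xi> \<theta> g)" "fst V"]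
        assoc_mult_mat[of "snd W (D_class \<xi> \<theta> f)" "fst W" "fst W" "snd W (D_class \<xi> \<theta> g)" "fst W" T "fst V"]
      by simp
  qed
  then show ?thesis
    using T by (auto simp: module_hom_def carrier_D_alg)
qed

lemma module_homD:
  assumes "T \<in> module_hom \<xi> \<theta> V W"
  shows "T \<in> carrier_mat (fst W) (fst V)" "T * act V s = act W s * T"
  using assms by (auto simp: module_hom_def carrier_D_alg act_def)

end

section \<open>Modules as quadruples of matrices\<close>

locale double_params =
  fixes \<xi> \<theta> :: "'k :: field_char_0"
  assumes xi6: "\<xi> ^ 6 = 1"
    and xi_primitive: "\<And>m. 0 < m \<Longrightarrow> m < 6 \<Longrightarrow> \<xi> ^ m \<noteq> 1"
    and theta_sq: "\<theta> ^ 2 = \<xi> ^ 2"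
begin

lemma xi_sq: "\<xi> * \<xi> = \<xi> - 1"
proof -
  \<comment> \<open>As \<open>\<xi>\<close> is primitive, it is a root of the last factor.\<close>
  have "(\<xi> ^ 3 - 1) * ((\<xi> + 1) * (\<xi> * \<xi> - \<xi> + 1)) = \<xi> ^ 6 - 1"
    by (simp add: eval_nat_numeral algebra_simps)
  moreover have "\<xi> ^ 3 \<noteq> 1" by (rule xi_primitive) auto
  moreover have "\<xi> + 1 \<noteq> 0"
  proof
    assume "\<xi> + 1 = 0"
    then have "\<xi> = -1" by (simp add: eq_neg_iff_add_eq_0)
    then show False using xi_primitive[of 2] by simp
  qed
  ultimately have "\<xi> * \<xi> - \<xi> + 1 = 0" using xi6 by simp
  then show ?thesis by (simp add: algebra_simps add_eq_0_iff)
qed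

lemma theta_theta: "\<theta> * \<theta> = \<xi> - 1"
  using theta_sq by (simp add: power2_eq_square xi_sq)

lemma xi_sq_left: "\<xi> * (\<xi> * z) = \<xi> * z - z"
  by (metis left_diff_distrib mult.assoc mult_1 xi_sq)

lemma theta_theta_left: "\<theta> * (\<theta> * z) = \<xi> * z - z"
  by (metis left_diff_distrib mult.assoc mult_1 theta_theta)

lemmas xi_simps = xi_sq theta_theta xi_sq_left theta_theta_left algebra_simps

lemma xi_nonzero [simp]: "\<xi> \<noteq> 0" and theta_nonzero [simp]: "\<theta> \<noteq> 0"
  and xi_plus_one [simp]: "\<xi> + 1 \<noteq> 0" and xi_minus_one [simp]: "\<xi> - 1 \<noteq> 0"
proof -
  show 0: "\<xi> \<noteq> 0" using xi_sq by auto
  show "\<xi> - 1 \<noteq> 0" using xi_primitive[of 1] by auto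
  then show "\<theta> \<noteq> 0" using theta_theta by auto
  show "\<xi> + 1 \<noteq> 0"
  proof
    assume "\<xi> + 1 = 0"
    then have "\<xi> = -1" by (simp add: eq_neg_iff_add_eq_0)
    then show False using xi_primitive[of 2] by simp
  qed
qed

text \<open>
  As \<open>\<xi>\<close> is a root of \<open>z^2 - z + 1\<close>, the coefficients of the two mixed relations can be written without
  division: \<open>inverse (\<xi> ^ 2) = - \<xi>\<close> and the other one becomes \<open>\<theta> * (\<xi> - 2)\<close>.
\<close>

lemma inverse_xi_sq: "inverse (\<xi> ^ 2) = - \<xi>"
proof (rule inverse_unique)
  have "\<xi> * (\<xi> * \<xi>) = -1" by (simp add: xi_sq algebra_simps)
  then show "\<xi> ^ 2 * - \<xi> = 1" by (simp add: power2_eq_square mult.assoc)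
qed

lemma mixed_coefficient: "inverse ((\<xi> - 1) / (\<xi> + 1)) * \<theta> * inverse (\<xi> ^ 2) = \<theta> * (\<xi> - 2)"
proof -
  have "(\<xi> + 1) * - \<xi> = (\<xi> - 2) * (\<xi> - 1)" by (simp add: xi_sq algebra_simps)
  then have "inverse ((\<xi> - 1) / (\<xi> + 1)) * - \<xi> = \<xi> - 2"
    by (simp add: divide_eq_eq flip: minus_divide_left)
       (metis minus_divide_left nonzero_mult_div_cancel_right xi_minus_one)
  then show ?thesis unfolding inverse_xi_sq by (metis mult.commute mult.left_commute)
qed

text \<open>
  The defining relations for matrices by which \<open>a, b, g, x\<close> act, written with right-nested products and with
  the simplified coefficients, so that they can serve as rewrite rules.
\<close>

definition D_matrices :: "nat \<Rightarrow> 'k mat \<Rightarrow> 'k mat \<Rightarrow> 'k mat \<Rightarrow> 'k mat \<Rightarrow> bool" where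
  "D_matrices n A B G Y \<longleftrightarrow>
     A \<in> carrier_mat n n \<and> B \<in> carrier_mat n n \<and> G \<in> carrier_mat n n \<and> Y \<in> carrier_mat n n \<and>
     A * (A * (A * (A * (A * A)))) = 1\<^sub>m n \<and> B * B = 0\<^sub>m n n \<and> B * A = \<xi> \<cdot>\<^sub>m (A * B) \<and>
     G * (G * (G * (G * (G * G)))) = 1\<^sub>m n \<and> Y * Y = 1\<^sub>m n + (-1) \<cdot>\<^sub>m (G * G) \<and>
     G * Y + Y * G = 0\<^sub>m n n \<and> A * G = G * A \<and> B * G + G * B = 0\<^sub>m n n \<and>
     A * Y + (- \<xi>) \<cdot>\<^sub>m (Y * A) = (\<theta> * (\<xi> - 2)) \<cdot>\<^sub>m (B * (A * (A * A)) + (-1) \<cdot>\<^sub>m (G * B)) \<and>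
     B * Y + (- \<xi>) \<cdot>\<^sub>m (Y * B) = (- (\<xi> * \<theta>)) \<cdot>\<^sub>m (A * (A * (A * A)) + (-1) \<cdot>\<^sub>m (G * A))"

lemma diff_as_scal: "f - g = f + scal (-1) * (g :: 'k free_algebra)"
proof -
  have "scal (-1) = (-1 :: 'k free_algebra)"
    by (simp add: scal_def single_uminus flip: single_one)
  then show ?thesis by simp
qed

lemma module_diff:
  assumes "is_module \<xi> \<theta> V"
  shows "snd V (D_class \<xi> \<theta> (f - g)) = snd V (D_class \<xi> \<theta> f) + (-1) \<cdot>\<^sub>m snd V (D_class \<xi> \<theta> g)"
  by (simp add: diff_as_scal module_simps[OF assms] mult_smult_assoc_mat[of _ "fst V" "fst V" _ "fst V"]
      left_mult_one_mat[of _ "fst V" "fst V"])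

lemma module_relation:
  assumes "is_module \<xi> \<theta> V" "l - r \<in> relations \<xi> \<theta>"
  shows "snd V (D_class \<xi> \<theta> l) = snd V (D_class \<xi> \<theta> r)"
proof -
  have "snd V (D_class \<xi> \<theta> ((l - r) + r)) = 0\<^sub>m (fst V) (fst V) + snd V (D_class \<xi> \<theta> r)"
    unfolding module_simps(2)[OF assms(1)] module_simps(7)[OF assms] by simp
  then show ?thesis using module_simps(1)[OF assms(1)] by simp
qed

lemma relations_mem:
  defines "a \<equiv> gen Gen_a" and "b \<equiv> gen Gen_b" and "g \<equiv> gen Gen_g" and "x \<equiv> gen Gen_x"
  shows "r \<in> relations \<xi> \<theta> \<longleftrightarrow> r \<in> {a ^ 6 - 1, b ^ 2 - 0, b * a - scal \<xi> * (a * b), g ^ 6 - 1, x ^ 2 - (1 - g ^ 2),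
     (g * x + x * g) - 0, a * g - g * a, (b * g + g * b) - 0,
     (a * x + scal (- \<xi>) * (x * a)) - scal (\<theta> * (\<xi> - 2)) * (b * a ^ 3 - g * b),
     (b * x + scal (- \<xi>) * (x * b)) - scal (- (\<xi> * \<theta>)) * (a ^ 4 - g * a)}"
  unfolding relations_def Let_def a_def b_def g_def x_def mixed_coefficient
  by (simp add: inverse_xi_sq mult.assoc mult.commute[of \<theta> \<xi>])

lemma act_D_matrices:
  assumes V: "is_module \<xi> \<theta> V"
  shows "D_matrices (fst V) (act \<xi> \<theta> V Gen_a) (act \<xi> \<theta> V Gen_b) (act \<xi> \<theta> V Gen_g) (act \<xi> \<theta> V Gen_x)"
proof -
  note rel = module_relation[OF V, unfolded relations_mem]
  have [simp]: "- \<theta> * \<xi> = - (\<theta> * \<xi>)" by simp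
  have smult: "snd V (D_class \<xi> \<theta> (scal c * f)) = c \<cdot>\<^sub>m snd V (D_class \<xi> \<theta> f)" for c f
    by (simp add: module_simps[OF V] mult_smult_assoc_mat[of _ "fst V" "fst V" _ "fst V"]
      left_mult_one_mat[of _ "fst V" "fst V"])
  note [simp] = module_simps(1-2,4-6)[OF V] module_diff[OF V] smult
  note m = module_simps(3)[OF V]
  show ?thesis
    unfolding D_matrices_def act_def
    using rel[of "gen Gen_a ^ 6" 1] rel[of "gen Gen_b ^ 2" 0]
      rel[of "gen Gen_b * gen Gen_a" "scal \<xi> * (gen Gen_a * gen Gen_b)"] rel[of "gen Gen_g ^ 6" 1]
      rel[of "gen Gen_x ^ 2" "1 - gen Gen_g ^ 2"]
      rel[of "gen Gen_g * gen Gen_x + gen Gen_x * gen Gen_g" 0]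
      rel[of "gen Gen_a * gen Gen_g" "gen Gen_g * gen Gen_a"]
      rel[of "gen Gen_b * gen Gen_g + gen Gen_g * gen Gen_b" 0]
      rel[of "gen Gen_a * gen Gen_x + scal (- \<xi>) * (gen Gen_x * gen Gen_a)"
         "scal (\<theta> * (\<xi> - 2)) * (gen Gen_b * gen Gen_a ^ 3 - gen Gen_g * gen Gen_b)"]
      rel[of "gen Gen_b * gen Gen_x + scal (- \<xi>) * (gen Gen_x * gen Gen_b)"
         "scal (- (\<xi> * \<theta>)) * (gen Gen_a ^ 4 - gen Gen_g * gen Gen_a)"]
    by (simp add: eval_nat_numeral del: mult_minus_left) (simp add: m)
qed

end

section \<open>Modules from quadruples of matrices\<close>

lemma ring_mat_hom:
  fixes h :: "'b :: ring_1 \<Rightarrow> 'k :: field mat"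
  assumes "\<And>x. h x \<in> carrier_mat n n" "\<And>x y. h (x + y) = h x + h y" "\<And>x y. h (x * y) = h x * h y" "h 1 = 1\<^sub>m n"
  shows "h \<in> Ring.ring_hom ring_of_type_algebra (ring_mat TYPE('k) n ())"
  using assms by (auto intro!: ring_hom_memI simp: ring_of_type_simps ring_mat_simps)

text \<open>
  The product is formed by hand because matrices of variable size are not a type with a unit.
\<close>

definition word_matrix :: "nat \<Rightarrow> (gen \<Rightarrow> 'k :: field mat) \<Rightarrow> gen list \<Rightarrow> 'k mat" where
  "word_matrix n m l = foldr (\<lambda>s M. m s * M) l (1\<^sub>m n)"

lemma mat_extension:
  fixes \<phi> :: "'m :: monoid_add \<Rightarrow> 'k :: field mat"
  assumes c: "\<And>w. \<phi> w \<in> carrier_mat n n" and "\<phi> 0 = 1\<^sub>m n" "\<And>u v. \<phi> (u + v) = \<phi> u * \<phi> v"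
  shows "algebra_extension (ring_mat TYPE('k) n ()) (\<lambda>c. c \<cdot>\<^sub>m 1\<^sub>m n) \<phi>"
proof -
  interpret R: ring "ring_mat TYPE('k) n ()" by (rule ring_mat)
  show ?thesis
  proof
    show "(\<lambda>c :: 'k. c \<cdot>\<^sub>m 1\<^sub>m n) \<in> Ring.ring_hom ring_of_type_algebra (ring_mat TYPE('k) n ())"
    proof (rule ring_mat_hom)
      show "(x * y) \<cdot>\<^sub>m 1\<^sub>m n = (x \<cdot>\<^sub>m 1\<^sub>m n) * (y \<cdot>\<^sub>m 1\<^sub>m n :: 'k mat)" for x y
        by (simp add: mult_smult_assoc_mat[of _ n n _ n] left_mult_one_mat[of _ n n])
          (auto intro!: eq_matI)
    qed (auto intro!: eq_matI simp: distrib_right)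
  qed (use assms in \<open>auto simp: ring_mat_simps mult_smult_assoc_mat[of _ n n _ n] mult_smult_distrib[of _ n n _ n]
     left_mult_one_mat[OF c] right_mult_one_mat[OF c]\<close>)
qed

text \<open>
  The action of the tensor square is defined entrywise; this lemma identifies it with a finite sum in the
  ring of matrices, and hence with a homomorphic extension.
\<close>

lemma finsum_ring_mat:
  assumes "finite I" "\<And>i. i \<in> I \<Longrightarrow> F i \<in> carrier_mat n n"
  shows "finsum (ring_mat TYPE('k :: field) n ()) F I = mat n n (\<lambda>ij. \<Sum>i\<in>I. F i $$ ij)"
proof -
  interpret R: ring "ring_mat TYPE('k) n ()" by (rule ring_mat)
  show ?thesis
    using assms
  proof (induction I)
    case empty
    show ?case by (auto simp: ring_mat_simps intro!: eq_matI)
  next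
    case (insert x I)
    then have "finsum (ring_mat TYPE('k) n ()) F (insert x I) = F x + mat n n (\<lambda>ij. \<Sum>i\<in>I. F i $$ ij)"
      by (subst R.finsum_insert) (auto simp: ring_mat_simps)
    then show ?case using insert by (auto intro!: eq_matI)
  qed
qed

context double_params
begin

definition gen_matrices :: "'k mat \<Rightarrow> 'k mat \<Rightarrow> 'k mat \<Rightarrow> 'k mat \<Rightarrow> gen \<Rightarrow> 'k mat" where
  "gen_matrices A B G Y s = (case s of Gen_a \<Rightarrow> A | Gen_b \<Rightarrow> B | Gen_g \<Rightarrow> G | Gen_x \<Rightarrow> Y)"

definition evaluate :: "nat \<Rightarrow> (gen \<Rightarrow> 'k mat) \<Rightarrow> 'k free_algebra \<Rightarrow> 'k mat" where
  "evaluate n m = algebra_extension.ext (ring_mat TYPE('k) n ()) (\<lambda>c. c \<cdot>\<^sub>m 1\<^sub>m n) (\<lambda>w. word_matrix n m (letters w))"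

lemma evaluate_simps:
  assumes m: "\<And>s. m s \<in> carrier_mat n n"
  shows "evaluate n m f \<in> carrier_mat n n"
    "evaluate n m (f + g) = evaluate n m f + evaluate n m g"
    "evaluate n m (f * g) = evaluate n m f * evaluate n m g"
    "evaluate n m 1 = 1\<^sub>m n" "evaluate n m (scal c) = c \<cdot>\<^sub>m 1\<^sub>m n"
    "evaluate n m (gen s) = m s"
    "evaluate n m \<in> Ring.ring_hom ring_of_type_algebra (ring_mat TYPE('k) n ())"
proof -
  have c: "word_matrix n m l \<in> carrier_mat n n" for l
    by (induction l) (use m in \<open>auto simp: word_matrix_def intro!: mult_carrier_mat\<close>)
  have app: "word_matrix n m (l @ l') = word_matrix n m l * word_matrix n m l'" for l l'
  proof (induction l)
    case Nil
    show ?case using c[of l'] by (simp add: word_matrix_def)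
  next
    case (Cons s l)
    have "word_matrix n m (s # l) = m s * word_matrix n m l" for l by (simp add: word_matrix_def)
    then show ?case using Cons assoc_mult_mat[OF m[of s] c[of l] c[of l']] by simp
  qed
  interpret algebra_extension "ring_mat TYPE('k) n ()" "\<lambda>c. c \<cdot>\<^sub>m 1\<^sub>m n" "\<lambda>w. word_matrix n m (letters w)"
    by (rule mat_extension) (auto simp: c zero_word_def plus_word_def app, simp add: word_matrix_def)
  show "evaluate n m \<in> Ring.ring_hom ring_of_type_algebra (ring_mat TYPE('k) n ())"
    unfolding evaluate_def by (rule ext_hom)
  then show "evaluate n m f \<in> carrier_mat n n"
    "evaluate n m (f + g) = evaluate n m f + evaluate n m g"
    "evaluate n m (f * g) = evaluate n m f * evaluate n m g"
    "evaluate n m 1 = 1\<^sub>m n"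
    by (auto simp: Ring.ring_hom_def ring_of_type_simps ring_mat_simps)
  show "evaluate n m (scal c) = c \<cdot>\<^sub>m 1\<^sub>m n"
    unfolding evaluate_def scal_def ext_single
    by (simp add: zero_word_def ring_mat_simps word_matrix_def right_mult_one_mat[of _ n n])
  show "evaluate n m (gen s) = m s"
    unfolding evaluate_def gen_def ext_single
    using m[of s] by (simp add: ring_mat_simps word_matrix_def right_mult_one_mat[of _ n n] left_mult_one_mat[of _ n n])
qed

text \<open>
  Each relation is the difference of two elements, and the matrix relation says that their images agree.
\<close>

lemma relations_evaluate:
  assumes h: "h \<in> Ring.ring_hom ring_of_type_algebra (ring_mat TYPE('k) n ())"
    and s: "\<And>c. h (scal c) = c \<cdot>\<^sub>m 1\<^sub>m n"
    and D: "D_matrices n (h (gen Gen_a)) (h (gen Gen_b)) (h (gen Gen_g)) (h (gen Gen_x))"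
    and r: "r \<in> relations \<xi> \<theta>"
  shows "h r = 0\<^sub>m n n"
proof -
  have h_simps: "h x \<in> carrier_mat n n" "h (x + y) = h x + h y" "h (x * y) = h x * h y" "h 1 = 1\<^sub>m n" for x y
    using h by (auto simp: Ring.ring_hom_def ring_of_type_simps ring_mat_simps)
  have scal: "h (scal c * f) = c \<cdot>\<^sub>m h f" for c f
    using h_simps(1)[of f] by (simp add: h_simps s mult_smult_assoc_mat[of _ n n _ n] left_mult_one_mat[of _ n n])
  have diff: "h (f - g) = h f + (-1) \<cdot>\<^sub>m h g" for f g
    by (simp add: diff_as_scal h_simps(2) scal)
  have zero: "h 0 = 0\<^sub>m n n"
    using scal[of 0 1] h_simps(1)[of 1] by (auto simp: scal_def intro!: eq_matI)
  have eq: "h (l - r) = 0\<^sub>m n n" if "h l = h r" for l r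
    using that h_simps(1)[of r] by (auto simp: diff intro!: eq_matI)
  have gen: "h (gen s * f) = h (gen s) * h f" for s f
    by (rule h_simps(3))
  note D' = D[unfolded D_matrices_def]
  show ?thesis
    using r unfolding relations_mem
    by (elim insertE emptyE; simp only:; intro eq)
      (use D' in \<open>simp_all add: h_simps(2,4) gen scal diff zero eval_nat_numeral del: mult_minus_left\<close>)
qed

definition rep :: "nat \<Rightarrow> 'k mat \<Rightarrow> 'k mat \<Rightarrow> 'k mat \<Rightarrow> 'k mat \<Rightarrow> 'k rep" where
  "rep n A B G Y = (n, \<lambda>d. the_elem (evaluate n (gen_matrices A B G Y) ` d))"

lemma module_of_hom:
  assumes h: "h \<in> Ring.ring_hom ring_of_type_algebra (ring_mat TYPE('k) n ())"
    and s: "\<And>c. h (scal c) = c \<cdot>\<^sub>m 1\<^sub>m n"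
    and D: "D_matrices n (h (gen Gen_a)) (h (gen Gen_b)) (h (gen Gen_g)) (h (gen Gen_x))"
  shows "is_module \<xi> \<theta> (n, \<lambda>d. the_elem (h ` d))"
    and "act \<xi> \<theta> (n, \<lambda>d. the_elem (h ` d)) s = h (gen s)"
proof -
  have r: "h r = \<zero>\<^bsub>ring_mat TYPE('k) n ()\<^esub>" if "r \<in> relations \<xi> \<theta>" for r
    using relations_evaluate[OF h s D that] by (simp add: ring_mat_simps)
  note d = descend[OF ring_mat h r]
  show "is_module \<xi> \<theta> (n, \<lambda>d. the_elem (h ` d))"
    using d by (simp add: is_module_def s)
  show "act \<xi> \<theta> (n, \<lambda>d. the_elem (h ` d)) s = h (gen s)"
    using d by (simp add: act_def)
qed

lemma rep_module:
  assumes D: "D_matrices n A B G Y"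
  shows "is_module \<xi> \<theta> (rep n A B G Y)" "act \<xi> \<theta> (rep n A B G Y) s = gen_matrices A B G Y s"
    "fst (rep n A B G Y) = n"
proof -
  have "gen_matrices A B G Y s \<in> carrier_mat n n" for s
    using D by (cases s) (auto simp: gen_matrices_def D_matrices_def)
  note e = evaluate_simps[OF this]
  have "D_matrices n (evaluate n (gen_matrices A B G Y) (gen Gen_a)) (evaluate n (gen_matrices A B G Y) (gen Gen_b))
    (evaluate n (gen_matrices A B G Y) (gen Gen_g)) (evaluate n (gen_matrices A B G Y) (gen Gen_x))"
    using D by (simp add: e gen_matrices_def)
  note m = module_of_hom[OF e(7) e(5) this]
  show "is_module \<xi> \<theta> (rep n A B G Y)" "act \<xi> \<theta> (rep n A B G Y) s = gen_matrices A B G Y s"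
    using m by (auto simp: rep_def e)
qed (simp add: rep_def)

end

section \<open>The coproduct respects the relations\<close>

text \<open>
  Matrix identities in which the size conditions are equations between dimensions, which the simplifier can
  discharge; the rules normalize an expression to a linear combination of right-nested products.
\<close>

lemma mat_dim_simps:
  fixes A B C :: "'a :: comm_ring_1 mat"
  shows "dim_col A = dim_row B \<Longrightarrow> dim_col B = dim_row C \<Longrightarrow> A * B * C = A * (B * C)"
    "dim_row A = dim_row B \<Longrightarrow> dim_col A = dim_col B \<Longrightarrow> dim_col A = dim_row C \<Longrightarrow> (A + B) * C = A * C + B * C"
    "dim_row A = dim_row B \<Longrightarrow> dim_col A = dim_col B \<Longrightarrow> dim_col C = dim_row A \<Longrightarrow> C * (A + B) = C * A + C * B"
    "dim_col A = dim_row B \<Longrightarrow> (k \<cdot>\<^sub>m A) * B = k \<cdot>\<^sub>m (A * B)"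
    "dim_col A = dim_row B \<Longrightarrow> A * (k \<cdot>\<^sub>m B) = k \<cdot>\<^sub>m (A * B)"
    "k \<cdot>\<^sub>m (l \<cdot>\<^sub>m A) = (k * l) \<cdot>\<^sub>m A"
    "dim_row A = dim_row B \<Longrightarrow> dim_col A = dim_col B \<Longrightarrow> k \<cdot>\<^sub>m (A + B) = k \<cdot>\<^sub>m A + k \<cdot>\<^sub>m B"
    "k \<cdot>\<^sub>m 0\<^sub>m r c = 0\<^sub>m r c"
    "dim_row A = r \<Longrightarrow> 1\<^sub>m r * A = A" "dim_col A = r \<Longrightarrow> A * 1\<^sub>m r = A"
    "dim_row A = r' \<Longrightarrow> 0\<^sub>m r r' * A = 0\<^sub>m r (dim_col A)" "dim_col A = r \<Longrightarrow> A * 0\<^sub>m r r' = 0\<^sub>m (dim_row A) r'"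
    "dim_row A = r \<Longrightarrow> dim_col A = r' \<Longrightarrow> A + 0\<^sub>m r r' = A" "dim_row A = r \<Longrightarrow> dim_col A = r' \<Longrightarrow> 0\<^sub>m r r' + A = A"
proof -
  show "dim_col A = dim_row B \<Longrightarrow> dim_col B = dim_row C \<Longrightarrow> A * B * C = A * (B * C)"
    by (rule assoc_mult_mat) auto
  show "dim_row A = dim_row B \<Longrightarrow> dim_col A = dim_col B \<Longrightarrow> dim_col A = dim_row C \<Longrightarrow> (A + B) * C = A * C + B * C"
    by (rule add_mult_distrib_mat) auto
  show "dim_row A = dim_row B \<Longrightarrow> dim_col A = dim_col B \<Longrightarrow> dim_col C = dim_row A \<Longrightarrow> C * (A + B) = C * A + C * B"
    by (rule mult_add_distrib_mat) auto
  show "dim_col A = dim_row B \<Longrightarrow> (k \<cdot>\<^sub>m A) * B = k \<cdot>\<^sub>m (A * B)"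
    by (rule mult_smult_assoc_mat) auto
  show "dim_col A = dim_row B \<Longrightarrow> A * (k \<cdot>\<^sub>m B) = k \<cdot>\<^sub>m (A * B)"
    by (rule mult_smult_distrib) auto
  show "dim_row A = r \<Longrightarrow> 1\<^sub>m r * A = A" "dim_col A = r \<Longrightarrow> A * 1\<^sub>m r = A"
    by (rule left_mult_one_mat right_mult_one_mat, auto)+
qed (auto intro!: eq_matI simp: distrib_left)

lemma kronecker_mult_dim:
  "dim_col A = dim_row C \<Longrightarrow> dim_col B = dim_row D \<Longrightarrow>
     kronecker A B * kronecker C D = kronecker (A * C) (B * D)"
  by (rule kronecker_mult) auto

lemma kronecker_dim_simps:
  "dim_row A = dim_row A' \<Longrightarrow> dim_col A = dim_col A' \<Longrightarrow> kronecker (A + A') B = kronecker A B + kronecker A' B"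
  "dim_row B = dim_row B' \<Longrightarrow> dim_col B = dim_col B' \<Longrightarrow> kronecker A (B + B') = kronecker A B + kronecker A B'"
  by (rule kronecker_add_left kronecker_add_right, auto)+

lemmas kronecker_simps = kronecker_mult_dim kronecker_dim_simps kronecker_smult_left kronecker_smult_right
  kronecker_zero_left kronecker_zero_right kronecker_one

context double_params
begin

lemma D_matrices_carrier:
  assumes "D_matrices n A B G Y"
  shows "A \<in> carrier_mat n n" "B \<in> carrier_mat n n" "G \<in> carrier_mat n n" "Y \<in> carrier_mat n n"
    "dim_row A = n" "dim_row B = n" "dim_row G = n" "dim_row Y = n"
    "dim_col A = n" "dim_col B = n" "dim_col G = n" "dim_col Y = n"
  using assms by (auto simp: D_matrices_def)

text \<open>
  The relations as rewrite rules: they move \<open>g\<close>, then \<open>a\<close>, then \<open>x\<close>, to the left of \<open>b\<close>. A product that is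
  preceded by a weight functional is evaluated this way, since \<open>g\<close> and \<open>a\<close> then meet the functional.
\<close>

lemma D_matrices_rewrite:
  assumes D: "D_matrices n A B G Y"
  shows "B * B = 0\<^sub>m n n" "B * A = \<xi> \<cdot>\<^sub>m (A * B)" "A * G = G * A" "B * G = (-1) \<cdot>\<^sub>m (G * B)"
    "Y * G = (-1) \<cdot>\<^sub>m (G * Y)" "Y * Y = 1\<^sub>m n + (-1) \<cdot>\<^sub>m (G * G)"
    "Y * A = (1 - \<xi>) \<cdot>\<^sub>m (A * Y) + ((2 * \<xi> - 1) * \<theta>) \<cdot>\<^sub>m (A * (A * (A * B)) + G * B)"
    "B * Y = \<xi> \<cdot>\<^sub>m (Y * B) + (- (\<xi> * \<theta>)) \<cdot>\<^sub>m (A * (A * (A * A)) + (-1) \<cdot>\<^sub>m (G * A))"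
proof -
  note D' = D[unfolded D_matrices_def] and [simp] = D_matrices_carrier[OF D]
  show 1: "B * B = 0\<^sub>m n n" "B * A = \<xi> \<cdot>\<^sub>m (A * B)" "A * G = G * A" "Y * Y = 1\<^sub>m n + (-1) \<cdot>\<^sub>m (G * G)"
    using D' by auto
  have neg: "P = (-1) \<cdot>\<^sub>m Q" if "P + Q = 0\<^sub>m n n" "P \<in> carrier_mat n n" "Q \<in> carrier_mat n n" for P Q :: "'k mat"
  proof (rule eq_matI)
    fix i j assume ij: "i < dim_row (- 1 \<cdot>\<^sub>m Q)" "j < dim_col (- 1 \<cdot>\<^sub>m Q)"
    have "P $$ (i, j) + Q $$ (i, j) = 0"
      using arg_cong[OF that(1), of "\<lambda>M. M $$ (i, j)"] that(2,3) ij by simp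
    then show "P $$ (i, j) = (- 1 \<cdot>\<^sub>m Q) $$ (i, j)" using that(2,3) ij by (simp add: eq_neg_iff_add_eq_0)
  qed (use that in auto)
  show "B * G = (-1) \<cdot>\<^sub>m (G * B)" "Y * G = (-1) \<cdot>\<^sub>m (G * Y)"
    using D' by (auto intro!: neg simp: mult_carrier_mat[of _ n n _ n] comm_add_mat[of "Y * G" n n "G * Y"])
  have b3: "B * (A * (A * A)) = (-1) \<cdot>\<^sub>m (A * (A * (A * B)))"
  proof -
    have BA: "B * (A * Z) = \<xi> \<cdot>\<^sub>m (A * (B * Z))" if "dim_row Z = n" for Z
      using that mat_dim_simps(1)[of B A Z] by (simp add: 1 mat_dim_simps)
    have c: "\<xi> * (\<xi> * \<xi>) = - 1" by (simp add: xi_sq algebra_simps)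
    show ?thesis by (simp add: 1 BA mat_dim_simps c mult.assoc)
  qed
  have A: "A * Y + (- \<xi>) \<cdot>\<^sub>m (Y * A) = (\<theta> * (\<xi> - 2)) \<cdot>\<^sub>m ((-1) \<cdot>\<^sub>m (A * (A * (A * B))) + (-1) \<cdot>\<^sub>m (G * B))"
    using D' by (simp add: b3)
  show "Y * A = (1 - \<xi>) \<cdot>\<^sub>m (A * Y) + ((2 * \<xi> - 1) * \<theta>) \<cdot>\<^sub>m (A * (A * (A * B)) + G * B)" (is "?l = ?r")
  proof (rule eq_matI)
    fix i j assume ij: "i < dim_row ?r" "j < dim_col ?r"
    define p q r s where "p = (A * Y) $$ (i, j)" and "q = (Y * A) $$ (i, j)"
      and "r = (A * (A * (A * B))) $$ (i, j)" and "s = (G * B) $$ (i, j)"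
    have "p - \<xi> * q = (\<theta> * (\<xi> - 2)) * (- r - s)"
      using arg_cong[OF A, of "\<lambda>M. M $$ (i, j)"] ij by (simp add: p_def q_def r_def s_def del: index_mult_mat(1))
    then have "\<xi> * q = p - (\<theta> * (\<xi> - 2)) * (- r - s)"
      by (simp add: algebra_simps)
    then have "(1 - \<xi>) * (\<xi> * q) = (1 - \<xi>) * (p - (\<theta> * (\<xi> - 2)) * (- r - s))"
      by (simp only:)
    then have "q = (1 - \<xi>) * p + (2 * \<xi> - 1) * \<theta> * (r + s)"
      by (simp add: xi_simps)
    then show "?l $$ (i, j) = ?r $$ (i, j)"
      using ij by (simp add: p_def q_def r_def s_def del: index_mult_mat(1))
  qed auto
  show "B * Y = \<xi> \<cdot>\<^sub>m (Y * B) + (- (\<xi> * \<theta>)) \<cdot>\<^sub>m (A * (A * (A * A)) + (-1) \<cdot>\<^sub>m (G * A))" (is "?l = ?r")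
  proof (rule eq_matI)
    fix i j assume ij: "i < dim_row ?r" "j < dim_col ?r"
    have "B * Y + (- \<xi>) \<cdot>\<^sub>m (Y * B) = (- (\<xi> * \<theta>)) \<cdot>\<^sub>m (A * (A * (A * A)) + (-1) \<cdot>\<^sub>m (G * A))"
      using D' by simp
    from arg_cong[OF this, of "\<lambda>M. M $$ (i, j)"] show "?l $$ (i, j) = ?r $$ (i, j)"
      using ij by (simp add: algebra_simps del: index_mult_mat(1))
  qed auto
qed

lemma D_matrices_rewrite_nested:
  assumes D: "D_matrices n A B G Y" and Z: "dim_row Z = n"
  shows "B * (B * Z) = 0\<^sub>m n (dim_col Z)" "B * (A * Z) = \<xi> \<cdot>\<^sub>m (A * (B * Z))" "A * (G * Z) = G * (A * Z)"
    "B * (G * Z) = (-1) \<cdot>\<^sub>m (G * (B * Z))" "Y * (G * Z) = (-1) \<cdot>\<^sub>m (G * (Y * Z))"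
    "Y * (Y * Z) = Z + (-1) \<cdot>\<^sub>m (G * (G * Z))"
    "Y * (A * Z) = (1 - \<xi>) \<cdot>\<^sub>m (A * (Y * Z)) + ((2 * \<xi> - 1) * \<theta>) \<cdot>\<^sub>m (A * (A * (A * (B * Z))) + G * (B * Z))"
    "B * (Y * Z) = \<xi> \<cdot>\<^sub>m (Y * (B * Z)) + (- (\<xi> * \<theta>)) \<cdot>\<^sub>m (A * (A * (A * (A * Z))) + (-1) \<cdot>\<^sub>m (G * (A * Z)))"
proof -
  note [simp] = D_matrices_carrier[OF D] Z
  note [simp del] = assoc_mult_mat
  have *: "P * (Q * Z) = (P * Q) * Z" if "dim_col P = n" "dim_row Q = n" "dim_col Q = n" for P Q
    using that by (simp add: mat_dim_simps)
  show "B * (B * Z) = 0\<^sub>m n (dim_col Z)"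
    by (subst *) (simp_all add: D_matrices_rewrite[OF D] mat_dim_simps)
  show "B * (A * Z) = \<xi> \<cdot>\<^sub>m (A * (B * Z))"
    by (subst *) (simp_all add: D_matrices_rewrite[OF D] mat_dim_simps)
  show "A * (G * Z) = G * (A * Z)"
    by (subst *) (simp_all add: D_matrices_rewrite[OF D] mat_dim_simps)
  show "B * (G * Z) = (-1) \<cdot>\<^sub>m (G * (B * Z))"
    by (subst *) (simp_all add: D_matrices_rewrite[OF D] mat_dim_simps)
  show "Y * (G * Z) = (-1) \<cdot>\<^sub>m (G * (Y * Z))"
    by (subst *) (simp_all add: D_matrices_rewrite[OF D] mat_dim_simps)
  show "Y * (Y * Z) = Z + (-1) \<cdot>\<^sub>m (G * (G * Z))"
    by (subst *) (simp_all add: D_matrices_rewrite[OF D] mat_dim_simps)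
  show "Y * (A * Z) = (1 - \<xi>) \<cdot>\<^sub>m (A * (Y * Z)) + ((2 * \<xi> - 1) * \<theta>) \<cdot>\<^sub>m (A * (A * (A * (B * Z))) + G * (B * Z))"
    by (subst *) (simp_all add: D_matrices_rewrite[OF D] mat_dim_simps)
  show "B * (Y * Z) = \<xi> \<cdot>\<^sub>m (Y * (B * Z)) + (- (\<xi> * \<theta>)) \<cdot>\<^sub>m (A * (A * (A * (A * Z))) + (-1) \<cdot>\<^sub>m (G * (A * Z)))"
    by (subst *) (simp_all add: D_matrices_rewrite[OF D] mat_dim_simps)
qed

text \<open>
  This is the statement that the comultiplication is compatible with the relations. All eight matrices are
  moved to normal form, and the coefficients are compared using \<open>\<xi>^2 = \<xi> - 1\<close> and \<open>\<theta>^2 = \<xi> - 1\<close>.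
\<close>

lemma D_matrices_tensor:
  assumes D: "D_matrices n A B G Y" and D': "D_matrices m A' B' G' Y'"
  shows "D_matrices (n * m) (kronecker A A' + (\<xi> ^ 4 + \<xi> ^ 5) \<cdot>\<^sub>m kronecker (B * (A * (A * A))) B')
     (kronecker (A * (A * (A * A))) B' + kronecker B A') (kronecker G G') (kronecker (1\<^sub>m n) Y' + kronecker Y G')"
    (is "D_matrices _ ?A ?B ?G ?Y")
proof -
  note [simp] = D_matrices_carrier[OF D] D_matrices_carrier[OF D']
  note rew = D_matrices_rewrite[OF D] D_matrices_rewrite_nested[OF D] D_matrices_rewrite[OF D'] D_matrices_rewrite_nested[OF D']
  note norm = rew mat_dim_simps kronecker_simps
  have a6: "A * (A * (A * (A * (A * A)))) = 1\<^sub>m n" "A' * (A' * (A' * (A' * (A' * A')))) = 1\<^sub>m m"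
    and g6: "G * (G * (G * (G * (G * G)))) = 1\<^sub>m n" "G' * (G' * (G' * (G' * (G' * G')))) = 1\<^sub>m m"
    using D D' by (auto simp: D_matrices_def)
  have a6_nested: "A * (A * (A * (A * (A * (A * Z))))) = Z" if "dim_row Z = n" for Z
  proof -
    have "A * (A * (A * (A * (A * (A * Z))))) = (A * (A * (A * (A * (A * A))))) * Z"
      using that by (simp add: mat_dim_simps del: assoc_mult_mat)
    then show ?thesis using that by (simp only: a6) (simp add: mat_dim_simps)
  qed
  have c: "\<xi> ^ 4 + \<xi> ^ 5 = 1 - 2 * \<xi>"
    by (simp add: eval_nat_numeral xi_simps)
  show ?thesis
    unfolding D_matrices_def c
    by (intro conjI carrier_matI; simp add: norm a6 a6_nested g6;
       (rule eq_matI; simp add: xi_simps del: index_mult_mat(1) kronecker_index)?)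
qed

end

section \<open>The tensor product of modules\<close>

lemma mult_scal2: "scal2 c * f = f * scal2 c"
  for f :: "'k :: field free_algebra2"
proof (induction f rule: poly_mapping_sum_induct)
  case (single w d)
  then show ?case by (simp add: scal2_def mult_single mult.commute)
qed (simp add: distrib_left distrib_right)

lemma comult_extension:
  "algebra_extension (ring_of_type_algebra :: 'k :: field free_algebra2 ring) scal2
     (\<lambda>w. prod_list (map (comult_gen \<xi>) (letters w)))"
proof -
  interpret R: ring "ring_of_type_algebra :: 'k :: field free_algebra2 ring"
    by (rule ring_ring_of_type_algebra)
  show ?thesis
    by unfold_locales
      (auto simp: ring_of_type_simps scal2_def single_add mult_single zero_word_def plus_word_def
        mult_scal2[unfolded scal2_def] intro!: ring_hom_memI)
qed

lemma comult_eq_ext: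
  "comult \<xi> = algebra_extension.ext (ring_of_type_algebra :: 'k :: field free_algebra2 ring) scal2
     (\<lambda>w. prod_list (map (comult_gen \<xi>) (letters w)))"
proof
  fix f :: "'k free_algebra"
  interpret E: algebra_extension "ring_of_type_algebra :: 'k free_algebra2 ring" scal2
    "\<lambda>w. prod_list (map (comult_gen \<xi>) (letters w))"
    by (rule comult_extension)
  have "finsum (ring_of_type_algebra :: 'k free_algebra2 ring) F I = sum F I" if "finite I" for F and I :: "word set"
    using that by (induction I) (auto simp: E.finsum_insert ring_of_type_simps E.finsum_empty[unfolded ring_of_type_simps])
  then show "comult \<xi> f = E.ext f"
    by (simp add: comult_def free_extend_def E.ext_def ring_of_type_simps)
qed

lemma comult_simps:
  fixes f g :: "'k :: field free_algebra"
  shows "comult \<xi> \<in> Ring.ring_hom ring_of_type_algebra ring_of_type_algebra"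
    "comult \<xi> (f + g) = comult \<xi> f + comult \<xi> g" "comult \<xi> (f * g) = comult \<xi> f * comult \<xi> g"
    "comult \<xi> 1 = 1" "comult \<xi> (scal c) = scal2 c" "comult \<xi> (gen s) = comult_gen \<xi> s"
proof -
  interpret E: algebra_extension "ring_of_type_algebra :: 'k free_algebra2 ring" scal2
    "\<lambda>w. prod_list (map (comult_gen \<xi>) (letters w))"
    by (rule comult_extension)
  show h: "comult \<xi> \<in> Ring.ring_hom ring_of_type_algebra ring_of_type_algebra"
    unfolding comult_eq_ext by (rule E.ext_hom)
  show "comult \<xi> (f + g) = comult \<xi> f + comult \<xi> g" "comult \<xi> (f * g) = comult \<xi> f * comult \<xi> g"
    "comult \<xi> 1 = 1"
    using h by (auto simp: Ring.ring_hom_def ring_of_type_simps)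
  show "comult \<xi> (scal c) = scal2 c" "comult \<xi> (gen s) = comult_gen \<xi> s"
    unfolding comult_eq_ext scal_def gen_def E.ext_single
    by (simp_all add: ring_of_type_simps zero_word_def scal2_def)
qed

lemma tens_single:
  "tens (Poly_Mapping.single u c) (Poly_Mapping.single v d) = (Poly_Mapping.single (u, v) (c * d) :: 'k :: field free_algebra2)"
  by (cases "c = 0"; cases "d = 0") (simp_all add: tens_def)

context double_params
begin

text \<open>
  Pairs of words act by Kronecker products, which are multiplicative in pairs; hence the action of the
  tensor square of the free algebra is a homomorphism.
\<close>

lemma act2_simps:
  assumes V: "is_module \<xi> \<theta> V" and W: "is_module \<xi> \<theta> W"
  shows "act2 \<xi> \<theta> V W \<in> Ring.ring_hom ring_of_type_algebra (ring_mat TYPE('k) (fst V * fst W) ())"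
    "act2 \<xi> \<theta> V W (f + g) = act2 \<xi> \<theta> V W f + act2 \<xi> \<theta> V W g"
    "act2 \<xi> \<theta> V W (f * g) = act2 \<xi> \<theta> V W f * act2 \<xi> \<theta> V W g"
    "act2 \<xi> \<theta> V W (scal2 c) = c \<cdot>\<^sub>m 1\<^sub>m (fst V * fst W)"
    "act2 \<xi> \<theta> V W (Poly_Mapping.single (u, v) 1) =
       kronecker (snd V (D_class \<xi> \<theta> (Poly_Mapping.single u 1))) (snd W (D_class \<xi> \<theta> (Poly_Mapping.single v 1)))"
    "act2 \<xi> \<theta> V W f \<in> carrier_mat (fst V * fst W) (fst V * fst W)"
proof -
  let ?n = "fst V * fst W"
  let ?p = "\<lambda>(u, v). kronecker (snd V (D_class \<xi> \<theta> (Poly_Mapping.single u 1)))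
        (snd W (D_class \<xi> \<theta> (Poly_Mapping.single v 1)))"
  note mV = module_simps[OF V] and mW = module_simps[OF W]
  have hom: "snd U (D_class \<xi> \<theta> (Poly_Mapping.single (u + v) 1)) =
      snd U (D_class \<xi> \<theta> (Poly_Mapping.single u 1)) * snd U (D_class \<xi> \<theta> (Poly_Mapping.single v 1))"
    if "is_module \<xi> \<theta> U" for U u v
    by (simp add: mult_single flip: module_simps(3)[OF that])
  have c: "?p w \<in> carrier_mat ?n ?n" for w
    by (cases w) (simp add: mV(1) mW(1))
  interpret E: algebra_extension "ring_mat TYPE('k) ?n ()" "\<lambda>c. c \<cdot>\<^sub>m 1\<^sub>m ?n" ?p
  proof (rule mat_extension)
    show "?p w \<in> carrier_mat ?n ?n" for w by (rule c)
    show "?p 0 = 1\<^sub>m ?n"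
      by (simp add: zero_prod_def mV(4) mW(4) kronecker_one)
    show "?p (u + v) = ?p u * ?p v" for u v
      by (cases u; cases v)
        (simp add: hom[OF V] hom[OF W] kronecker_mult[OF mV(1) mV(1) mW(1) mW(1)])
  qed
  have smult: "c \<cdot>\<^sub>m 1\<^sub>m ?n * ?p w = c \<cdot>\<^sub>m ?p w" for c :: 'k and w
    using c[of w] by (simp add: mult_smult_assoc_mat[of _ ?n ?n _ ?n] left_mult_one_mat[of _ ?n ?n])
  have ext: "act2 \<xi> \<theta> V W f = E.ext f" for f
  proof -
    have "E.ext f = mat ?n ?n (\<lambda>ij. \<Sum>w\<in>Poly_Mapping.keys f.
        (Poly_Mapping.lookup f w \<cdot>\<^sub>m ?p w) $$ ij)"
      unfolding E.ext_def
      by (subst finsum_ring_mat) (use c in \<open>auto simp: ring_mat_simps smult intro!: smult_carrier_mat\<close>)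
    also have "\<dots> = act2 \<xi> \<theta> V W f"
      unfolding act2_def
    proof (rule eq_matI, goal_cases)
      case (1 i j)
      then show ?case
        using c by (auto intro!: sum.cong simp: mV(1)[THEN carrier_matD(1)] mV(1)[THEN carrier_matD(2)]
          mW(1)[THEN carrier_matD(1)] mW(1)[THEN carrier_matD(2)] simp del: kronecker_index)
    qed auto
    finally show ?thesis ..
  qed
  show h: "act2 \<xi> \<theta> V W \<in> Ring.ring_hom ring_of_type_algebra (ring_mat TYPE('k) (fst V * fst W) ())"
    unfolding ext[abs_def] by (rule E.ext_hom)
  then show "act2 \<xi> \<theta> V W (f + g) = act2 \<xi> \<theta> V W f + act2 \<xi> \<theta> V W g"
    "act2 \<xi> \<theta> V W (f * g) = act2 \<xi> \<theta> V W f * act2 \<xi> \<theta> V W g"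
    "act2 \<xi> \<theta> V W f \<in> carrier_mat ?n ?n"
    by (auto simp: Ring.ring_hom_def ring_of_type_simps ring_mat_simps)
  show "act2 \<xi> \<theta> V W (scal2 c) = c \<cdot>\<^sub>m 1\<^sub>m ?n"
    unfolding ext scal2_def E.ext_single E.\<phi>_zero by (simp add: ring_mat_simps right_mult_one_mat[of _ ?n ?n])
  show "act2 \<xi> \<theta> V W (Poly_Mapping.single (u, v) 1) =
       kronecker (snd V (D_class \<xi> \<theta> (Poly_Mapping.single u 1))) (snd W (D_class \<xi> \<theta> (Poly_Mapping.single v 1)))"
    unfolding ext E.ext_single using c[of "(u, v)"] smult[of 1 "(u, v)"]
    by (auto simp: ring_mat_simps intro!: eq_matI)
qed

definition tensor_act :: "'k rep \<Rightarrow> 'k rep \<Rightarrow> gen \<Rightarrow> 'k mat" where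
  "tensor_act V W s = (let A = act \<xi> \<theta> V Gen_a; B = act \<xi> \<theta> V Gen_b; G = act \<xi> \<theta> V Gen_g; Y = act \<xi> \<theta> V Gen_x;
       A' = act \<xi> \<theta> W Gen_a; B' = act \<xi> \<theta> W Gen_b; G' = act \<xi> \<theta> W Gen_g; Y' = act \<xi> \<theta> W Gen_x
     in case s of Gen_a \<Rightarrow> kronecker A A' + (\<xi> ^ 4 + \<xi> ^ 5) \<cdot>\<^sub>m kronecker (B * (A * (A * A))) B'
       | Gen_b \<Rightarrow> kronecker (A * (A * (A * A))) B' + kronecker B A'
       | Gen_g \<Rightarrow> kronecker G G'
       | Gen_x \<Rightarrow> kronecker (1\<^sub>m (fst V)) Y' + kronecker Y G')"

lemma tensor_module:
  assumes V: "is_module \<xi> \<theta> V" and W: "is_module \<xi> \<theta> W"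
  shows "is_module \<xi> \<theta> (tensor_module \<xi> \<theta> V W)"
    "act \<xi> \<theta> (tensor_module \<xi> \<theta> V W) s = tensor_act V W s"
    "fst (tensor_module \<xi> \<theta> V W) = fst V * fst W"
proof -
  let ?n = "fst V * fst W"
  note a = act2_simps[OF V W]
  let ?h = "\<lambda>f. act2 \<xi> \<theta> V W (comult \<xi> f)"
  have h: "?h \<in> Ring.ring_hom ring_of_type_algebra (ring_mat TYPE('k) ?n ())"
    using a(4)[of 1] by (intro ring_mat_hom) (auto simp: a comult_simps scal2_def)
  have tens: "act2 \<xi> \<theta> V W (tens (Poly_Mapping.single u 1) (Poly_Mapping.single v 1)) =
      kronecker (snd V (D_class \<xi> \<theta> (Poly_Mapping.single u 1))) (snd W (D_class \<xi> \<theta> (Poly_Mapping.single v 1)))" for u v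
    by (simp add: tens_single a(5))
  have ba: "gen Gen_b * gen Gen_a ^ 3 = Poly_Mapping.single (Word [Gen_b, Gen_a, Gen_a, Gen_a]) (1 :: 'k)"
    "gen Gen_a ^ 4 = Poly_Mapping.single (Word [Gen_a, Gen_a, Gen_a, Gen_a]) (1 :: 'k)"
    by (simp_all add: gen_def eval_nat_numeral mult_single plus_word_def)
  have mV: "snd V (D_class \<xi> \<theta> (f * g)) = snd V (D_class \<xi> \<theta> f) * snd V (D_class \<xi> \<theta> g)" for f g
    by (rule module_simps(3)[OF V])
  have tens_gen: "act2 \<xi> \<theta> V W (tens (gen s) (gen s')) = kronecker (act \<xi> \<theta> V s) (act \<xi> \<theta> W s')"
    "act2 \<xi> \<theta> V W (tens 1 (gen s')) = kronecker (1\<^sub>m (fst V)) (act \<xi> \<theta> W s')" for s s'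
    using tens[of 0] by (simp_all add: tens gen_def act_def module_simps(4)[OF V])
  have tens_ba: "act2 \<xi> \<theta> V W (tens (gen Gen_b * gen Gen_a ^ 3) (gen s')) = kronecker
      (act \<xi> \<theta> V Gen_b * (act \<xi> \<theta> V Gen_a * (act \<xi> \<theta> V Gen_a * act \<xi> \<theta> V Gen_a))) (act \<xi> \<theta> W s')"
    "act2 \<xi> \<theta> V W (tens (gen Gen_a ^ 4) (gen s')) = kronecker
      (act \<xi> \<theta> V Gen_a * (act \<xi> \<theta> V Gen_a * (act \<xi> \<theta> V Gen_a * act \<xi> \<theta> V Gen_a))) (act \<xi> \<theta> W s')" for s'
  proof -
    have "act2 \<xi> \<theta> V W (tens f (gen s')) = kronecker (snd V (D_class \<xi> \<theta> f)) (act \<xi> \<theta> W s')"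
      if "f = Poly_Mapping.single u 1" for f u
      unfolding that gen_def tens act_def ..
    from this[OF ba(1)] this[OF ba(2)] show "act2 \<xi> \<theta> V W (tens (gen Gen_b * gen Gen_a ^ 3) (gen s')) = kronecker
        (act \<xi> \<theta> V Gen_b * (act \<xi> \<theta> V Gen_a * (act \<xi> \<theta> V Gen_a * act \<xi> \<theta> V Gen_a))) (act \<xi> \<theta> W s')"
      "act2 \<xi> \<theta> V W (tens (gen Gen_a ^ 4) (gen s')) = kronecker
        (act \<xi> \<theta> V Gen_a * (act \<xi> \<theta> V Gen_a * (act \<xi> \<theta> V Gen_a * act \<xi> \<theta> V Gen_a))) (act \<xi> \<theta> W s')"
      by (simp_all add: eval_nat_numeral act_def mV)
  qed
  have smult: "act2 \<xi> \<theta> V W (scal2 c * f) = c \<cdot>\<^sub>m act2 \<xi> \<theta> V W f" for c f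
    using a(6)[of f] by (simp add: a mult_smult_assoc_mat[of _ ?n ?n _ ?n] left_mult_one_mat[of _ ?n ?n])
  have gens: "?h (gen s) = tensor_act V W s" for s
    unfolding comult_simps(6)
    by (cases s) (simp_all add: a(2) smult tens_gen tens_ba tensor_act_def Let_def)
  have s: "?h (scal c) = c \<cdot>\<^sub>m 1\<^sub>m ?n" for c
    by (simp add: comult_simps a)
  have D: "D_matrices ?n (?h (gen Gen_a)) (?h (gen Gen_b)) (?h (gen Gen_g)) (?h (gen Gen_x))"
    using D_matrices_tensor[OF act_D_matrices[OF V] act_D_matrices[OF W]] by (simp add: gens tensor_act_def Let_def)
  note m = module_of_hom[OF h s D]
  show "is_module \<xi> \<theta> (tensor_module \<xi> \<theta> V W)" "act \<xi> \<theta> (tensor_module \<xi> \<theta> V W) s = tensor_act V W s"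
    using m by (simp_all add: tensor_module_def gens)
qed (simp add: tensor_module_def)

end

section \<open>Biproducts of coordinate spaces\<close>

definition inl_mat :: "nat \<Rightarrow> nat \<Rightarrow> 'a :: comm_ring_1 mat" where
  "inl_mat n m = mat (n + m) n (\<lambda>(i, j). if i = j then 1 else 0)"
definition inr_mat :: "nat \<Rightarrow> nat \<Rightarrow> 'a :: comm_ring_1 mat" where
  "inr_mat n m = mat (n + m) m (\<lambda>(i, j). if i = n + j then 1 else 0)"
definition prl_mat :: "nat \<Rightarrow> nat \<Rightarrow> 'a :: comm_ring_1 mat" where
  "prl_mat n m = mat n (n + m) (\<lambda>(i, j). if i = j then 1 else 0)"
definition prr_mat :: "nat \<Rightarrow> nat \<Rightarrow> 'a :: comm_ring_1 mat" where
  "prr_mat n m = mat m (n + m) (\<lambda>(i, j). if n + i = j then 1 else 0)"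

lemma biproduct_dims [simp]:
  "dim_row (inl_mat n m) = n + m" "dim_col (inl_mat n m) = n" "dim_row (inr_mat n m) = n + m" "dim_col (inr_mat n m) = m"
  "dim_row (prl_mat n m) = n" "dim_col (prl_mat n m) = n + m" "dim_row (prr_mat n m) = m" "dim_col (prr_mat n m) = n + m"
  by (auto simp: inl_mat_def inr_mat_def prl_mat_def prr_mat_def)

lemma sum_shifted_delta:
  fixes f :: "nat \<Rightarrow> 'a :: comm_monoid_add"
  assumes "n \<le> j"
  shows "(\<Sum>i = 0..<m. if j = n + i then f i else 0) = (if j - n < m then f (j - n) else 0)"
    "(\<Sum>i = 0..<m. if n + i = j then f i else 0) = (if j - n < m then f (j - n) else 0)"
proof -
  have "j = n + i \<longleftrightarrow> i = j - n" "n + i = j \<longleftrightarrow> i = j - n" for i using assms by auto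
  then show "(\<Sum>i = 0..<m. if j = n + i then f i else 0) = (if j - n < m then f (j - n) else 0)"
    "(\<Sum>i = 0..<m. if n + i = j then f i else 0) = (if j - n < m then f (j - n) else 0)"
    by (simp_all add: sum.delta)
qed

lemma biproduct_simps:
  "prl_mat n m * inl_mat n m = 1\<^sub>m n" "prr_mat n m * inr_mat n m = 1\<^sub>m m"
  "prl_mat n m * inr_mat n m = 0\<^sub>m n m" "prr_mat n m * inl_mat n m = 0\<^sub>m m n"
  "inl_mat n m * prl_mat n m + inr_mat n m * prr_mat n m = 1\<^sub>m (n + m)"
  by (auto intro!: eq_matI simp: inl_mat_def inr_mat_def prl_mat_def prr_mat_def scalar_prod_def
      if_distrib[of "\<lambda>x. x * _"] sum.delta sum_shifted_delta cong: if_cong)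

lemma biproduct_simps_nested:
  "dim_row Z = n \<Longrightarrow> prl_mat n m * (inl_mat n m * Z) = Z" "dim_row Z = m \<Longrightarrow> prr_mat n m * (inr_mat n m * Z) = Z"
  "dim_row Z = m \<Longrightarrow> prl_mat n m * (inr_mat n m * Z) = 0\<^sub>m n (dim_col Z)"
  "dim_row Z = n \<Longrightarrow> prr_mat n m * (inl_mat n m * Z) = 0\<^sub>m m (dim_col Z)"
proof -
  note [simp del] = assoc_mult_mat
  have *: "P * (Q * Z) = (P * Q) * Z" if "dim_col P = dim_row Q" "dim_col Q = dim_row Z" for P Q Z :: "'a mat"
    using that by (simp add: mat_dim_simps)
  show "dim_row Z = n \<Longrightarrow> prl_mat n m * (inl_mat n m * Z) = Z" "dim_row Z = m \<Longrightarrow> prr_mat n m * (inr_mat n m * Z) = Z"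
    "dim_row Z = m \<Longrightarrow> prl_mat n m * (inr_mat n m * Z) = 0\<^sub>m n (dim_col Z)"
    "dim_row Z = n \<Longrightarrow> prr_mat n m * (inl_mat n m * Z) = 0\<^sub>m m (dim_col Z)"
    by (subst *; simp add: biproduct_simps mat_dim_simps)+
qed

lemma four_block_biproduct:
  assumes "A \<in> carrier_mat n n" "D \<in> carrier_mat m m"
  shows "four_block_mat A (0\<^sub>m n m) (0\<^sub>m m n) D = inl_mat n m * (A * prl_mat n m) + inr_mat n m * (D * prr_mat n m)"
proof (rule eq_matI, goal_cases)
  case (1 i j)
  then show ?case
    using assms
    by (auto simp: inl_mat_def inr_mat_def prl_mat_def prr_mat_def scalar_prod_def if_distrib[of "\<lambda>x. x * _"]
        if_distrib[of "\<lambda>x. _ * x"] sum.delta sum_shifted_delta cong: if_cong)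
qed (use assms in auto)

text \<open>
  If \<open>k > n\<close>, padding with zeros makes both factors square, and then a one-sided inverse is two-sided; but
  the padded product in the other order has a zero row.
\<close>

lemma left_inverse_size:
  fixes P :: "'a :: field mat"
  assumes "P \<in> carrier_mat k n" "Q \<in> carrier_mat n k" "P * Q = 1\<^sub>m k"
  shows "k \<le> n"
proof (rule ccontr)
  assume "\<not> k \<le> n"
  then obtain d where k: "k = n + Suc d" by (metis add_Suc_right less_imp_Suc_add not_le)
  have [simp]: "dim_row P = n + Suc d" "dim_col P = n" "dim_row Q = n" "dim_col Q = n + Suc d"
    using assms k by auto
  let ?P = "P * prl_mat n (Suc d)" and ?Q = "inl_mat n (Suc d) * Q"
  have "?P * ?Q = 1\<^sub>m k"
    using assms k by (simp add: mat_dim_simps biproduct_simps_nested del: assoc_mult_mat)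
  then have "?Q * ?P = 1\<^sub>m k"
    by (rule mat_mult_left_right_inverse[rotated 2]) (use k in \<open>auto intro!: carrier_matI\<close>)
  then have "inl_mat n (Suc d) * (Q * ?P) = 1\<^sub>m k"
    by (simp add: mat_dim_simps del: assoc_mult_mat)
  from arg_cong[OF this, of "\<lambda>M. M $$ (n, n)"] show False
    using k by (simp add: inl_mat_def scalar_prod_def)
qed

text \<open>
  Unit columns and rows are matrices, not vectors, so that vectors, functionals and operators can be
  composed by the one matrix product: vectors of a module are columns, functionals are rows.
\<close>

definition ucol :: "nat \<Rightarrow> nat \<Rightarrow> 'a :: comm_ring_1 mat" where
  "ucol n i = mat n 1 (\<lambda>(a, b). if a = i then 1 else 0)"
definition urow :: "nat \<Rightarrow> nat \<Rightarrow> 'a :: comm_ring_1 mat" where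
  "urow n i = mat 1 n (\<lambda>(a, b). if b = i then 1 else 0)"

lemma unit_dims [simp]: "dim_row (ucol n i) = n" "dim_col (ucol n i) = 1" "dim_row (urow n i) = 1" "dim_col (urow n i) = n"
  by (auto simp: ucol_def urow_def)

lemma urow_mult_ucol: "i < n \<Longrightarrow> j < n \<Longrightarrow> urow n i * ucol n j = (if i = j then 1\<^sub>m 1 else 0\<^sub>m 1 1)"
  by (auto intro!: eq_matI simp: ucol_def urow_def scalar_prod_def if_distrib[of "\<lambda>x. x * _"] sum.delta cong: if_cong)

lemma mat_entry_as_product:
  "i < dim_row N \<Longrightarrow> j < dim_col N \<Longrightarrow> urow (dim_row N) i * (N * ucol (dim_col N) j) = N $$ (i, j) \<cdot>\<^sub>m 1\<^sub>m 1"
  by (auto intro!: eq_matI simp: ucol_def urow_def scalar_prod_def if_distrib[of "\<lambda>x. x * _"]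
      if_distrib[of "\<lambda>x. _ * x"] sum.delta cong: if_cong)

text \<open>
  A nonzero entry is the product of the matrix with a unit row and a unit column.
\<close>

lemma nonzero_mat_pairing:
  fixes N :: "'a :: field mat"
  assumes "N \<noteq> 0\<^sub>m (dim_row N) (dim_col N)"
  obtains w v where "w \<in> carrier_mat 1 (dim_row N)" "v \<in> carrier_mat (dim_col N) 1" "w * (N * v) = 1\<^sub>m 1"
proof -
  obtain i j where ij: "i < dim_row N" "j < dim_col N" "N $$ (i, j) \<noteq> 0"
    using assms by (metis eq_matI index_zero_mat)
  show thesis
  proof (rule that)
    show "(inverse (N $$ (i, j)) \<cdot>\<^sub>m urow (dim_row N) i) * (N * ucol (dim_col N) j) = 1\<^sub>m 1"
      using ij mat_entry_as_product[OF ij(1,2)]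
      by (subst mat_dim_simps) (auto intro!: eq_matI simp del: index_mult_mat(1))
  qed (auto intro!: carrier_matI)
qed

text \<open>
  The image of an idempotent has a basis. Instead of choosing one, a split factorization through the image
  is enlarged as long as possible.
\<close>

lemma idempotent_splits:
  fixes E :: "'a :: field mat"
  assumes E: "E \<in> carrier_mat n n" and idem: "E * E = E"
  obtains k i p where "i \<in> carrier_mat n k" "p \<in> carrier_mat k n" "i * p = E" "p * i = 1\<^sub>m k"
proof -
  \<comment> \<open>Factorizations of \<open>1\<close> through the image of \<open>E\<close>; a maximal one exhausts the image.\<close>
  define K where "K = {k. \<exists>i p. i \<in> carrier_mat n k \<and> p \<in> carrier_mat k n \<and> p * i = 1\<^sub>m k \<and> E * i = i \<and> p * E = p}"
  have "k \<le> n" if "k \<in> K" for k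
    using that left_inverse_size unfolding K_def by blast
  moreover have "0 \<in> K"
    unfolding K_def
    by (intro CollectI exI[of _ "0\<^sub>m n 0"] exI[of _ "0\<^sub>m 0 n"] conjI eq_matI) (use E in auto)
  ultimately obtain k where k: "k \<in> K" "\<And>l. l \<in> K \<Longrightarrow> l \<le> k"
    using Max_in[of K] Max_ge[of K] by (metis empty_iff finite_nat_set_iff_bounded_le)
  then obtain i p where ip: "i \<in> carrier_mat n k" "p \<in> carrier_mat k n" "p * i = 1\<^sub>m k" "E * i = i" "p * E = p"
    unfolding K_def by blast
  have [simp]: "dim_row i = n" "dim_col i = k" "dim_row p = k" "dim_col p = n" "dim_row E = n" "dim_col E = n"
    using ip E by auto
  note [simp del] = assoc_mult_mat
  have nest: "E * (i * Z) = i * Z" if "dim_row Z = k" for Z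
    using that ip(4) mat_dim_simps(1)[of E i Z] by simp
  have nest2: "p * (E * Z) = p * Z" "E * (E * Z) = E * Z" if "dim_row Z = n" for Z
    using that ip(5) idem mat_dim_simps(1)[of p E Z] mat_dim_simps(1)[of E E Z] by simp_all
  have nest3: "p * (i * Z) = Z" if "dim_row Z = k" for Z
    using that ip(3) mat_dim_simps(1)[of p i Z] by (simp add: mat_dim_simps)
  note norm = mat_dim_simps nest nest2 nest3 ip(3-5) idem
  \<comment> \<open>The part of the image that the factorization misses. If \<open>F\<close> is nonzero, then a row \<open>w F\<close> and a
    column \<open>F v\<close> with \<open>w F v = 1\<close> enlarge the factorization by one.\<close>
  define F where "F = E + (-1) \<cdot>\<^sub>m (i * p)"
  have [simp]: "dim_row F = n" "dim_col F = n" by (auto simp: F_def)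
  have cancel: "M + (-1) \<cdot>\<^sub>m M = 0\<^sub>m (dim_row M) (dim_col M)" "M + (M' + (-1) \<cdot>\<^sub>m M) = M'"
    if "dim_row M = dim_row M'" "dim_col M = dim_col M'" for M M' :: "'a mat"
    using that by (auto intro!: eq_matI)
  have F: "E * F = F" "F * E = F" "p * F = 0\<^sub>m k n" "F * i = 0\<^sub>m n k"
    by (simp_all add: F_def norm cancel(1)[OF refl refl])
  have FF: "F * F = F"
  proof -
    have "F * F = F * E + (-1) \<cdot>\<^sub>m (F * i * p)"
      by (subst (2) F_def) (simp add: mat_dim_simps)
    also have "\<dots> = F" by (simp add: F mat_dim_simps)
    finally show ?thesis .
  qed
  have nestF: "E * (F * Z) = F * Z" "p * (F * Z) = 0\<^sub>m k (dim_col Z)" "F * (F * Z) = F * Z" if "dim_row Z = n" for Z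
    using that F FF mat_dim_simps(1)[of E F Z] mat_dim_simps(1)[of p F Z] mat_dim_simps(1)[of F F Z]
    by (simp_all add: mat_dim_simps)
  have "F = 0\<^sub>m n n"
  proof (rule ccontr)
    assume "F \<noteq> 0\<^sub>m n n"
    then obtain w v where wv: "w \<in> carrier_mat 1 n" "v \<in> carrier_mat n 1" "w * (F * v) = 1\<^sub>m 1"
      by (metis \<open>dim_col F = n\<close> \<open>dim_row F = n\<close> nonzero_mat_pairing)
    then have [simp]: "dim_row w = 1" "dim_col w = n" "dim_row v = n" "dim_col v = 1" by auto
    define i' where "i' = i * prl_mat k 1 + F * (v * prr_mat k 1)"
    define p' where "p' = inl_mat k 1 * p + inr_mat k 1 * (w * F)"
    have wF: "w * (F * (v * Z)) = Z" if "dim_row Z = 1" for Z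
      using that wv(3) mat_dim_simps(1)[of w "F * v" Z] by (simp add: mat_dim_simps)
    have Fi: "F * (i * Z) = 0\<^sub>m n (dim_col Z)" if "dim_row Z = k" for Z
      using that F(4) mat_dim_simps(1)[of F i Z] by (simp add: mat_dim_simps)
    have "p' * i' = 1\<^sub>m (k + 1)" "E * i' = i'" "p' * E = p'"
      unfolding p'_def i'_def
      by (simp_all add: norm nestF wF F Fi biproduct_simps(5))
    moreover have "i' \<in> carrier_mat n (k + 1)" "p' \<in> carrier_mat (k + 1) n"
      by (auto simp: i'_def p'_def intro!: carrier_matI)
    ultimately have "k + 1 \<in> K"
      unfolding K_def by blast
    then show False using k(2) by fastforce
  qed
  have "i * p = E"
  proof (rule eq_matI, goal_cases)
    case (1 a b)
    then show ?case
      using arg_cong[OF \<open>F = 0\<^sub>m n n\<close>, of "\<lambda>M. M $$ (a, b)"] by (simp add: F_def del: index_mult_mat(1))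
  qed auto
  then show thesis using ip that by blast
qed

context double_params
begin

section \<open>Homomorphisms, isomorphisms and direct sums\<close>

abbreviation Rep :: "'k rep \<Rightarrow> bool" where "Rep \<equiv> is_module \<xi> \<theta>"
abbreviation Hom :: "'k rep \<Rightarrow> 'k rep \<Rightarrow> 'k mat set" where "Hom \<equiv> module_hom \<xi> \<theta>"
abbreviation Iso :: "'k rep \<Rightarrow> 'k rep \<Rightarrow> bool" where "Iso \<equiv> module_iso \<xi> \<theta>"
abbreviation Act :: "'k rep \<Rightarrow> gen \<Rightarrow> 'k mat" where "Act \<equiv> act \<xi> \<theta>"

lemma Act_dims [simp]: "Rep V \<Longrightarrow> dim_row (Act V s) = fst V" "Rep V \<Longrightarrow> dim_col (Act V s) = fst V"
  using act_carrier[of \<xi> \<theta> V s] by auto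

lemma Hom_dims: "T \<in> Hom V W \<Longrightarrow> dim_row T = fst W" "T \<in> Hom V W \<Longrightarrow> dim_col T = fst V"
  using module_homD(1)[of T \<xi> \<theta> V W] by auto

lemma HomI:
  assumes "Rep V" "Rep W" "dim_row T = fst W" "dim_col T = fst V" "\<And>s. T * Act V s = Act W s * T"
  shows "T \<in> Hom V W"
  by (rule module_homI) (use assms in auto)

lemma Hom_D: "T \<in> Hom V W \<Longrightarrow> T * Act V s = Act W s * T"
  by (rule module_homD(2))

lemma Hom_nested:
  assumes "T \<in> Hom V W" "Rep V" "Rep W" "dim_row Z = fst V"
  shows "T * (Act V s * Z) = Act W s * (T * Z)"
  using Hom_D[OF assms(1), of s] assms Hom_dims[OF assms(1)] mat_dim_simps(1)[of T "Act V s" Z]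
    mat_dim_simps(1)[of "Act W s" T Z] by simp

lemma Hom_comp:
  assumes "T \<in> Hom V W" "S \<in> Hom U V" "Rep U" "Rep V" "Rep W"
  shows "T * S \<in> Hom U W"
  using assms Hom_dims[OF assms(1)] Hom_dims[OF assms(2)]
  by (intro HomI) (simp_all add: mat_dim_simps Hom_D[OF assms(2)] Hom_nested[OF assms(1)])

lemma Hom_one: "Rep V \<Longrightarrow> 1\<^sub>m (fst V) \<in> Hom V V"
  by (rule HomI) (simp_all add: mat_dim_simps)

lemma Iso_refl: "Rep V \<Longrightarrow> Iso V V"
  unfolding module_iso_def using Hom_one[of V] by (intro bexI[of _ "1\<^sub>m (fst V)"]) auto

lemma Iso_sym: "Iso V W \<Longrightarrow> Iso W V"
  unfolding module_iso_def by blast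

lemma Iso_trans:
  assumes "Iso U V" "Iso V W" "Rep U" "Rep V" "Rep W"
  shows "Iso U W"
proof -
  obtain T S T' S' where 1: "T \<in> Hom U V" "S \<in> Hom V U" "S * T = 1\<^sub>m (fst U)" "T * S = 1\<^sub>m (fst V)"
    and 2: "T' \<in> Hom V W" "S' \<in> Hom W V" "S' * T' = 1\<^sub>m (fst V)" "T' * S' = 1\<^sub>m (fst W)"
    using assms unfolding module_iso_def by blast
  note d = Hom_dims[OF 1(1)] Hom_dims[OF 1(2)] Hom_dims[OF 2(1)] Hom_dims[OF 2(2)]
  have "S * S' * (T' * T) = S * (S' * T') * T" "T' * T * (S * S') = T' * (T * S) * S'"
    using d by (simp_all add: mat_dim_simps del: assoc_mult_mat)
  then have "S * S' * (T' * T) = 1\<^sub>m (fst U)" "T' * T * (S * S') = 1\<^sub>m (fst W)"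
    using 1 2 d by (simp_all add: mat_dim_simps)
  then show ?thesis
    unfolding module_iso_def using Hom_comp[OF 2(1) 1(1)] Hom_comp[OF 1(2) 2(2)] assms by blast
qed

lemma Iso_dim: "Iso V W \<Longrightarrow> fst V = fst W"
  unfolding module_iso_def
  by (meson le_antisym left_inverse_size module_homD(1))

text \<open>
  The inverse of a bijective homomorphism is a homomorphism, so only one direction needs to be
  equivariant.
\<close>

lemma Iso_of_inverse:
  assumes V: "Rep V" and W: "Rep W" and T: "T \<in> Hom V W"
    and S: "S \<in> carrier_mat (fst V) (fst W)" "S * T = 1\<^sub>m (fst V)" "T * S = 1\<^sub>m (fst W)"
  shows "Iso V W"
proof -
  note d = Hom_dims[OF T]
  have nested: "S * (T * Z) = Z" if "dim_row Z = fst V" for Z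
    using that S d mat_dim_simps(1)[of S T Z] by (simp add: mat_dim_simps)
  have "S * Act W s = Act V s * S" for s
  proof -
    have "S * Act W s = S * (Act W s * (T * S))" using S W d by (simp add: mat_dim_simps)
    also have "\<dots> = S * (T * (Act V s * S))"
      using S V W d Hom_nested[OF T V W, of S] by simp
    also have "\<dots> = Act V s * S" using S V W d by (intro nested) simp
    finally show ?thesis .
  qed
  then have "S \<in> Hom W V" using S V W by (intro HomI) auto
  then show ?thesis using T S unfolding module_iso_def by blast
qed

lemma direct_sum_biproduct:
  assumes "Rep V" "Rep W"
  shows "snd (direct_sum V W) (D_class \<xi> \<theta> f) =
    inl_mat (fst V) (fst W) * (snd V (D_class \<xi> \<theta> f) * prl_mat (fst V) (fst W))
    + inr_mat (fst V) (fst W) * (snd W (D_class \<xi> \<theta> f) * prr_mat (fst V) (fst W))"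
  using module_simps(1)[OF assms(1)] module_simps(1)[OF assms(2)]
  by (simp add: direct_sum_def four_block_biproduct)

lemma fst_direct_sum [simp]: "fst (direct_sum V W) = fst V + fst W"
  by (simp add: direct_sum_def)

lemma is_moduleI:
  assumes "\<And>f. snd V (D_class \<xi> \<theta> f) \<in> carrier_mat (fst V) (fst V)"
    "\<And>f g. snd V (D_class \<xi> \<theta> (f + g)) = snd V (D_class \<xi> \<theta> f) + snd V (D_class \<xi> \<theta> g)"
    "\<And>f g. snd V (D_class \<xi> \<theta> (f * g)) = snd V (D_class \<xi> \<theta> f) * snd V (D_class \<xi> \<theta> g)"
    "\<And>c. snd V (D_class \<xi> \<theta> (scal c)) = c \<cdot>\<^sub>m 1\<^sub>m (fst V)"
  shows "Rep V"
proof -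
  have "snd V (D_class \<xi> \<theta> 1) = 1\<^sub>m (fst V)"
    using assms(4)[of 1] by (auto simp: scal_def intro!: eq_matI)
  then show ?thesis
    unfolding is_module_def
    using assms by (auto intro!: ring_hom_memI simp: carrier_D_alg D_class_simps ring_mat_simps)
qed

lemma module_dims [simp]:
  "Rep V \<Longrightarrow> dim_row (snd V (D_class \<xi> \<theta> f)) = fst V" "Rep V \<Longrightarrow> dim_col (snd V (D_class \<xi> \<theta> f)) = fst V"
  using module_simps(1)[of \<xi> \<theta> V f] by auto

lemma mat_add_ac:
  fixes A B C :: "'k mat"
  shows "dim_row A = dim_row B \<Longrightarrow> dim_col A = dim_col B \<Longrightarrow> A + B = B + A"
    "dim_row A = dim_row B \<Longrightarrow> dim_col A = dim_col B \<Longrightarrow> dim_row B = dim_row C \<Longrightarrow> dim_col B = dim_col C \<Longrightarrow> A + B + C = A + (B + C)"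
    "dim_row A = dim_row B \<Longrightarrow> dim_col A = dim_col B \<Longrightarrow> dim_row B = dim_row C \<Longrightarrow> dim_col B = dim_col C \<Longrightarrow> A + (B + C) = B + (A + C)"
  by (auto intro!: eq_matI)

lemma direct_sum_module:
  assumes V: "Rep V" and W: "Rep W"
  shows "Rep (direct_sum V W)"
    "Act (direct_sum V W) s = inl_mat (fst V) (fst W) * (Act V s * prl_mat (fst V) (fst W))
       + inr_mat (fst V) (fst W) * (Act W s * prr_mat (fst V) (fst W))"
proof -
  note [simp] = V W and b = direct_sum_biproduct[OF V W]
  note [simp del] = assoc_mult_mat
  show "Rep (direct_sum V W)"
  proof (rule is_moduleI)
    show "snd (direct_sum V W) (D_class \<xi> \<theta> (scal c)) = c \<cdot>\<^sub>m 1\<^sub>m (fst (direct_sum V W))" for c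
      unfolding fst_direct_sum biproduct_simps(5)[symmetric]
      by (simp add: b module_simps(5) mat_dim_simps)
    show "snd (direct_sum V W) (D_class \<xi> \<theta> f) \<in> carrier_mat (fst (direct_sum V W)) (fst (direct_sum V W))" for f
      by (rule carrier_matI) (simp_all add: b)
  qed (simp_all add: b module_simps(2,3) mat_dim_simps biproduct_simps_nested mat_add_ac)
  show "Act (direct_sum V W) s = inl_mat (fst V) (fst W) * (Act V s * prl_mat (fst V) (fst W))
       + inr_mat (fst V) (fst W) * (Act W s * prr_mat (fst V) (fst W))"
    by (simp add: act_def b)
qed

text \<open>
  The inclusions and projections of a biproduct assemble to mutually inverse maps.
\<close>

lemma Iso_direct_sumI:
  assumes V: "Rep V" and W: "Rep W" and M: "Rep M"
    and i1: "i1 \<in> Hom V M" and i2: "i2 \<in> Hom W M" and p1: "p1 \<in> Hom M V" and p2: "p2 \<in> Hom M W"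
    and 1: "p1 * i1 = 1\<^sub>m (fst V)" "p2 * i2 = 1\<^sub>m (fst W)" "p1 * i2 = 0\<^sub>m (fst V) (fst W)" "p2 * i1 = 0\<^sub>m (fst W) (fst V)"
    and sum: "i1 * p1 + i2 * p2 = 1\<^sub>m (fst M)"
  shows "Iso M (direct_sum V W)"
proof -
  let ?n = "fst V" and ?m = "fst W"
  note [simp] = V W M Hom_dims[OF i1] Hom_dims[OF i2] Hom_dims[OF p1] Hom_dims[OF p2] direct_sum_module(1)[OF V W]
  note [simp del] = assoc_mult_mat
  have nested: "p1 * (i1 * Z) = Z" "p2 * (i1 * Z) = 0\<^sub>m ?m (dim_col Z)" if "dim_row Z = ?n" for Z
    using that 1 mat_dim_simps(1)[of p1 i1 Z] mat_dim_simps(1)[of p2 i1 Z] by (simp_all add: mat_dim_simps)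
  have nested': "p1 * (i2 * Z) = 0\<^sub>m ?n (dim_col Z)" "p2 * (i2 * Z) = Z" if "dim_row Z = ?m" for Z
    using that 1 mat_dim_simps(1)[of p1 i2 Z] mat_dim_simps(1)[of p2 i2 Z] by (simp_all add: mat_dim_simps)
  let ?T = "inl_mat ?n ?m * p1 + inr_mat ?n ?m * p2" and ?S = "i1 * prl_mat ?n ?m + i2 * prr_mat ?n ?m"
  show ?thesis
  proof (rule Iso_of_inverse)
    show "?T \<in> Hom M (direct_sum V W)"
      by (rule HomI) (simp_all add: direct_sum_module(2) mat_dim_simps biproduct_simps_nested
          Hom_D[OF p1] Hom_D[OF p2])
    show "?S * ?T = 1\<^sub>m (fst M)"
      by (simp add: mat_dim_simps biproduct_simps_nested sum)
    show "?T * ?S = 1\<^sub>m (fst (direct_sum V W))"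
      by (simp add: mat_dim_simps nested nested' biproduct_simps)
  qed (auto intro!: carrier_matI)
qed

text \<open>
  The complement of the summand \<open>Q\<close> is the image of the idempotent endomorphism \<open>1 - T * H\<close>. It is returned
  with its inclusion and projection, which show that it inherits projectivity.
\<close>

lemma split_summand:
  assumes Q: "Rep Q" and M: "Rep M" and T: "T \<in> Hom Q M" and H: "H \<in> Hom M Q" and HT: "H * T = 1\<^sub>m (fst Q)"
  obtains K i p where "Rep K" "Iso M (direct_sum Q K)" "fst M = fst Q + fst K"
    "i \<in> Hom K M" "p \<in> Hom M K" "p * i = 1\<^sub>m (fst K)" "H * i = 0\<^sub>m (fst Q) (fst K)"
proof -
  let ?n = "fst M"
  note [simp] = Q M Hom_dims[OF T] Hom_dims[OF H]
  note [simp del] = assoc_mult_mat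
  define E where "E = 1\<^sub>m ?n + (-1) \<cdot>\<^sub>m (T * H)"
  have [simp]: "dim_row E = ?n" "dim_col E = ?n" by (simp_all add: E_def)
  have HTn: "H * (T * Z) = Z" if "dim_row Z = fst Q" for Z
    using that HT mat_dim_simps(1)[of H T Z] by (simp add: mat_dim_simps)
  have cancel: "M + (-1) \<cdot>\<^sub>m M = 0\<^sub>m (dim_row M) (dim_col M)" for M :: "'k mat"
    by (auto intro!: eq_matI)
  have ET: "E * T = 0\<^sub>m ?n (fst Q)" and HE: "H * E = 0\<^sub>m (fst Q) ?n"
    using cancel[of T] cancel[of H] by (simp_all add: E_def mat_dim_simps HT HTn)
  have EE: "E * E = E"
  proof -
    have "E * E = E * 1\<^sub>m ?n + (-1) \<cdot>\<^sub>m (E * T * H)"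
      by (subst (2) E_def) (simp add: mat_dim_simps)
    also have "\<dots> = E" by (simp add: ET mat_dim_simps)
    finally show ?thesis .
  qed
  have E: "E \<in> carrier_mat ?n ?n" by (auto intro!: carrier_matI)
  obtain k i p where ip: "i \<in> carrier_mat ?n k" "p \<in> carrier_mat k ?n" "i * p = E" "p * i = 1\<^sub>m k"
    using idempotent_splits[OF E EE] .
  have [simp]: "dim_row i = ?n" "dim_col i = k" "dim_row p = k" "dim_col p = ?n"
    using ip by auto
  have ipn: "p * (i * Z) = Z" if "dim_row Z = k" for Z
    using that ip(4) mat_dim_simps(1)[of p i Z] by (simp add: mat_dim_simps)
  have iE: "E * i = i" "p * E = p"
    using ip(4) by (simp_all add: mat_dim_simps flip: ip(3)) (simp add: ipn)
  \<comment> \<open>The action compressed to the image of \<open>E\<close>, which is a submodule.\<close>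
  define \<rho> where "\<rho> d = p * (snd M d * i)" for d
  let ?K = "(k, \<rho>)"
  have comm: "snd M (D_class \<xi> \<theta> f) * (T * Z) = T * (snd Q (D_class \<xi> \<theta> f) * Z)"
    if "dim_row Z = fst Q" for f Z
  proof -
    have "T * snd Q (D_class \<xi> \<theta> f) = snd M (D_class \<xi> \<theta> f) * T"
      using T by (auto simp: module_hom_def carrier_D_alg)
    then show "snd M (D_class \<xi> \<theta> f) * (T * Z) = T * (snd Q (D_class \<xi> \<theta> f) * Z)"
      using that mat_dim_simps(1)[of T "snd Q (D_class \<xi> \<theta> f)" Z] mat_dim_simps(1)[of "snd M (D_class \<xi> \<theta> f)" T Z]
      by simp
  qed
  have comm2: "H * (snd M (D_class \<xi> \<theta> f) * Y) = snd Q (D_class \<xi> \<theta> f) * (H * Y)"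
    if "dim_row Y = ?n" for f Y
  proof -
    have "H * snd M (D_class \<xi> \<theta> f) = snd Q (D_class \<xi> \<theta> f) * H"
      using H by (auto simp: module_hom_def carrier_D_alg)
    then show "H * (snd M (D_class \<xi> \<theta> f) * Y) = snd Q (D_class \<xi> \<theta> f) * (H * Y)"
      using that mat_dim_simps(1)[of H "snd M (D_class \<xi> \<theta> f)" Y] mat_dim_simps(1)[of "snd Q (D_class \<xi> \<theta> f)" H Y]
      by simp
  qed
  have Hi: "H * i = 0\<^sub>m (fst Q) k"
    using HE iE(1) mat_dim_simps(1)[of H E i] by (simp add: mat_dim_simps)
  have Hin: "H * (i * Z) = 0\<^sub>m (fst Q) (dim_col Z)" if "dim_row Z = k" for Z
    using Hi that mat_dim_simps(1)[of H i Z] by (simp add: mat_dim_simps)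
  have pE: "i * (p * Z) = E * Z" if "dim_row Z = ?n" for Z
    using that mat_dim_simps(1)[of i p Z] by (simp add: ip(3))
  have Ex: "E * (snd M (D_class \<xi> \<theta> f) * (i * Z)) = snd M (D_class \<xi> \<theta> f) * (i * Z)" if "dim_row Z = k" for f Z
    using that by (simp add: E_def mat_dim_simps comm2 Hin)
  have Exi: "E * (snd M (D_class \<xi> \<theta> f) * i) = snd M (D_class \<xi> \<theta> f) * i" for f
    by (simp add: E_def mat_dim_simps comm2 Hi)
  have K: "Rep ?K"
    by (rule is_moduleI) (auto intro!: carrier_matI simp: \<rho>_def module_simps(2,3,5) mat_dim_simps pE Exi ip(4))
  have Ki: "Act ?K s = p * (Act M s * i)" for s by (simp add: act_def \<rho>_def)
  have i: "i \<in> Hom ?K M"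
    by (rule HomI) (simp_all add: K Ki pE, simp add: act_def Exi)
  have pT: "p * T = 0\<^sub>m k (fst Q)"
    using ET iE(2) mat_dim_simps(1)[of p E T] by (simp add: mat_dim_simps)
  have pTn: "p * (T * Z) = 0\<^sub>m k (dim_col Z)" if "dim_row Z = fst Q" for Z
    using pT that mat_dim_simps(1)[of p T Z] by (simp add: mat_dim_simps)
  have xE: "p * (Act M s * E) = p * Act M s" for s
    by (simp add: E_def mat_dim_simps) (simp add: act_def comm pTn mat_dim_simps)
  have p: "p \<in> Hom M ?K"
    by (rule HomI) (simp_all add: K Ki mat_dim_simps ip(3) xE)
  have "T * H + E = 1\<^sub>m ?n"
    by (auto intro!: eq_matI simp: E_def simp del: index_mult_mat(1))
  then have iso: "Iso M (direct_sum Q ?K)"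
    by (intro Iso_direct_sumI[OF Q K M T i H p HT]) (simp_all add: ip Hi pT)
  from Iso_dim[OF iso] show thesis
    by (intro that[OF K iso _ i p]) (simp_all add: ip Hi)
qed

section \<open>Weight vectors and weight functionals\<close>

text \<open>
  Six times the projection onto the eigenspace of \<open>A\<close> for the sixth root of unity \<open>\<alpha>\<close>: the sum of
  \<open>(A / \<alpha>)^k\<close> over \<open>k < 6\<close>, with the negative powers of \<open>\<alpha>\<close> written as positive ones.
\<close>

definition weight_proj :: "nat \<Rightarrow> 'k mat \<Rightarrow> 'k \<Rightarrow> 'k mat" where
  "weight_proj n A \<alpha> = 1\<^sub>m n + (\<alpha> ^ 5 \<cdot>\<^sub>m A + (\<alpha> ^ 4 \<cdot>\<^sub>m (A * A) + (\<alpha> ^ 3 \<cdot>\<^sub>m (A * (A * A))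
     + (\<alpha> ^ 2 \<cdot>\<^sub>m (A * (A * (A * A))) + \<alpha> \<cdot>\<^sub>m (A * (A * (A * (A * A))))))))"

lemma weight_proj:
  assumes [simp]: "dim_row A = n" "dim_col A = n" and A6: "A * (A * (A * (A * (A * A)))) = 1\<^sub>m n"
    and \<alpha>: "\<alpha> ^ 6 = 1"
  shows "dim_row (weight_proj n A \<alpha>) = n" "dim_col (weight_proj n A \<alpha>) = n"
    "A * weight_proj n A \<alpha> = \<alpha> \<cdot>\<^sub>m weight_proj n A \<alpha>"
    "weight_proj n A \<alpha> * A = \<alpha> \<cdot>\<^sub>m weight_proj n A \<alpha>"
proof -
  note [simp del] = assoc_mult_mat
  have a: "\<alpha> * \<alpha> ^ 5 = 1" "\<alpha> * \<alpha> ^ 4 = \<alpha> ^ 5" "\<alpha> * \<alpha> ^ 3 = \<alpha> ^ 4" "\<alpha> * \<alpha> ^ 2 = \<alpha> ^ 3" "\<alpha> * \<alpha> = \<alpha> ^ 2"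
    using \<alpha> by (simp_all add: eval_nat_numeral)
  show "dim_row (weight_proj n A \<alpha>) = n" "dim_col (weight_proj n A \<alpha>) = n"
    by (simp_all add: weight_proj_def)
  show "A * weight_proj n A \<alpha> = \<alpha> \<cdot>\<^sub>m weight_proj n A \<alpha>" "weight_proj n A \<alpha> * A = \<alpha> \<cdot>\<^sub>m weight_proj n A \<alpha>"
    unfolding weight_proj_def
    by (simp_all add: mat_dim_simps A6 a) (auto intro!: eq_matI simp del: index_mult_mat(1))
qed

lemma weight_proj_commute:
  assumes [simp]: "dim_row A = n" "dim_col A = n" "dim_row G = n" "dim_col G = n" and AG: "A * G = G * A"
  shows "weight_proj n A \<alpha> * G = G * weight_proj n A \<alpha>"
proof -
  note [simp del] = assoc_mult_mat
  have "A * (G * Z) = G * (A * Z)" if "dim_row Z = n" for Z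
    using that mat_dim_simps(1)[of A G Z] mat_dim_simps(1)[of G A Z] by (simp add: AG)
  then show ?thesis
    by (simp add: weight_proj_def mat_dim_simps AG)
qed

lemma weight_proj_eigenvector:
  assumes [simp]: "dim_row A = n" "dim_col A = n" "dim_row u = n" and u: "A * u = \<alpha> \<cdot>\<^sub>m u"
    and \<alpha>: "\<alpha> ^ 6 = 1"
  shows "weight_proj n A \<alpha> * u = 6 \<cdot>\<^sub>m u"
proof -
  note [simp del] = assoc_mult_mat
  have a: "\<alpha> * (\<alpha> * (\<alpha> * (\<alpha> * (\<alpha> * \<alpha>)))) = 1" "\<alpha> ^ 2 = \<alpha> * \<alpha>" "\<alpha> ^ 3 = \<alpha> * (\<alpha> * \<alpha>)" "\<alpha> ^ 4 = \<alpha> * (\<alpha> * (\<alpha> * \<alpha>))"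
    "\<alpha> ^ 5 = \<alpha> * (\<alpha> * (\<alpha> * (\<alpha> * \<alpha>)))"
    using \<alpha> by (simp_all add: eval_nat_numeral)
  show ?thesis
    unfolding weight_proj_def
    by (simp add: mat_dim_simps u a mult.assoc) (auto intro!: eq_matI)
qed

lemma xi_powers: "\<xi> ^ 2 = \<xi> - 1" "\<xi> ^ 3 = -1" "\<xi> ^ 4 = - \<xi>" "\<xi> ^ 5 = 1 - \<xi>"
  by (simp_all add: eval_nat_numeral xi_simps)

text \<open>
  The eigenprojections add up to the identity, because the sum of the powers of a nontrivial sixth root of
  unity vanishes.
\<close>

lemma weight_proj_sum:
  assumes [simp]: "dim_row A = n" "dim_col A = n"
  shows "weight_proj n A (\<xi> ^ 0) + (weight_proj n A (\<xi> ^ 1) + (weight_proj n A (\<xi> ^ 2) +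
    (weight_proj n A (\<xi> ^ 3) + (weight_proj n A (\<xi> ^ 4) + weight_proj n A (\<xi> ^ 5))))) = 6 \<cdot>\<^sub>m 1\<^sub>m n"
proof (rule eq_matI, goal_cases)
  case (1 i j)
  then show ?case
    unfolding xi_powers weight_proj_def
    by (simp add: eval_nat_numeral xi_simps del: index_mult_mat(1) index_one_mat(1))
qed (simp_all add: weight_proj_def)

lemma weight_proj_nonzero:
  assumes [simp]: "dim_row A = n" "dim_col A = n" "dim_col N = n" and N: "N \<noteq> 0\<^sub>m (dim_row N) n"
  obtains i where "i < 6" "N * weight_proj n A (\<xi> ^ i) \<noteq> 0\<^sub>m (dim_row N) n"
proof (rule ccontr)
  assume "\<not> thesis"
  then have 0: "\<forall>i<6. N * weight_proj n A (\<xi> ^ i) = 0\<^sub>m (dim_row N) n"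
    using that by blast
  have [simp]: "dim_row (weight_proj n A \<alpha>) = n" "dim_col (weight_proj n A \<alpha>) = n" for \<alpha>
    by (simp_all add: weight_proj_def)
  have "6 \<cdot>\<^sub>m N = N * (6 \<cdot>\<^sub>m 1\<^sub>m n)" by (simp add: mat_dim_simps)
  also have "\<dots> = 0\<^sub>m (dim_row N) n"
    unfolding weight_proj_sum[OF assms(1,2), symmetric]
    using 0[rule_format, of 0] 0[rule_format, of 1] 0[rule_format, of 2] 0[rule_format, of 3]
      0[rule_format, of 4] 0[rule_format, of 5] by (simp add: mat_dim_simps)
  finally have 6: "6 \<cdot>\<^sub>m N = 0\<^sub>m (dim_row N) n" .
  have "N = 0\<^sub>m (dim_row N) n"
  proof (rule eq_matI, goal_cases)
    case (1 i j)
    then show ?case using arg_cong[OF 6, of "\<lambda>M. M $$ (i, j)"] by simp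
  qed auto
  then show False using N by contradiction
qed

lemma root_pow: "(\<xi> ^ i) ^ 6 = 1"
  by (metis power_mult mult.commute xi6 power_one)

lemma module_a6_g6:
  assumes "Rep M"
  shows "Act M Gen_a * (Act M Gen_a * (Act M Gen_a * (Act M Gen_a * (Act M Gen_a * Act M Gen_a)))) = 1\<^sub>m (fst M)"
    "Act M Gen_g * (Act M Gen_g * (Act M Gen_g * (Act M Gen_g * (Act M Gen_g * Act M Gen_g)))) = 1\<^sub>m (fst M)"
    "Act M Gen_a * Act M Gen_g = Act M Gen_g * Act M Gen_a"
  using act_D_matrices[OF assms] by (auto simp: D_matrices_def)

text \<open>
  As \<open>a\<close> and \<open>g\<close> commute and have order dividing six, the products of their eigenprojections decompose every
  module; a nonzero matrix \<open>N\<close> remains nonzero on some weight space.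
\<close>

lemma weight_projector:
  assumes M: "Rep M" and N: "dim_col N = fst M" "N \<noteq> 0\<^sub>m (dim_row N) (fst M)"
  obtains i j R where "i < 6" "j < 6" "dim_row R = fst M" "dim_col R = fst M" "N * R \<noteq> 0\<^sub>m (dim_row N) (fst M)"
    "Act M Gen_a * R = \<xi> ^ i \<cdot>\<^sub>m R" "Act M Gen_g * R = \<xi> ^ j \<cdot>\<^sub>m R"
    "R * Act M Gen_a = \<xi> ^ i \<cdot>\<^sub>m R" "R * Act M Gen_g = \<xi> ^ j \<cdot>\<^sub>m R"
proof -
  let ?n = "fst M" and ?A = "Act M Gen_a" and ?G = "Act M Gen_g"
  note [simp] = M N(1)
  note [simp del] = assoc_mult_mat
  obtain i where i: "i < 6" "N * weight_proj ?n ?A (\<xi> ^ i) \<noteq> 0\<^sub>m (dim_row N) ?n"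
    using weight_proj_nonzero[of ?A ?n N] N by auto
  let ?R = "weight_proj ?n ?A (\<xi> ^ i)"
  note R = weight_proj[of ?A ?n "\<xi> ^ i", OF _ _ module_a6_g6(1)[OF M] root_pow, simplified]
  obtain j where j: "j < 6" "N * ?R * weight_proj ?n ?G (\<xi> ^ j) \<noteq> 0\<^sub>m (dim_row N) ?n"
    using weight_proj_nonzero[of ?G ?n "N * ?R"] i R by auto
  let ?S = "weight_proj ?n ?G (\<xi> ^ j)"
  note S = weight_proj[of ?G ?n "\<xi> ^ j", OF _ _ module_a6_g6(2)[OF M] root_pow, simplified]
  note c = weight_proj_commute[of ?A ?n ?G "\<xi> ^ i", simplified, OF module_a6_g6(3)[OF M]]
    weight_proj_commute[of ?G ?n ?A "\<xi> ^ j", simplified, OF module_a6_g6(3)[OF M, symmetric]]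
  have "?A * (?R * ?S) = \<xi> ^ i \<cdot>\<^sub>m (?R * ?S)" 
    using mat_dim_simps(1)[of ?A ?R ?S] R S by (simp add: mat_dim_simps)
  moreover have "?G * (?R * ?S) = \<xi> ^ j \<cdot>\<^sub>m (?R * ?S)" 
    using mat_dim_simps(1)[of ?G ?R ?S] mat_dim_simps(1)[of ?R ?G ?S] R S c by (simp add: mat_dim_simps)
  moreover have "?R * ?S * ?A = \<xi> ^ i \<cdot>\<^sub>m (?R * ?S)" 
    using mat_dim_simps(1)[of ?R ?A ?S] R S c by (simp add: mat_dim_simps)
  moreover have "?R * ?S * ?G = \<xi> ^ j \<cdot>\<^sub>m (?R * ?S)" 
    using R S c by (simp add: mat_dim_simps)
  ultimately show thesis
    using i j R S by (intro that[of i j "?R * ?S"]) (simp_all add: mat_dim_simps)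
qed

lemma nonzero_column:
  assumes "(N :: 'k mat) * R \<noteq> 0\<^sub>m (dim_row N) (dim_col R)" "dim_col N = dim_row R"
  obtains v where "dim_row v = dim_col R" "dim_col v = 1" "N * (R * v) \<noteq> 0\<^sub>m (dim_row N) 1"
proof -
  have "N * R \<noteq> 0\<^sub>m (dim_row (N * R)) (dim_col (N * R))" using assms by simp
  from nonzero_mat_pairing[OF this] obtain w v where wv: "w \<in> carrier_mat 1 (dim_row N)" "v \<in> carrier_mat (dim_col R) 1"
    "w * (N * R * v) = 1\<^sub>m 1" by auto
  show thesis
  proof (rule that[of v])
    show "N * (R * v) \<noteq> 0\<^sub>m (dim_row N) 1"
    proof
      assume "N * (R * v) = 0\<^sub>m (dim_row N) 1"
      then have "w * (N * R * v) = 0\<^sub>m 1 1" using wv assms(2) by (simp add: mat_dim_simps)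
      from arg_cong[OF this, of "\<lambda>M. M $$ (0, 0)"] show False unfolding wv(3) by simp
    qed
  qed (use wv in auto)
qed

text \<open>
  The functional dual to a weight vector can be chosen in the same weight: any functional that is nonzero
  on \<open>u\<close>, composed with the projection onto the weight space, will do. The factor \<open>36\<close> is the normalization
  of the two projections.
\<close>

lemma weight_functional:
  assumes M: "Rep M" and [simp]: "dim_row u = fst M" "dim_col u = 1" and u0: "u \<noteq> 0\<^sub>m (fst M) 1"
    and u: "Act M Gen_a * u = \<alpha> \<cdot>\<^sub>m u" "Act M Gen_g * u = \<gamma> \<cdot>\<^sub>m u" and \<alpha>: "\<alpha> ^ 6 = 1" and \<gamma>: "\<gamma> ^ 6 = 1"
  obtains \<phi> where "dim_row \<phi> = 1" "dim_col \<phi> = fst M" "\<phi> * u = 1\<^sub>m 1"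
    "\<phi> * Act M Gen_a = \<alpha> \<cdot>\<^sub>m \<phi>" "\<phi> * Act M Gen_g = \<gamma> \<cdot>\<^sub>m \<phi>"
proof -
  let ?n = "fst M" and ?A = "Act M Gen_a" and ?G = "Act M Gen_g"
  note [simp] = M
  note [simp del] = assoc_mult_mat
  obtain w v where wv: "w \<in> carrier_mat 1 ?n" "v \<in> carrier_mat 1 1" "w * (u * v) = 1\<^sub>m 1"
    using nonzero_mat_pairing[of u] u0 by auto
  have [simp]: "dim_row w = 1" "dim_col w = ?n" "dim_row v = 1" "dim_col v = 1" using wv by auto
  have wu: "v * (w * u) = 1\<^sub>m 1"
    by (rule mat_mult_left_right_inverse[of "w * u"]) (use wv in \<open>auto intro!: carrier_matI simp: mat_dim_simps\<close>)
  let ?R = "weight_proj ?n ?A \<alpha>" and ?S = "weight_proj ?n ?G \<gamma>"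
  note R = weight_proj[of ?A ?n \<alpha>, OF _ _ module_a6_g6(1)[OF M] \<alpha>, simplified]
  note S = weight_proj[of ?G ?n \<gamma>, OF _ _ module_a6_g6(2)[OF M] \<gamma>, simplified]
  note c = weight_proj_commute[of ?A ?n ?G \<alpha>, simplified, OF module_a6_g6(3)[OF M]]
    weight_proj_commute[of ?G ?n ?A \<gamma>, simplified, OF module_a6_g6(3)[OF M, symmetric]]
  have e: "?R * u = 6 \<cdot>\<^sub>m u" "?S * u = 6 \<cdot>\<^sub>m u"
    using weight_proj_eigenvector[of ?A ?n u \<alpha>] weight_proj_eigenvector[of ?G ?n u \<gamma>] u \<alpha> \<gamma> by simp_all
  have RA: "?R * (?A * Z) = \<alpha> \<cdot>\<^sub>m (?R * Z)" if "dim_row Z = ?n" for Z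
    using that R mat_dim_simps(1)[of ?R ?A Z] by (simp add: mat_dim_simps)
  show thesis
  proof (rule that[of "(1 / 36) \<cdot>\<^sub>m (v * (w * (?R * ?S)))"])
    show "(1 / 36) \<cdot>\<^sub>m (v * (w * (?R * ?S))) * u = 1\<^sub>m 1"
      using R S by (simp add: mat_dim_simps e wu) (auto intro!: eq_matI)
  qed (use R S c in \<open>simp_all add: mat_dim_simps RA mult.commute\<close>)
qed

end

lemma unit_nested:
  assumes "i < n" "j < n" "dim_row Z = 1"
  shows "urow n i * (ucol n j * Z) = (if i = j then Z else 0\<^sub>m 1 (dim_col Z))"
proof -
  have "urow n i * (ucol n j * Z) = (urow n i * ucol n j) * Z"
    using assms by (simp add: mat_dim_simps)
  then show ?thesis using assms by (simp add: urow_mult_ucol mat_dim_simps)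
qed

lemma one_mat_2: "(1\<^sub>m 2 :: 'a :: comm_ring_1 mat) = ucol 2 0 * urow 2 0 + ucol 2 1 * urow 2 1"
  by (auto intro!: eq_matI simp: ucol_def urow_def scalar_prod_def)

lemma one_mat_4: "(1\<^sub>m 4 :: 'a :: comm_ring_1 mat) = ucol 4 0 * urow 4 0 + (ucol 4 1 * urow 4 1 +
    (ucol 4 2 * urow 4 2 + ucol 4 3 * urow 4 3))"
  by (auto intro!: eq_matI simp: ucol_def urow_def scalar_prod_def)

context double_params
begin

section \<open>The indecomposable modules\<close>

text \<open>
  The scalar \<open>t\<close> by which \<open>b x - \<xi> x b\<close> acts on the weight space of \<open>(\<alpha>, \<gamma>)\<close>. It vanishes exactly if
  \<open>\<gamma> = \<alpha>^3\<close>, that is, if the central element \<open>a^3 g\<close> acts by \<open>1\<close>.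
\<close>

definition twist :: "'k \<Rightarrow> 'k \<Rightarrow> 'k" where
  "twist \<alpha> \<gamma> = - (\<xi> * \<theta>) * (\<alpha> * (\<alpha> * (\<alpha> * \<alpha>)) - \<gamma> * \<alpha>)"

text \<open>
  The module with basis \<open>v, x v\<close>, where \<open>v\<close> has weight \<open>(\<alpha>, \<gamma>)\<close> and is killed by \<open>b\<close>; the entry of \<open>b\<close> is forced
  by \<open>b x v = t v\<close>.
\<close>

definition V2 :: "'k \<Rightarrow> 'k \<Rightarrow> 'k rep" where
  "V2 \<alpha> \<gamma> = rep 2 (\<alpha> \<cdot>\<^sub>m (ucol 2 0 * urow 2 0) + (\<xi> * \<alpha>) \<cdot>\<^sub>m (ucol 2 1 * urow 2 1))
     (twist \<alpha> \<gamma> \<cdot>\<^sub>m (ucol 2 0 * urow 2 1))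
     (\<gamma> \<cdot>\<^sub>m (ucol 2 0 * urow 2 0) + (- \<gamma>) \<cdot>\<^sub>m (ucol 2 1 * urow 2 1))
     (ucol 2 1 * urow 2 0 + (1 - \<gamma> * \<gamma>) \<cdot>\<^sub>m (ucol 2 0 * urow 2 1))"

text \<open>
  The module with basis \<open>p, x p, b p, x b p\<close>, where \<open>p\<close> has the degenerate weight \<open>(\<alpha>, \<alpha>^3)\<close>. On this weight
  space \<open>x^2 = 1 - g^2 = 0\<close> and \<open>b x = \<xi> x b\<close>. The off-diagonal entry of \<open>a\<close> comes from the term
  \<open>b a^3 - g b\<close> in the relation between \<open>a\<close> and \<open>x\<close>, to which both summands contribute equally.
\<close>

definition P4 :: "'k \<Rightarrow> 'k rep" where
  "P4 \<alpha> = rep 4 (\<alpha> \<cdot>\<^sub>m (ucol 4 0 * urow 4 0) + ((\<xi> * \<alpha>) \<cdot>\<^sub>m (ucol 4 1 * urow 4 1) +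
        ((2 * \<theta> * (\<xi> - 2) * (\<alpha> * (\<alpha> * \<alpha>))) \<cdot>\<^sub>m (ucol 4 2 * urow 4 1) +
        (((1 - \<xi>) * \<alpha>) \<cdot>\<^sub>m (ucol 4 2 * urow 4 2) + \<alpha> \<cdot>\<^sub>m (ucol 4 3 * urow 4 3)))))
     (ucol 4 2 * urow 4 0 + \<xi> \<cdot>\<^sub>m (ucol 4 3 * urow 4 1))
     ((\<alpha> * (\<alpha> * \<alpha>)) \<cdot>\<^sub>m (ucol 4 0 * urow 4 0 + ((-1) \<cdot>\<^sub>m (ucol 4 1 * urow 4 1) +
        ((-1) \<cdot>\<^sub>m (ucol 4 2 * urow 4 2) + ucol 4 3 * urow 4 3))))
     (ucol 4 1 * urow 4 0 + ucol 4 3 * urow 4 2)"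

text \<open>
  The one-dimensional module of weight \<open>(\<alpha>, \<alpha>^3)\<close>; the weight must be degenerate because \<open>b\<close> and \<open>x\<close> act by
  zero.
\<close>

definition chi :: "'k \<Rightarrow> 'k rep" where
  "chi \<alpha> = rep 1 (\<alpha> \<cdot>\<^sub>m 1\<^sub>m 1) (0\<^sub>m 1 1) ((\<alpha> * (\<alpha> * \<alpha>)) \<cdot>\<^sub>m 1\<^sub>m 1) (0\<^sub>m 1 1)"

lemma root6:
  assumes "\<alpha> ^ 6 = 1"
  shows "\<alpha> * (\<alpha> * (\<alpha> * (\<alpha> * (\<alpha> * \<alpha>)))) = (1 :: 'k)" "\<alpha> * (\<alpha> * (\<alpha> * (\<alpha> * (\<alpha> * (\<alpha> * z))))) = z"
proof -
  show *: "\<alpha> * (\<alpha> * (\<alpha> * (\<alpha> * (\<alpha> * \<alpha>)))) = 1" using assms by (simp add: eval_nat_numeral)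
  have "\<alpha> * (\<alpha> * (\<alpha> * (\<alpha> * (\<alpha> * (\<alpha> * z))))) = (\<alpha> * (\<alpha> * (\<alpha> * (\<alpha> * (\<alpha> * \<alpha>))))) * z"
    by (simp only: mult.assoc)
  then show "\<alpha> * (\<alpha> * (\<alpha> * (\<alpha> * (\<alpha> * (\<alpha> * z))))) = z" by (simp add: *)
qed

lemma V2_matrices:
  assumes "\<alpha> ^ 6 = 1" "\<gamma> ^ 6 = 1"
  shows "D_matrices 2 (\<alpha> \<cdot>\<^sub>m (ucol 2 0 * urow 2 0) + (\<xi> * \<alpha>) \<cdot>\<^sub>m (ucol 2 1 * urow 2 1))
     (twist \<alpha> \<gamma> \<cdot>\<^sub>m (ucol 2 0 * urow 2 1))
     (\<gamma> \<cdot>\<^sub>m (ucol 2 0 * urow 2 0) + (- \<gamma>) \<cdot>\<^sub>m (ucol 2 1 * urow 2 1))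
     (ucol 2 1 * urow 2 0 + (1 - \<gamma> * \<gamma>) \<cdot>\<^sub>m (ucol 2 0 * urow 2 1))"
  unfolding D_matrices_def one_mat_2
  by (intro conjI carrier_matI;
     simp add: mat_dim_simps urow_mult_ucol unit_nested twist_def del: assoc_mult_mat;
     (rule eq_matI; simp add: xi_simps root6[OF assms(1)] root6[OF assms(2)] del: index_mult_mat(1))?)

lemma P4_matrices:
  assumes "\<alpha> ^ 6 = 1"
  shows "D_matrices 4 (\<alpha> \<cdot>\<^sub>m (ucol 4 0 * urow 4 0) + ((\<xi> * \<alpha>) \<cdot>\<^sub>m (ucol 4 1 * urow 4 1) +
        ((2 * \<theta> * (\<xi> - 2) * (\<alpha> * (\<alpha> * \<alpha>))) \<cdot>\<^sub>m (ucol 4 2 * urow 4 1) +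
        (((1 - \<xi>) * \<alpha>) \<cdot>\<^sub>m (ucol 4 2 * urow 4 2) + \<alpha> \<cdot>\<^sub>m (ucol 4 3 * urow 4 3)))))
     (ucol 4 2 * urow 4 0 + \<xi> \<cdot>\<^sub>m (ucol 4 3 * urow 4 1))
     ((\<alpha> * (\<alpha> * \<alpha>)) \<cdot>\<^sub>m (ucol 4 0 * urow 4 0 + ((-1) \<cdot>\<^sub>m (ucol 4 1 * urow 4 1) +
        ((-1) \<cdot>\<^sub>m (ucol 4 2 * urow 4 2) + ucol 4 3 * urow 4 3))))
     (ucol 4 1 * urow 4 0 + ucol 4 3 * urow 4 2)"
  unfolding D_matrices_def one_mat_4
  by (intro conjI carrier_matI;
     simp add: mat_dim_simps urow_mult_ucol unit_nested del: assoc_mult_mat;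
     (rule eq_matI; simp add: xi_simps root6[OF assms] del: index_mult_mat(1))?)

lemma chi_matrices:
  assumes "\<alpha> ^ 6 = 1"
  shows "D_matrices 1 (\<alpha> \<cdot>\<^sub>m 1\<^sub>m 1) (0\<^sub>m 1 1) ((\<alpha> * (\<alpha> * \<alpha>)) \<cdot>\<^sub>m 1\<^sub>m 1) (0\<^sub>m 1 1)"
  unfolding D_matrices_def
  by (intro conjI carrier_matI;
     simp add: mat_dim_simps del: assoc_mult_mat;
     (rule eq_matI; simp add: xi_simps root6[OF assms] del: index_mult_mat(1))?)

lemma V2_module:
  assumes "\<alpha> ^ 6 = 1" "\<gamma> ^ 6 = 1"
  shows "Rep (V2 \<alpha> \<gamma>)" "fst (V2 \<alpha> \<gamma>) = 2"
   "Act (V2 \<alpha> \<gamma>) Gen_a = \<alpha> \<cdot>\<^sub>m (ucol 2 0 * urow 2 0) + (\<xi> * \<alpha>) \<cdot>\<^sub>m (ucol 2 1 * urow 2 1)"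
   "Act (V2 \<alpha> \<gamma>) Gen_b = twist \<alpha> \<gamma> \<cdot>\<^sub>m (ucol 2 0 * urow 2 1)"
   "Act (V2 \<alpha> \<gamma>) Gen_g = \<gamma> \<cdot>\<^sub>m (ucol 2 0 * urow 2 0) + (- \<gamma>) \<cdot>\<^sub>m (ucol 2 1 * urow 2 1)"
   "Act (V2 \<alpha> \<gamma>) Gen_x = ucol 2 1 * urow 2 0 + (1 - \<gamma> * \<gamma>) \<cdot>\<^sub>m (ucol 2 0 * urow 2 1)"
  unfolding V2_def using rep_module[OF V2_matrices[OF assms]] by (simp_all add: gen_matrices_def)

lemma P4_module:
  assumes "\<alpha> ^ 6 = 1"
  shows "Rep (P4 \<alpha>)" "fst (P4 \<alpha>) = 4"
   "Act (P4 \<alpha>) Gen_a = \<alpha> \<cdot>\<^sub>m (ucol 4 0 * urow 4 0) + ((\<xi> * \<alpha>) \<cdot>\<^sub>m (ucol 4 1 * urow 4 1) +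
        ((2 * \<theta> * (\<xi> - 2) * (\<alpha> * (\<alpha> * \<alpha>))) \<cdot>\<^sub>m (ucol 4 2 * urow 4 1) +
        (((1 - \<xi>) * \<alpha>) \<cdot>\<^sub>m (ucol 4 2 * urow 4 2) + \<alpha> \<cdot>\<^sub>m (ucol 4 3 * urow 4 3))))"
   "Act (P4 \<alpha>) Gen_b = ucol 4 2 * urow 4 0 + \<xi> \<cdot>\<^sub>m (ucol 4 3 * urow 4 1)"
   "Act (P4 \<alpha>) Gen_g = (\<alpha> * (\<alpha> * \<alpha>)) \<cdot>\<^sub>m (ucol 4 0 * urow 4 0 + ((-1) \<cdot>\<^sub>m (ucol 4 1 * urow 4 1) +
        ((-1) \<cdot>\<^sub>m (ucol 4 2 * urow 4 2) + ucol 4 3 * urow 4 3)))"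
   "Act (P4 \<alpha>) Gen_x = ucol 4 1 * urow 4 0 + ucol 4 3 * urow 4 2"
  unfolding P4_def using rep_module[OF P4_matrices[OF assms]] by (simp_all add: gen_matrices_def)

lemma chi_module:
  assumes "\<alpha> ^ 6 = 1"
  shows "Rep (chi \<alpha>)" "fst (chi \<alpha>) = 1" "Act (chi \<alpha>) Gen_a = \<alpha> \<cdot>\<^sub>m 1\<^sub>m 1" "Act (chi \<alpha>) Gen_b = 0\<^sub>m 1 1"
   "Act (chi \<alpha>) Gen_g = (\<alpha> * (\<alpha> * \<alpha>)) \<cdot>\<^sub>m 1\<^sub>m 1" "Act (chi \<alpha>) Gen_x = 0\<^sub>m 1 1"
  unfolding chi_def using rep_module[OF chi_matrices[OF assms]] by (simp_all add: gen_matrices_def)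

section \<open>Splitting off summands\<close>

lemmas act_rewrite = D_matrices_rewrite[OF act_D_matrices] D_matrices_rewrite_nested[OF act_D_matrices]

text \<open>
  The relations in the opposite order, with \<open>g\<close> and \<open>a\<close> moved to the right, where they meet a weight
  vector.
\<close>

lemma act_rewrite_right:
  assumes M: "Rep M"
  shows "Act M Gen_b * Act M Gen_b = 0\<^sub>m (fst M) (fst M)" "Act M Gen_a * Act M Gen_b = (1 - \<xi>) \<cdot>\<^sub>m (Act M Gen_b * Act M Gen_a)"
    "Act M Gen_a * Act M Gen_g = Act M Gen_g * Act M Gen_a" "Act M Gen_g * Act M Gen_b = (-1) \<cdot>\<^sub>m (Act M Gen_b * Act M Gen_g)"
    "Act M Gen_g * Act M Gen_x = (-1) \<cdot>\<^sub>m (Act M Gen_x * Act M Gen_g)"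
    "Act M Gen_x * Act M Gen_x = 1\<^sub>m (fst M) + (-1) \<cdot>\<^sub>m (Act M Gen_g * Act M Gen_g)"
    "Act M Gen_a * Act M Gen_x = \<xi> \<cdot>\<^sub>m (Act M Gen_x * Act M Gen_a) +
       (\<theta> * (\<xi> - 2)) \<cdot>\<^sub>m (Act M Gen_b * (Act M Gen_a * (Act M Gen_a * Act M Gen_a)) + Act M Gen_b * Act M Gen_g)"
    "Act M Gen_b * Act M Gen_x = \<xi> \<cdot>\<^sub>m (Act M Gen_x * Act M Gen_b) + (- (\<xi> * \<theta>)) \<cdot>\<^sub>m
       (Act M Gen_a * (Act M Gen_a * (Act M Gen_a * Act M Gen_a)) + (-1) \<cdot>\<^sub>m (Act M Gen_g * Act M Gen_a))"
proof -
  note [simp] = M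
  note [simp del] = assoc_mult_mat
  note r = act_rewrite[OF M]
  show "Act M Gen_b * Act M Gen_b = 0\<^sub>m (fst M) (fst M)" "Act M Gen_a * Act M Gen_g = Act M Gen_g * Act M Gen_a"
    "Act M Gen_x * Act M Gen_x = 1\<^sub>m (fst M) + (-1) \<cdot>\<^sub>m (Act M Gen_g * Act M Gen_g)"
    "Act M Gen_b * Act M Gen_x = \<xi> \<cdot>\<^sub>m (Act M Gen_x * Act M Gen_b) + (- (\<xi> * \<theta>)) \<cdot>\<^sub>m
       (Act M Gen_a * (Act M Gen_a * (Act M Gen_a * Act M Gen_a)) + (-1) \<cdot>\<^sub>m (Act M Gen_g * Act M Gen_a))"
    by (fact r)+
  show "Act M Gen_a * Act M Gen_b = (1 - \<xi>) \<cdot>\<^sub>m (Act M Gen_b * Act M Gen_a)" "Act M Gen_g * Act M Gen_b = (-1) \<cdot>\<^sub>m (Act M Gen_b * Act M Gen_g)"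
    "Act M Gen_g * Act M Gen_x = (-1) \<cdot>\<^sub>m (Act M Gen_x * Act M Gen_g)"
    by ((simp only: r mat_dim_simps Act_dims[OF M]; rule eq_matI; simp add: xi_simps del: index_mult_mat(1))+)
  show "Act M Gen_a * Act M Gen_x = \<xi> \<cdot>\<^sub>m (Act M Gen_x * Act M Gen_a) +
       (\<theta> * (\<xi> - 2)) \<cdot>\<^sub>m (Act M Gen_b * (Act M Gen_a * (Act M Gen_a * Act M Gen_a)) + Act M Gen_b * Act M Gen_g)"
    by (simp add: r mat_dim_simps; rule eq_matI; simp add: xi_simps del: index_mult_mat(1))
qed

lemma act_rewrite_right_nested:
  assumes M: "Rep M" and Z: "dim_row Z = fst M"
  shows "Act M Gen_b * (Act M Gen_b * Z) = 0\<^sub>m (fst M) (dim_col Z)"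
    "Act M Gen_a * (Act M Gen_b * Z) = (1 - \<xi>) \<cdot>\<^sub>m (Act M Gen_b * (Act M Gen_a * Z))"
    "Act M Gen_a * (Act M Gen_g * Z) = Act M Gen_g * (Act M Gen_a * Z)"
    "Act M Gen_g * (Act M Gen_b * Z) = (-1) \<cdot>\<^sub>m (Act M Gen_b * (Act M Gen_g * Z))"
    "Act M Gen_g * (Act M Gen_x * Z) = (-1) \<cdot>\<^sub>m (Act M Gen_x * (Act M Gen_g * Z))"
    "Act M Gen_x * (Act M Gen_x * Z) = Z + (-1) \<cdot>\<^sub>m (Act M Gen_g * (Act M Gen_g * Z))"
    "Act M Gen_a * (Act M Gen_x * Z) = \<xi> \<cdot>\<^sub>m (Act M Gen_x * (Act M Gen_a * Z)) +
       (\<theta> * (\<xi> - 2)) \<cdot>\<^sub>m (Act M Gen_b * (Act M Gen_a * (Act M Gen_a * (Act M Gen_a * Z))) + Act M Gen_b * (Act M Gen_g * Z))"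
    "Act M Gen_b * (Act M Gen_x * Z) = \<xi> \<cdot>\<^sub>m (Act M Gen_x * (Act M Gen_b * Z)) + (- (\<xi> * \<theta>)) \<cdot>\<^sub>m
       (Act M Gen_a * (Act M Gen_a * (Act M Gen_a * (Act M Gen_a * Z))) + (-1) \<cdot>\<^sub>m (Act M Gen_g * (Act M Gen_a * Z)))"
proof -
  note [simp] = M Z
  note [simp del] = assoc_mult_mat
  have *: "P * (Q * Z) = (P * Q) * Z" if "dim_col P = fst M" "dim_row Q = fst M" "dim_col Q = fst M" for P Q
    using that by (simp add: mat_dim_simps)
  note r = act_rewrite_right[OF M]
  show "Act M Gen_b * (Act M Gen_b * Z) = 0\<^sub>m (fst M) (dim_col Z)"
    by (subst *) (simp_all add: r mat_dim_simps)
  show "Act M Gen_a * (Act M Gen_b * Z) = (1 - \<xi>) \<cdot>\<^sub>m (Act M Gen_b * (Act M Gen_a * Z))"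
    by (subst *) (simp_all add: r mat_dim_simps)
  show "Act M Gen_a * (Act M Gen_g * Z) = Act M Gen_g * (Act M Gen_a * Z)"
    by (subst *) (simp_all add: r mat_dim_simps)
  show "Act M Gen_g * (Act M Gen_b * Z) = (-1) \<cdot>\<^sub>m (Act M Gen_b * (Act M Gen_g * Z))"
    by (subst *) (simp_all add: r mat_dim_simps)
  show "Act M Gen_g * (Act M Gen_x * Z) = (-1) \<cdot>\<^sub>m (Act M Gen_x * (Act M Gen_g * Z))"
    by (subst *) (simp_all add: r mat_dim_simps)
  show "Act M Gen_x * (Act M Gen_x * Z) = Z + (-1) \<cdot>\<^sub>m (Act M Gen_g * (Act M Gen_g * Z))"
    by (subst *) (simp_all add: r mat_dim_simps)
  show "Act M Gen_a * (Act M Gen_x * Z) = \<xi> \<cdot>\<^sub>m (Act M Gen_x * (Act M Gen_a * Z)) +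
       (\<theta> * (\<xi> - 2)) \<cdot>\<^sub>m (Act M Gen_b * (Act M Gen_a * (Act M Gen_a * (Act M Gen_a * Z))) + Act M Gen_b * (Act M Gen_g * Z))"
    by (subst *) (simp_all add: r mat_dim_simps)
  show "Act M Gen_b * (Act M Gen_x * Z) = \<xi> \<cdot>\<^sub>m (Act M Gen_x * (Act M Gen_b * Z)) + (- (\<xi> * \<theta>)) \<cdot>\<^sub>m
       (Act M Gen_a * (Act M Gen_a * (Act M Gen_a * (Act M Gen_a * Z))) + (-1) \<cdot>\<^sub>m (Act M Gen_g * (Act M Gen_a * Z)))"
    by (subst *) (simp_all add: r mat_dim_simps)
qed

lemmas act_right = act_rewrite_right act_rewrite_right_nested

lemma left_eigen_nested:
  assumes "dim_col \<phi> = n" "dim_row A = n" "dim_col A = n" "\<phi> * A = \<alpha> \<cdot>\<^sub>m (\<phi> :: 'k mat)" "dim_row Z = n"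
  shows "\<phi> * (A * Z) = \<alpha> \<cdot>\<^sub>m (\<phi> * Z)"
  using assms mat_dim_simps(1)[of \<phi> A Z] by (simp add: mat_dim_simps)

lemma right_eigen_nested:
  assumes "dim_row u = n" "dim_row A = n" "dim_col A = n" "A * u = \<alpha> \<cdot>\<^sub>m (u :: 'k mat)" "dim_row Z = dim_col u"
  shows "A * (u * Z) = \<alpha> \<cdot>\<^sub>m (u * Z)"
  using assms mat_dim_simps(1)[of A u Z] by (simp add: mat_dim_simps)

text \<open>
  The map sends the basis \<open>v, x v\<close> to \<open>u, x u\<close>.
\<close>

lemma V2_hom:
  assumes M: "Rep M" and \<alpha>: "\<alpha> ^ 6 = 1" and \<gamma>: "\<gamma> ^ 6 = 1" and [simp]: "dim_row u = fst M" "dim_col u = 1"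
    and u: "Act M Gen_a * u = \<alpha> \<cdot>\<^sub>m u" "Act M Gen_g * u = \<gamma> \<cdot>\<^sub>m u" "Act M Gen_b * u = 0\<^sub>m (fst M) 1"
  shows "u * urow 2 0 + Act M Gen_x * (u * urow 2 1) \<in> Hom (V2 \<alpha> \<gamma>) M"
proof -
  note [simp] = M V2_module[OF \<alpha> \<gamma>]
  note [simp del] = assoc_mult_mat
  have un: "Act M Gen_a * (u * Z) = \<alpha> \<cdot>\<^sub>m (u * Z)" "Act M Gen_g * (u * Z) = \<gamma> \<cdot>\<^sub>m (u * Z)"
    "Act M Gen_b * (u * Z) = 0\<^sub>m (fst M) (dim_col Z)" if "dim_row Z = 1" for Z
    using that u mat_dim_simps(1)[of "Act M Gen_b" u Z] by (simp_all add: right_eigen_nested mat_dim_simps)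
  show ?thesis
  proof (rule HomI)
    fix s
    show "(u * urow 2 0 + Act M Gen_x * (u * urow 2 1)) * Act (V2 \<alpha> \<gamma>) s =
        Act M s * (u * urow 2 0 + Act M Gen_x * (u * urow 2 1))"
      by (cases s; simp add: mat_dim_simps urow_mult_ucol unit_nested un act_right[OF M] twist_def;
         (rule eq_matI; simp add: xi_simps root6[OF \<alpha>] root6[OF \<gamma>] del: index_mult_mat(1))?)
  qed simp_all
qed

lemma Hom_smult:
  assumes "T \<in> Hom V W" "Rep V" "Rep W"
  shows "c \<cdot>\<^sub>m T \<in> Hom V W"
  by (rule HomI) (use assms Hom_dims[OF assms(1)] in \<open>simp_all add: mat_dim_simps Hom_D[OF assms(1)]\<close>)

text \<open>
  The functional \<open>\<phi>\<close> of weight \<open>(\<alpha>, \<gamma>)\<close> is composed with \<open>b x\<close> and \<open>b\<close>; equivariance uses \<open>b^2 = 0\<close>,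
  \<open>x^2 = 1 - g^2\<close> and \<open>b x = \<xi> x b + t\<close>.
\<close>

lemma V2_retraction:
  assumes M: "Rep M" and \<alpha>: "\<alpha> ^ 6 = 1" and \<gamma>: "\<gamma> ^ 6 = 1" and [simp]: "dim_row \<phi> = 1" "dim_col \<phi> = fst M"
    and \<phi>: "\<phi> * Act M Gen_a = \<alpha> \<cdot>\<^sub>m \<phi>" "\<phi> * Act M Gen_g = \<gamma> \<cdot>\<^sub>m \<phi>"
  shows "ucol 2 0 * (\<phi> * (Act M Gen_b * Act M Gen_x)) + ucol 2 1 * (\<phi> * Act M Gen_b) \<in> Hom M (V2 \<alpha> \<gamma>)"
    (is "?H \<in> _")
proof -
  note [simp] = M V2_module[OF \<alpha> \<gamma>]
  note [simp del] = assoc_mult_mat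
  have \<phi>n: "\<phi> * (Act M Gen_a * Z) = \<alpha> \<cdot>\<^sub>m (\<phi> * Z)" "\<phi> * (Act M Gen_g * Z) = \<gamma> \<cdot>\<^sub>m (\<phi> * Z)" if "dim_row Z = fst M" for Z
    using that \<phi> by (simp_all add: left_eigen_nested)
  show ?thesis
  proof (rule HomI)
    fix s
    show "?H * Act M s = Act (V2 \<alpha> \<gamma>) s * ?H"
      apply (cases s; simp add: mat_dim_simps urow_mult_ucol unit_nested \<phi>n \<phi> act_rewrite[OF M] twist_def)
      apply (rule eq_matI; simp add: xi_simps root6[OF \<alpha>] root6[OF \<gamma>] del: index_mult_mat(1))+
      done
  qed simp_all
qed

lemma weight_orthogonal:
  assumes "dim_row \<phi> = 1" "dim_col \<phi> = n" "dim_row G = n" "dim_col G = n" "dim_row Z = n"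
    and "\<phi> * G = \<gamma> \<cdot>\<^sub>m (\<phi> :: 'k mat)" "G * Z = \<gamma>' \<cdot>\<^sub>m Z" "\<gamma> \<noteq> \<gamma>'"
  shows "\<phi> * Z = 0\<^sub>m 1 (dim_col Z)"
proof -
  have *: "\<gamma> \<cdot>\<^sub>m (\<phi> * Z) = \<gamma>' \<cdot>\<^sub>m (\<phi> * Z)"
    using assms left_eigen_nested[of \<phi> n G \<gamma> Z] by (simp add: mat_dim_simps)
  show ?thesis
  proof (rule eq_matI, goal_cases)
    case (1 i j)
    then show ?case
      using arg_cong[OF *, of "\<lambda>M. M $$ (i, j)"] assms(1,8) by (simp del: index_mult_mat(1))
  qed (use assms in auto)
qed

text \<open>
  By \<open>b x u = t u\<close> and \<open>b u = 0\<close> the composite is \<open>t\<close> times the identity; the remaining entry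
  \<open>\<phi> b x x u\<close> vanishes because \<open>x x u\<close> is a multiple of \<open>u\<close>.
\<close>

lemma V2_retract_inclusion:
  assumes M: "Rep M" and \<alpha>: "\<alpha> ^ 6 = 1" and \<gamma>: "\<gamma> ^ 6 = 1" and t: "twist \<alpha> \<gamma> \<noteq> 0"
    and [simp]: "dim_row u = fst M" "dim_col u = 1" "dim_row \<phi> = 1" "dim_col \<phi> = fst M"
    and u: "Act M Gen_a * u = \<alpha> \<cdot>\<^sub>m u" "Act M Gen_g * u = \<gamma> \<cdot>\<^sub>m u" "Act M Gen_b * u = 0\<^sub>m (fst M) 1"
    and \<phi>: "\<phi> * u = 1\<^sub>m 1" "\<phi> * Act M Gen_a = \<alpha> \<cdot>\<^sub>m \<phi>" "\<phi> * Act M Gen_g = \<gamma> \<cdot>\<^sub>m \<phi>"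
  shows "(1 / twist \<alpha> \<gamma>) \<cdot>\<^sub>m (ucol 2 0 * (\<phi> * (Act M Gen_b * Act M Gen_x)) + ucol 2 1 * (\<phi> * Act M Gen_b)) *
    (u * urow 2 0 + Act M Gen_x * (u * urow 2 1)) = 1\<^sub>m 2"
proof -
  note [simp] = M
  note [simp del] = assoc_mult_mat
  have un: "Act M Gen_a * (u * Z) = \<alpha> \<cdot>\<^sub>m (u * Z)" "Act M Gen_g * (u * Z) = \<gamma> \<cdot>\<^sub>m (u * Z)" "\<phi> * (u * Z) = Z"
    "Act M Gen_b * (u * Z) = 0\<^sub>m (fst M) (dim_col Z)" if "dim_row Z = 1" for Z
    using that u \<phi>(1) mat_dim_simps(1)[of "Act M Gen_b" u Z] mat_dim_simps(1)[of \<phi> u Z]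
    by (simp_all add: right_eigen_nested mat_dim_simps)
  have "(ucol 2 0 * (\<phi> * (Act M Gen_b * Act M Gen_x)) + ucol 2 1 * (\<phi> * Act M Gen_b)) *
    (u * urow 2 0 + Act M Gen_x * (u * urow 2 1)) = twist \<alpha> \<gamma> \<cdot>\<^sub>m 1\<^sub>m 2"
    unfolding one_mat_2
    by (simp add: mat_dim_simps urow_mult_ucol unit_nested un u act_right[OF M] twist_def)
      (rule eq_matI; simp add: xi_simps root6[OF \<alpha>] root6[OF \<gamma>] del: index_mult_mat(1))
  then show ?thesis
    using t by (subst mat_dim_simps(4)) (auto intro!: eq_matI simp del: index_mult_mat(1))
qed

text \<open>
  A nonzero vector that is killed by \<open>b\<close> and has a weight with \<open>t \<noteq> 0\<close> generates a copy of \<open>V2\<close> that is a direct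
  summand of whatever module contains it, so such summands are found by looking for a single vector.
\<close>

lemma V2_summand:
  assumes M: "Rep M" and \<alpha>: "\<alpha> ^ 6 = 1" and \<gamma>: "\<gamma> ^ 6 = 1" and t: "twist \<alpha> \<gamma> \<noteq> 0"
    and ud: "dim_row u = fst M" "dim_col u = 1" and u0: "u \<noteq> 0\<^sub>m (fst M) 1"
    and u: "Act M Gen_a * u = \<alpha> \<cdot>\<^sub>m u" "Act M Gen_g * u = \<gamma> \<cdot>\<^sub>m u" "Act M Gen_b * u = 0\<^sub>m (fst M) 1"
  obtains \<phi> T H where "T = u * urow 2 0 + Act M Gen_x * (u * urow 2 1)"
    "H = (1 / twist \<alpha> \<gamma>) \<cdot>\<^sub>m (ucol 2 0 * (\<phi> * (Act M Gen_b * Act M Gen_x)) + ucol 2 1 * (\<phi> * Act M Gen_b))"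
    "dim_row \<phi> = 1" "dim_col \<phi> = fst M" "\<phi> * Act M Gen_a = \<alpha> \<cdot>\<^sub>m \<phi>" "\<phi> * Act M Gen_g = \<gamma> \<cdot>\<^sub>m \<phi>"
    "T \<in> Hom (V2 \<alpha> \<gamma>) M" "H \<in> Hom M (V2 \<alpha> \<gamma>)" "H * T = 1\<^sub>m (fst (V2 \<alpha> \<gamma>))"
proof -
  obtain \<phi> where \<phi>: "dim_row \<phi> = 1" "dim_col \<phi> = fst M" "\<phi> * u = 1\<^sub>m 1"
    "\<phi> * Act M Gen_a = \<alpha> \<cdot>\<^sub>m \<phi>" "\<phi> * Act M Gen_g = \<gamma> \<cdot>\<^sub>m \<phi>"
    using weight_functional[OF M ud u0 u(1,2) \<alpha> \<gamma>] .
  show thesis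
    by (rule that[OF refl refl \<phi>(1,2,4,5) V2_hom[OF M \<alpha> \<gamma> ud u] Hom_smult[OF V2_retraction[OF M \<alpha> \<gamma> \<phi>(1,2,4,5)]]])
      (use M V2_module[OF \<alpha> \<gamma>] V2_retract_inclusion[OF M \<alpha> \<gamma> t ud \<phi>(1,2) u \<phi>(3-5)] in simp_all)
qed

text \<open>
  The map that sends the basis \<open>p, x p, b p, x b p\<close> to \<open>u, x u, b u, x b u\<close>.
\<close>

definition P4_incl :: "'k rep \<Rightarrow> 'k mat \<Rightarrow> 'k mat" where
  "P4_incl M u = u * urow 4 0 + (Act M Gen_x * (u * urow 4 1) + (Act M Gen_b * (u * urow 4 2) +
     Act M Gen_x * (Act M Gen_b * (u * urow 4 3))))"

text \<open>
  The coordinates of a vector \<open>m\<close> are read off from \<open>\<phi>\<close> applied to \<open>x b m\<close>, \<open>b m\<close>, \<open>x m\<close> and \<open>m\<close>; here \<open>\<phi>\<close> is dual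
  to the generator \<open>x b p\<close> of the socle. The factor \<open>1 - \<xi>\<close> is the inverse of \<open>\<xi>\<close> and compensates for
  \<open>b x = \<xi> x b\<close>.
\<close>

definition P4_retr :: "'k rep \<Rightarrow> 'k mat \<Rightarrow> 'k mat" where
  "P4_retr M \<phi> = ucol 4 0 * (\<phi> * (Act M Gen_x * Act M Gen_b)) + ((1 - \<xi>) \<cdot>\<^sub>m (ucol 4 1 * (\<phi> * Act M Gen_b)) +
     (ucol 4 2 * (\<phi> * Act M Gen_x) + ucol 4 3 * \<phi>))"

lemma P4_hom:
  assumes M: "Rep M" and \<alpha>: "\<alpha> ^ 6 = 1" and [simp]: "dim_row u = fst M" "dim_col u = 1"
    and u: "Act M Gen_a * u = \<alpha> \<cdot>\<^sub>m u" "Act M Gen_g * u = (\<alpha> * (\<alpha> * \<alpha>)) \<cdot>\<^sub>m u"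
  shows "P4_incl M u \<in> Hom (P4 \<alpha>) M"
proof -
  note [simp] = M P4_module[OF \<alpha>]
  note [simp del] = assoc_mult_mat
  have un: "Act M Gen_a * (u * Z) = \<alpha> \<cdot>\<^sub>m (u * Z)" "Act M Gen_g * (u * Z) = (\<alpha> * (\<alpha> * \<alpha>)) \<cdot>\<^sub>m (u * Z)"
    if "dim_row Z = 1" for Z
    using that u by (simp_all add: right_eigen_nested)
  show ?thesis
    unfolding P4_incl_def
  proof (rule HomI)
    fix s
    show "(u * urow 4 0 + (Act M Gen_x * (u * urow 4 1) + (Act M Gen_b * (u * urow 4 2) +
      Act M Gen_x * (Act M Gen_b * (u * urow 4 3))))) * Act (P4 \<alpha>) s =
        Act M s * (u * urow 4 0 + (Act M Gen_x * (u * urow 4 1) + (Act M Gen_b * (u * urow 4 2) +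
      Act M Gen_x * (Act M Gen_b * (u * urow 4 3)))))"
      by (cases s; simp add: mat_dim_simps urow_mult_ucol unit_nested un act_right[OF M];
         rule eq_matI; simp add: xi_simps root6[OF \<alpha>] del: index_mult_mat(1))
  qed simp_all
qed

lemma P4_retraction:
  assumes M: "Rep M" and \<alpha>: "\<alpha> ^ 6 = 1" and [simp]: "dim_row \<phi> = 1" "dim_col \<phi> = fst M"
    and \<phi>: "\<phi> * Act M Gen_a = \<alpha> \<cdot>\<^sub>m \<phi>" "\<phi> * Act M Gen_g = (\<alpha> * (\<alpha> * \<alpha>)) \<cdot>\<^sub>m \<phi>"
  shows "P4_retr M \<phi> \<in> Hom M (P4 \<alpha>)"
proof -
  note [simp] = M P4_module[OF \<alpha>]
  note [simp del] = assoc_mult_mat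
  have \<phi>n: "\<phi> * (Act M Gen_a * Z) = \<alpha> \<cdot>\<^sub>m (\<phi> * Z)" "\<phi> * (Act M Gen_g * Z) = (\<alpha> * (\<alpha> * \<alpha>)) \<cdot>\<^sub>m (\<phi> * Z)"
    if "dim_row Z = fst M" for Z
    using that \<phi> by (simp_all add: left_eigen_nested)
  show ?thesis
    unfolding P4_retr_def
  proof (rule HomI)
    fix s
    show "(ucol 4 0 * (\<phi> * (Act M Gen_x * Act M Gen_b)) + ((1 - \<xi>) \<cdot>\<^sub>m (ucol 4 1 * (\<phi> * Act M Gen_b)) +
     (ucol 4 2 * (\<phi> * Act M Gen_x) + ucol 4 3 * \<phi>))) * Act M s =
     Act (P4 \<alpha>) s * (ucol 4 0 * (\<phi> * (Act M Gen_x * Act M Gen_b)) + ((1 - \<xi>) \<cdot>\<^sub>m (ucol 4 1 * (\<phi> * Act M Gen_b)) +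
     (ucol 4 2 * (\<phi> * Act M Gen_x) + ucol 4 3 * \<phi>)))"
      by (cases s; simp add: mat_dim_simps urow_mult_ucol unit_nested \<phi>n \<phi> act_rewrite[OF M];
         rule eq_matI; simp add: xi_simps root6[OF \<alpha>] del: index_mult_mat(1))
  qed simp_all
qed

lemma P4_retract_inclusion:
  assumes M: "Rep M" and \<alpha>: "\<alpha> ^ 6 = 1"
    and [simp]: "dim_row u = fst M" "dim_col u = 1" "dim_row \<phi> = 1" "dim_col \<phi> = fst M"
    and u: "Act M Gen_a * u = \<alpha> \<cdot>\<^sub>m u" "Act M Gen_g * u = (\<alpha> * (\<alpha> * \<alpha>)) \<cdot>\<^sub>m u"
    and \<phi>: "\<phi> * u = 0\<^sub>m 1 1" "\<phi> * (Act M Gen_x * (Act M Gen_b * u)) = 1\<^sub>m 1" "\<phi> * Act M Gen_g = (\<alpha> * (\<alpha> * \<alpha>)) \<cdot>\<^sub>m \<phi>"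
  shows "P4_retr M \<phi> * P4_incl M u = 1\<^sub>m 4"
proof -
  note [simp] = M
  note [simp del] = assoc_mult_mat
  have \<alpha>0: "\<alpha> \<noteq> 0" using \<alpha> by auto
  have "Act M Gen_g * (Act M Gen_x * u) = (- (\<alpha> * (\<alpha> * \<alpha>))) \<cdot>\<^sub>m (Act M Gen_x * u)"
     "Act M Gen_g * (Act M Gen_b * u) = (- (\<alpha> * (\<alpha> * \<alpha>))) \<cdot>\<^sub>m (Act M Gen_b * u)"
    by (simp_all add: act_right[OF M] u mat_dim_simps)
  from weight_orthogonal[OF _ _ _ _ _ \<phi>(3) this(1)] weight_orthogonal[OF _ _ _ _ _ \<phi>(3) this(2)]
  have 0: "\<phi> * (Act M Gen_x * u) = 0\<^sub>m 1 1" "\<phi> * (Act M Gen_b * u) = 0\<^sub>m 1 1"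
    using \<alpha>0 by auto
  have un: "Act M Gen_a * (u * Z) = \<alpha> \<cdot>\<^sub>m (u * Z)" "Act M Gen_g * (u * Z) = (\<alpha> * (\<alpha> * \<alpha>)) \<cdot>\<^sub>m (u * Z)"
    "\<phi> * (u * Z) = 0\<^sub>m 1 (dim_col Z)" "\<phi> * (Act M Gen_x * (u * Z)) = 0\<^sub>m 1 (dim_col Z)"
    "\<phi> * (Act M Gen_b * (u * Z)) = 0\<^sub>m 1 (dim_col Z)" "\<phi> * (Act M Gen_x * (Act M Gen_b * (u * Z))) = Z"
    if "dim_row Z = 1" for Z
    using that u \<phi>(1) 0 \<phi>(2) mat_dim_simps(1)[of \<phi> u Z] mat_dim_simps(1)[of \<phi> "Act M Gen_x * u" Z]
      mat_dim_simps(1)[of \<phi> "Act M Gen_b * u" Z] mat_dim_simps(1)[of \<phi> "Act M Gen_x * (Act M Gen_b * u)" Z]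
    by (simp_all add: right_eigen_nested mat_dim_simps)
  show ?thesis
    unfolding one_mat_4 P4_retr_def P4_incl_def
    by (simp add: mat_dim_simps urow_mult_ucol unit_nested un act_right[OF M])
      (rule eq_matI; simp add: xi_simps root6[OF \<alpha>] del: index_mult_mat(1))
qed

text \<open>
  A functional \<open>\<phi>\<close> dual to the socle vector \<open>x b p\<close> defines a map back to \<open>P4\<close>. It is a retraction once \<open>p\<close> has been
  corrected by a multiple of \<open>x b p\<close> so that \<open>\<phi>\<close> vanishes on it.
\<close>

lemma P4_summand:
  assumes M: "Rep M" and \<alpha>: "\<alpha> ^ 6 = 1" and [simp]: "dim_row p = fst M" "dim_col p = 1"
    and p: "Act M Gen_a * p = \<alpha> \<cdot>\<^sub>m p" "Act M Gen_g * p = (\<alpha> * (\<alpha> * \<alpha>)) \<cdot>\<^sub>m p"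
    and xb: "Act M Gen_x * (Act M Gen_b * p) \<noteq> 0\<^sub>m (fst M) 1"
  obtains T H where "T \<in> Hom (P4 \<alpha>) M" "H \<in> Hom M (P4 \<alpha>)" "H * T = 1\<^sub>m (fst (P4 \<alpha>))"
proof -
  note [simp] = M
  note [simp del] = assoc_mult_mat
  let ?s = "Act M Gen_x * (Act M Gen_b * p)"
  have s: "Act M Gen_a * ?s = \<alpha> \<cdot>\<^sub>m ?s" "Act M Gen_g * ?s = (\<alpha> * (\<alpha> * \<alpha>)) \<cdot>\<^sub>m ?s"
    by (simp_all add: act_right[OF M] p mat_dim_simps; rule eq_matI; simp add: xi_simps del: index_mult_mat(1))+
  have \<gamma>: "(\<alpha> * (\<alpha> * \<alpha>)) ^ 6 = 1" using \<alpha> by (simp add: power_mult_distrib)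
  obtain \<phi> where \<phi>: "dim_row \<phi> = 1" "dim_col \<phi> = fst M" "\<phi> * ?s = 1\<^sub>m 1"
    "\<phi> * Act M Gen_a = \<alpha> \<cdot>\<^sub>m \<phi>" "\<phi> * Act M Gen_g = (\<alpha> * (\<alpha> * \<alpha>)) \<cdot>\<^sub>m \<phi>"
    using weight_functional[OF M _ _ xb s \<alpha> \<gamma>] by auto
  note [simp] = \<phi>(1,2)
  \<comment> \<open>Now \<open>\<phi> u = 0\<close>, and \<open>x b u = x b p\<close> because \<open>b x b p = 0\<close>.\<close>
  define u where "u = p + (-1) \<cdot>\<^sub>m (?s * (\<phi> * p))"
  have ud: "dim_row u = fst M" "dim_col u = 1" by (simp_all add: u_def)
  have sn: "Act M Gen_a * (Act M Gen_x * (Act M Gen_b * (p * Z))) = \<alpha> \<cdot>\<^sub>m (?s * Z)"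
    "Act M Gen_g * (Act M Gen_x * (Act M Gen_b * (p * Z))) = (\<alpha> * (\<alpha> * \<alpha>)) \<cdot>\<^sub>m (?s * Z)" 
    "\<phi> * (Act M Gen_x * (Act M Gen_b * (p * Z))) = Z" if "dim_row Z = 1" for Z
    using that s \<phi>(3) mat_dim_simps(1)[of "Act M Gen_a" ?s Z] mat_dim_simps(1)[of "Act M Gen_g" ?s Z]
      mat_dim_simps(1)[of \<phi> ?s Z]
    by (simp_all add: mat_dim_simps)
  have "Act M Gen_b * (Act M Gen_x * (Act M Gen_b * p)) = 0\<^sub>m (fst M) 1"
    by (simp add: act_right[OF M] p mat_dim_simps; rule eq_matI; simp add: xi_simps del: index_mult_mat(1))
  then have bs: "Act M Gen_b * (Act M Gen_x * (Act M Gen_b * (p * Z))) = 0\<^sub>m (fst M) (dim_col Z)" if "dim_row Z = 1" for Z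
    using that mat_dim_simps(1)[of "Act M Gen_b" ?s Z] by (simp add: mat_dim_simps)
  have u: "Act M Gen_a * u = \<alpha> \<cdot>\<^sub>m u" "Act M Gen_g * u = (\<alpha> * (\<alpha> * \<alpha>)) \<cdot>\<^sub>m u"
    by (simp_all add: u_def mat_dim_simps sn p mult.commute)
  have "\<phi> * u = 0\<^sub>m 1 1"
    by (simp add: u_def mat_dim_simps sn) (auto intro!: eq_matI simp del: index_mult_mat(1))
  moreover have "\<phi> * (Act M Gen_x * (Act M Gen_b * u)) = 1\<^sub>m 1"
    by (simp add: u_def mat_dim_simps sn bs \<phi>(3))
  ultimately have "P4_retr M \<phi> * P4_incl M u = 1\<^sub>m 4"
    by (intro P4_retract_inclusion[OF M \<alpha> ud \<phi>(1,2) u _ _ \<phi>(5)])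
  then show thesis
    using that[OF P4_hom[OF M \<alpha> ud u] P4_retraction[OF M \<alpha> \<phi>(1,2,4,5)]] P4_module(2)[OF \<alpha>] by simp
qed

text \<open>
  The polynomial \<open>z^6 - 1\<close> splits into the linear factors belonging to the powers of \<open>\<xi>\<close>.
\<close>

lemma roots:
  assumes "\<alpha> ^ 6 = 1"
  obtains i where "i < 6" "\<alpha> = \<xi> ^ i"
proof -
  have "(\<alpha> - 1) * ((\<alpha> - \<xi>) * ((\<alpha> - (\<xi> - 1)) * ((\<alpha> + 1) * ((\<alpha> + \<xi>) * (\<alpha> - (1 - \<xi>)))))) = 0"
    by (simp add: xi_simps root6[OF assms])
  then have "\<alpha> = \<xi> ^ 0 \<or> \<alpha> = \<xi> ^ 1 \<or> \<alpha> = \<xi> ^ 2 \<or> \<alpha> = \<xi> ^ 3 \<or> \<alpha> = \<xi> ^ 4 \<or> \<alpha> = \<xi> ^ 5"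
    by (auto simp: xi_powers eq_neg_iff_add_eq_0)
  then show thesis
    using that[of 0] that[of 1] that[of 2] that[of 3] that[of 4] that[of 5] by auto
qed

lemma twist_eq_0_iff: "\<alpha> ^ 6 = 1 \<Longrightarrow> twist \<alpha> \<gamma> = 0 \<longleftrightarrow> \<gamma> = \<alpha> * (\<alpha> * \<alpha>)"
proof -
  assume "\<alpha> ^ 6 = 1"
  then have "\<alpha> \<noteq> 0" by auto
  moreover have "twist \<alpha> \<gamma> = (- (\<xi> * \<theta>) * \<alpha>) * (\<alpha> * (\<alpha> * \<alpha>) - \<gamma>)"
    by (simp add: twist_def algebra_simps)
  ultimately show ?thesis by (auto simp: algebra_simps)
qed

lemma root_shift:
  assumes "\<alpha> ^ 6 = 1"
  shows "(\<xi> * \<alpha>) ^ 6 = 1" "((1 - \<xi>) * \<alpha>) ^ 6 = 1" "(- \<alpha>) ^ 6 = 1"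
proof -
  have "(1 - \<xi>) ^ 6 = 1" by (simp add: eval_nat_numeral xi_simps)
  then show "(\<xi> * \<alpha>) ^ 6 = 1" "((1 - \<xi>) * \<alpha>) ^ 6 = 1" "(- \<alpha>) ^ 6 = 1"
    using assms xi6 by (simp_all add: power_mult_distrib)
qed

text \<open>
  The operators \<open>x\<close> and \<open>b\<close> change the weight, but not the vanishing of \<open>t\<close>, as \<open>a^3 g\<close> is central.
\<close>

lemma twist_shift:
  "twist (\<xi> * \<alpha>) (- \<gamma>) = - \<xi> * twist \<alpha> \<gamma>"
  "twist ((1 - \<xi>) * \<alpha>) (- \<gamma>) = (\<xi> - 1) * twist \<alpha> \<gamma>"
  by (simp_all add: twist_def xi_simps)

text \<open>
  If \<open>b p\<close> is nonzero, then it is itself killed by \<open>b\<close>, as \<open>b^2 = 0\<close>.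
\<close>

lemma lowest_weight_vector:
  assumes M: "Rep M" and [simp]: "dim_row p = fst M" "dim_col p = 1" and p0: "p \<noteq> 0\<^sub>m (fst M) 1"
    and p: "Act M Gen_a * p = \<alpha> \<cdot>\<^sub>m p" "Act M Gen_g * p = \<gamma> \<cdot>\<^sub>m p" and \<alpha>: "\<alpha> ^ 6 = 1" and \<gamma>: "\<gamma> ^ 6 = 1"
  obtains u \<beta> \<delta> where "dim_row u = fst M" "dim_col u = 1" "u \<noteq> 0\<^sub>m (fst M) 1" "\<beta> ^ 6 = 1" "\<delta> ^ 6 = 1"
    "Act M Gen_a * u = \<beta> \<cdot>\<^sub>m u" "Act M Gen_g * u = \<delta> \<cdot>\<^sub>m u" "Act M Gen_b * u = 0\<^sub>m (fst M) 1"
    "twist \<beta> \<delta> = 0 \<longleftrightarrow> twist \<alpha> \<gamma> = 0"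
proof (cases "Act M Gen_b * p = 0\<^sub>m (fst M) 1")
  case True
  then show thesis using that[of p \<alpha> \<gamma>] p0 p \<alpha> \<gamma> by simp
next
  case False
  note [simp] = M
  note [simp del] = assoc_mult_mat
  show thesis
  proof (rule that[of "Act M Gen_b * p" "(1 - \<xi>) * \<alpha>" "- \<gamma>"])
    show "twist ((1 - \<xi>) * \<alpha>) (- \<gamma>) = 0 \<longleftrightarrow> twist \<alpha> \<gamma> = 0"
      unfolding twist_shift using xi_minus_one by simp
  qed (use False root_shift[OF \<alpha>] root_shift[OF \<gamma>] in \<open>simp_all add: act_right[OF M] p mat_dim_simps\<close>)
qed

section \<open>Classification of simple modules\<close>

lemma chi_hom:
  assumes M: "Rep M" and \<alpha>: "\<alpha> ^ 6 = 1" and "dim_row u = fst M" "dim_col u = 1"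
    and "Act M Gen_a * u = \<alpha> \<cdot>\<^sub>m u" "Act M Gen_g * u = (\<alpha> * (\<alpha> * \<alpha>)) \<cdot>\<^sub>m u"
    "Act M Gen_b * u = 0\<^sub>m (fst M) 1" "Act M Gen_x * u = 0\<^sub>m (fst M) 1"
  shows "u \<in> Hom (chi \<alpha>) M"
proof (rule HomI)
  fix s
  show "u * Act (chi \<alpha>) s = Act M s * u"
    using assms by (cases s) (simp_all add: chi_module mat_dim_simps del: One_nat_def)
qed (use assms chi_module[OF \<alpha>] in simp_all)

lemma hom_to_chi:
  assumes M: "Rep M" and \<alpha>: "\<alpha> ^ 6 = 1" and "dim_row \<phi> = 1" "dim_col \<phi> = fst M"
    and "\<phi> * Act M Gen_a = \<alpha> \<cdot>\<^sub>m \<phi>" "\<phi> * Act M Gen_g = (\<alpha> * (\<alpha> * \<alpha>)) \<cdot>\<^sub>m \<phi>"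
    "\<phi> * Act M Gen_b = 0\<^sub>m 1 (fst M)" "\<phi> * Act M Gen_x = 0\<^sub>m 1 (fst M)"
  shows "\<phi> \<in> Hom M (chi \<alpha>)"
proof (rule HomI)
  fix s
  show "\<phi> * Act M s = Act (chi \<alpha>) s * \<phi>"
    using assms by (cases s) (simp_all add: chi_module mat_dim_simps del: One_nat_def)
qed (use assms chi_module[OF \<alpha>] in simp_all)

lemma image_submodule:
  assumes Q: "Rep Q" and S: "Rep S" and T: "T \<in> Hom Q S"
  shows "submodule_of \<xi> \<theta> ((\<lambda>v. T *\<^sub>v v) ` carrier_vec (fst Q)) S"
proof -
  have Tc: "T \<in> carrier_mat (fst S) (fst Q)" by (rule module_homD(1)[OF T])
  have add: "T *\<^sub>v x + T *\<^sub>v y \<in> (\<lambda>v. T *\<^sub>v v) ` carrier_vec (fst Q)" if "x \<in> carrier_vec (fst Q)" "y \<in> carrier_vec (fst Q)" for x y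
    using mult_add_distrib_mat_vec[OF Tc that] that by (metis add_carrier_vec imageI)
  have smult: "c \<cdot>\<^sub>v (T *\<^sub>v x) \<in> (\<lambda>v. T *\<^sub>v v) ` carrier_vec (fst Q)" if "x \<in> carrier_vec (fst Q)" for x c
    using mult_mat_vec[OF Tc that] that by (metis smult_carrier_vec imageI)
  have act: "snd S d *\<^sub>v (T *\<^sub>v x) \<in> (\<lambda>v. T *\<^sub>v v) ` carrier_vec (fst Q)"
    if that: "x \<in> carrier_vec (fst Q)" "d \<in> carrier (D_alg \<xi> \<theta>)" for x d
  proof -
    from that(2) obtain f where d: "d = D_class \<xi> \<theta> f" by (auto simp: carrier_D_alg)
    have c: "snd S d \<in> carrier_mat (fst S) (fst S)" "snd Q d \<in> carrier_mat (fst Q) (fst Q)"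
      unfolding d by (rule module_simps(1)[OF S] module_simps(1)[OF Q])+
    have "snd S d *\<^sub>v (T *\<^sub>v x) = (snd S d * T) *\<^sub>v x" using assoc_mult_mat_vec[OF c(1) Tc that(1)] by simp
    also have "\<dots> = (T * snd Q d) *\<^sub>v x" using T that(2) by (simp add: module_hom_def)
    also have "\<dots> = T *\<^sub>v (snd Q d *\<^sub>v x)" using assoc_mult_mat_vec[OF Tc c(2) that(1)] by simp
    finally show ?thesis using c that by auto
  qed
  have "T *\<^sub>v 0\<^sub>v (fst Q) = 0\<^sub>v (fst S)" using Tc by auto
  then have "0\<^sub>v (fst S) \<in> (\<lambda>v. T *\<^sub>v v) ` carrier_vec (fst Q)"
    by (metis imageI zero_carrier_vec)
  then show ?thesis
    unfolding submodule_of_def using Tc add smult act by (auto simp: image_subset_iff)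
qed

text \<open>
  The image of \<open>T\<close> is a nonzero submodule, hence everything.
\<close>

lemma Iso_simple_of_retract:
  assumes S: "simple_module \<xi> \<theta> S" and Q: "Rep Q" and Q0: "fst Q \<noteq> 0" and T: "T \<in> Hom Q S"
    and H: "dim_row H = fst Q" "dim_col H = fst S" and HT: "H * T = 1\<^sub>m (fst Q)"
  shows "Iso Q S"
proof -
  have S': "Rep S" using S by (simp add: simple_module_def)
  have Tc: "T \<in> carrier_mat (fst S) (fst Q)" by (rule module_homD(1)[OF T])
  have Hc: "H \<in> carrier_mat (fst Q) (fst S)" using H by auto
  let ?U = "(\<lambda>v. T *\<^sub>v v) ` carrier_vec (fst Q)"
  have HTx: "H *\<^sub>v (T *\<^sub>v x) = x" if "x \<in> carrier_vec (fst Q)" for x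
    using assoc_mult_mat_vec[OF Hc Tc that] HT that by simp
  have "?U \<noteq> {0\<^sub>v (fst S)}"
  proof
    assume *: "?U = {0\<^sub>v (fst S)}"
    let ?e = "unit_vec (fst Q) 0 :: 'k vec"
    have "T *\<^sub>v ?e = 0\<^sub>v (fst S)" using * by (metis imageI singletonD unit_vec_carrier)
    then have "?e = H *\<^sub>v 0\<^sub>v (fst S)" using HTx[of ?e] by simp
    also have "\<dots> = 0\<^sub>v (fst Q)" using Hc by auto
    finally have "?e $ 0 = 0\<^sub>v (fst Q) $ 0" by simp
    then show False using Q0 by simp
  qed
  then have U: "?U = carrier_vec (fst S)"
    using image_submodule[OF Q S' T] S by (auto simp: simple_module_def)
  have "T * H = 1\<^sub>m (fst S)"
  proof (rule mat_col_eqI)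
    fix j assume j: "j < dim_col (1\<^sub>m (fst S) :: 'k mat)"
    then obtain x where x: "x \<in> carrier_vec (fst Q)" "unit_vec (fst S) j = T *\<^sub>v x"
      using U by (metis imageE unit_vec_carrier)
    have "col H j = H *\<^sub>v unit_vec (fst S) j"
      using j Hc col_mult2[of H "fst Q" "fst S" "1\<^sub>m (fst S)" "fst S" j] by simp
    then have "col (T * H) j = T *\<^sub>v (H *\<^sub>v unit_vec (fst S) j)"
      using j Tc Hc by (simp add: col_mult2[of T "fst S" "fst Q" H "fst S" j])
    also have "\<dots> = unit_vec (fst S) j" using x HTx by simp
    finally show "col (T * H) j = col (1\<^sub>m (fst S)) j" using j by simp
  qed (use Tc Hc in auto)
  then show ?thesis
    by (intro Iso_of_inverse[OF Q S' T Hc HT])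
qed

lemma nonzero_weight_vector:
  assumes M: "Rep M" and N: "dim_col N = fst M" "N \<noteq> 0\<^sub>m (dim_row N) (fst M)"
  obtains p \<alpha> \<gamma> where "dim_row p = fst M" "dim_col p = 1" "N * p \<noteq> 0\<^sub>m (dim_row N) 1" "\<alpha> ^ 6 = 1" "\<gamma> ^ 6 = 1"
    "Act M Gen_a * p = \<alpha> \<cdot>\<^sub>m p" "Act M Gen_g * p = \<gamma> \<cdot>\<^sub>m p"
proof -
  note [simp] = M N(1)
  note [simp del] = assoc_mult_mat
  obtain i j R where R: "dim_row R = fst M" "dim_col R = fst M" "N * R \<noteq> 0\<^sub>m (dim_row N) (fst M)"
    "Act M Gen_a * R = \<xi> ^ i \<cdot>\<^sub>m R" "Act M Gen_g * R = \<xi> ^ j \<cdot>\<^sub>m R"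
    using weight_projector[OF M N] by metis
  obtain v where v: "dim_row v = fst M" "dim_col v = 1" "N * (R * v) \<noteq> 0\<^sub>m (dim_row N) 1"
    using nonzero_column[of N R] R by auto
  show thesis
    by (rule that[of "R * v" "\<xi> ^ i" "\<xi> ^ j"])
      (use R v in \<open>simp_all add: root_pow right_eigen_nested[of R "fst M" _ _ v]\<close>)
qed

lemma one_nonzero: "n \<noteq> 0 \<Longrightarrow> 1\<^sub>m n \<noteq> (0\<^sub>m n n :: 'k mat)"
  by (metis index_one_mat(1) index_zero_mat(1) gr0I zero_neq_one)

text \<open>
  A simple module contains a weight vector \<open>u\<close> that is killed by \<open>b\<close>. If \<open>t \<noteq> 0\<close> on its weight, then \<open>u\<close> generates
  a summand \<open>V2\<close>. If \<open>t = 0\<close>, then one of \<open>u\<close> and \<open>x u\<close> is a nonzero vector killed by both \<open>b\<close> and \<open>x\<close>, as \<open>b x u\<close> and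
  \<open>x^2 u\<close> vanish, and it spans the module.
\<close>

theorem simple_module_classification:
  assumes S: "simple_module \<xi> \<theta> S"
  shows "(\<exists>\<alpha>. \<alpha> ^ 6 = 1 \<and> Iso S (chi \<alpha>)) \<or>
    (\<exists>\<alpha> \<gamma>. \<alpha> ^ 6 = 1 \<and> \<gamma> ^ 6 = 1 \<and> \<gamma> \<noteq> \<alpha> * (\<alpha> * \<alpha>) \<and> Iso S (V2 \<alpha> \<gamma>))"
proof -
  have M: "Rep S" and S0: "fst S \<noteq> 0" using S by (auto simp: simple_module_def)
  note [simp] = M
  note [simp del] = assoc_mult_mat
  obtain p \<alpha>' \<gamma>' where p: "dim_row p = fst S" "dim_col p = 1" "1\<^sub>m (fst S) * p \<noteq> 0\<^sub>m (fst S) 1" "\<alpha>' ^ 6 = 1" "\<gamma>' ^ 6 = 1"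
    "Act S Gen_a * p = \<alpha>' \<cdot>\<^sub>m p" "Act S Gen_g * p = \<gamma>' \<cdot>\<^sub>m p"
    using nonzero_weight_vector[OF M, of "1\<^sub>m (fst S)"] one_nonzero[OF S0] by auto
  then have p0: "p \<noteq> 0\<^sub>m (fst S) 1" by (simp add: mat_dim_simps)
  obtain u \<alpha> \<gamma> where u: "dim_row u = fst S" "dim_col u = 1" "u \<noteq> 0\<^sub>m (fst S) 1" "\<alpha> ^ 6 = 1" "\<gamma> ^ 6 = 1"
    "Act S Gen_a * u = \<alpha> \<cdot>\<^sub>m u" "Act S Gen_g * u = \<gamma> \<cdot>\<^sub>m u" "Act S Gen_b * u = 0\<^sub>m (fst S) 1"
    using lowest_weight_vector[OF M p(1,2) p0 p(6,7,4,5)] by metis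
  show ?thesis
  proof (cases "twist \<alpha> \<gamma> = 0")
    case False
    obtain T H where TH: "T \<in> Hom (V2 \<alpha> \<gamma>) S" "H \<in> Hom S (V2 \<alpha> \<gamma>)" "H * T = 1\<^sub>m (fst (V2 \<alpha> \<gamma>))"
      using V2_summand[OF M u(4,5) False u(1,2,3,6,7,8)] by metis
    have "Iso (V2 \<alpha> \<gamma>) S"
      by (rule Iso_simple_of_retract[OF S _ _ TH(1) _ _ TH(3)])
        (use V2_module[OF u(4,5)] Hom_dims[OF TH(2)] in simp_all)
    then show ?thesis using False u(4,5) twist_eq_0_iff[OF u(4)] Iso_sym by blast
  next
    case True
    then have \<gamma>: "\<gamma> = \<alpha> * (\<alpha> * \<alpha>)" using twist_eq_0_iff[OF u(4)] by simp
    have *: "\<exists>\<alpha>. \<alpha> ^ 6 = 1 \<and> Iso S (chi \<alpha>)"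
      if w: "dim_row w = fst S" "dim_col w = 1" "w \<noteq> 0\<^sub>m (fst S) 1" "\<beta> ^ 6 = 1"
      "Act S Gen_a * w = \<beta> \<cdot>\<^sub>m w" "Act S Gen_g * w = (\<beta> * (\<beta> * \<beta>)) \<cdot>\<^sub>m w" "Act S Gen_b * w = 0\<^sub>m (fst S) 1"
      "Act S Gen_x * w = 0\<^sub>m (fst S) 1" for w \<beta>
    proof -
      obtain \<phi> where \<phi>: "dim_row \<phi> = 1" "dim_col \<phi> = fst S" "\<phi> * w = 1\<^sub>m 1"
        using weight_functional[OF M w(1-3,5,6,4)] w(4) by (metis power_mult_distrib mult_1)
      have "Iso (chi \<beta>) S"
        by (rule Iso_simple_of_retract[OF S _ _ chi_hom[OF M w(4,1,2,5-8)], of \<phi>])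
          (use chi_module[OF w(4)] \<phi> in simp_all)
      then show ?thesis using w(4) Iso_sym by blast
    qed
    show ?thesis
    proof (cases "Act S Gen_x * u = 0\<^sub>m (fst S) 1")
      case True
      then show ?thesis using *[of u \<alpha>] u \<gamma> by auto
    next
      case False
      have "Act S Gen_b * (Act S Gen_x * u) = 0\<^sub>m (fst S) 1"
        by (simp add: act_right[OF M] u \<gamma> mat_dim_simps; rule eq_matI; simp add: xi_simps u)
      moreover have "Act S Gen_x * (Act S Gen_x * u) = 0\<^sub>m (fst S) 1"
        by (simp add: act_right[OF M] u \<gamma> mat_dim_simps; rule eq_matI; simp add: xi_simps u root6[OF u(4)])
      moreover have "Act S Gen_a * (Act S Gen_x * u) = (\<xi> * \<alpha>) \<cdot>\<^sub>m (Act S Gen_x * u)"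
        by (simp add: act_right[OF M] u \<gamma> mat_dim_simps)
      moreover have "Act S Gen_g * (Act S Gen_x * u) = (\<xi> * \<alpha> * (\<xi> * \<alpha> * (\<xi> * \<alpha>))) \<cdot>\<^sub>m (Act S Gen_x * u)"
        by (simp add: act_right[OF M] u \<gamma> mat_dim_simps; rule eq_matI; simp add: xi_simps u)
      ultimately show ?thesis
        using *[of "Act S Gen_x * u" "\<xi> * \<alpha>"] False root_shift(1)[OF u(4)] u(2) by auto
    qed
  qed
qed

section \<open>Decomposition of projective modules\<close>

text \<open>
  Maps from a retract extend to the whole module by composition with the projection.
\<close>

lemma projective_summand:
  assumes P: "projective_module \<xi> \<theta> P" and K: "Rep K" and i: "i \<in> Hom K P" and p: "p \<in> Hom P K" and pi: "p * i = 1\<^sub>m (fst K)"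
  shows "projective_module \<xi> \<theta> K"
  unfolding projective_module_def
proof (intro conjI allI impI)
  have P': "Rep P" using P by (simp add: projective_module_def)
  note [simp del] = assoc_mult_mat
  fix M N f g
  assume MN: "Rep M" "Rep N" and f: "f \<in> Hom M N" "(\<lambda>v. f *\<^sub>v v) ` carrier_vec (fst M) = carrier_vec (fst N)"
    and g: "g \<in> Hom K N"
  have "g * p \<in> Hom P N" by (rule Hom_comp[OF g p P' K MN(2)])
  then obtain h where h: "h \<in> Hom P M" "f * h = g * p"
    using P MN f unfolding projective_module_def by blast
  have "f * (h * i) = (f * h) * i" 
    using Hom_dims[OF f(1)] Hom_dims[OF h(1)] Hom_dims[OF i] by (simp add: mat_dim_simps)
  also have "\<dots> = g"
    unfolding h(2) using Hom_dims[OF g] Hom_dims[OF p] Hom_dims[OF i] by (simp add: mat_dim_simps pi)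
  finally show "\<exists>h\<in>Hom K M. f * h = g"
    using Hom_comp[OF h(1) i K P' MN(1)] by blast
qed (rule K)

text \<open>
  The hypotheses say that neither kind of summand can be split off. A nonzero module of this kind has a
  one-dimensional quotient \<open>chi \<beta>\<close>: applying \<open>b\<close> or \<open>x\<close> to a weight functional leads to one that both annihilate. By
  projectivity the quotient map lifts along the surjection \<open>P4 \<beta> \<rightarrow> chi \<beta>\<close>, so that \<open>x b\<close> does not vanish on
  the image of the lift, although \<open>x b = 0\<close> on \<open>P\<close>.
\<close>

lemma projective_without_summands:
  assumes P: "projective_module \<xi> \<theta> P"
    and t: "Act P Gen_a * (Act P Gen_a * (Act P Gen_a * Act P Gen_a)) + (-1) \<cdot>\<^sub>m (Act P Gen_g * Act P Gen_a) = 0\<^sub>m (fst P) (fst P)"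
    and xb: "Act P Gen_x * Act P Gen_b = 0\<^sub>m (fst P) (fst P)"
  shows "fst P = 0"
proof (rule ccontr)
  assume n0: "fst P \<noteq> 0"
  have M: "Rep P" using P by (simp add: projective_module_def)
  note [simp] = M
  note [simp del] = assoc_mult_mat
  let ?A = "Act P Gen_a" and ?B = "Act P Gen_b" and ?G = "Act P Gen_g" and ?Y = "Act P Gen_x"
  let ?good = "\<lambda>\<phi> \<alpha>. dim_row \<phi> = 1 \<and> dim_col \<phi> = fst P \<and> \<phi> \<noteq> 0\<^sub>m 1 (fst P) \<and> \<alpha> ^ 6 = 1 \<and> \<phi> * ?A = \<alpha> \<cdot>\<^sub>m \<phi> \<and>
    \<phi> * ?G = (\<alpha> * (\<alpha> * \<alpha>)) \<cdot>\<^sub>m \<phi>"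
  \<comment> \<open>The relation \<open>b x = \<xi> x b + t\<close>.\<close>
  have bY: "?B * ?Y = 0\<^sub>m (fst P) (fst P)"
    unfolding D_matrices_rewrite(8)[OF act_D_matrices[OF M]] t xb by (auto intro!: eq_matI)
  have YY: "\<phi> * (?Y * ?Y) = 0\<^sub>m 1 (fst P)" if "?good \<phi> \<alpha>" for \<phi> \<alpha>
    using that by (simp add: act_rewrite[OF M] mat_dim_simps left_eigen_nested[of \<phi> "fst P"];
        intro eq_matI; simp add: xi_simps root6)
  \<comment> \<open>\<open>?good\<close> describes a nonzero functional of degenerate weight; \<open>b\<close> and \<open>x\<close> move it to another one.\<close>
  have down: "?good (\<phi> * ?B) (\<xi> * \<alpha>)" if "?good \<phi> \<alpha>" "\<phi> * ?B \<noteq> 0\<^sub>m 1 (fst P)" for \<phi> \<alpha>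
  proof -
    have n: "\<phi> * (?A * Z) = \<alpha> \<cdot>\<^sub>m (\<phi> * Z)" "\<phi> * (?G * Z) = (\<alpha> * (\<alpha> * \<alpha>)) \<cdot>\<^sub>m (\<phi> * Z)" if "dim_row Z = fst P" for Z
      using that \<open>?good \<phi> \<alpha>\<close> by (simp_all add: left_eigen_nested[of \<phi> "fst P"])
    have "\<phi> * ?B * ?A = (\<xi> * \<alpha>) \<cdot>\<^sub>m (\<phi> * ?B)" "\<phi> * ?B * ?G = (\<xi> * \<alpha> * (\<xi> * \<alpha> * (\<xi> * \<alpha>))) \<cdot>\<^sub>m (\<phi> * ?B)"
      using that(1) by (simp_all add: mat_dim_simps act_rewrite[OF M] n; intro eq_matI; simp add: xi_simps)+
    then show ?thesis using that root_shift(1)[of \<alpha>] by simp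
  qed
  have up: "?good (\<phi> * ?Y) ((1 - \<xi>) * \<alpha>)" if "?good \<phi> \<alpha>" "\<phi> * ?B = 0\<^sub>m 1 (fst P)" "\<phi> * ?Y \<noteq> 0\<^sub>m 1 (fst P)" for \<phi> \<alpha>
  proof -
    have n: "\<phi> * (?A * Z) = \<alpha> \<cdot>\<^sub>m (\<phi> * Z)" "\<phi> * (?G * Z) = (\<alpha> * (\<alpha> * \<alpha>)) \<cdot>\<^sub>m (\<phi> * Z)" if "dim_row Z = fst P" for Z
      using that \<open>?good \<phi> \<alpha>\<close> by (simp_all add: left_eigen_nested[of \<phi> "fst P"])
    have "\<phi> * ?Y * ?A = ((1 - \<xi>) * \<alpha>) \<cdot>\<^sub>m (\<phi> * ?Y)"
      using that(1,2) by (simp add: mat_dim_simps act_rewrite[OF M] n)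
    moreover have "\<phi> * ?Y * ?G = ((1 - \<xi>) * \<alpha> * ((1 - \<xi>) * \<alpha> * ((1 - \<xi>) * \<alpha>))) \<cdot>\<^sub>m (\<phi> * ?Y)"
      using that(1) by (simp_all add: mat_dim_simps act_rewrite[OF M] n; intro eq_matI; simp add: xi_simps)
    ultimately show ?thesis using that root_shift(2)[of \<alpha>] by simp
  qed
  obtain \<phi> \<alpha> where 0: "?good \<phi> \<alpha>"
  proof -
    obtain i j R where R: "dim_row R = fst P" "dim_col R = fst P" "1\<^sub>m (fst P) * R \<noteq> 0\<^sub>m (fst P) (fst P)"
      "R * Act P Gen_a = \<xi> ^ i \<cdot>\<^sub>m R" "R * Act P Gen_g = \<xi> ^ j \<cdot>\<^sub>m R"
      using weight_projector[OF M, of "1\<^sub>m (fst P)"] one_nonzero[OF n0] by (metis index_one_mat(2,3))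
    then have "R \<noteq> 0\<^sub>m (dim_row R) (dim_col R)" by (simp add: mat_dim_simps)
    then obtain w v where wv: "w \<in> carrier_mat 1 (fst P)" "v \<in> carrier_mat (fst P) 1" "w * (R * v) = 1\<^sub>m 1"
      using nonzero_mat_pairing[of R] R by metis
    let ?f = "w * R"
    have d: "dim_row ?f = 1" "dim_col ?f = fst P" using R wv by auto
    have "?f \<noteq> 0\<^sub>m 1 (fst P)"
    proof
      assume *: "?f = 0\<^sub>m 1 (fst P)"
      have "w * (R * v) = ?f * v" using wv R by (simp add: mat_dim_simps)
      also have "\<dots> = 0\<^sub>m 1 1" unfolding * using wv by (auto intro!: eq_matI)
      finally show False unfolding wv(3) by (metis one_nonzero one_neq_zero)
    qed
    moreover have f: "?f * ?A = \<xi> ^ i \<cdot>\<^sub>m ?f" "?f * ?G = \<xi> ^ j \<cdot>\<^sub>m ?f"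
      using wv R by (simp_all add: mat_dim_simps)
    moreover have "\<xi> ^ j = \<xi> ^ i * (\<xi> ^ i * \<xi> ^ i)"
    proof -
      define \<alpha> \<gamma> where ag: "\<alpha> = \<xi> ^ i" "\<gamma> = \<xi> ^ j"
      have "?f * (?A * (?A * (?A * ?A)) + (-1) \<cdot>\<^sub>m (?G * ?A)) = (\<alpha> * (\<alpha> * (\<alpha> * \<alpha>)) - \<gamma> * \<alpha>) \<cdot>\<^sub>m ?f"
        using d f unfolding ag
        by (simp add: mat_dim_simps(2-8) left_eigen_nested[OF d(2) _ _ f(1)] left_eigen_nested[OF d(2) _ _ f(2)];
            intro eq_matI; simp add: algebra_simps del: index_mult_mat(1))
      then have z: "(\<alpha> * (\<alpha> * (\<alpha> * \<alpha>)) - \<gamma> * \<alpha>) \<cdot>\<^sub>m ?f = 0\<^sub>m 1 (fst P)"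
        unfolding t using d by (simp add: mat_dim_simps)
      have "\<alpha> * (\<alpha> * (\<alpha> * \<alpha>)) - \<gamma> * \<alpha> = 0"
      proof (rule ccontr)
        assume nz: "\<alpha> * (\<alpha> * (\<alpha> * \<alpha>)) - \<gamma> * \<alpha> \<noteq> 0"
        have "?f = 0\<^sub>m 1 (fst P)"
        proof (rule eq_matI, goal_cases)
          case (1 r c)
          then show ?case using arg_cong[OF z, of "\<lambda>M. M $$ (r, c)"] nz d by (simp del: index_mult_mat(1))
        qed (use d in simp_all)
        then show False using \<open>?f \<noteq> 0\<^sub>m 1 (fst P)\<close> by contradiction
      qed
      then have "twist \<alpha> \<gamma> = 0" by (simp add: twist_def)
      then show ?thesis using twist_eq_0_iff[of \<alpha>] root_pow unfolding ag by blast
    qed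
    ultimately show thesis using that[of ?f "\<xi> ^ i"] d root_pow by simp
  qed
  obtain \<psi> \<beta> where 1: "?good \<psi> \<beta>" "\<psi> * ?B = 0\<^sub>m 1 (fst P)" "\<psi> * ?Y = 0\<^sub>m 1 (fst P)"
  proof (cases "\<phi> * ?B = 0\<^sub>m 1 (fst P)")
    case False
    moreover have "\<phi> * ?B * ?B = 0\<^sub>m 1 (fst P)" "\<phi> * ?B * ?Y = 0\<^sub>m 1 (fst P)"
      using 0 by (simp_all add: mat_dim_simps bY D_matrices_rewrite(1)[OF act_D_matrices[OF M]])
    ultimately show thesis using that down[OF 0] by blast
  next
    case B: True
    show thesis
    proof (cases "\<phi> * ?Y = 0\<^sub>m 1 (fst P)")
      case False
      moreover have "\<phi> * ?Y * ?B = 0\<^sub>m 1 (fst P)" "\<phi> * ?Y * ?Y = 0\<^sub>m 1 (fst P)"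
        using 0 YY[OF 0] xb by (simp_all add: mat_dim_simps(1,12))
      ultimately show thesis using that up[OF 0 B] by blast
    qed (use that 0 B in blast)
  qed
  then have \<beta>: "\<beta> ^ 6 = 1" and d: "dim_row \<psi> = 1" "dim_col \<psi> = fst P" by auto
  have g: "\<psi> \<in> Hom P (chi \<beta>)" using 1 by (intro hom_to_chi[OF M \<beta>]) auto
  note [simp] = P4_module[OF \<beta>] chi_module[OF \<beta>]
  have f: "urow 4 0 \<in> Hom (P4 \<beta>) (chi \<beta>)"
    by (rule hom_to_chi; simp add: \<beta> mat_dim_simps urow_mult_ucol unit_nested)
  have surj: "(\<lambda>v. (urow 4 0 :: 'k mat) *\<^sub>v v) ` carrier_vec (fst (P4 \<beta>)) = carrier_vec (fst (chi \<beta>))"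
  proof (intro equalityI subsetI)
    fix y :: "'k vec" assume y: "y \<in> carrier_vec (fst (chi \<beta>))"
    have "y = urow 4 0 *\<^sub>v (vec 4 (\<lambda>_. y $ 0))"
      using y by (intro eq_vecI) (auto simp: urow_def scalar_prod_def if_distrib[of "\<lambda>x. x * _"] cong: if_cong)
    then show "y \<in> (\<lambda>v. urow 4 0 *\<^sub>v v) ` carrier_vec (fst (P4 \<beta>))" by (rule image_eqI) simp
  qed (auto intro!: carrier_vecI)
  obtain h where h: "h \<in> Hom P (P4 \<beta>)" "urow 4 0 * h = \<psi>"
    using P f surj g P4_module(1)[OF \<beta>] chi_module(1)[OF \<beta>] unfolding projective_module_def by blast
  have hd: "dim_row h = 4" "dim_col h = fst P" using Hom_dims[OF h(1)] by auto
  have "Act (P4 \<beta>) Gen_x * (Act (P4 \<beta>) Gen_b * h) = h * (?Y * ?B)"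
    using Hom_D[OF h(1)] Hom_nested[OF h(1)] M hd
    by (simp add: del: P4_module(3-6)[OF \<beta>])
  also have "\<dots> = 0\<^sub>m 4 (fst P)" unfolding xb using hd by (simp add: mat_dim_simps)
  finally have "urow 4 3 * (Act (P4 \<beta>) Gen_x * (Act (P4 \<beta>) Gen_b * h)) = 0\<^sub>m 1 (fst P)"
    by (simp only: mat_dim_simps unit_dims)
  then have "urow 4 0 * h = 0\<^sub>m 1 (fst P)"
    using hd by (simp add: mat_dim_simps urow_mult_ucol unit_nested)
  then show False using h(2) 1 by simp
qed

text \<open>
  As long as \<open>t\<close> or \<open>x b\<close> does not vanish identically on a projective module, a weight vector witnessing this
  splits off a summand \<open>V2\<close> or \<open>P4\<close>. The complement is projective of smaller dimension.
\<close>

lemma projective_module_induct [consumes 1, case_names zero V2 P4]: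
  assumes P: "projective_module \<xi> \<theta> P"
    and zero: "\<And>M. Rep M \<Longrightarrow> fst M = 0 \<Longrightarrow> Q M"
    and V2: "\<And>M K \<alpha> \<gamma>. Rep M \<Longrightarrow> Rep K \<Longrightarrow> \<alpha> ^ 6 = 1 \<Longrightarrow> \<gamma> ^ 6 = 1 \<Longrightarrow> \<gamma> \<noteq> \<alpha> * (\<alpha> * \<alpha>) \<Longrightarrow>
       Iso M (direct_sum (V2 \<alpha> \<gamma>) K) \<Longrightarrow> Q K \<Longrightarrow> Q M"
    and P4: "\<And>M K \<alpha>. Rep M \<Longrightarrow> Rep K \<Longrightarrow> \<alpha> ^ 6 = 1 \<Longrightarrow> Iso M (direct_sum (P4 \<alpha>) K) \<Longrightarrow> Q K \<Longrightarrow> Q M"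
  shows "Q P"
  using P
proof (induction "fst P" arbitrary: P rule: less_induct)
  case less
  have M: "Rep P" using less.prems by (simp add: projective_module_def)
  note [simp] = M
  note [simp del] = assoc_mult_mat
  let ?A = "Act P Gen_a" and ?B = "Act P Gen_b" and ?G = "Act P Gen_g" and ?Y = "Act P Gen_x"
  let ?N = "?A * (?A * (?A * ?A)) + (-1) \<cdot>\<^sub>m (?G * ?A)"
  have Nd: "dim_row ?N = fst P" "dim_col ?N = fst P" by simp_all
  have twist: "twist \<alpha> \<gamma> \<cdot>\<^sub>m p = (- (\<xi> * \<theta>)) \<cdot>\<^sub>m (?N * p)"
    if "dim_row p = fst P" "?A * p = \<alpha> \<cdot>\<^sub>m p" "?G * p = \<gamma> \<cdot>\<^sub>m p" for p \<alpha> \<gamma>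
    using that by (simp add: mat_dim_simps twist_def; intro eq_matI; simp add: algebra_simps del: index_mult_mat(1))
  show ?case
  proof (cases "?N = 0\<^sub>m (fst P) (fst P)")
    case False
    then obtain p \<alpha> \<gamma> where p: "dim_row p = fst P" "dim_col p = 1" "?N * p \<noteq> 0\<^sub>m (fst P) 1" "\<alpha> ^ 6 = 1" "\<gamma> ^ 6 = 1"
      "?A * p = \<alpha> \<cdot>\<^sub>m p" "?G * p = \<gamma> \<cdot>\<^sub>m p"
      using nonzero_weight_vector[OF M Nd(2)] Nd(1) by metis
    have p0: "p \<noteq> 0\<^sub>m (fst P) 1" using p(3) Nd by (auto simp: mat_dim_simps(12))
    have t: "twist \<alpha> \<gamma> \<noteq> 0"
    proof
      assume "twist \<alpha> \<gamma> = 0"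
      then have z: "0 \<cdot>\<^sub>m p = (- (\<xi> * \<theta>)) \<cdot>\<^sub>m (?N * p)"
        using twist[OF p(1,6,7)] by simp
      have "?N * p = 0\<^sub>m (fst P) 1"
      proof (rule eq_matI, goal_cases)
        case (1 r c)
        then show ?case
          using arg_cong[OF z, of "\<lambda>M. M $$ (r, c)"] p(1,2) Nd by (simp del: index_mult_mat(1) index_add_mat)
      qed (use p(1,2) Nd in simp_all)
      then show False using p(3) by contradiction
    qed
    obtain u \<beta> \<delta> where u: "dim_row u = fst P" "dim_col u = 1" "u \<noteq> 0\<^sub>m (fst P) 1" "\<beta> ^ 6 = 1" "\<delta> ^ 6 = 1"
      "?A * u = \<beta> \<cdot>\<^sub>m u" "?G * u = \<delta> \<cdot>\<^sub>m u" "?B * u = 0\<^sub>m (fst P) 1" "twist \<beta> \<delta> \<noteq> 0"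
      using lowest_weight_vector[OF M p(1,2) p0 p(6,7,4,5)] t by metis
    obtain T H where TH: "T \<in> Hom (V2 \<beta> \<delta>) P" "H \<in> Hom P (V2 \<beta> \<delta>)" "H * T = 1\<^sub>m (fst (V2 \<beta> \<delta>))"
      using V2_summand[OF M u(4,5,9) u(1,2,3,6,7,8)] by metis
    obtain K i q where K: "Rep K" "Iso P (direct_sum (V2 \<beta> \<delta>) K)" "fst P = fst (V2 \<beta> \<delta>) + fst K"
      "i \<in> Hom K P" "q \<in> Hom P K" "q * i = 1\<^sub>m (fst K)"
      using split_summand[OF V2_module(1)[OF u(4,5)] M TH] by metis
    have "Q K"
      by (rule less.hyps[OF _ projective_summand[OF less.prems K(1,4,5,6)]])
        (use K(3) V2_module(2)[OF u(4,5)] in simp)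
    moreover have "\<delta> \<noteq> \<beta> * (\<beta> * \<beta>)" using u(9) twist_eq_0_iff[OF u(4)] by simp
    ultimately show ?thesis using V2[OF M K(1) u(4,5) _ K(2)] by simp
  next
    case t: True
    show ?thesis
    proof (cases "?Y * ?B = 0\<^sub>m (fst P) (fst P)")
      case True
      then show ?thesis using projective_without_summands[OF less.prems t] zero[OF M] by simp
    next
      case False
      obtain p \<alpha> \<gamma> where p: "dim_row p = fst P" "dim_col p = 1" "?Y * ?B * p \<noteq> 0\<^sub>m (fst P) 1" "\<alpha> ^ 6 = 1" "\<gamma> ^ 6 = 1"
        "?A * p = \<alpha> \<cdot>\<^sub>m p" "?G * p = \<gamma> \<cdot>\<^sub>m p"
        using nonzero_weight_vector[OF M, of "?Y * ?B"] False by auto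
      have xb: "?Y * (?B * p) \<noteq> 0\<^sub>m (fst P) 1" using p(1,3) by (simp add: mat_dim_simps)
      have z: "twist \<alpha> \<gamma> \<cdot>\<^sub>m p = 0\<^sub>m (fst P) 1"
        unfolding twist[OF p(1,6,7)] t using p(1,2) by (simp add: mat_dim_simps)
      have "twist \<alpha> \<gamma> = 0"
      proof (rule ccontr)
        assume nz: "twist \<alpha> \<gamma> \<noteq> 0"
        have "p = 0\<^sub>m (fst P) 1"
        proof (rule eq_matI, goal_cases)
          case (1 r c)
          then show ?case using arg_cong[OF z, of "\<lambda>M. M $$ (r, c)"] nz p(1,2) by simp
        qed (use p(1,2) in simp_all)
        then show False using xb by (simp add: mat_dim_simps)
      qed
      then have \<gamma>: "?G * p = (\<alpha> * (\<alpha> * \<alpha>)) \<cdot>\<^sub>m p" using p(4,7) twist_eq_0_iff by simp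
      obtain T H where TH: "T \<in> Hom (P4 \<alpha>) P" "H \<in> Hom P (P4 \<alpha>)" "H * T = 1\<^sub>m (fst (P4 \<alpha>))"
        using P4_summand[OF M p(4,1,2,6) \<gamma> xb] by metis
      obtain K i q where K: "Rep K" "Iso P (direct_sum (P4 \<alpha>) K)" "fst P = fst (P4 \<alpha>) + fst K"
        "i \<in> Hom K P" "q \<in> Hom P K" "q * i = 1\<^sub>m (fst K)"
        using split_summand[OF P4_module(1)[OF p(4)] M TH] by metis
      have "Q K"
        by (rule less.hyps[OF _ projective_summand[OF less.prems K(1,4,5,6)]])
          (use K(3) P4_module(2)[OF p(4)] in simp)
      then show ?thesis using P4[OF M K(1) p(4) K(2)] by simp
    qed
  qed
qed

section \<open>Simplicity of the standard modules\<close>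

lemma chi_simple:
  assumes "\<alpha> ^ 6 = 1"
  shows "simple_module \<xi> \<theta> (chi \<alpha>)"
proof -
  note [simp] = chi_module[OF assms]
  have "U = carrier_vec 1" if U: "submodule_of \<xi> \<theta> U (chi \<alpha>)" "U \<noteq> {0\<^sub>v 1}" for U
  proof -
    have sub: "U \<subseteq> carrier_vec 1" "0\<^sub>v 1 \<in> U" "\<And>c u. u \<in> U \<Longrightarrow> c \<cdot>\<^sub>v u \<in> U"
      using U(1) by (auto simp: submodule_of_def)
    obtain u where u: "u \<in> U" "u \<noteq> 0\<^sub>v 1" using U(2) sub(2) by blast
    then have u0: "u $ 0 \<noteq> 0" using sub(1) by (auto intro!: eq_vecI)
    have "y \<in> U" if "y \<in> carrier_vec 1" for y
    proof -
      have "y = (y $ 0 / u $ 0) \<cdot>\<^sub>v u"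
        using that u u0 sub(1) by (intro eq_vecI) auto
      then show ?thesis using sub(3)[OF u(1)] by metis
    qed
    then show ?thesis using sub(1) by blast
  qed
  then show ?thesis by (auto simp: simple_module_def)
qed

text \<open>
  A nonzero vector, or its image under \<open>b\<close>, is a multiple of the basis vector \<open>v\<close>, and \<open>v\<close> generates \<open>x v\<close>.
\<close>

lemma V2_simple:
  assumes \<alpha>: "\<alpha> ^ 6 = 1" and \<gamma>: "\<gamma> ^ 6 = 1" and ne: "\<gamma> \<noteq> \<alpha> * (\<alpha> * \<alpha>)"
  shows "simple_module \<xi> \<theta> (V2 \<alpha> \<gamma>)"
proof -
  note m = V2_module[OF assms(1,2)]
  have t: "twist \<alpha> \<gamma> \<noteq> 0" using ne twist_eq_0_iff[OF \<alpha>] by simp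
  have "U = carrier_vec 2" if U: "submodule_of \<xi> \<theta> U (V2 \<alpha> \<gamma>)" "U \<noteq> {0\<^sub>v 2}" for U
  proof -
    have sub: "U \<subseteq> carrier_vec 2" "0\<^sub>v 2 \<in> U" "\<And>c u. u \<in> U \<Longrightarrow> c \<cdot>\<^sub>v u \<in> U" "\<And>u v. u \<in> U \<Longrightarrow> v \<in> U \<Longrightarrow> u + v \<in> U"
      "\<And>s u. u \<in> U \<Longrightarrow> Act (V2 \<alpha> \<gamma>) s *\<^sub>v u \<in> U"
      using U(1) m(2) by (auto simp: submodule_of_def act_def carrier_D_alg)
    let ?e = "unit_vec 2 0 :: 'k vec" and ?f = "unit_vec 2 1 :: 'k vec"
    have sum2: "sum f {0..<2} = f 0 + f 1" for f :: "nat \<Rightarrow> 'k"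
      by (simp add: numeral_2_eq_2)
    have B: "Act (V2 \<alpha> \<gamma>) Gen_b *\<^sub>v u = (twist \<alpha> \<gamma> * u $ 1) \<cdot>\<^sub>v ?e" if "u \<in> carrier_vec 2" for u
      using that unfolding m
      by (intro eq_vecI) (auto simp: ucol_def urow_def scalar_prod_def less_2_cases_iff sum2)
    have Y: "Act (V2 \<alpha> \<gamma>) Gen_x *\<^sub>v ?e = ?f"
      unfolding m by (intro eq_vecI) (auto simp: ucol_def urow_def scalar_prod_def less_2_cases_iff sum2)
    obtain u where u: "u \<in> U" "u \<noteq> 0\<^sub>v 2" using U(2) sub(2) by blast
    have uc: "u \<in> carrier_vec 2" using u sub(1) by blast
    have e: "?e \<in> U"
    proof (cases "u $ 1 = 0")
      case False
      have "?e = (1 / (twist \<alpha> \<gamma> * u $ 1)) \<cdot>\<^sub>v (Act (V2 \<alpha> \<gamma>) Gen_b *\<^sub>v u)"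
        unfolding B[OF uc] using False t by (intro eq_vecI) auto
      then show ?thesis using sub(3)[OF sub(5)[OF u(1), of Gen_b]] by metis
    next
      case True
      have "u $ 0 \<noteq> 0"
      proof
        assume "u $ 0 = 0"
        then have "u = 0\<^sub>v 2" using True uc by (intro eq_vecI) (auto simp: less_2_cases_iff)
        then show False using u(2) by contradiction
      qed
      then have "?e = (1 / u $ 0) \<cdot>\<^sub>v u" using True uc by (intro eq_vecI) (auto simp: less_2_cases_iff)
      then show ?thesis using sub(3)[OF u(1)] by metis
    qed
    then have f: "?f \<in> U" using sub(5)[OF e, of Gen_x] Y by simp
    have "y \<in> U" if "y \<in> carrier_vec 2" for y
    proof -
      have "y = y $ 0 \<cdot>\<^sub>v ?e + y $ 1 \<cdot>\<^sub>v ?f"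
        using that by (intro eq_vecI) (auto simp: less_2_cases_iff)
      then show ?thesis using sub(4)[OF sub(3)[OF e] sub(3)[OF f]] by metis
    qed
    then show ?thesis using sub(1) by blast
  qed
  then show ?thesis using m(1,2) by (auto simp: simple_module_def)
qed

section \<open>Tensor products of simple modules\<close>

lemma Iso_square_retract:
  assumes "Rep Q" "Rep M" "T \<in> Hom Q M" "H \<in> Hom M Q" "H * T = 1\<^sub>m (fst Q)" "fst Q = fst M"
  shows "Iso Q M"
proof (rule Iso_of_inverse[OF assms(1-3) _ assms(5)])
  show H: "H \<in> carrier_mat (fst Q) (fst M)" using Hom_dims[OF assms(4)] by auto
  have "T \<in> carrier_mat (fst M) (fst M)" "H \<in> carrier_mat (fst M) (fst M)"
    using Hom_dims[OF assms(3)] Hom_dims[OF assms(4)] assms(6) by auto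
  then show "T * H = 1\<^sub>m (fst M)"
    using mat_mult_left_right_inverse[of H "fst M" T] assms(5,6) by simp
qed

lemma Iso_square_biproduct:
  assumes V: "Rep V" and W: "Rep W" and M: "Rep M"
    and i1: "i1 \<in> Hom V M" and i2: "i2 \<in> Hom W M" and p1: "p1 \<in> Hom M V" and p2: "p2 \<in> Hom M W"
    and 1: "p1 * i1 = 1\<^sub>m (fst V)" "p2 * i2 = 1\<^sub>m (fst W)" "p1 * i2 = 0\<^sub>m (fst V) (fst W)" "p2 * i1 = 0\<^sub>m (fst W) (fst V)"
    and dim: "fst M = fst V + fst W"
  shows "Iso M (direct_sum V W)"
proof (rule Iso_direct_sumI[OF V W M i1 i2 p1 p2 1])
  let ?n = "fst V" and ?m = "fst W"
  note [simp] = V W M Hom_dims[OF i1] Hom_dims[OF i2] Hom_dims[OF p1] Hom_dims[OF p2]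
  note [simp del] = assoc_mult_mat
  have nested: "p1 * (i1 * Z) = Z" "p2 * (i1 * Z) = 0\<^sub>m ?m (dim_col Z)" if "dim_row Z = ?n" for Z
    using that 1 mat_dim_simps(1)[of p1 i1 Z] mat_dim_simps(1)[of p2 i1 Z] by (simp_all add: mat_dim_simps)
  have nested': "p1 * (i2 * Z) = 0\<^sub>m ?n (dim_col Z)" "p2 * (i2 * Z) = Z" if "dim_row Z = ?m" for Z
    using that 1 mat_dim_simps(1)[of p1 i2 Z] mat_dim_simps(1)[of p2 i2 Z] by (simp_all add: mat_dim_simps)
  let ?T = "inl_mat ?n ?m * p1 + inr_mat ?n ?m * p2" and ?S = "i1 * prl_mat ?n ?m + i2 * prr_mat ?n ?m"
  have "?T * ?S = 1\<^sub>m (?n + ?m)"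
    by (simp add: mat_dim_simps nested nested' biproduct_simps)
  then have "?S * ?T = 1\<^sub>m (?n + ?m)"
    by (rule mat_mult_left_right_inverse[rotated 2]) (auto intro!: carrier_matI simp: dim)
  then show "i1 * p1 + i2 * p2 = 1\<^sub>m (fst M)"
    by (simp add: mat_dim_simps biproduct_simps_nested dim)
qed

text \<open>
  A retraction built from a functional of one \<open>g\<close>-weight kills the submodule generated by a lowest weight
  vector of another \<open>g\<close>-weight.
\<close>

lemma V2_retract_other_weight:
  assumes M: "Rep M" and [simp]: "dim_row u = fst M" "dim_col u = 1" "dim_row \<phi> = 1" "dim_col \<phi> = fst M"
    and u: "Act M Gen_a * u = \<beta> \<cdot>\<^sub>m u" "Act M Gen_g * u = \<delta> \<cdot>\<^sub>m u" "Act M Gen_b * u = 0\<^sub>m (fst M) 1"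
    and \<phi>: "\<phi> * Act M Gen_g = \<gamma> \<cdot>\<^sub>m \<phi>" and ne: "\<gamma> \<noteq> \<delta>"
  shows "c \<cdot>\<^sub>m (ucol 2 0 * (\<phi> * (Act M Gen_b * Act M Gen_x)) + ucol 2 1 * (\<phi> * Act M Gen_b)) *
    (u * urow 2 0 + Act M Gen_x * (u * urow 2 1)) = 0\<^sub>m 2 2"
proof -
  note [simp] = M
  note [simp del] = assoc_mult_mat
  have "\<phi> * u = 0\<^sub>m 1 1"
    using weight_orthogonal[of \<phi> "fst M" "Act M Gen_g" u \<gamma> \<delta>] \<phi> u ne by simp
  then have un: "Act M Gen_a * (u * Z) = \<beta> \<cdot>\<^sub>m (u * Z)" "Act M Gen_g * (u * Z) = \<delta> \<cdot>\<^sub>m (u * Z)" "\<phi> * (u * Z) = 0\<^sub>m 1 (dim_col Z)"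
    "Act M Gen_b * (u * Z) = 0\<^sub>m (fst M) (dim_col Z)" if "dim_row Z = 1" for Z
    using that u mat_dim_simps(1)[of "Act M Gen_b" u Z] mat_dim_simps(1)[of \<phi> u Z]
    by (simp_all add: right_eigen_nested mat_dim_simps)
  show ?thesis
    by (simp add: mat_dim_simps un act_right[OF M]; rule eq_matI; simp add: xi_simps del: index_mult_mat(1))
qed

text \<open>
  The two summands generated by the vectors are independent because the retraction of each kills the other;
  by dimension they fill the module.
\<close>

lemma four_dim_two_lowest_vectors:
  assumes M: "Rep M" "fst M = 4" and \<alpha>: "\<alpha> ^ 6 = 1" and \<gamma>: "\<gamma> ^ 6 = 1" and t: "twist \<alpha> \<gamma> \<noteq> 0"
    and u: "dim_row u = fst M" "dim_col u = 1" "u \<noteq> 0\<^sub>m (fst M) 1"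
     "Act M Gen_a * u = \<alpha> \<cdot>\<^sub>m u" "Act M Gen_g * u = \<gamma> \<cdot>\<^sub>m u" "Act M Gen_b * u = 0\<^sub>m (fst M) 1"
    and \<beta>: "\<beta> ^ 6 = 1" and \<delta>: "\<delta> ^ 6 = 1" and s: "twist \<beta> \<delta> \<noteq> 0"
    and w: "dim_row w = fst M" "dim_col w = 1" "w \<noteq> 0\<^sub>m (fst M) 1"
     "Act M Gen_a * w = \<beta> \<cdot>\<^sub>m w" "Act M Gen_g * w = \<delta> \<cdot>\<^sub>m w" "Act M Gen_b * w = 0\<^sub>m (fst M) 1"
    and ne: "\<gamma> \<noteq> \<delta>"
  shows "Iso M (direct_sum (V2 \<alpha> \<gamma>) (V2 \<beta> \<delta>))"
proof -
  obtain \<phi> T H where 1: "T = u * urow 2 0 + Act M Gen_x * (u * urow 2 1)"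
    "H = (1 / twist \<alpha> \<gamma>) \<cdot>\<^sub>m (ucol 2 0 * (\<phi> * (Act M Gen_b * Act M Gen_x)) + ucol 2 1 * (\<phi> * Act M Gen_b))"
    "dim_row \<phi> = 1" "dim_col \<phi> = fst M" "\<phi> * Act M Gen_g = \<gamma> \<cdot>\<^sub>m \<phi>"
    "T \<in> Hom (V2 \<alpha> \<gamma>) M" "H \<in> Hom M (V2 \<alpha> \<gamma>)" "H * T = 1\<^sub>m (fst (V2 \<alpha> \<gamma>))"
    using V2_summand[OF M(1) \<alpha> \<gamma> t u] by metis
  obtain \<psi> T' H' where 2: "T' = w * urow 2 0 + Act M Gen_x * (w * urow 2 1)"
    "H' = (1 / twist \<beta> \<delta>) \<cdot>\<^sub>m (ucol 2 0 * (\<psi> * (Act M Gen_b * Act M Gen_x)) + ucol 2 1 * (\<psi> * Act M Gen_b))"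
    "dim_row \<psi> = 1" "dim_col \<psi> = fst M" "\<psi> * Act M Gen_g = \<delta> \<cdot>\<^sub>m \<psi>"
    "T' \<in> Hom (V2 \<beta> \<delta>) M" "H' \<in> Hom M (V2 \<beta> \<delta>)" "H' * T' = 1\<^sub>m (fst (V2 \<beta> \<delta>))"
    using V2_summand[OF M(1) \<beta> \<delta> s w] by metis
  have "H * T' = 0\<^sub>m 2 2"
    unfolding 1(2) 2(1) by (rule V2_retract_other_weight[OF M(1) w(1,2) 1(3,4) w(4-6) 1(5) ne])
  moreover have "H' * T = 0\<^sub>m 2 2"
    unfolding 2(2) 1(1) by (rule V2_retract_other_weight[OF M(1) u(1,2) 2(3,4) u(4-6) 2(5) ne[symmetric]])
  ultimately show ?thesis
    using V2_module[OF \<alpha> \<gamma>] V2_module[OF \<beta> \<delta>] M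
    by (intro Iso_square_biproduct[OF _ _ M(1) 1(6) 2(6) 1(7) 2(7)]) (use 1(8) 2(8) in simp_all)
qed

abbreviation Tensor :: "'k rep \<Rightarrow> 'k rep \<Rightarrow> 'k rep" where "Tensor \<equiv> tensor_module \<xi> \<theta>"

lemma nonzero_of_pairing:
  fixes r N :: "'k mat"
  assumes "r * N = 1\<^sub>m 1" "dim_col r = n"
  shows "N \<noteq> 0\<^sub>m n 1"
proof
  assume "N = 0\<^sub>m n 1"
  then have "1\<^sub>m 1 = (0\<^sub>m (dim_row r) 1 :: 'k mat)" using assms by (simp add: mat_dim_simps)
  moreover have "dim_row r = 1" using arg_cong[OF assms(1), of dim_row] by simp
  ultimately show False using one_nonzero[of 1] by simp
qed

lemma tensor_chi_chi:
  assumes \<alpha>: "\<alpha> ^ 6 = 1" and \<beta>: "\<beta> ^ 6 = 1"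
  shows "Iso (Tensor (chi \<alpha>) (chi \<beta>)) (chi (\<alpha> * \<beta>))"
proof -
  note [simp] = chi_module[OF \<alpha>] chi_module[OF \<beta>]
  have \<alpha>\<beta>: "(\<alpha> * \<beta>) ^ 6 = 1" using assms by (simp add: power_mult_distrib)
  let ?M = "Tensor (chi \<alpha>) (chi \<beta>)"
  note M = tensor_module[OF chi_module(1)[OF \<alpha>] chi_module(1)[OF \<beta>]]
  note tact = M(2) tensor_act_def Let_def
  have k1: "kronecker (1\<^sub>m 1) (1\<^sub>m 1) = (1\<^sub>m 1 :: 'k mat)" by (rule kronecker_one_left)
  have "1\<^sub>m 1 \<in> Hom (chi (\<alpha> * \<beta>)) ?M"
    by (rule chi_hom[OF M(1) \<alpha>\<beta>]; simp add: M(3) tact mat_dim_simps kronecker_simps k1 del: One_nat_def;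
        (rule eq_matI; simp)?)
  then have "Iso (chi (\<alpha> * \<beta>)) ?M"
    using M chi_module[OF \<alpha>\<beta>] by (intro Iso_of_inverse[of _ _ "1\<^sub>m 1" "1\<^sub>m 1"]) auto
  then show ?thesis by (rule Iso_sym)
qed

lemma tensor_chi_V2:
  assumes \<alpha>: "\<alpha> ^ 6 = 1" and \<beta>: "\<beta> ^ 6 = 1" and \<gamma>: "\<gamma> ^ 6 = 1" and ne: "\<gamma> \<noteq> \<beta> * (\<beta> * \<beta>)"
  shows "Iso (Tensor (chi \<alpha>) (V2 \<beta> \<gamma>)) (V2 (\<alpha> * \<beta>) (\<alpha> * (\<alpha> * \<alpha>) * \<gamma>))"
    "Iso (Tensor (V2 \<beta> \<gamma>) (chi \<alpha>)) (V2 (\<alpha> * \<beta>) (\<alpha> * (\<alpha> * \<alpha>) * \<gamma>))"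
proof -
  note [simp] = chi_module[OF \<alpha>] V2_module[OF \<beta> \<gamma>]
  have w: "(\<alpha> * \<beta>) ^ 6 = 1" "(\<alpha> * (\<alpha> * \<alpha>) * \<gamma>) ^ 6 = 1" using assms by (simp_all add: power_mult_distrib)
  have "\<alpha> \<noteq> 0" using \<alpha> by auto
  then have t: "twist (\<alpha> * \<beta>) (\<alpha> * (\<alpha> * \<alpha>) * \<gamma>) \<noteq> 0"
    using ne by (simp add: twist_eq_0_iff[OF w(1)] mult.assoc mult.left_commute)
  have *: "Iso M (V2 (\<alpha> * \<beta>) (\<alpha> * (\<alpha> * \<alpha>) * \<gamma>))"
    if M: "Rep M" "fst M = 2" and u: "Act M Gen_a * ucol 2 0 = (\<alpha> * \<beta>) \<cdot>\<^sub>m ucol 2 0"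
      "Act M Gen_g * ucol 2 0 = (\<alpha> * (\<alpha> * \<alpha>) * \<gamma>) \<cdot>\<^sub>m ucol 2 0" "Act M Gen_b * ucol 2 0 = 0\<^sub>m 2 1" for M
  proof -
    have "ucol 2 0 \<noteq> (0\<^sub>m 2 1 :: 'k mat)"
      by (rule nonzero_of_pairing[of "urow 2 0"]) (simp_all add: urow_mult_ucol)
    then obtain T H where "T \<in> Hom (V2 (\<alpha> * \<beta>) (\<alpha> * (\<alpha> * \<alpha>) * \<gamma>)) M" "H \<in> Hom M (V2 (\<alpha> * \<beta>) (\<alpha> * (\<alpha> * \<alpha>) * \<gamma>))"
      "H * T = 1\<^sub>m (fst (V2 (\<alpha> * \<beta>) (\<alpha> * (\<alpha> * \<alpha>) * \<gamma>)))"
      using V2_summand[OF M(1) w t, of "ucol 2 0"] u M(2) by (metis unit_dims(1,2))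
    then show ?thesis
      using Iso_square_retract[OF V2_module(1)[OF w] M(1)] M(2) V2_module(2)[OF w] Iso_sym by simp
  qed
  have c: "\<beta> * \<alpha> = \<alpha> * \<beta>" "\<gamma> * (\<alpha> * (\<alpha> * \<alpha>)) = \<alpha> * (\<alpha> * \<alpha>) * \<gamma>"
    by (rule mult.commute)+
  note M = tensor_module[OF chi_module(1)[OF \<alpha>] V2_module(1)[OF \<beta> \<gamma>]]
  show "Iso (Tensor (chi \<alpha>) (V2 \<beta> \<gamma>)) (V2 (\<alpha> * \<beta>) (\<alpha> * (\<alpha> * \<alpha>) * \<gamma>))"
    by (rule *; simp add: M tensor_act_def Let_def mat_dim_simps kronecker_simps kronecker_one_left urow_mult_ucol c del: One_nat_def)
  note M = tensor_module[OF V2_module(1)[OF \<beta> \<gamma>] chi_module(1)[OF \<alpha>]]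
  show "Iso (Tensor (V2 \<beta> \<gamma>) (chi \<alpha>)) (V2 (\<alpha> * \<beta>) (\<alpha> * (\<alpha> * \<alpha>) * \<gamma>))"
    by (rule *; simp add: M tensor_act_def Let_def mat_dim_simps kronecker_simps kronecker_one_right urow_mult_ucol del: One_nat_def)
qed

lemma kron_unit_pairing:
  "i < 2 \<Longrightarrow> j < 2 \<Longrightarrow> i' < 2 \<Longrightarrow> j' < 2 \<Longrightarrow> kronecker (urow 2 i) (urow 2 j) * kronecker (ucol 2 i') (ucol 2 j') =
     (if i = i' \<and> j = j' then 1\<^sub>m 1 else 0\<^sub>m 1 (1 :: nat) :: 'k mat)"
  using kronecker_one_left[of "1\<^sub>m 1 :: 'k mat"]
  by (simp add: kronecker_mult_dim urow_mult_ucol kronecker_zero_left kronecker_zero_right)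

text \<open>
  Write \<open>v\<close> and \<open>v'\<close> for the lowest weight vectors of the factors. The vector \<open>v \<otimes> v'\<close> has weight
  \<open>(\<alpha> \<beta>, \<gamma> \<delta>)\<close> and is killed by \<open>b\<close>. If \<open>t \<noteq> 0\<close> on this weight, a second lowest weight vector is found in the
  span of \<open>x v \<otimes> v'\<close> and \<open>v \<otimes> x v'\<close>, and the product is a sum of two modules \<open>V2\<close>. If \<open>t = 0\<close>, then
  \<open>x b (x v \<otimes> v')\<close> is nonzero, and the four-dimensional product is the summand \<open>P4\<close> generated by \<open>x v \<otimes> v'\<close>.
\<close>

lemma tensor_V2_V2:
  assumes \<alpha>: "\<alpha> ^ 6 = 1" and \<gamma>: "\<gamma> ^ 6 = 1" and \<beta>: "\<beta> ^ 6 = 1" and \<delta>: "\<delta> ^ 6 = 1"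
    and ne: "\<gamma> \<noteq> \<alpha> * (\<alpha> * \<alpha>)" "\<delta> \<noteq> \<beta> * (\<beta> * \<beta>)"
  shows "\<gamma> * \<delta> \<noteq> \<alpha> * \<beta> * (\<alpha> * \<beta> * (\<alpha> * \<beta>)) \<Longrightarrow>
      Iso (Tensor (V2 \<alpha> \<gamma>) (V2 \<beta> \<delta>)) (direct_sum (V2 (\<alpha> * \<beta>) (\<gamma> * \<delta>)) (V2 (\<xi> * (\<alpha> * \<beta>)) (- (\<gamma> * \<delta>))))"
    "\<gamma> * \<delta> = \<alpha> * \<beta> * (\<alpha> * \<beta> * (\<alpha> * \<beta>)) \<Longrightarrow> Iso (Tensor (V2 \<alpha> \<gamma>) (V2 \<beta> \<delta>)) (P4 (\<xi> * (\<alpha> * \<beta>)))"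
proof -
  note [simp] = V2_module[OF \<alpha> \<gamma>] V2_module[OF \<beta> \<delta>]
  note [simp del] = assoc_mult_mat
  let ?M = "Tensor (V2 \<alpha> \<gamma>) (V2 \<beta> \<delta>)"
  have t: "twist \<alpha> \<gamma> \<noteq> 0" "twist \<beta> \<delta> \<noteq> 0" using ne by (simp_all add: twist_eq_0_iff \<alpha> \<beta>)
  have nz: "\<alpha> \<noteq> 0" "\<beta> \<noteq> 0" "\<gamma> \<noteq> 0" "\<delta> \<noteq> 0" using assms by auto
  have w: "(\<alpha> * \<beta>) ^ 6 = 1" "(\<gamma> * \<delta>) ^ 6 = 1" using assms by (simp_all add: power_mult_distrib)
  note w' = root_shift(1)[OF w(1)] root_shift(3)[OF w(2)]
  note M = tensor_module[OF V2_module(1)[OF \<alpha> \<gamma>] V2_module(1)[OF \<beta> \<delta>]]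
  have dim: "fst ?M = 4" by (simp add: M)
  let ?e00 = "kronecker (ucol 2 0) (ucol 2 0) :: 'k mat" and ?e10 = "kronecker (ucol 2 1) (ucol 2 0) :: 'k mat"
    and ?e01 = "kronecker (ucol 2 0) (ucol 2 1) :: 'k mat"
  note tact = M tensor_act_def Let_def
  have one_smult: "1 \<cdot>\<^sub>m A = A" for A :: "'k mat" by (auto intro!: eq_matI)
  note norm = mat_dim_simps kronecker_simps urow_mult_ucol unit_nested one_smult
  show "Iso ?M (direct_sum (V2 (\<alpha> * \<beta>) (\<gamma> * \<delta>)) (V2 (\<xi> * (\<alpha> * \<beta>)) (- (\<gamma> * \<delta>))))"
    if ne': "\<gamma> * \<delta> \<noteq> \<alpha> * \<beta> * (\<alpha> * \<beta> * (\<alpha> * \<beta>))"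
  proof -
    \<comment> \<open>By the coproduct of \<open>b\<close>, its values on \<open>?e10\<close> and \<open>?e01\<close> are the multiples \<open>twist \<alpha> \<gamma> * \<beta>\<close> and
      \<open>\<alpha>^4 * twist \<beta> \<delta>\<close> of \<open>?e00\<close>, so that \<open>b\<close> kills \<open>?w\<close>.\<close>
    let ?w = "(\<alpha> * (\<alpha> * (\<alpha> * \<alpha>)) * twist \<beta> \<delta>) \<cdot>\<^sub>m ?e10 + (- (\<beta> * twist \<alpha> \<gamma>)) \<cdot>\<^sub>m ?e01"
    have t1: "twist (\<alpha> * \<beta>) (\<gamma> * \<delta>) \<noteq> 0" "twist (\<xi> * (\<alpha> * \<beta>)) (- (\<gamma> * \<delta>)) \<noteq> 0"
      using ne' by (simp_all add: twist_shift twist_eq_0_iff[OF w(1)])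
    have "?e00 \<noteq> 0\<^sub>m (fst ?M) 1"
      by (rule nonzero_of_pairing[of "kronecker (urow 2 0) (urow 2 0)"]) (simp_all add: kron_unit_pairing dim)
    moreover have "?w \<noteq> 0\<^sub>m (fst ?M) 1"
      using t nz
      by (intro nonzero_of_pairing[of "(1 / (\<alpha> * (\<alpha> * (\<alpha> * \<alpha>)) * twist \<beta> \<delta>)) \<cdot>\<^sub>m kronecker (urow 2 1) (urow 2 0)"])
        (simp_all add: mat_dim_simps kron_unit_pairing dim one_smult)
    moreover have "Act ?M Gen_a * ?e00 = (\<alpha> * \<beta>) \<cdot>\<^sub>m ?e00" "Act ?M Gen_g * ?e00 = (\<gamma> * \<delta>) \<cdot>\<^sub>m ?e00"
      "Act ?M Gen_b * ?e00 = 0\<^sub>m (fst ?M) 1"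
      by (simp_all add: tact norm mult.commute)
    moreover have "Act ?M Gen_a * ?w = (\<xi> * (\<alpha> * \<beta>)) \<cdot>\<^sub>m ?w" "Act ?M Gen_g * ?w = (- (\<gamma> * \<delta>)) \<cdot>\<^sub>m ?w"
      "Act ?M Gen_b * ?w = 0\<^sub>m (fst ?M) 1"
      by (simp add: tact norm; rule eq_matI; simp add: xi_simps del: kronecker_index)+
    moreover have "\<gamma> * \<delta> \<noteq> - (\<gamma> * \<delta>)" using nz by (simp add: eq_neg_iff_add_eq_0)
    ultimately show ?thesis
      by (intro four_dim_two_lowest_vectors[OF M(1) dim w t1(1) _ _ _ _ _ _ w' t1(2), of ?e00 ?w]) (simp_all add: dim)
  qed
  show "Iso ?M (P4 (\<xi> * (\<alpha> * \<beta>)))" if eq: "\<gamma> * \<delta> = \<alpha> * \<beta> * (\<alpha> * \<beta> * (\<alpha> * \<beta>))"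
  proof -
    \<comment> \<open>The pairing below reads off the coefficient of \<open>x b ?e10\<close> at \<open>?e01\<close>, which comes from the summand
      \<open>1 \<otimes> x\<close> of the coproduct of \<open>x\<close>.\<close>
    have "Act ?M Gen_a * ?e10 = (\<xi> * (\<alpha> * \<beta>)) \<cdot>\<^sub>m ?e10"
      by (simp add: tact norm; rule eq_matI; simp add: xi_simps del: kronecker_index)
    moreover have "Act ?M Gen_g * ?e10 = (- (\<gamma> * \<delta>)) \<cdot>\<^sub>m ?e10"
      by (simp add: tact norm; rule eq_matI; simp add: xi_simps del: kronecker_index)
    moreover have "- (\<gamma> * \<delta>) = \<xi> * (\<alpha> * \<beta>) * (\<xi> * (\<alpha> * \<beta>) * (\<xi> * (\<alpha> * \<beta>)))"
      unfolding eq by (simp add: xi_simps)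
    moreover have "Act ?M Gen_x * (Act ?M Gen_b * ?e10) \<noteq> 0\<^sub>m (fst ?M) 1"
    proof (rule nonzero_of_pairing[of "(1 / (twist \<alpha> \<gamma> * \<beta>)) \<cdot>\<^sub>m kronecker (urow 2 0) (urow 2 1)"])
      show "(1 / (twist \<alpha> \<gamma> * \<beta>)) \<cdot>\<^sub>m kronecker (urow 2 0) (urow 2 1) * (Act ?M Gen_x * (Act ?M Gen_b * ?e10)) = 1\<^sub>m 1"
        using t nz kronecker_one_left[of "1\<^sub>m 1 :: 'k mat"] by (simp add: tact norm)
    qed (simp add: dim)
    ultimately obtain T H where "T \<in> Hom (P4 (\<xi> * (\<alpha> * \<beta>))) ?M" "H \<in> Hom ?M (P4 (\<xi> * (\<alpha> * \<beta>)))"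
      "H * T = 1\<^sub>m (fst (P4 (\<xi> * (\<alpha> * \<beta>))))"
      using P4_summand[OF M(1) w'(1), of ?e10] by (auto simp: dim)
    then show ?thesis
      using Iso_square_retract[OF P4_module(1)[OF w'(1)] M(1)] dim P4_module(2)[OF w'(1)] Iso_sym by simp
  qed
qed

section \<open>Functoriality and coherence of the tensor product\<close>

lemma Tensor_module [simp]:
  "Rep V \<Longrightarrow> Rep W \<Longrightarrow> Rep (Tensor V W)" "Rep V \<Longrightarrow> Rep W \<Longrightarrow> fst (Tensor V W) = fst V * fst W"
  by (rule tensor_module; assumption)+

text \<open>
  Kronecker products of equivariant maps are equivariant. Distributivity over direct sums follows by applying
  this to the inclusions and projections of a biproduct.
\<close>

lemma Tensor_hom:
  assumes "Rep V" "Rep V'" "Rep W" "Rep W'" and T: "T \<in> Hom V V'" and S: "S \<in> Hom W W'"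
  shows "kronecker T S \<in> Hom (Tensor V W) (Tensor V' W')"
proof (rule HomI)
  note [simp] = assms(1-4) Hom_dims[OF T] Hom_dims[OF S]
  note [simp del] = assoc_mult_mat
  note n = Hom_D[OF T] Hom_D[OF S] Hom_nested[OF T assms(1,2)] Hom_nested[OF S assms(3,4)]
  fix s
  show "kronecker T S * Act (Tensor V W) s = Act (Tensor V' W') s * kronecker T S"
    by (cases s; simp add: tensor_module(2) tensor_act_def Let_def mat_dim_simps kronecker_simps n)
qed (use assms Hom_dims[OF T] Hom_dims[OF S] in simp_all)

lemma Tensor_iso:
  assumes V: "Rep V" "Rep V'" "Rep W" "Rep W'" and "Iso V V'" "Iso W W'"
  shows "Iso (Tensor V W) (Tensor V' W')"
proof -
  obtain T T' S S' where 1: "T \<in> Hom V V'" "T' \<in> Hom V' V" "T' * T = 1\<^sub>m (fst V)" "T * T' = 1\<^sub>m (fst V')"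
    and 2: "S \<in> Hom W W'" "S' \<in> Hom W' W" "S' * S = 1\<^sub>m (fst W)" "S * S' = 1\<^sub>m (fst W')"
    using assms unfolding module_iso_def by blast
  note [simp] = V Hom_dims[OF 1(1)] Hom_dims[OF 1(2)] Hom_dims[OF 2(1)] Hom_dims[OF 2(2)]
  show ?thesis
    by (rule Iso_of_inverse[OF _ _ Tensor_hom[OF V 1(1) 2(1)], of "kronecker T' S'"])
      (auto intro!: carrier_matI simp: kronecker_mult_dim 1(3,4) 2(3,4) kronecker_one)
qed

lemma direct_sum_homs:
  assumes V: "Rep V" and W: "Rep W"
  shows "inl_mat (fst V) (fst W) \<in> Hom V (direct_sum V W)" "inr_mat (fst V) (fst W) \<in> Hom W (direct_sum V W)"
    "prl_mat (fst V) (fst W) \<in> Hom (direct_sum V W) V" "prr_mat (fst V) (fst W) \<in> Hom (direct_sum V W) W"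
proof -
  note [simp] = assms direct_sum_module(1)[OF assms]
  note [simp del] = assoc_mult_mat
  show "inl_mat (fst V) (fst W) \<in> Hom V (direct_sum V W)" "inr_mat (fst V) (fst W) \<in> Hom W (direct_sum V W)"
    "prl_mat (fst V) (fst W) \<in> Hom (direct_sum V W) V" "prr_mat (fst V) (fst W) \<in> Hom (direct_sum V W) W"
    by (rule HomI; simp add: direct_sum_module(2)[OF assms] mat_dim_simps biproduct_simps biproduct_simps_nested)+
qed

lemma Tensor_distrib:
  assumes V: "Rep V" and V': "Rep V'" and W: "Rep W"
  shows "Iso (Tensor (direct_sum V V') W) (direct_sum (Tensor V W) (Tensor V' W))"
    "Iso (Tensor W (direct_sum V V')) (direct_sum (Tensor W V) (Tensor W V'))"
proof -
  note [simp] = assms direct_sum_module(1)[OF V V']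
  note h = direct_sum_homs[OF V V']
  note k = kronecker_mult_dim biproduct_simps kronecker_one kronecker_zero_left kronecker_zero_right mat_dim_simps
  have sum: "kronecker (inl_mat (fst V) (fst V') * prl_mat (fst V) (fst V')) (1\<^sub>m (fst W)) +
      kronecker (inr_mat (fst V) (fst V') * prr_mat (fst V) (fst V')) (1\<^sub>m (fst W)) = (1\<^sub>m ((fst V + fst V') * fst W) :: 'k mat)"
    "kronecker (1\<^sub>m (fst W)) (inl_mat (fst V) (fst V') * prl_mat (fst V) (fst V')) +
      kronecker (1\<^sub>m (fst W)) (inr_mat (fst V) (fst V') * prr_mat (fst V) (fst V')) = (1\<^sub>m (fst W * (fst V + fst V')) :: 'k mat)"
    by (subst kronecker_dim_simps[symmetric]; simp add: biproduct_simps(5) kronecker_one)+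
  show "Iso (Tensor (direct_sum V V') W) (direct_sum (Tensor V W) (Tensor V' W))"
    by (rule Iso_direct_sumI[OF _ _ _ Tensor_hom[OF _ _ _ _ h(1) Hom_one[OF W]] Tensor_hom[OF _ _ _ _ h(2) Hom_one[OF W]]
          Tensor_hom[OF _ _ _ _ h(3) Hom_one[OF W]] Tensor_hom[OF _ _ _ _ h(4) Hom_one[OF W]]])
      (simp_all add: k sum)
  show "Iso (Tensor W (direct_sum V V')) (direct_sum (Tensor W V) (Tensor W V'))"
    by (rule Iso_direct_sumI[OF _ _ _ Tensor_hom[OF _ _ _ _ Hom_one[OF W] h(1)] Tensor_hom[OF _ _ _ _ Hom_one[OF W] h(2)]
          Tensor_hom[OF _ _ _ _ Hom_one[OF W] h(3)] Tensor_hom[OF _ _ _ _ Hom_one[OF W] h(4)]])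
      (simp_all add: k sum)
qed

lemma Iso_of_equal_Act:
  assumes "Rep V" "Rep W" "fst V = fst W" "\<And>s. Act V s = Act W s"
  shows "Iso V W"
proof (rule Iso_of_inverse[OF assms(1,2), of "1\<^sub>m (fst V)" "1\<^sub>m (fst V)"])
  show "1\<^sub>m (fst V) \<in> Hom V W"
    by (rule HomI) (use assms in \<open>simp_all add: mat_dim_simps\<close>)
qed (use assms(3) in auto)

text \<open>
  The Kronecker product of matrices is strictly associative, so the two modules have the same underlying
  space, and coassociativity of the comultiplication makes the actions of the generators equal.
\<close>

lemma Tensor_assoc:
  assumes "Rep V" "Rep W" "Rep U"
  shows "Iso (Tensor (Tensor V W) U) (Tensor V (Tensor W U))"
proof (rule Iso_of_equal_Act)
  note [simp] = assms
  note [simp del] = assoc_mult_mat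
  fix s
  have c: "\<xi> ^ 4 + \<xi> ^ 5 = 1 - 2 * \<xi>"
    by (simp add: eval_nat_numeral xi_simps)
  have a6: "Act M Gen_a * (Act M Gen_a * (Act M Gen_a * (Act M Gen_a * (Act M Gen_a * (Act M Gen_a * Z))))) = Z"
    if "Rep M" "dim_row Z = fst M" for M Z
  proof -
    have "Act M Gen_a * (Act M Gen_a * (Act M Gen_a * (Act M Gen_a * (Act M Gen_a * (Act M Gen_a * Z))))) =
       (Act M Gen_a * (Act M Gen_a * (Act M Gen_a * (Act M Gen_a * (Act M Gen_a * Act M Gen_a))))) * Z"
      using that by (simp add: mat_dim_simps)
    then show ?thesis unfolding module_a6_g6(1)[OF that(1)] using that(2) by (simp add: mat_dim_simps)
  qed
  note r = act_rewrite[OF assms(1)] act_rewrite[OF assms(2)] act_rewrite[OF assms(3)] a6 module_a6_g6(1)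
  show "Act (Tensor (Tensor V W) U) s = Act (Tensor V (Tensor W U)) s"
    by (cases s; simp add: tensor_module tensor_act_def Let_def mat_dim_simps kronecker_simps kronecker_assoc r c
         kronecker_one[symmetric] del: kronecker_one;
       (rule eq_matI; simp add: xi_simps mult.assoc del: index_mult_mat(1) kronecker_index)?)
qed (use assms in \<open>simp_all add: mult.assoc\<close>)

lemma counit_extension:
  "algebra_extension (ring_of_type_algebra :: 'k ring) (\<lambda>c. c) (\<lambda>w. prod_list (map counit_gen (letters w)))"
proof (intro algebra_extension.intro algebra_extension_axioms.intro)
  show "(\<lambda>c. c) \<in> Ring.ring_hom ring_of_type_algebra (ring_of_type_algebra :: 'k ring)"
    by (rule ring_hom_memI) (simp_all add: ring_of_type_simps)
qed (simp_all add: ring_ring_of_type_algebra ring_of_type_simps zero_word_def plus_word_def mult.commute)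

lemma counit_eq_ext:
  "counit = algebra_extension.ext (ring_of_type_algebra :: 'k ring) (\<lambda>c. c) (\<lambda>w. prod_list (map counit_gen (letters w)))"
proof
  fix f :: "'k free_algebra"
  interpret E: algebra_extension "ring_of_type_algebra :: 'k ring" "\<lambda>c. c" "\<lambda>w. prod_list (map counit_gen (letters w))"
    by (rule counit_extension)
  have fin: "finsum (ring_of_type_algebra :: 'k ring) F I = sum F I" if "finite I" for F and I :: "word set"
    using that
  proof induction
    case empty
    show ?case unfolding E.finsum_empty sum.empty by (rule ring_of_type_simps(5))
  next
    case (insert x I)
    have "finsum (ring_of_type_algebra :: 'k ring) F (insert x I) = F x + finsum ring_of_type_algebra F I"
      using E.finsum_insert[OF insert(1,2), of F] unfolding ring_of_type_simps by blast
    then show ?case unfolding insert(3) sum.insert[OF insert(1,2)] .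
  qed
  show "counit f = E.ext f"
    unfolding counit_def free_extend_def E.ext_def ring_of_type_simps by (rule fin[symmetric]) (rule finite_keys)
qed

lemma counit_simps:
  "counit (scal c) = (c :: 'k)" "counit (gen s) = (counit_gen s :: 'k)" "counit (f + g) = counit f + (counit g :: 'k)"
  "counit (f * g) = counit f * (counit g :: 'k)" "counit 1 = (1 :: 'k)"
proof -
  interpret E: algebra_extension "ring_of_type_algebra :: 'k ring" "\<lambda>c. c" "\<lambda>w. prod_list (map counit_gen (letters w))"
    by (rule counit_extension)
  show "counit (f + g) = counit f + (counit g :: 'k)" "counit (f * g) = counit f * (counit g :: 'k)" "counit 1 = (1 :: 'k)"
    unfolding counit_eq_ext
    using ring_hom_add[OF E.ext_hom, of f g] ring_hom_mult[OF E.ext_hom, of f g] ring_hom_one[OF E.ext_hom]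
    unfolding ring_of_type_simps by blast+
  show "counit (scal c) = (c :: 'k)" "counit (gen s) = (counit_gen s :: 'k)"
    unfolding counit_eq_ext scal_def gen_def E.ext_single ring_of_type_simps
    by (simp_all only: zero_word_def word.sel list.map prod_list.Nil prod_list.Cons mult_1 mult_1_right)
qed

lemma trivial_module:
  "Rep trivial_module" "fst trivial_module = 1"
  "Act trivial_module s = counit_gen s \<cdot>\<^sub>m 1\<^sub>m 1"
proof -
  let ?h = "\<lambda>f. counit f \<cdot>\<^sub>m 1\<^sub>m 1 :: 'k mat"
  have h: "?h \<in> Ring.ring_hom ring_of_type_algebra (ring_mat TYPE('k) 1 ())"
    by (rule ring_mat_hom) (auto simp: counit_simps mat_dim_simps distrib_right intro!: eq_matI)
  have D: "D_matrices 1 (?h (gen Gen_a)) (?h (gen Gen_b)) (?h (gen Gen_g)) (?h (gen Gen_x))"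
    unfolding D_matrices_def counit_simps
    by (intro conjI carrier_matI; simp add: mat_dim_simps del: One_nat_def; (rule eq_matI; simp)?)
  note m = module_of_hom[OF h _ D]
  show "Rep trivial_module" "Act trivial_module s = counit_gen s \<cdot>\<^sub>m 1\<^sub>m 1"
    using m by (simp_all add: trivial_module_def counit_simps)
qed (simp add: trivial_module_def)

lemma trivial_iso_chi: "Iso trivial_module (chi 1)"
proof (rule Iso_of_equal_Act)
  fix s show "Act trivial_module s = Act (chi 1) s"
    by (cases s) (auto simp: trivial_module chi_module intro!: eq_matI)
qed (simp_all add: trivial_module chi_module)

lemma Tensor_trivial:
  assumes "Rep V"
  shows "Iso (Tensor trivial_module V) V" "Iso (Tensor V trivial_module) V"
proof -
  note [simp] = assms trivial_module(1,2)
  have t: "Act trivial_module Gen_a = 1\<^sub>m 1" "Act trivial_module Gen_b = 0\<^sub>m 1 1"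
    "Act trivial_module Gen_g = 1\<^sub>m 1" "Act trivial_module Gen_x = 0\<^sub>m 1 1"
    unfolding trivial_module(3) by (auto intro!: eq_matI)
  show "Iso (Tensor trivial_module V) V"
  proof (rule Iso_of_equal_Act)
    fix s show "Act (Tensor trivial_module V) s = Act V s"
      by (cases s) (simp_all add: t tensor_module tensor_act_def Let_def mat_dim_simps kronecker_zero_left kronecker_zero_right kronecker_one_left del: One_nat_def)
  qed simp_all
  show "Iso (Tensor V trivial_module) V"
  proof (rule Iso_of_equal_Act)
    fix s show "Act (Tensor V trivial_module) s = Act V s"
      by (cases s) (simp_all add: t tensor_module tensor_act_def Let_def mat_dim_simps kronecker_zero_left kronecker_zero_right kronecker_one_right del: One_nat_def)
  qed simp_all
qed

section \<open>The Green ring\<close>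

abbreviation IC :: "'k rep \<Rightarrow> 'k rep set" where "IC \<equiv> iso_class \<xi> \<theta>"
abbreviation FG :: "('k rep set \<Rightarrow>\<^sub>0 int) ring" where "FG \<equiv> free_green_ring \<xi> \<theta>"
abbreviation TC :: "'k rep set \<Rightarrow> 'k rep set \<Rightarrow> 'k rep set" where "TC \<equiv> tensor_class \<xi> \<theta>"

lemma IC_eq:
  assumes "Rep V" "Rep W" "Iso V W"
  shows "IC V = IC W"
  unfolding iso_class_def using Iso_trans[OF assms(3) _ assms(1,2)] Iso_trans[OF Iso_sym[OF assms(3)] _ assms(2,1)] by blast

lemma IC_self: "Rep V \<Longrightarrow> V \<in> IC V"
  by (simp add: iso_class_def Iso_refl)

text \<open>
  The product of isomorphism classes is defined as a union over all representatives, and all of these have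
  isomorphic tensor products.
\<close>

lemma TC_eq:
  assumes V: "Rep V" and W: "Rep W"
  shows "TC (IC V) (IC W) = IC (Tensor V W)"
proof -
  have "IC (Tensor V' W') = IC (Tensor V W)" if "V' \<in> IC V" "W' \<in> IC W" for V' W'
    using that V W by (intro IC_eq Iso_sym[OF Tensor_iso]) (auto simp: iso_class_def)
  then show ?thesis
    unfolding tensor_class_def using IC_self[OF V] IC_self[OF W] by blast
qed

lemma FG_simps:
  "carrier FG = {c. Poly_Mapping.keys c \<subseteq> IC ` {V. Rep V}}"
  "x \<otimes>\<^bsub>FG\<^esub> y = frag_extend (\<lambda>C. frag_extend (\<lambda>E. frag_of (TC C E)) y) x"
  "\<one>\<^bsub>FG\<^esub> = frag_of (IC trivial_module)" "\<zero>\<^bsub>FG\<^esub> = 0" "x \<oplus>\<^bsub>FG\<^esub> y = x + y"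
  by (simp_all add: free_green_ring_def)

lemma FG_carrier:
  "Rep V \<Longrightarrow> frag_of (IC V) \<in> carrier FG" "0 \<in> carrier FG"
  "x \<in> carrier FG \<Longrightarrow> y \<in> carrier FG \<Longrightarrow> x + y \<in> carrier FG" "x \<in> carrier FG \<Longrightarrow> - x \<in> carrier FG"
  "x \<in> carrier FG \<Longrightarrow> y \<in> carrier FG \<Longrightarrow> x - y \<in> carrier FG"
  unfolding FG_simps using keys_add[of x y] keys_diff[of x y] by auto

lemma FG_induct [consumes 1, case_names zero one diff]:
  assumes "x \<in> carrier FG" "P 0" "\<And>V. Rep V \<Longrightarrow> P (frag_of (IC V))"
    "\<And>x y. x \<in> carrier FG \<Longrightarrow> y \<in> carrier FG \<Longrightarrow> P x \<Longrightarrow> P y \<Longrightarrow> P (x - y)"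
  shows "P x"
proof -
  have "Poly_Mapping.keys x \<subseteq> IC ` {V. Rep V}" using assms(1) by (simp add: FG_simps)
  then have "x \<in> carrier FG \<and> P x"
    by (induction x rule: frag_induction) (use assms FG_carrier in auto)
  then show ?thesis ..
qed

lemma FG_mult_simps:
  "(x + y) \<otimes>\<^bsub>FG\<^esub> z = x \<otimes>\<^bsub>FG\<^esub> z + y \<otimes>\<^bsub>FG\<^esub> z" "(x - y) \<otimes>\<^bsub>FG\<^esub> z = x \<otimes>\<^bsub>FG\<^esub> z - y \<otimes>\<^bsub>FG\<^esub> z"
  "z \<otimes>\<^bsub>FG\<^esub> (x + y) = z \<otimes>\<^bsub>FG\<^esub> x + z \<otimes>\<^bsub>FG\<^esub> y" "z \<otimes>\<^bsub>FG\<^esub> (x - y) = z \<otimes>\<^bsub>FG\<^esub> x - z \<otimes>\<^bsub>FG\<^esub> y"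
  "0 \<otimes>\<^bsub>FG\<^esub> z = 0" "z \<otimes>\<^bsub>FG\<^esub> 0 = 0"
proof -
  show "(x + y) \<otimes>\<^bsub>FG\<^esub> z = x \<otimes>\<^bsub>FG\<^esub> z + y \<otimes>\<^bsub>FG\<^esub> z" "(x - y) \<otimes>\<^bsub>FG\<^esub> z = x \<otimes>\<^bsub>FG\<^esub> z - y \<otimes>\<^bsub>FG\<^esub> z"
    "0 \<otimes>\<^bsub>FG\<^esub> z = 0" "z \<otimes>\<^bsub>FG\<^esub> 0 = 0"
    by (simp_all add: FG_simps frag_extend_add frag_extend_diff frag_extend_eq_0)
  have *: "z \<otimes>\<^bsub>FG\<^esub> (x + y) = z \<otimes>\<^bsub>FG\<^esub> x + z \<otimes>\<^bsub>FG\<^esub> y \<and> z \<otimes>\<^bsub>FG\<^esub> (x - y) = z \<otimes>\<^bsub>FG\<^esub> x - z \<otimes>\<^bsub>FG\<^esub> y"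
    using subset_UNIV
    by (induction z rule: frag_induction)
      (simp_all add: FG_simps frag_extend_add frag_extend_diff algebra_simps)
  then show "z \<otimes>\<^bsub>FG\<^esub> (x + y) = z \<otimes>\<^bsub>FG\<^esub> x + z \<otimes>\<^bsub>FG\<^esub> y" "z \<otimes>\<^bsub>FG\<^esub> (x - y) = z \<otimes>\<^bsub>FG\<^esub> x - z \<otimes>\<^bsub>FG\<^esub> y"
    by simp_all
qed

lemma FG_mult_of: "Rep V \<Longrightarrow> Rep W \<Longrightarrow> frag_of (IC V) \<otimes>\<^bsub>FG\<^esub> frag_of (IC W) = frag_of (IC (Tensor V W))"
  by (simp add: FG_simps(2) TC_eq)

lemma FG_mult_closed: "x \<in> carrier FG \<Longrightarrow> y \<in> carrier FG \<Longrightarrow> x \<otimes>\<^bsub>FG\<^esub> y \<in> carrier FG"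
proof (induction x rule: FG_induct)
  case (one V)
  show ?case
    using \<open>y \<in> carrier FG\<close>
    by (induction y rule: FG_induct) (use one FG_carrier in \<open>auto simp: FG_mult_simps FG_mult_of\<close>)
qed (simp_all add: FG_mult_simps FG_carrier)

text \<open>
  By biadditivity the ring axioms need to be checked on isomorphism classes of modules, where they are the
  coherence isomorphisms of the tensor product.
\<close>

lemma FG_mult_assoc:
  assumes "x \<in> carrier FG" "y \<in> carrier FG" "z \<in> carrier FG"
  shows "x \<otimes>\<^bsub>FG\<^esub> y \<otimes>\<^bsub>FG\<^esub> z = x \<otimes>\<^bsub>FG\<^esub> (y \<otimes>\<^bsub>FG\<^esub> z)"
  using assms(1)
proof (induction x rule: FG_induct)
  case (one V)
  show ?case
    using assms(2)
  proof (induction y rule: FG_induct)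
    case (one W)
    show ?case
      using assms(3)
    proof (induction z rule: FG_induct)
      case (one U)
      show ?case
        using IC_eq[OF _ _ Tensor_assoc[OF \<open>Rep V\<close> \<open>Rep W\<close> \<open>Rep U\<close>]] \<open>Rep V\<close> \<open>Rep W\<close> \<open>Rep U\<close>
        by (simp add: FG_mult_of)
    qed (simp_all add: FG_mult_simps)
  qed (simp_all add: FG_mult_simps)
qed (simp_all add: FG_mult_simps)

lemma FG_mult_one:
  assumes "x \<in> carrier FG"
  shows "\<one>\<^bsub>FG\<^esub> \<otimes>\<^bsub>FG\<^esub> x = x" "x \<otimes>\<^bsub>FG\<^esub> \<one>\<^bsub>FG\<^esub> = x"
proof -
  have "\<one>\<^bsub>FG\<^esub> \<otimes>\<^bsub>FG\<^esub> x = x \<and> x \<otimes>\<^bsub>FG\<^esub> \<one>\<^bsub>FG\<^esub> = x"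
    using assms
  proof (induction x rule: FG_induct)
    case (one V)
    then show ?case
      using IC_eq[OF _ _ Tensor_trivial(1)[OF one]] IC_eq[OF _ _ Tensor_trivial(2)[OF one]] trivial_module(1)
      by (simp add: FG_simps(3) FG_mult_of)
  qed (simp_all add: FG_mult_simps)
  then show "\<one>\<^bsub>FG\<^esub> \<otimes>\<^bsub>FG\<^esub> x = x" "x \<otimes>\<^bsub>FG\<^esub> \<one>\<^bsub>FG\<^esub> = x" by simp_all
qed

lemma ring_FG: "ring FG"
proof (rule ringI)
  show "abelian_group FG"
  proof (rule abelian_groupI)
    fix x assume "x \<in> carrier FG"
    then show "\<exists>y\<in>carrier FG. y \<oplus>\<^bsub>FG\<^esub> x = \<zero>\<^bsub>FG\<^esub>"
      by (intro bexI[of _ "- x"]) (simp_all add: FG_simps(4,5) FG_carrier)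
  qed (simp_all add: FG_simps(4,5) FG_carrier algebra_simps)
  show "Group.monoid FG"
    by (rule monoidI) (simp_all add: FG_mult_closed FG_mult_assoc FG_mult_one[unfolded FG_simps(3)] FG_simps(3) FG_carrier trivial_module)
qed (simp_all add: FG_simps(5) FG_mult_simps)

lemma FG_a_inv: "x \<in> carrier FG \<Longrightarrow> \<ominus>\<^bsub>FG\<^esub> x = - x"
proof -
  interpret ring FG by (rule ring_FG)
  assume x: "x \<in> carrier FG"
  then have "- x \<oplus>\<^bsub>FG\<^esub> x = \<zero>\<^bsub>FG\<^esub>" by (simp add: FG_simps(4,5))
  from minus_equality[OF this x] show ?thesis using FG_carrier(4)[OF x] by simp
qed

abbreviation DS :: "('k rep set \<Rightarrow>\<^sub>0 int) set" where "DS \<equiv> direct_sum_subgroup \<xi> \<theta>"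

lemma direct_sum_relations_carrier: "direct_sum_relations \<xi> \<theta> \<subseteq> carrier FG"
  by (auto simp: direct_sum_relations_def FG_carrier direct_sum_module)

lemma DS_induct [consumes 1, case_names zero rel uminus add]:
  assumes "x \<in> DS" "P 0"
    "\<And>V W. Rep V \<Longrightarrow> Rep W \<Longrightarrow> P (frag_of (IC (direct_sum V W)) - (frag_of (IC V) + frag_of (IC W)))"
    "\<And>x. x \<in> carrier FG \<Longrightarrow> P x \<Longrightarrow> P (- x)"
    "\<And>x y. x \<in> carrier FG \<Longrightarrow> y \<in> carrier FG \<Longrightarrow> P x \<Longrightarrow> P y \<Longrightarrow> P (x + y)"
  shows "P x"
proof -
  interpret ring FG by (rule ring_FG)
  have "x \<in> carrier FG \<and> P x"
    using assms(1) unfolding direct_sum_subgroup_def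
  proof induction
    case one
    then show ?case using assms(2) by (simp add: FG_simps(4) FG_carrier)
  next
    case (incl h)
    then have "P h" using assms(3) by (auto simp: direct_sum_relations_def)
    then show ?case using subsetD[OF direct_sum_relations_carrier incl] by simp
  next
    case (inv h)
    then have h: "h \<in> carrier FG" using direct_sum_relations_carrier by auto
    have "P h" using inv assms(3) by (auto simp: direct_sum_relations_def)
    then show ?case
      using assms(4)[OF h] FG_a_inv[OF h] FG_carrier(4)[OF h] by (simp add: a_inv_def)
  next
    case (eng h1 h2)
    then show ?case using assms(5) FG_carrier(3) by (simp add: FG_simps(5))
  qed
  then show ?thesis ..
qed

lemma DS_closed:
  "0 \<in> DS" "x \<in> DS \<Longrightarrow> y \<in> DS \<Longrightarrow> x + y \<in> DS"
  "Rep V \<Longrightarrow> Rep W \<Longrightarrow> frag_of (IC (direct_sum V W)) - (frag_of (IC V) + frag_of (IC W)) \<in> DS"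
  "x \<in> DS \<Longrightarrow> - x \<in> DS" "x \<in> DS \<Longrightarrow> y \<in> DS \<Longrightarrow> x - y \<in> DS" "x \<in> DS \<Longrightarrow> x \<in> carrier FG"
proof -
  interpret ring FG by (rule ring_FG)
  have sub: "subgroup DS (add_monoid FG)"
    unfolding direct_sum_subgroup_def
    by (rule group.generate_is_subgroup[OF a_group]) (use direct_sum_relations_carrier in simp)
  show "0 \<in> DS" using subgroup.one_closed[OF sub] by (simp add: FG_simps(4))
  show add: "x \<in> DS \<Longrightarrow> y \<in> DS \<Longrightarrow> x + y \<in> DS" for x y using subgroup.m_closed[OF sub] by (simp add: FG_simps(5))
  show "Rep V \<Longrightarrow> Rep W \<Longrightarrow> frag_of (IC (direct_sum V W)) - (frag_of (IC V) + frag_of (IC W)) \<in> DS"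
    unfolding direct_sum_subgroup_def direct_sum_relations_def by (rule generate.incl) blast
  show c: "x \<in> DS \<Longrightarrow> x \<in> carrier FG" for x using subgroup.mem_carrier[OF sub] by simp
  show neg: "x \<in> DS \<Longrightarrow> - x \<in> DS" for x
    using subgroup.m_inv_closed[OF sub, of x] FG_a_inv[of x] c by (simp add: a_inv_def)
  show "x \<in> DS \<Longrightarrow> y \<in> DS \<Longrightarrow> x - y \<in> DS" using add[of x "- y"] neg[of y] by simp
qed

lemma DS_mult_of:
  assumes "x \<in> DS" "Rep U"
  shows "x \<otimes>\<^bsub>FG\<^esub> frag_of (IC U) \<in> DS" "frag_of (IC U) \<otimes>\<^bsub>FG\<^esub> x \<in> DS"
proof -
  have neg: "(- x) \<otimes>\<^bsub>FG\<^esub> z = - (x \<otimes>\<^bsub>FG\<^esub> z)" "z \<otimes>\<^bsub>FG\<^esub> (- x) = - (z \<otimes>\<^bsub>FG\<^esub> x)" for x z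
    using FG_mult_simps(2)[of 0 x z] FG_mult_simps(4)[of z 0 x] by (simp_all add: FG_mult_simps(5,6))
  have "x \<otimes>\<^bsub>FG\<^esub> frag_of (IC U) \<in> DS \<and> frag_of (IC U) \<otimes>\<^bsub>FG\<^esub> x \<in> DS"
    using assms(1)
  proof (induction x rule: DS_induct)
    case (rel V W)
    note [simp] = rel direct_sum_module(1)[OF rel] \<open>Rep U\<close>
    show ?case
      using IC_eq[OF _ _ Tensor_distrib(1)[OF rel \<open>Rep U\<close>]] IC_eq[OF _ _ Tensor_distrib(2)[OF rel \<open>Rep U\<close>]]
        DS_closed(3)[of "Tensor V U" "Tensor W U"] DS_closed(3)[of "Tensor U V" "Tensor U W"]
      by (simp add: FG_mult_simps(1-4) FG_mult_of direct_sum_module)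
  qed (simp_all add: FG_mult_simps DS_closed neg)
  then show "x \<otimes>\<^bsub>FG\<^esub> frag_of (IC U) \<in> DS" "frag_of (IC U) \<otimes>\<^bsub>FG\<^esub> x \<in> DS" by simp_all
qed

text \<open>
  Tensoring a relation \<open>[V \<oplus> W] - [V] - [W]\<close> with a module gives a relation of the same kind by
  distributivity, so the subgroup generated by the relations is an ideal.
\<close>

lemma ideal_DS: "ideal DS FG"
proof -
  interpret ring FG by (rule ring_FG)
  have "x \<otimes>\<^bsub>FG\<^esub> a \<in> DS \<and> a \<otimes>\<^bsub>FG\<^esub> x \<in> DS" if "a \<in> DS" "x \<in> carrier FG" for a x
    using that(2)
    by (induction x rule: FG_induct) (use that(1) DS_mult_of in \<open>auto simp: FG_mult_simps DS_closed\<close>)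
  moreover have "subgroup DS (add_monoid FG)"
    unfolding direct_sum_subgroup_def
    by (rule group.generate_is_subgroup[OF a_group]) (use direct_sum_relations_carrier in simp)
  ultimately show ?thesis
    by (intro idealI ring_FG) auto
qed

abbreviation GR :: "('k rep set \<Rightarrow>\<^sub>0 int) set ring" where "GR \<equiv> green_ring \<xi> \<theta>"
abbreviation cls :: "'k rep \<Rightarrow> ('k rep set \<Rightarrow>\<^sub>0 int) set" where "cls \<equiv> green_class \<xi> \<theta>"

lemma ring_GR: "ring GR"
  unfolding green_ring_def by (rule ideal.quotient_is_ring[OF ideal_DS])

lemma coset_hom: "(+>\<^bsub>FG\<^esub>) DS \<in> Ring.ring_hom FG GR"
  unfolding green_ring_def by (rule ideal.rcos_ring_hom[OF ideal_DS])

lemma cls_coset: "cls V = DS +>\<^bsub>FG\<^esub> frag_of (IC V)"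
  by (simp add: green_class_def)

lemma cls_closed: "Rep V \<Longrightarrow> cls V \<in> carrier GR"
  unfolding cls_coset by (rule ring_hom_closed[OF coset_hom FG_carrier(1)])

lemma cls_iso: "Rep V \<Longrightarrow> Rep W \<Longrightarrow> Iso V W \<Longrightarrow> cls V = cls W"
  using IC_eq by (simp add: cls_coset)

lemma cls_tensor: "Rep V \<Longrightarrow> Rep W \<Longrightarrow> cls (Tensor V W) = cls V \<otimes>\<^bsub>GR\<^esub> cls W"
  unfolding cls_coset by (simp add: ring_hom_mult[OF coset_hom FG_carrier(1) FG_carrier(1), symmetric] FG_mult_of)

lemma cls_one: "\<one>\<^bsub>GR\<^esub> = cls (chi 1)"
  using ring_hom_one[OF coset_hom] cls_iso[OF trivial_module(1) chi_module(1) trivial_iso_chi]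
  by (simp add: cls_coset FG_simps(3))

lemma coset_eq_iff:
  assumes "x \<in> carrier FG" "y \<in> carrier FG"
  shows "DS +>\<^bsub>FG\<^esub> x = DS +>\<^bsub>FG\<^esub> y \<longleftrightarrow> x - y \<in> DS"
proof
  assume "DS +>\<^bsub>FG\<^esub> x = DS +>\<^bsub>FG\<^esub> y"
  moreover have "x \<in> DS +>\<^bsub>FG\<^esub> x"
    using DS_closed(1) by (auto simp: a_r_coset_def' FG_simps(5) intro!: bexI[of _ 0])
  ultimately obtain d where "d \<in> DS" "x = d + y"
    by (auto simp: a_r_coset_def' FG_simps(5))
  then show "x - y \<in> DS" by simp
next
  assume d: "x - y \<in> DS"
  show "DS +>\<^bsub>FG\<^esub> x = DS +>\<^bsub>FG\<^esub> y"
  proof (intro equalityI subsetI)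
    fix z assume "z \<in> DS +>\<^bsub>FG\<^esub> x"
    then obtain e where "e \<in> DS" "z = e + x" by (auto simp: a_r_coset_def' FG_simps(5))
    then show "z \<in> DS +>\<^bsub>FG\<^esub> y"
      using DS_closed(2)[OF _ d, of e] by (auto simp: a_r_coset_def' FG_simps(5) intro!: bexI[of _ "e + (x - y)"])
  next
    fix z assume "z \<in> DS +>\<^bsub>FG\<^esub> y"
    then obtain e where "e \<in> DS" "z = e + y" by (auto simp: a_r_coset_def' FG_simps(5))
    then show "z \<in> DS +>\<^bsub>FG\<^esub> x"
      using DS_closed(5)[OF _ d, of e] by (auto simp: a_r_coset_def' FG_simps(5) intro!: bexI[of _ "e - (x - y)"])
  qed
qed

lemma cls_direct_sum:
  assumes "Rep V" "Rep W"
  shows "cls (direct_sum V W) = cls V \<oplus>\<^bsub>GR\<^esub> cls W"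
proof -
  have "cls V \<oplus>\<^bsub>GR\<^esub> cls W = DS +>\<^bsub>FG\<^esub> (frag_of (IC V) + frag_of (IC W))"
    unfolding cls_coset using ring_hom_add[OF coset_hom FG_carrier(1) FG_carrier(1)] assms by (simp add: FG_simps(5))
  moreover have "cls (direct_sum V W) = DS +>\<^bsub>FG\<^esub> (frag_of (IC V) + frag_of (IC W))"
    unfolding cls_coset
    using DS_closed(3)[OF assms] by (subst coset_eq_iff) (use assms direct_sum_module FG_carrier in auto)
  ultimately show ?thesis by simp
qed

lemma carrier_GR: "carrier GR = (\<lambda>x. DS +>\<^bsub>FG\<^esub> x) ` carrier FG"
  by (auto simp: green_ring_def FactRing_def A_RCOSETS_def')

text \<open>
  An isomorphism invariant that is additive on direct sums is an additive function on the free abelian group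
  that kills the relations. This is how elements of the Green ring are distinguished without a
  Krull-Schmidt theorem.
\<close>

lemma green_functional:
  fixes f :: "'k rep \<Rightarrow> int"
  assumes iso: "\<And>V W. Rep V \<Longrightarrow> Rep W \<Longrightarrow> Iso V W \<Longrightarrow> f V = f W"
    and add: "\<And>V W. Rep V \<Longrightarrow> Rep W \<Longrightarrow> f (direct_sum V W) = f V + f W"
  obtains \<Phi> where "\<And>x y. x \<in> carrier GR \<Longrightarrow> y \<in> carrier GR \<Longrightarrow> \<Phi> (x \<oplus>\<^bsub>GR\<^esub> y) = \<Phi> x + \<Phi> y"
    "\<And>V. Rep V \<Longrightarrow> \<Phi> (cls V) = f V"
proof -
  define F :: "('k rep set \<Rightarrow>\<^sub>0 int) \<Rightarrow> unit \<Rightarrow>\<^sub>0 int" where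
    "F = frag_extend (\<lambda>C. Poly_Mapping.single () (f (SOME V. V \<in> C)))"
  define G where "G x = Poly_Mapping.lookup (F x) ()" for x
  have G: "G (x + y) = G x + G y" "G (x - y) = G x - G y" "G 0 = 0" for x y
    by (simp_all add: G_def F_def frag_extend_add frag_extend_diff lookup_add lookup_minus)
  have GV: "G (frag_of (IC V)) = f V" if "Rep V" for V
  proof -
    have "(SOME W. W \<in> IC V) \<in> IC V" by (rule someI, rule IC_self[OF that])
    then have "Rep (SOME W. W \<in> IC V)" "Iso V (SOME W. W \<in> IC V)" by (simp_all add: iso_class_def)
    from iso[OF that this] have "f (SOME W. W \<in> IC V) = f V" by (rule sym)
    then show ?thesis by (simp add: G_def F_def)
  qed
  have G0: "G x = 0" if "x \<in> DS" for x
    using that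
  proof (induction x rule: DS_induct)
    case (uminus x)
    then show ?case using G(2)[of 0 x] G(3) by simp
  qed (simp_all add: G GV add direct_sum_module)
  define \<Phi> where "\<Phi> C = the_elem (G ` C)" for C
  have \<Phi>: "\<Phi> (DS +>\<^bsub>FG\<^esub> x) = G x" for x
  proof -
    have "G ` (DS +>\<^bsub>FG\<^esub> x) = {G x}"
      using DS_closed(1) by (auto simp: a_r_coset_def' FG_simps(5) G G0 intro!: image_eqI[of _ G "0 + x"])
    then show ?thesis by (simp add: \<Phi>_def)
  qed
  show thesis
  proof (rule that)
    fix C E assume "C \<in> carrier GR" "E \<in> carrier GR"
    then obtain x y where "x \<in> carrier FG" "y \<in> carrier FG" "C = DS +>\<^bsub>FG\<^esub> x" "E = DS +>\<^bsub>FG\<^esub> y"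
      by (auto simp: carrier_GR)
    note xy = this
    have "C \<oplus>\<^bsub>GR\<^esub> E = DS +>\<^bsub>FG\<^esub> (x + y)"
      unfolding xy(3,4) using ring_hom_add[OF coset_hom xy(1,2)] by (simp add: FG_simps(5))
    then show "\<Phi> (C \<oplus>\<^bsub>GR\<^esub> E) = \<Phi> C + \<Phi> E"
      unfolding xy(3,4) by (simp add: \<Phi> G)
  qed (simp add: cls_coset \<Phi> GV)
qed

end

text \<open>
  By Gauss elimination the kernel has dimension \<open>n - r\<close> with \<open>r\<close> the number of nonzero rows of the echelon
  form.
\<close>

lemma kernel_dim_full_iff:
  fixes A :: "'a :: field mat"
  assumes A: "A \<in> carrier_mat n n"
  shows "kernel_dim A = n \<longleftrightarrow> A = 0\<^sub>m n n"
proof -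
  let ?B = "gauss_jordan_single A"
  from gauss_jordan_single[OF A refl]
  obtain P Q where AB: "?B = P * A" and QP: "Q * P = 1\<^sub>m n" and
    P: "P \<in> carrier_mat n n" and Q: "Q \<in> carrier_mat n n" and B: "?B \<in> carrier_mat n n"
    and row: "row_echelon_form ?B" by auto
  define r where "r = card {i. i < n \<and> row ?B i \<noteq> 0\<^sub>v n}"
  have kd: "kernel_dim A = n - r"
    using find_base_vectors(5)[OF row B] A unfolding kernel_dim_code r_def by simp
  show ?thesis
  proof
    assume "A = 0\<^sub>m n n"
    then have "?B = 0\<^sub>m n n" unfolding AB using P by simp
    then have "r = 0" by (auto simp: r_def)
    then show "kernel_dim A = n" using kd by simp
  next
    assume "kernel_dim A = n"
    then have "n = 0 \<or> r = 0" using kd by linarith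
    then have rows: "row ?B i = 0\<^sub>v n" if "i < n" for i
      using that by (auto simp: r_def)
    have "?B = 0\<^sub>m n n"
    proof (rule eq_rowI)
      fix i assume "i < dim_row (0\<^sub>m n n :: 'a mat)"
      then show "row ?B i = row (0\<^sub>m n n) i" using rows[of i] by simp
    qed (use B in auto)
    then have "Q * (P * A) = 0\<^sub>m n n" using AB Q by simp
    then show "A = 0\<^sub>m n n" using assoc_mult_mat[OF Q P A] QP A by simp
  qed
qed

context double_params
begin

section \<open>Rank functions on the Green ring\<close>

text \<open>
  The rank of \<open>d\<close> on \<open>V\<close>, as an integer so that it can be extended additively to the Green ring.
\<close>

definition rank_of :: "'k free_algebra \<Rightarrow> 'k rep \<Rightarrow> int" where
  "rank_of d V = int (fst V) - int (kernel_dim (snd V (D_class \<xi> \<theta> d)))"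

lemma rank_of_eq_0_iff: "Rep V \<Longrightarrow> rank_of d V = 0 \<longleftrightarrow> snd V (D_class \<xi> \<theta> d) = 0\<^sub>m (fst V) (fst V)"
  using kernel_dim_full_iff[OF module_simps(1)[of \<xi> \<theta> V d]] by (auto simp: rank_of_def)

lemma rank_of_iso:
  assumes "Rep V" "Rep W" "Iso V W"
  shows "rank_of d V = rank_of d W"
proof -
  have n: "fst V = fst W" by (rule Iso_dim[OF assms(3)])
  obtain T S where TS: "T \<in> Hom V W" "S \<in> Hom W V" "S * T = 1\<^sub>m (fst V)" "T * S = 1\<^sub>m (fst W)"
    using assms(3) unfolding module_iso_def by blast
  note [simp] = assms(1,2) Hom_dims[OF TS(1)] Hom_dims[OF TS(2)]
  let ?A = "snd V (D_class \<xi> \<theta> d)" and ?B = "snd W (D_class \<xi> \<theta> d)"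
  have "T * ?A = ?B * T" using TS(1) by (auto simp: module_hom_def carrier_D_alg)
  then have "S * ?B * T = (S * T) * ?A" by (simp add: mat_dim_simps)
  then have "?A = S * ?B * T" using TS(3) by (simp add: mat_dim_simps)
  then have "similar_mat_wit ?A ?B S T"
    using TS(3,4) n by (auto simp: similar_mat_wit_def Let_def intro!: carrier_matI)
  from similar_mat_wit_kernel_dim[OF module_simps(1)[OF assms(1)] this] show ?thesis
    using n by (simp add: rank_of_def kernel_dim_def)
qed

lemma rank_of_direct_sum:
  assumes "Rep V" "Rep W"
  shows "rank_of d (direct_sum V W) = rank_of d V + rank_of d W"
proof -
  have "kernel.dim (fst V + fst W) (snd (direct_sum V W) (D_class \<xi> \<theta> d)) =
      kernel.dim (fst V) (snd V (D_class \<xi> \<theta> d)) + kernel.dim (fst W) (snd W (D_class \<xi> \<theta> d))"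
    by (rule kernel_four_block_0_mat[OF _ module_simps(1)[OF assms(1)] module_simps(1)[OF assms(2)]])
      (simp add: direct_sum_def)
  then show ?thesis
    using assms direct_sum_module(1)[OF assms] by (simp add: rank_of_def kernel_dim_def)
qed

text \<open>
  The element of the algebra that acts by \<open>weight_proj\<close>.
\<close>

definition weight_elem :: "gen \<Rightarrow> 'k \<Rightarrow> 'k free_algebra" where
  "weight_elem s \<alpha> = 1 + (scal (\<alpha> ^ 5) * gen s + (scal (\<alpha> ^ 4) * (gen s * gen s) + (scal (\<alpha> ^ 3) * (gen s * (gen s * gen s))
     + (scal (\<alpha> ^ 2) * (gen s * (gen s * (gen s * gen s))) + scal \<alpha> * (gen s * (gen s * (gen s * (gen s * gen s))))))))"

lemma weight_elem_act:
  assumes V: "Rep V"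
  shows "snd V (D_class \<xi> \<theta> (weight_elem s \<alpha>)) = weight_proj (fst V) (Act V s) \<alpha>"
proof -
  note [simp] = V
  have smult: "snd V (D_class \<xi> \<theta> (scal c * f)) = c \<cdot>\<^sub>m snd V (D_class \<xi> \<theta> f)" for c f
    by (simp add: module_simps(3,5)[OF V] mat_dim_simps)
  show ?thesis
    unfolding weight_elem_def weight_proj_def module_simps(2,4)[OF V] smult
    by (simp add: module_simps(3)[OF V] act_def)
qed

text \<open>
  On an eigenvector the projection acts by a geometric sum of sixth roots of unity.
\<close>

lemma row_weight_proj:
  assumes [simp]: "dim_row \<phi> = 1" "dim_col \<phi> = n" "dim_row A = n" "dim_col A = n"
    and \<phi>: "\<phi> * A = \<mu> \<cdot>\<^sub>m (\<phi> :: 'k mat)" and \<alpha>: "\<alpha> ^ 6 = 1" and \<mu>: "\<mu> ^ 6 = 1"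
  shows "\<phi> * weight_proj n A \<alpha> = (if \<mu> = \<alpha> then 6 else 0) \<cdot>\<^sub>m \<phi>"
proof -
  note [simp del] = assoc_mult_mat
  have n: "\<phi> * (A * Z) = \<mu> \<cdot>\<^sub>m (\<phi> * Z)" if "dim_row Z = n" for Z
    using that \<phi> by (simp add: left_eigen_nested)
  define s where "s = 1 + (\<alpha> ^ 5 * \<mu> + (\<alpha> ^ 4 * (\<mu> * \<mu>) + (\<alpha> ^ 3 * (\<mu> * (\<mu> * \<mu>)) +
      (\<alpha> ^ 2 * (\<mu> * (\<mu> * (\<mu> * \<mu>))) + \<alpha> * (\<mu> * (\<mu> * (\<mu> * (\<mu> * \<mu>))))))))"
  have "\<phi> * weight_proj n A \<alpha> = s \<cdot>\<^sub>m \<phi>"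
    unfolding weight_proj_def s_def
    by (simp add: mat_dim_simps n \<phi>) (rule eq_matI; simp add: algebra_simps)
  moreover have "s = (if \<mu> = \<alpha> then 6 else 0)"
  proof (cases "\<mu> = \<alpha>")
    case True
    then show ?thesis using \<alpha> by (simp add: s_def eval_nat_numeral)
  next
    case False
    have "(\<mu> - \<alpha>) * s = \<mu> - \<alpha> + \<alpha> * \<mu> ^ 6 - \<alpha> ^ 6 * \<mu>"
      by (simp add: s_def eval_nat_numeral algebra_simps)
    then show ?thesis using False \<alpha> \<mu> by simp
  qed
  ultimately show ?thesis by simp
qed

lemma row_weight:
  assumes V: "Rep V" and [simp]: "dim_row \<phi> = 1" "dim_col \<phi> = fst V"
    and \<phi>: "\<phi> * Act V Gen_a = \<mu> \<cdot>\<^sub>m \<phi>" "\<phi> * Act V Gen_g = \<nu> \<cdot>\<^sub>m \<phi>"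
    and roots: "\<alpha> ^ 6 = 1" "\<mu> ^ 6 = 1" "\<gamma> ^ 6 = 1" "\<nu> ^ 6 = 1"
  shows "\<phi> * (snd V (D_class \<xi> \<theta> (weight_elem Gen_a \<alpha> * weight_elem Gen_g \<gamma>))) = (if \<mu> = \<alpha> \<and> \<nu> = \<gamma> then 36 else 0) \<cdot>\<^sub>m \<phi>"
proof -
  have [simp]: "dim_row (weight_proj (fst V) (Act V s) \<beta>) = fst V" "dim_col (weight_proj (fst V) (Act V s) \<beta>) = fst V" for s \<beta>
    using V by (simp_all add: weight_proj_def)
  note [simp del] = assoc_mult_mat
  have "\<phi> * (weight_proj (fst V) (Act V Gen_a) \<alpha> * weight_proj (fst V) (Act V Gen_g) \<gamma>) =
      (\<phi> * weight_proj (fst V) (Act V Gen_a) \<alpha>) * weight_proj (fst V) (Act V Gen_g) \<gamma>"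
    by (simp add: mat_dim_simps)
  also have "\<dots> = (if \<mu> = \<alpha> \<and> \<nu> = \<gamma> then 36 else 0) \<cdot>\<^sub>m \<phi>"
    using V row_weight_proj[of \<phi> "fst V" "Act V Gen_a" \<mu> \<alpha>] row_weight_proj[of \<phi> "fst V" "Act V Gen_g" \<nu> \<gamma>] \<phi> roots
    by (simp add: mat_dim_simps)
  finally show ?thesis
    by (simp add: module_simps(3)[OF V] weight_elem_act[OF V])
qed

lemma V2_rows:
  assumes "\<alpha> ^ 6 = 1" "\<gamma> ^ 6 = 1"
  shows "urow 2 0 * Act (V2 \<alpha> \<gamma>) Gen_a = \<alpha> \<cdot>\<^sub>m urow 2 0" "urow 2 0 * Act (V2 \<alpha> \<gamma>) Gen_g = \<gamma> \<cdot>\<^sub>m urow 2 0"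
    "urow 2 1 * Act (V2 \<alpha> \<gamma>) Gen_a = (\<xi> * \<alpha>) \<cdot>\<^sub>m urow 2 1" "urow 2 1 * Act (V2 \<alpha> \<gamma>) Gen_g = (- \<gamma>) \<cdot>\<^sub>m urow 2 1"
  by (simp_all add: V2_module[OF assms] mat_dim_simps urow_mult_ucol unit_nested del: One_nat_def)

lemma P4_rows:
  assumes "\<alpha> ^ 6 = 1"
  shows "urow 4 0 * Act (P4 \<alpha>) Gen_a = \<alpha> \<cdot>\<^sub>m urow 4 0" "urow 4 0 * Act (P4 \<alpha>) Gen_g = (\<alpha> * (\<alpha> * \<alpha>)) \<cdot>\<^sub>m urow 4 0"
    "urow 4 1 * Act (P4 \<alpha>) Gen_a = (\<xi> * \<alpha>) \<cdot>\<^sub>m urow 4 1"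
    "urow 4 1 * Act (P4 \<alpha>) Gen_g = (- (\<alpha> * (\<alpha> * \<alpha>))) \<cdot>\<^sub>m urow 4 1"
  by (simp_all add: P4_module[OF assms] mat_dim_simps urow_mult_ucol unit_nested del: One_nat_def)

text \<open>
  Elements that detect one indecomposable module each: the composite of a weight projection with \<open>1\<close>, with
  \<open>x b\<close>, or with \<open>b\<close>. The first also acts on modules \<open>P4\<close>; it is used only after these have been
  dealt with. For \<open>V2\<close> the projection is onto the weight of the second basis vector \<open>x v\<close>, on which \<open>b\<close>
  acts by \<open>t\<close>.
\<close>

definition chi_elem :: "'k \<Rightarrow> 'k free_algebra" where
  "chi_elem \<alpha> = weight_elem Gen_a \<alpha> * weight_elem Gen_g (\<alpha> * (\<alpha> * \<alpha>))"
definition P4_elem :: "'k \<Rightarrow> 'k free_algebra" where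
  "P4_elem \<alpha> = gen Gen_x * (gen Gen_b * (weight_elem Gen_a \<alpha> * weight_elem Gen_g (\<alpha> * (\<alpha> * \<alpha>))))"
definition V2_elem :: "'k \<Rightarrow> 'k \<Rightarrow> 'k free_algebra" where
  "V2_elem \<alpha> \<gamma> = gen Gen_b * (weight_elem Gen_a (\<xi> * \<alpha>) * weight_elem Gen_g (- \<gamma>))"

lemma cube_root:
  assumes "\<alpha> ^ 6 = (1 :: 'k)"
  shows "(\<alpha> * (\<alpha> * \<alpha>)) ^ 6 = 1" "(\<xi> * \<alpha>) * ((\<xi> * \<alpha>) * (\<xi> * \<alpha>)) = - (\<alpha> * (\<alpha> * \<alpha>))"
  using assms by (simp_all add: power_mult_distrib xi_simps)

lemma smult_nonzero:
  assumes "(c :: 'k) \<noteq> 0" "i < dim_row M" "j < dim_col M" "M $$ (i, j) \<noteq> 0"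
  shows "c \<cdot>\<^sub>m M \<noteq> 0\<^sub>m r k"
proof
  assume *: "c \<cdot>\<^sub>m M = 0\<^sub>m r k"
  have "dim_row M = r" "dim_col M = k" using arg_cong[OF *, of dim_row] arg_cong[OF *, of dim_col] by simp_all
  then show False using arg_cong[OF *, of "\<lambda>M. M $$ (i, j)"] assms by simp
qed

text \<open>
  The weights of \<open>V2\<close> are not degenerate, hence the other two elements kill it, and \<open>b\<close> is nonzero only on the
  weight space of \<open>x v\<close>.
\<close>

lemma rank_V2:
  assumes r: "\<alpha> ^ 6 = 1" "\<gamma> ^ 6 = 1" "\<beta> ^ 6 = 1" "\<delta> ^ 6 = 1" and ne: "\<gamma> \<noteq> \<alpha> * (\<alpha> * \<alpha>)" "\<delta> \<noteq> \<beta> * (\<beta> * \<beta>)"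
  shows "rank_of (V2_elem \<beta> \<delta>) (V2 \<alpha> \<gamma>) = 0 \<longleftrightarrow> \<not> (\<alpha> = \<beta> \<and> \<gamma> = \<delta>)"
    "rank_of (P4_elem \<beta>) (V2 \<alpha> \<gamma>) = 0" "rank_of (chi_elem \<beta>) (V2 \<alpha> \<gamma>) = 0"
proof -
  note m = V2_module[OF r(1,2)]
  note [simp] = m(1,2) and [simp del] = assoc_mult_mat
  have t: "twist \<alpha> \<gamma> \<noteq> 0" using ne twist_eq_0_iff[OF r(1)] by simp
  let ?\<rho> = "\<lambda>d. snd (V2 \<alpha> \<gamma>) (D_class \<xi> \<theta> d)"
  note mult = module_simps(3)[OF m(1)]
  let ?E = "?\<rho> (weight_elem Gen_a \<beta> * weight_elem Gen_g (\<beta> * (\<beta> * \<beta>)))"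
  let ?F = "?\<rho> (weight_elem Gen_a (\<xi> * \<beta>) * weight_elem Gen_g (- \<delta>))"
  have zero: "0 \<cdot>\<^sub>m M = 0\<^sub>m (dim_row M) (dim_col M)" for M :: "'k mat" by (auto intro!: eq_matI)
  \<comment> \<open>The rows of \<open>V2\<close> have the weights \<open>(\<alpha>, \<gamma>)\<close> and \<open>(\<xi> \<alpha>, - \<gamma>)\<close>, both different from \<open>(\<beta>, \<beta>^3)\<close>.\<close>
  have "urow 2 0 * ?E = 0\<^sub>m 1 2"
    using row_weight[OF m(1) _ _ V2_rows(1,2)[OF r(1,2)] r(3) r(1) cube_root(1)[OF r(3)] r(2)] ne(1) by (auto simp: zero)
  moreover have "urow 2 1 * ?E = 0\<^sub>m 1 2"
    using row_weight[OF m(1) _ _ V2_rows(3,4)[OF r(1,2)] r(3) root_shift(1)[OF r(1)] cube_root(1)[OF r(3)] root_shift(3)[OF r(2)]]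
      ne(1) cube_root(2)[OF r(1)] by (auto simp: zero)
  ultimately have "(ucol 2 0 * urow 2 0 + ucol 2 1 * urow 2 1) * ?E = 0\<^sub>m 2 2"
    by (simp add: mat_dim_simps)
  then have E: "?E = 0\<^sub>m 2 2" unfolding one_mat_2[symmetric] by (simp add: mat_dim_simps)
  show "rank_of (P4_elem \<beta>) (V2 \<alpha> \<gamma>) = 0" "rank_of (chi_elem \<beta>) (V2 \<alpha> \<gamma>) = 0"
    unfolding rank_of_eq_0_iff[OF m(1)] P4_elem_def chi_elem_def mult[of "gen _"] E by (simp_all add: mat_dim_simps)
  have F: "urow 2 1 * ?F = (if \<alpha> = \<beta> \<and> \<gamma> = \<delta> then 36 else 0) \<cdot>\<^sub>m urow 2 1"
    using row_weight[OF m(1) _ _ V2_rows(3,4)[OF r(1,2)] root_shift(1)[OF r(3)] root_shift(1)[OF r(1)] root_shift(3)[OF r(4)] root_shift(3)[OF r(2)]]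
    by simp
  have "?\<rho> (V2_elem \<beta> \<delta>) = Act (V2 \<alpha> \<gamma>) Gen_b * ?F"
    unfolding V2_elem_def mult[of "gen _"] by (simp add: act_def)
  also have "\<dots> = (twist \<alpha> \<gamma> * (if \<alpha> = \<beta> \<and> \<gamma> = \<delta> then 36 else 0)) \<cdot>\<^sub>m (ucol 2 0 * urow 2 1)"
    unfolding m(4) by (simp add: mat_dim_simps F del: One_nat_def)
  finally have *: "?\<rho> (V2_elem \<beta> \<delta>) = (twist \<alpha> \<gamma> * (if \<alpha> = \<beta> \<and> \<gamma> = \<delta> then 36 else 0)) \<cdot>\<^sub>m (ucol 2 0 * urow 2 1)" .
  show "rank_of (V2_elem \<beta> \<delta>) (V2 \<alpha> \<gamma>) = 0 \<longleftrightarrow> \<not> (\<alpha> = \<beta> \<and> \<gamma> = \<delta>)"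
    unfolding rank_of_eq_0_iff[OF m(1)] * m(2)
    using t smult_nonzero[of "twist \<alpha> \<gamma> * 36" 0 "ucol 2 0 * urow 2 1" 1 2 2]
    by (auto simp: zero ucol_def urow_def scalar_prod_def)
qed

lemma rank_chi:
  assumes r: "\<alpha> ^ 6 = 1" "\<beta> ^ 6 = 1"
  shows "rank_of (V2_elem \<beta> \<delta>) (chi \<alpha>) = 0" "rank_of (P4_elem \<beta>) (chi \<alpha>) = 0"
    "rank_of (chi_elem \<beta>) (chi \<alpha>) = 0 \<longleftrightarrow> \<alpha> \<noteq> \<beta>"
proof -
  note m = chi_module[OF r(1)]
  note [simp] = m(1,2) and [simp del] = assoc_mult_mat
  note mult = module_simps(3)[OF m(1)]
  have b: "snd (chi \<alpha>) (D_class \<xi> \<theta> (gen Gen_b * f)) = 0\<^sub>m 1 1" for f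
    using m(4) by (simp add: mult act_def mat_dim_simps)
  show "rank_of (V2_elem \<beta> \<delta>) (chi \<alpha>) = 0" "rank_of (P4_elem \<beta>) (chi \<alpha>) = 0"
    unfolding rank_of_eq_0_iff[OF m(1)] V2_elem_def P4_elem_def mult[of "gen Gen_x"] b by (simp_all add: mat_dim_simps)
  have "1\<^sub>m 1 * snd (chi \<alpha>) (D_class \<xi> \<theta> (chi_elem \<beta>)) = (if \<alpha> = \<beta> \<and> \<alpha> * (\<alpha> * \<alpha>) = \<beta> * (\<beta> * \<beta>) then 36 else 0) \<cdot>\<^sub>m 1\<^sub>m 1"
    unfolding chi_elem_def
    by (rule row_weight[OF m(1)]) (use r cube_root(1) in \<open>simp_all add: m mat_dim_simps del: One_nat_def\<close>)
  then have *: "snd (chi \<alpha>) (D_class \<xi> \<theta> (chi_elem \<beta>)) = (if \<alpha> = \<beta> then 36 else 0) \<cdot>\<^sub>m 1\<^sub>m 1"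
    by (auto simp: mat_dim_simps)
  show "rank_of (chi_elem \<beta>) (chi \<alpha>) = 0 \<longleftrightarrow> \<alpha> \<noteq> \<beta>"
    unfolding rank_of_eq_0_iff[OF m(1)] * m(2)
    using smult_nonzero[of 36 0 "1\<^sub>m 1" 0 1 1] by (auto intro!: eq_matI)
qed

text \<open>
  All weights of \<open>P4\<close> are degenerate, and \<open>x b\<close> is nonzero only on the weight space of the generator.
\<close>

lemma rank_P4:
  assumes r: "\<alpha> ^ 6 = 1" "\<beta> ^ 6 = 1" "\<delta> ^ 6 = 1" and ne: "\<delta> \<noteq> \<beta> * (\<beta> * \<beta>)"
  shows "rank_of (V2_elem \<beta> \<delta>) (P4 \<alpha>) = 0" "rank_of (P4_elem \<beta>) (P4 \<alpha>) = 0 \<longleftrightarrow> \<alpha> \<noteq> \<beta>"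
proof -
  note m = P4_module[OF r(1)]
  note [simp] = m(1,2) and [simp del] = assoc_mult_mat
  let ?\<rho> = "\<lambda>d. snd (P4 \<alpha>) (D_class \<xi> \<theta> d)"
  note mult = module_simps(3)[OF m(1)]
  let ?E = "?\<rho> (weight_elem Gen_a \<beta> * weight_elem Gen_g (\<beta> * (\<beta> * \<beta>)))"
  let ?F = "?\<rho> (weight_elem Gen_a (\<xi> * \<beta>) * weight_elem Gen_g (- \<delta>))"
  have zero: "0 \<cdot>\<^sub>m M = 0\<^sub>m (dim_row M) (dim_col M)" for M :: "'k mat" by (auto intro!: eq_matI)
  note R = root_shift(1)[OF r(2)] root_shift(3)[OF r(3)]
  have "urow 4 0 * ?F = 0\<^sub>m 1 4"
    using row_weight[OF m(1) _ _ P4_rows(1,2)[OF r(1)] R(1) r(1) R(2) cube_root(1)[OF r(1)]] ne cube_root(2)[OF r(2)]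
    by (auto simp: zero)
  moreover have "urow 4 1 * ?F = 0\<^sub>m 1 4"
    using row_weight[OF m(1) _ _ P4_rows(3,4)[OF r(1)] R(1) root_shift(1)[OF r(1)] R(2) root_shift(3)[OF cube_root(1)[OF r(1)]]]
      ne cube_root(2)[OF r(1)] by (auto simp: zero)
  ultimately have "Act (P4 \<alpha>) Gen_b * ?F = 0\<^sub>m 4 4"
    unfolding m(4) by (simp add: mat_dim_simps)
  then show "rank_of (V2_elem \<beta> \<delta>) (P4 \<alpha>) = 0"
    unfolding rank_of_eq_0_iff[OF m(1)] V2_elem_def mult[of "gen _"] by (simp add: act_def)
  have E: "urow 4 0 * ?E = (if \<alpha> = \<beta> then 36 else 0) \<cdot>\<^sub>m urow 4 0"
    using row_weight[OF m(1) _ _ P4_rows(1,2)[OF r(1)] r(2,1) cube_root(1)[OF r(2)] cube_root(1)[OF r(1)]]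
    by (auto simp: zero)
  have "?\<rho> (P4_elem \<beta>) = Act (P4 \<alpha>) Gen_x * (Act (P4 \<alpha>) Gen_b * ?E)"
    unfolding P4_elem_def mult[of "gen _"] by (simp add: act_def)
  also have "\<dots> = (if \<alpha> = \<beta> then 36 else 0) \<cdot>\<^sub>m (ucol 4 3 * urow 4 0)"
    unfolding m(4,6) by (simp add: mat_dim_simps urow_mult_ucol unit_nested E del: One_nat_def)
  finally have *: "?\<rho> (P4_elem \<beta>) = (if \<alpha> = \<beta> then 36 else 0) \<cdot>\<^sub>m (ucol 4 3 * urow 4 0)" .
  show "rank_of (P4_elem \<beta>) (P4 \<alpha>) = 0 \<longleftrightarrow> \<alpha> \<noteq> \<beta>"
    unfolding rank_of_eq_0_iff[OF m(1)] * m(2)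
    using smult_nonzero[of 36 3 "ucol 4 3 * urow 4 0" 0 4 4]
    by (auto simp: zero ucol_def urow_def scalar_prod_def)
qed

end

section \<open>Normal forms modulo the ideal of relations\<close>

lemma of_nat_image_6: "of_nat ` {..<6} = (UNIV :: 6 set)"
proof -
  have "x \<in> of_nat ` {..<6}" for x :: 6
  proof (cases x)
    case (of_int z)
    then have "nat z < 6" "x = of_nat (nat z)" by auto
    then show ?thesis by blast
  qed
  then show ?thesis by blast
qed

lemma of_nat_inj_6: "i < 6 \<Longrightarrow> j < 6 \<Longrightarrow> (of_nat i :: 6) = of_nat j \<longleftrightarrow> i = j"
proof -
  have "inj_on (of_nat :: nat \<Rightarrow> 6) {..<6}"
    by (rule eq_card_imp_inj_on) (simp_all add: of_nat_image_6)
  then show "i < 6 \<Longrightarrow> j < 6 \<Longrightarrow> (of_nat i :: 6) = of_nat j \<longleftrightarrow> i = j"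
    by (auto simp: inj_on_def)
qed

text \<open>
  An induction over products with one more variable: it fits the normal form below, for which
  multiplication by a variable is the essential step.
\<close>

lemma poly6_induct [case_names one add uminus var]:
  fixes p :: poly6
  assumes one: "P 1" and add: "\<And>p q. P p \<Longrightarrow> P q \<Longrightarrow> P (p + q)" and uminus: "\<And>p. P p \<Longrightarrow> P (- p)"
    and var: "\<And>i p. i < 6 \<Longrightarrow> P p \<Longrightarrow> P (Y_var i * p)"
  shows "P p"
proof (induction p rule: poly_mapping_sum_induct)
  case (single m c)
  have mon: "\<forall>q. P q \<longrightarrow> P (Poly_Mapping.single m 1 * q)"
  proof (induction m rule: poly_mapping_sum_induct)
    case (single i k)
    obtain j where j: "j < 6" "i = of_nat j" using of_nat_image_6 by (metis UNIV_I imageE lessThan_iff)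
    show ?case
    proof (induction k)
      case 0
      then show ?case by simp
    next
      case (Suc k)
      have "Poly_Mapping.single (Poly_Mapping.single i (Suc k)) 1 * q = Y_var j * (Poly_Mapping.single (Poly_Mapping.single i k) 1 * q)"
        for q :: poly6
        by (simp add: Y_var_def j mult_single flip: mult.assoc single_add)
      note eq = this
      show ?case
        unfolding eq using Suc var[OF j(1)] by blast
    qed
  next
    case (add m m')
    have "Poly_Mapping.single (m + m') 1 * q = Poly_Mapping.single m 1 * (Poly_Mapping.single m' 1 * q)" for q :: poly6
      by (simp add: mult_single flip: mult.assoc)
    note eq = this
    show ?case
      unfolding eq using add by blast
  qed
  then have m: "P (Poly_Mapping.single m 1)" using one by (metis mult.right_neutral)
  have "P (1 + - 1)" by (intro add one uminus)
  then have zero: "P 0" by simp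
  have nat: "P (Poly_Mapping.single m (int n))" for n
  proof (induction n)
    case (Suc n)
    then show ?case using add[OF m Suc] by (simp flip: single_add)
  qed (simp add: zero)
  show ?case
  proof (cases c rule: int_cases)
    case (neg n)
    then show ?thesis using uminus[OF nat[of "Suc n"]] by (simp flip: single_uminus)
  qed (simp add: nat)
qed (rule add)

lemma J_ideal_closed:
  "0 \<in> J_ideal" "p \<in> J_ideal \<Longrightarrow> q \<in> J_ideal \<Longrightarrow> p + q \<in> J_ideal" "p \<in> J_ideal \<Longrightarrow> q * p \<in> J_ideal"
  "p \<in> J_ideal \<Longrightarrow> - p \<in> J_ideal" "p \<in> J_ideal \<Longrightarrow> q \<in> J_ideal \<Longrightarrow> p - q \<in> J_ideal"
  "r \<in> J_relations \<Longrightarrow> r \<in> J_ideal"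
proof -
  have I: "ideal J_ideal (ring_of_type_algebra :: poly6 ring)"
    unfolding J_ideal_def by (rule ring.genideal_ideal[OF ring_ring_of_type_algebra]) (simp add: ring_of_type_simps)
  note A = ideal.axioms(1)[OF I]
  show "0 \<in> J_ideal" using additive_subgroup.zero_closed[OF A] by (simp add: ring_of_type_simps)
  show add: "p \<in> J_ideal \<Longrightarrow> q \<in> J_ideal \<Longrightarrow> p + q \<in> J_ideal" for p q
    using additive_subgroup.a_closed[OF A, of p q] by (simp add: ring_of_type_simps)
  show mult: "p \<in> J_ideal \<Longrightarrow> q * p \<in> J_ideal" for p q
    using ideal.I_l_closed[OF I, of p q] by (simp add: ring_of_type_simps)
  show neg: "p \<in> J_ideal \<Longrightarrow> - p \<in> J_ideal" for p
    using mult[of p "-1"] by simp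
  show "p \<in> J_ideal \<Longrightarrow> q \<in> J_ideal \<Longrightarrow> p - q \<in> J_ideal"
    using add[of p "- q"] neg[of q] by simp
  show "r \<in> J_relations \<Longrightarrow> r \<in> J_ideal"
    using ring.genideal_self[OF ring_ring_of_type_algebra, of J_relations]
    unfolding J_ideal_def ring_of_type_simps by blast
qed

definition J_cong :: "poly6 \<Rightarrow> poly6 \<Rightarrow> bool" (infix "\<simeq>\<^sub>J" 50) where
  "p \<simeq>\<^sub>J q \<longleftrightarrow> p - q \<in> J_ideal"

lemma J_cong_intros:
  "p \<simeq>\<^sub>J p" "p \<simeq>\<^sub>J q \<Longrightarrow> q \<simeq>\<^sub>J r \<Longrightarrow> p \<simeq>\<^sub>J r" "p \<simeq>\<^sub>J q \<Longrightarrow> r * p \<simeq>\<^sub>J r * q" "p \<simeq>\<^sub>J q \<Longrightarrow> p * r \<simeq>\<^sub>J q * r"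
  "p \<simeq>\<^sub>J q \<Longrightarrow> p' \<simeq>\<^sub>J q' \<Longrightarrow> p + p' \<simeq>\<^sub>J q + q'"
proof -
  show "p \<simeq>\<^sub>J p" by (simp add: J_cong_def J_ideal_closed)
  show "p \<simeq>\<^sub>J q \<Longrightarrow> q \<simeq>\<^sub>J r \<Longrightarrow> p \<simeq>\<^sub>J r"
    unfolding J_cong_def using J_ideal_closed(2)[of "p - q" "q - r"] by simp
  show mult: "p \<simeq>\<^sub>J q \<Longrightarrow> r * p \<simeq>\<^sub>J r * q"
    unfolding J_cong_def using J_ideal_closed(3)[of "p - q" r] by (simp add: algebra_simps)
  then show "p \<simeq>\<^sub>J q \<Longrightarrow> p * r \<simeq>\<^sub>J q * r" by (simp add: mult.commute)
  show "p \<simeq>\<^sub>J q \<Longrightarrow> p' \<simeq>\<^sub>J q' \<Longrightarrow> p + p' \<simeq>\<^sub>J q + q'"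
    unfolding J_cong_def using J_ideal_closed(2)[of "p - q" "p' - q'"] by (simp add: algebra_simps)
qed

lemma J_cong_relations:
  "Y_var 0 ^ 6 \<simeq>\<^sub>J 1"
  "i \<in> {1..5} \<Longrightarrow> Y_var i * Y_var 3 ^ 2 \<simeq>\<^sub>J 2 * Y_var i * Y_var 0 + Y_var i * Y_var 0 ^ 2 + Y_var i"
  "j \<in> {1..5} \<Longrightarrow> Y_var j * Y_var (6 - j) \<simeq>\<^sub>J Y_var 3 ^ 2"
  "k \<in> {1..5} \<Longrightarrow> l \<in> {1..5} \<Longrightarrow> (k + l) mod 6 \<noteq> 0 \<Longrightarrow>
     Y_var k * Y_var l \<simeq>\<^sub>J Y_var ((k + l) mod 6) + Y_var ((k + l) mod 6) * Y_var 0"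
  unfolding J_cong_def by (rule J_ideal_closed(6), unfold J_relations_def, blast)+

text \<open>
  The product \<open>Y_0^a Y_k\<close>, where the index \<open>0\<close> stands for the empty product and the index \<open>6\<close> for the square of
  \<open>Y_3\<close>, which is congruent to every \<open>Y_j Y_(6-j)\<close>.
\<close>

definition basis_monomial :: "nat \<Rightarrow> nat \<Rightarrow> poly6" where
  "basis_monomial k a = Y_var 0 ^ a * (if k = 0 then 1 else if k = 6 then Y_var 3 ^ 2 else Y_var k)"

definition normal_form :: "(nat \<Rightarrow> nat \<Rightarrow> int) \<Rightarrow> poly6" where
  "normal_form c = (\<Sum>k\<le>6. \<Sum>a<6. of_int (c k a) * basis_monomial k a)"

definition normalizable :: "poly6 \<Rightarrow> bool" where
  "normalizable p \<longleftrightarrow> (\<exists>c. p \<simeq>\<^sub>J normal_form c)"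

lemma normalizable_cong: "p \<simeq>\<^sub>J q \<Longrightarrow> normalizable q \<Longrightarrow> normalizable p"
  unfolding normalizable_def using J_cong_intros(2) by blast

lemma normalizable_add:
  assumes "normalizable p" "normalizable q"
  shows "normalizable (p + q)"
proof -
  obtain c d where "p \<simeq>\<^sub>J normal_form c" "q \<simeq>\<^sub>J normal_form d" using assms by (auto simp: normalizable_def)
  moreover have "normal_form c + normal_form d = normal_form (\<lambda>k a. c k a + d k a)"
    by (simp add: normal_form_def sum.distrib distrib_right)
  ultimately show ?thesis unfolding normalizable_def using J_cong_intros(5) by metis
qed

lemma normalizable_of_int_mult:
  assumes "normalizable p"
  shows "normalizable (of_int n * p)"
proof -
  obtain c where "p \<simeq>\<^sub>J normal_form c" using assms by (auto simp: normalizable_def)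
  moreover have "of_int n * normal_form c = normal_form (\<lambda>k a. n * c k a)"
    by (simp add: normal_form_def sum_distrib_left mult.assoc)
  ultimately show ?thesis unfolding normalizable_def using J_cong_intros(3) by metis
qed

lemma normalizable_sum: "finite I \<Longrightarrow> (\<And>i. i \<in> I \<Longrightarrow> normalizable (f i)) \<Longrightarrow> normalizable (sum f I)"
proof (induction I rule: finite_induct)
  case empty
  have "normal_form (\<lambda>_ _. 0) = 0" by (simp add: normal_form_def)
  then show ?case using J_cong_intros(1)[of 0] unfolding normalizable_def by (metis sum.empty)
qed (auto intro: normalizable_add)

text \<open>
  The relation \<open>Y_0^6 = 1\<close> reduces the exponent modulo six.
\<close>

lemma normalizable_basis_monomial:
  assumes k: "k \<le> 6"
  shows "normalizable (basis_monomial k a)"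
proof -
  have of_int_if_eq: "of_int (if b' = b then 1 else 0) * p = (if b' = b then p else 0)" for b' b :: nat and p :: poly6
    by simp
  have pow: "(Y_var 0 ^ 6) ^ n \<simeq>\<^sub>J 1" for n
  proof (induction n)
    case (Suc n)
    have "Y_var 0 ^ 6 * (Y_var 0 ^ 6) ^ n \<simeq>\<^sub>J Y_var 0 ^ 6 * 1" by (rule J_cong_intros(3)[OF Suc])
    then show ?case using J_cong_intros(2)[OF _ J_cong_relations(1)] by simp
  qed (simp add: J_cong_intros)
  have "basis_monomial k a = (Y_var 0 ^ 6) ^ (a div 6) * basis_monomial k (a mod 6)"
    by (simp add: basis_monomial_def flip: power_mult power_add mult.assoc)
  then have "basis_monomial k a \<simeq>\<^sub>J 1 * basis_monomial k (a mod 6)" using J_cong_intros(4)[OF pow] by simp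
  moreover have "basis_monomial k b = normal_form (\<lambda>l b'. if l = k then if b' = b then 1 else 0 else 0)" if "b < 6" for b
  proof -
    have "normal_form (\<lambda>l b'. if l = k then if b' = b then 1 else 0 else 0) =
        (\<Sum>l\<le>6. if l = k then \<Sum>b'<6. if b' = b then basis_monomial l b' else 0 else 0)"
      unfolding normal_form_def
    proof (intro sum.cong refl)
      fix l
      show "(\<Sum>a<6. of_int (if l = k then if a = b then 1 else 0 else 0) * basis_monomial l a) =
          (if l = k then \<Sum>b'<6. if b' = b then basis_monomial l b' else 0 else 0)"
        by (cases "l = k") (simp_all only: simp_thms if_True if_False of_int_if_eq of_int_0 mult_zero_left sum.neutral_const)
    qed
    also have "\<dots> = basis_monomial k b" using k that by (simp add: sum.delta)
    finally show ?thesis ..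
  qed
  ultimately show ?thesis unfolding normalizable_def by (metis mod_less_divisor mult_1 zero_less_numeral)
qed

text \<open>
  Each relation rewrites one kind of product of a variable with a basis monomial: by \<open>Y_0\<close>, by the empty
  product, by the square of \<open>Y_3\<close>, and by \<open>Y_k\<close> with \<open>i + k\<close> divisible by six or not.
\<close>

lemma normalizable_var_mult:
  assumes i: "i < 6" and k: "k \<le> 6"
  shows "normalizable (Y_var i * basis_monomial k a)"
proof -
  have "i \<in> {1..5}" if "i \<noteq> 0" using that i by auto
  moreover have "k \<in> {1..5}" if "k \<noteq> 0" "k \<noteq> 6" using that k by auto
  ultimately consider "i = 0" | "i \<in> {1..5}" "k = 0" | "i \<in> {1..5}" "k = 6"
    | "i \<in> {1..5}" "k \<in> {1..5}" "(i + k) mod 6 = 0" | "i \<in> {1..5}" "k \<in> {1..5}" "(i + k) mod 6 \<noteq> 0"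
    by blast
  then show ?thesis
  proof cases
    case 1
    then have "Y_var i * basis_monomial k a = basis_monomial k (Suc a)" by (simp add: basis_monomial_def)
    then show ?thesis using normalizable_basis_monomial[OF k] by simp
  next
    case 2
    then have "Y_var i * basis_monomial k a = basis_monomial i a" using i by (simp add: basis_monomial_def mult.commute)
    then show ?thesis using normalizable_basis_monomial[of i a] i by simp
  next
    case 3
    have "Y_var i * basis_monomial k a = Y_var 0 ^ a * (Y_var i * Y_var 3 ^ 2)"
      using 3 by (simp add: basis_monomial_def mult.left_commute)
    note eq = this
    have "Y_var i * basis_monomial k a \<simeq>\<^sub>J Y_var 0 ^ a * (2 * Y_var i * Y_var 0 + Y_var i * Y_var 0 ^ 2 + Y_var i)"
      unfolding eq by (rule J_cong_intros(3)[OF J_cong_relations(2)[OF 3(1)]])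
    moreover have "Y_var 0 ^ a * (2 * Y_var i * Y_var 0 + Y_var i * Y_var 0 ^ 2 + Y_var i) =
       basis_monomial i (a + 1) + basis_monomial i (a + 1) + basis_monomial i (a + 2) + basis_monomial i a"
      using 3 i by (simp add: basis_monomial_def distrib_left power2_eq_square mult.commute mult.left_commute)
    moreover have "normalizable (basis_monomial i (a + 1) + basis_monomial i (a + 1) + basis_monomial i (a + 2) + basis_monomial i a)"
      using i by (intro normalizable_add normalizable_basis_monomial) auto
    ultimately show ?thesis
      using normalizable_cong by simp
  next
    case 4
    then have "i + k = 6"
      unfolding atLeastAtMost_iff by presburger
    then have k': "k = 6 - i" by simp
    have "Y_var i * basis_monomial k a = Y_var 0 ^ a * (Y_var i * Y_var (6 - i))"
      using 4 by (simp add: basis_monomial_def mult.left_commute k')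
    note eq = this
    have b6: "basis_monomial 6 a = Y_var 0 ^ a * Y_var 3 ^ 2" by (simp add: basis_monomial_def)
    have "Y_var i * basis_monomial k a \<simeq>\<^sub>J basis_monomial 6 a"
      unfolding eq b6 by (rule J_cong_intros(3)[OF J_cong_relations(3)[OF 4(1)]])
    then show ?thesis using normalizable_cong normalizable_basis_monomial[of 6] by blast
  next
    case 5
    let ?m = "(i + k) mod 6"
    have m: "?m < 6" "?m \<noteq> 6" by (simp, metis mod_less_divisor less_irrefl zero_less_numeral)
    have "Y_var i * basis_monomial k a = Y_var 0 ^ a * (Y_var i * Y_var k)"
      using 5 by (simp add: basis_monomial_def mult.left_commute)
    note eq = this
    have "Y_var i * basis_monomial k a \<simeq>\<^sub>J Y_var 0 ^ a * (Y_var ?m + Y_var ?m * Y_var 0)"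
      unfolding eq by (rule J_cong_intros(3)[OF J_cong_relations(4)[OF 5]])
    moreover have "Y_var 0 ^ a * (Y_var ?m + Y_var ?m * Y_var 0) = basis_monomial ?m a + basis_monomial ?m (a + 1)"
      using 5(3) m by (simp add: basis_monomial_def distrib_left mult.commute mult.left_commute)
    moreover have "normalizable (basis_monomial ?m a + basis_monomial ?m (a + 1))"
      using m by (intro normalizable_add normalizable_basis_monomial) auto
    ultimately show ?thesis
      using normalizable_cong by simp
  qed
qed

lemma all_normalizable: "normalizable p"
proof (induction p rule: poly6_induct)
  case one
  have "basis_monomial 0 0 = 1" by (simp add: basis_monomial_def)
  then show ?case using normalizable_basis_monomial[of 0 0] by simp
next
  case (uminus p)
  then show ?case using normalizable_of_int_mult[of p "-1"] by simp
next
  case (var i p)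
  then obtain c where "p \<simeq>\<^sub>J normal_form c" by (auto simp: normalizable_def)
  then have *: "Y_var i * p \<simeq>\<^sub>J Y_var i * normal_form c" by (rule J_cong_intros(3))
  have "Y_var i * normal_form c = (\<Sum>k\<le>6. \<Sum>a<6. of_int (c k a) * (Y_var i * basis_monomial k a))"
    by (simp add: normal_form_def sum_distrib_left mult.left_commute)
  moreover have "normalizable \<dots>"
    using var(1) by (intro normalizable_sum normalizable_of_int_mult normalizable_var_mult) auto
  ultimately show ?case using normalizable_cong[OF *] by simp
qed (rule normalizable_add)

section \<open>Evaluation of polynomials at commuting elements\<close>

text \<open>
  The double commutant of a set of commuting elements is commutative and contains the set.
\<close>

lemma (in ring) commuting_in_subcring:
  assumes Y: "Y \<subseteq> carrier R" and comm: "\<And>x y. x \<in> Y \<Longrightarrow> y \<in> Y \<Longrightarrow> x \<otimes> y = y \<otimes> x"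
  obtains C where "subcring C R" "Y \<subseteq> C"
proof -
  define commutant where "commutant S = {z \<in> carrier R. \<forall>w\<in>S. z \<otimes> w = w \<otimes> z}" for S
  have sub: "subring (commutant S) R" if "S \<subseteq> carrier R" for S
  proof (rule subringI)
    show "h1 \<otimes> h2 \<in> commutant S" if h: "h1 \<in> commutant S" "h2 \<in> commutant S" for h1 h2
    proof -
      have "h1 \<otimes> h2 \<otimes> w = w \<otimes> (h1 \<otimes> h2)" if w: "w \<in> S" for w
      proof -
        have c: "w \<in> carrier R" "h1 \<in> carrier R" "h2 \<in> carrier R" "h1 \<otimes> w = w \<otimes> h1" "h2 \<otimes> w = w \<otimes> h2"
          using w h \<open>S \<subseteq> carrier R\<close> by (auto simp: commutant_def)
        have "h1 \<otimes> h2 \<otimes> w = h1 \<otimes> (w \<otimes> h2)" unfolding m_assoc[OF c(2,3,1)] c(5) ..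
        also have "\<dots> = w \<otimes> h1 \<otimes> h2" unfolding m_assoc[OF c(2,1,3), symmetric] c(4) ..
        also have "\<dots> = w \<otimes> (h1 \<otimes> h2)" by (rule m_assoc[OF c(1-3)])
        finally show ?thesis .
      qed
      then show ?thesis using h by (auto simp: commutant_def)
    qed
  qed (use that in \<open>auto simp: commutant_def subset_iff l_distr r_distr l_minus r_minus\<close>)
  let ?K = "commutant Y"
  have K: "?K \<subseteq> carrier R" by (auto simp: commutant_def)
  have YK: "Y \<subseteq> ?K" using Y comm by (auto simp: commutant_def)
  have CK: "commutant ?K \<subseteq> ?K" using YK by (auto simp: commutant_def)
  show thesis
  proof (rule that[of "commutant ?K"])
    show "subcring (commutant ?K) R"
      by (rule subcringI[OF sub[OF K]]) (use CK in \<open>auto simp: commutant_def\<close>)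
    show "Y \<subseteq> commutant ?K" using Y by (auto simp: commutant_def)
  qed
qed

text \<open>
  The evaluation takes place in a commutative subring, where finite products of powers are defined; the
  commutativity of the whole ring is not known.
\<close>

lemma (in ring) poly6_evaluation:
  assumes y: "\<And>i. i < 6 \<Longrightarrow> y i \<in> carrier R" and comm: "\<And>i j. i < 6 \<Longrightarrow> j < 6 \<Longrightarrow> y i \<otimes> y j = y j \<otimes> y i"
  obtains h where "h \<in> Ring.ring_hom (ring_of_type_algebra :: poly6 ring) R" "\<And>i. i < 6 \<Longrightarrow> h (Y_var i) = y i"
proof -
  obtain C where C: "subcring C R" "y ` {..<6} \<subseteq> C"
    by (rule commuting_in_subcring[of "y ` {..<6}"]) (use y comm in auto)
  have CR: "C \<subseteq> carrier R" using subcring.axioms(1)[OF C(1)] by (rule subringE(1))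
  let ?S = "R\<lparr>carrier := C\<rparr>"
  interpret S: cring ?S
    using subcring_iff[OF CR] C(1) by simp
  define \<iota> where "\<iota> k = add_pow ?S k \<one>\<^bsub>?S\<^esub>" for k :: int
  define \<phi> where "\<phi> m = finprod ?S (\<lambda>j. y j [^]\<^bsub>?S\<^esub> Poly_Mapping.lookup m (of_nat j)) {..<6}" for m :: "6 \<Rightarrow>\<^sub>0 nat"
  have yC: "y j \<in> carrier ?S" if "j < 6" for j using C(2) that by auto
  have \<iota>_closed: "\<iota> k \<in> carrier ?S" for k unfolding \<iota>_def by (rule S.add.int_pow_closed) (rule S.one_closed)
  have fc: "(\<lambda>j. y j [^]\<^bsub>?S\<^esub> Poly_Mapping.lookup m (of_nat j)) \<in> {..<6} \<rightarrow> carrier ?S" for m :: "6 \<Rightarrow>\<^sub>0 nat"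
    by (rule Pi_I, rule S.nat_pow_closed, rule yC) simp
  have \<phi>_closed: "\<phi> m \<in> carrier ?S" for m unfolding \<phi>_def by (rule S.finprod_closed[OF fc])
  interpret E: algebra_extension ?S \<iota> \<phi>
  proof (intro algebra_extension.intro algebra_extension_axioms.intro S.ring_axioms \<phi>_closed)
    show "\<iota> \<in> Ring.ring_hom ring_of_type_algebra ?S"
    proof (rule ring_hom_memI)
      fix k l :: int
      show "\<iota> (k \<oplus>\<^bsub>ring_of_type_algebra\<^esub> l) = \<iota> k \<oplus>\<^bsub>?S\<^esub> \<iota> l"
        unfolding ring_of_type_simps \<iota>_def by (rule S.add.int_pow_mult[OF S.one_closed])
      have "\<iota> k \<otimes>\<^bsub>?S\<^esub> \<iota> l = add_pow ?S k (\<one>\<^bsub>?S\<^esub> \<otimes>\<^bsub>?S\<^esub> \<iota> l)"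
        unfolding \<iota>_def[of k] by (rule S.add_pow_ldistr_int[OF S.one_closed \<iota>_closed])
      also have "\<dots> = add_pow ?S k (add_pow ?S l \<one>\<^bsub>?S\<^esub>)"
        unfolding S.l_one[OF \<iota>_closed] by (simp only: \<iota>_def)
      also have "\<dots> = add_pow ?S (l * k) \<one>\<^bsub>?S\<^esub>"
        by (rule S.add.int_pow_pow[OF S.one_closed])
      finally show "\<iota> (k \<otimes>\<^bsub>ring_of_type_algebra\<^esub> l) = \<iota> k \<otimes>\<^bsub>?S\<^esub> \<iota> l"
        unfolding ring_of_type_simps \<iota>_def by (simp only: mult.commute)
    next
      show "\<iota> \<one>\<^bsub>ring_of_type_algebra\<^esub> = \<one>\<^bsub>?S\<^esub>"
        unfolding ring_of_type_simps \<iota>_def by (rule S.add.int_pow_1[OF S.one_closed])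
    qed (rule \<iota>_closed)
    show "\<phi> 0 = \<one>\<^bsub>?S\<^esub>"
      unfolding \<phi>_def by (rule S.finprod_one_eqI) simp
    fix u v
    have "\<phi> (u + v) = finprod ?S (\<lambda>j. y j [^]\<^bsub>?S\<^esub> Poly_Mapping.lookup u (of_nat j) \<otimes>\<^bsub>?S\<^esub> y j [^]\<^bsub>?S\<^esub> Poly_Mapping.lookup v (of_nat j)) {..<6}"
      unfolding \<phi>_def lookup_add
    proof (rule S.finprod_cong'[OF refl])
      show "(\<lambda>j. y j [^]\<^bsub>?S\<^esub> Poly_Mapping.lookup u (of_nat j) \<otimes>\<^bsub>?S\<^esub> y j [^]\<^bsub>?S\<^esub> Poly_Mapping.lookup v (of_nat j)) \<in> {..<6} \<rightarrow> carrier ?S"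
        by (rule Pi_I, rule S.m_closed; rule S.nat_pow_closed, rule yC, simp)
      fix j assume "j \<in> {..<6 :: nat}"
      then show "y j [^]\<^bsub>?S\<^esub> (Poly_Mapping.lookup u (of_nat j) + Poly_Mapping.lookup v (of_nat j)) =
          y j [^]\<^bsub>?S\<^esub> Poly_Mapping.lookup u (of_nat j) \<otimes>\<^bsub>?S\<^esub> y j [^]\<^bsub>?S\<^esub> Poly_Mapping.lookup v (of_nat j)"
        using S.nat_pow_mult[OF yC] by simp
    qed
    also have "\<dots> = \<phi> u \<otimes>\<^bsub>?S\<^esub> \<phi> v"
      unfolding \<phi>_def by (rule S.finprod_multf[OF fc fc])
    finally show "\<phi> (u + v) = \<phi> u \<otimes>\<^bsub>?S\<^esub> \<phi> v" .
  next
    fix m k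
    show "\<phi> m \<otimes>\<^bsub>?S\<^esub> \<iota> k = \<iota> k \<otimes>\<^bsub>?S\<^esub> \<phi> m" by (rule S.m_comm[OF \<phi>_closed \<iota>_closed])
  qed
  show thesis
  proof (rule that)
    show "E.ext \<in> Ring.ring_hom (ring_of_type_algebra :: poly6 ring) R"
      using E.ext_hom CR by (auto simp: Ring.ring_hom_def)
    fix i :: nat assume i: "i < 6"
    have "\<phi> (Poly_Mapping.single (of_nat i) 1) = finprod ?S (\<lambda>j. if i = j then y j else \<one>\<^bsub>?S\<^esub>) {..<6}"
      unfolding \<phi>_def
    proof (rule S.finprod_cong')
      fix j assume "j \<in> {..<6 :: nat}"
      then have j: "j < 6" by simp
      have "Poly_Mapping.lookup (Poly_Mapping.single (of_nat i :: 6) (1 :: nat)) (of_nat j) = (if i = j then 1 else 0)"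
        using of_nat_inj_6[OF i j] by (simp add: lookup_single when_def)
      then show "y j [^]\<^bsub>?S\<^esub> Poly_Mapping.lookup (Poly_Mapping.single (of_nat i :: 6) (1 :: nat)) (of_nat j) = (if i = j then y j else \<one>\<^bsub>?S\<^esub>)"
        using S.nat_pow_eone[OF yC[OF j]] by (simp only: if_split S.nat_pow_0) simp
    qed (use yC S.one_closed in auto)
    also have "\<dots> = y i"
      using yC i by (intro S.finprod_singleton) auto
    finally show "E.ext (Y_var i) = y i"
      unfolding Y_var_def E.ext_single E.\<iota>_simps(4) using S.l_one[OF yC[OF i]] by simp
  qed
qed

context double_params
begin

section \<open>Products of the generating classes\<close>

text \<open>
  The intended images of the variables \<open>Y_0, ..., Y_5\<close>.
\<close>

definition gen_class :: "nat \<Rightarrow> ('k rep set \<Rightarrow>\<^sub>0 int) set" where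
  "gen_class i = (if i = 0 then cls (chi \<xi>) else cls (V2 1 (\<xi> ^ i)))"

text \<open>
  The representation whose class is the image of \<open>basis_monomial k a\<close>: the tensor product of the \<open>a\<close>-th power
  of \<open>chi \<xi>\<close> with the trivial module, with \<open>V2 1 (\<xi>^k)\<close>, or with \<open>P4 \<xi>\<close>.
\<close>

definition standard_rep :: "nat \<Rightarrow> nat \<Rightarrow> 'k rep" where
  "standard_rep k a = (if k = 0 then chi (\<xi> ^ a) else if k = 6 then P4 (\<xi> ^ (a + 1)) else V2 (\<xi> ^ a) (\<xi> ^ (3 * a + k)))"

lemma xi_pow_mod: "\<xi> ^ n = \<xi> ^ (n mod 6)"
  by (metis mod_mult_div_eq power_add power_mult power_one mult.right_neutral xi6 add.commute)

lemma xi_pow_inj: "i < 6 \<Longrightarrow> j < 6 \<Longrightarrow> \<xi> ^ i = \<xi> ^ j \<Longrightarrow> i = j"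
proof (induction i j rule: linorder_wlog)
  case (le i j)
  then have "\<xi> ^ i * \<xi> ^ (j - i) = \<xi> ^ i * 1" by (metis power_add le_add_diff_inverse mult.right_neutral)
  then have "\<xi> ^ (j - i) = 1" by (rule mult_left_cancel[THEN iffD1, rotated]) (use xi_nonzero in simp)
  then show ?case using xi_primitive[of "j - i"] le by force
qed auto

lemma xi_pow_eq_iff: "\<xi> ^ m = \<xi> ^ n \<longleftrightarrow> m mod 6 = n mod 6"
  using xi_pow_inj[of "m mod 6" "n mod 6"] xi_pow_mod[of m] xi_pow_mod[of n] by auto

lemma xi_cubes: "\<xi> ^ a * (\<xi> ^ a * \<xi> ^ a) = \<xi> ^ (3 * a)"
  by (simp add: eval_nat_numeral flip: power_add)

text \<open>
  The index \<open>k\<close> measures the distance of the weight \<open>(\<xi>^a, \<xi>^(3 a + k))\<close> from a degenerate one.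
\<close>

lemma generic_weight: "\<xi> ^ (3 * a + k) \<noteq> \<xi> ^ a * (\<xi> ^ a * \<xi> ^ a) \<longleftrightarrow> k mod 6 \<noteq> 0"
proof -
  have "(3 * a + k) mod 6 = (3 * a) mod 6 \<longleftrightarrow> k mod 6 = 0" by presburger
  then show ?thesis unfolding xi_cubes xi_pow_eq_iff by simp
qed

lemma V2_1: "k \<in> {1..5} \<Longrightarrow> \<xi> ^ k \<noteq> 1 * (1 * 1)"
  using generic_weight[of 0 k] by auto

lemma standard_rep_module: "Rep (standard_rep k a)"
  unfolding standard_rep_def using chi_module(1)[OF root_pow] V2_module(1)[OF root_pow root_pow] P4_module(1)[OF root_pow]
  by (simp only: split: if_split) blast

lemma gen_class_closed: "i < 6 \<Longrightarrow> gen_class i \<in> carrier GR"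
  using root_pow xi6 by (auto simp: gen_class_def intro!: cls_closed chi_module V2_module)

lemma cls_chi_V2:
  assumes "\<alpha> ^ 6 = 1" "\<beta> ^ 6 = 1" "\<gamma> ^ 6 = 1" "\<gamma> \<noteq> \<beta> * (\<beta> * \<beta>)"
  shows "cls (chi \<alpha>) \<otimes>\<^bsub>GR\<^esub> cls (V2 \<beta> \<gamma>) = cls (V2 (\<alpha> * \<beta>) (\<alpha> * (\<alpha> * \<alpha>) * \<gamma>))"
    "cls (V2 \<beta> \<gamma>) \<otimes>\<^bsub>GR\<^esub> cls (chi \<alpha>) = cls (V2 (\<alpha> * \<beta>) (\<alpha> * (\<alpha> * \<alpha>) * \<gamma>))"
proof -
  have r: "(\<alpha> * \<beta>) ^ 6 = 1" "(\<alpha> * (\<alpha> * \<alpha>) * \<gamma>) ^ 6 = 1" using assms by (simp_all add: power_mult_distrib)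
  note m = chi_module(1)[OF assms(1)] V2_module(1)[OF assms(2,3)] V2_module(1)[OF r]
  show "cls (chi \<alpha>) \<otimes>\<^bsub>GR\<^esub> cls (V2 \<beta> \<gamma>) = cls (V2 (\<alpha> * \<beta>) (\<alpha> * (\<alpha> * \<alpha>) * \<gamma>))"
    "cls (V2 \<beta> \<gamma>) \<otimes>\<^bsub>GR\<^esub> cls (chi \<alpha>) = cls (V2 (\<alpha> * \<beta>) (\<alpha> * (\<alpha> * \<alpha>) * \<gamma>))"
    using cls_tensor[OF m(1,2)] cls_tensor[OF m(2,1)] cls_iso[OF _ m(3) tensor_chi_V2(1)[OF assms]]
      cls_iso[OF _ m(3) tensor_chi_V2(2)[OF assms]] m by simp_all
qed

lemma cls_chi_chi:
  assumes "\<alpha> ^ 6 = 1" "\<beta> ^ 6 = 1"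
  shows "cls (chi \<alpha>) \<otimes>\<^bsub>GR\<^esub> cls (chi \<beta>) = cls (chi (\<alpha> * \<beta>))"
proof -
  have r: "(\<alpha> * \<beta>) ^ 6 = 1" using assms by (simp_all add: power_mult_distrib)
  note m = chi_module(1)[OF assms(1)] chi_module(1)[OF assms(2)] chi_module(1)[OF r]
  show ?thesis
    using cls_tensor[OF m(1,2)] cls_iso[OF _ m(3) tensor_chi_chi[OF assms]] m by simp
qed

lemma cls_V2_V2:
  assumes "\<alpha> ^ 6 = 1" "\<gamma> ^ 6 = 1" "\<beta> ^ 6 = 1" "\<delta> ^ 6 = 1" "\<gamma> \<noteq> \<alpha> * (\<alpha> * \<alpha>)" "\<delta> \<noteq> \<beta> * (\<beta> * \<beta>)"
  shows "\<gamma> * \<delta> \<noteq> \<alpha> * \<beta> * (\<alpha> * \<beta> * (\<alpha> * \<beta>)) \<Longrightarrow> cls (V2 \<alpha> \<gamma>) \<otimes>\<^bsub>GR\<^esub> cls (V2 \<beta> \<delta>) =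
      cls (V2 (\<alpha> * \<beta>) (\<gamma> * \<delta>)) \<oplus>\<^bsub>GR\<^esub> cls (V2 (\<xi> * (\<alpha> * \<beta>)) (- (\<gamma> * \<delta>)))"
    "\<gamma> * \<delta> = \<alpha> * \<beta> * (\<alpha> * \<beta> * (\<alpha> * \<beta>)) \<Longrightarrow> cls (V2 \<alpha> \<gamma>) \<otimes>\<^bsub>GR\<^esub> cls (V2 \<beta> \<delta>) = cls (P4 (\<xi> * (\<alpha> * \<beta>)))"
proof -
  have r: "(\<alpha> * \<beta>) ^ 6 = 1" "(\<gamma> * \<delta>) ^ 6 = 1" using assms by (simp_all add: power_mult_distrib)
  note m = V2_module(1)[OF assms(1,2)] V2_module(1)[OF assms(3,4)] V2_module(1)[OF r]
    V2_module(1)[OF root_shift(1)[OF r(1)] root_shift(3)[OF r(2)]] P4_module(1)[OF root_shift(1)[OF r(1)]]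
  note t = cls_tensor[OF m(1,2), symmetric]
  show "\<gamma> * \<delta> \<noteq> \<alpha> * \<beta> * (\<alpha> * \<beta> * (\<alpha> * \<beta>)) \<Longrightarrow> cls (V2 \<alpha> \<gamma>) \<otimes>\<^bsub>GR\<^esub> cls (V2 \<beta> \<delta>) =
      cls (V2 (\<alpha> * \<beta>) (\<gamma> * \<delta>)) \<oplus>\<^bsub>GR\<^esub> cls (V2 (\<xi> * (\<alpha> * \<beta>)) (- (\<gamma> * \<delta>)))"
    unfolding t cls_direct_sum[OF m(3,4), symmetric]
    by (rule cls_iso[OF _ _ tensor_V2_V2(1)[OF assms]]) (use m direct_sum_module in simp_all)
  show "\<gamma> * \<delta> = \<alpha> * \<beta> * (\<alpha> * \<beta> * (\<alpha> * \<beta>)) \<Longrightarrow> cls (V2 \<alpha> \<gamma>) \<otimes>\<^bsub>GR\<^esub> cls (V2 \<beta> \<delta>) = cls (P4 (\<xi> * (\<alpha> * \<beta>)))"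
    unfolding t by (rule cls_iso[OF _ _ tensor_V2_V2(2)[OF assms]]) (use m in simp_all)
qed

lemma gen_class_mult_0: "k \<in> {1..5} \<Longrightarrow> gen_class 0 \<otimes>\<^bsub>GR\<^esub> gen_class k = cls (V2 \<xi> (- (\<xi> ^ k)))"
  "k \<in> {1..5} \<Longrightarrow> gen_class k \<otimes>\<^bsub>GR\<^esub> gen_class 0 = cls (V2 \<xi> (- (\<xi> ^ k)))"
  using cls_chi_V2[OF xi6 power_one root_pow V2_1, of k] xi_powers(2)
  by (auto simp: gen_class_def xi_simps)

text \<open>
  The weights of the factors have \<open>\<alpha> = \<beta> = 1\<close>, so the product is degenerate exactly if \<open>\<xi>^(k + l) = 1\<close>. The
  summand \<open>V2 \<xi> (- \<xi>^(k + l))\<close> is the product of \<open>V2 1 (\<xi>^(k + l))\<close> with \<open>chi \<xi>\<close>, because \<open>\<xi>^3 = -1\<close>.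
\<close>

lemma gen_class_mult:
  assumes "k \<in> {1..5}" "l \<in> {1..5}"
  shows "(k + l) mod 6 \<noteq> 0 \<Longrightarrow> gen_class k \<otimes>\<^bsub>GR\<^esub> gen_class l = gen_class ((k + l) mod 6) \<oplus>\<^bsub>GR\<^esub> gen_class ((k + l) mod 6) \<otimes>\<^bsub>GR\<^esub> gen_class 0"
    "(k + l) mod 6 = 0 \<Longrightarrow> gen_class k \<otimes>\<^bsub>GR\<^esub> gen_class l = cls (P4 \<xi>)"
proof -
  note V = cls_V2_V2[OF power_one root_pow power_one root_pow V2_1[OF assms(1)] V2_1[OF assms(2)]]
  have p: "\<xi> ^ k * \<xi> ^ l = \<xi> ^ ((k + l) mod 6)" by (metis power_add xi_pow_mod)
  have nz: "k \<noteq> 0" "l \<noteq> 0" using assms by auto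
  show "gen_class k \<otimes>\<^bsub>GR\<^esub> gen_class l = gen_class ((k + l) mod 6) \<oplus>\<^bsub>GR\<^esub> gen_class ((k + l) mod 6) \<otimes>\<^bsub>GR\<^esub> gen_class 0" if "(k + l) mod 6 \<noteq> 0"
  proof -
    have m: "(k + l) mod 6 \<in> {1..5}" using that mod_less_divisor[of 6 "k + l"] by simp
    show ?thesis
      unfolding gen_class_mult_0(2)[OF m] using V(1) V2_1[OF m] that nz by (simp add: p gen_class_def)
  qed
  show "gen_class k \<otimes>\<^bsub>GR\<^esub> gen_class l = cls (P4 \<xi>)" if "(k + l) mod 6 = 0"
    using V(2) that nz by (simp add: p gen_class_def)
qed

lemma gen_class_commute: "i < 6 \<Longrightarrow> j < 6 \<Longrightarrow> gen_class i \<otimes>\<^bsub>GR\<^esub> gen_class j = gen_class j \<otimes>\<^bsub>GR\<^esub> gen_class i"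
proof -
  assume "i < 6" "j < 6"
  then consider "i = j" | "i = 0" "j \<in> {1..5}" | "j = 0" "i \<in> {1..5}" | "i \<in> {1..5}" "j \<in> {1..5}" "(i + j) mod 6 = 0"
    | "i \<in> {1..5}" "j \<in> {1..5}" "(i + j) mod 6 \<noteq> 0" by force
  then show ?thesis
  proof cases
    case 2
    show ?thesis unfolding 2(1) gen_class_mult_0[OF 2(2)] ..
  next
    case 3
    show ?thesis unfolding 3(1) gen_class_mult_0[OF 3(2)] ..
  next
    case 4
    have "(j + i) mod 6 = 0" using 4(3) unfolding add.commute[of j i] .
    then show ?thesis unfolding gen_class_mult(2)[OF 4(1,2,3)] by (rule gen_class_mult(2)[OF 4(2,1), symmetric])
  next
    case 5
    have "(j + i) mod 6 \<noteq> 0" using 5(3) unfolding add.commute[of j i] .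
    note ji = gen_class_mult(1)[OF 5(2,1) this]
    show ?thesis by (rule trans[OF gen_class_mult(1)[OF 5] ji[unfolded add.commute[of j i], symmetric]])
  qed simp
qed

end

section \<open>Kernel and image of the evaluation\<close>

lemma sum_single_term:
  fixes f :: "'a \<Rightarrow> 'b \<Rightarrow> 'c :: comm_monoid_add"
  assumes "finite I" "finite J" "i \<in> I" "j \<in> J"
    and "\<And>i' j'. i' \<in> I \<Longrightarrow> j' \<in> J \<Longrightarrow> (i', j') \<noteq> (i, j) \<Longrightarrow> f i' j' = 0"
  shows "(\<Sum>i'\<in>I. \<Sum>j'\<in>J. f i' j') = f i j"
proof -
  have "(\<Sum>i'\<in>I. \<Sum>j'\<in>J. f i' j') = (\<Sum>p\<in>I \<times> J. f (fst p) (snd p))"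
    by (simp add: sum.cartesian_product case_prod_unfold)
  also have "\<dots> = (\<Sum>p\<in>{(i, j)}. f (fst p) (snd p))"
  proof (rule sum.mono_neutral_right)
    show "\<forall>p\<in>I \<times> J - {(i, j)}. f (fst p) (snd p) = 0"
    proof
      fix p assume "p \<in> I \<times> J - {(i, j)}"
      then show "f (fst p) (snd p) = 0" by (intro assms(5)) auto
    qed
  qed (use assms in auto)
  finally show ?thesis by simp
qed

text \<open>
  A homomorphism that sends the variables to the generating classes. Its kernel is the ideal of relations
  and its image is the projective class ring.
\<close>

locale green_evaluation = double_params \<xi> \<theta> for \<xi> \<theta> :: "'k :: field_char_0" +
  fixes h :: "poly6 \<Rightarrow> ('k rep set \<Rightarrow>\<^sub>0 int) set"
  assumes h_hom: "h \<in> Ring.ring_hom ring_of_type_algebra GR" and h_var: "i < 6 \<Longrightarrow> h (Y_var i) = gen_class i"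
begin

lemma ring_hom_ring_h: "ring_hom_ring ring_of_type_algebra GR h"
  by (rule ring_hom_ringI2[OF ring_ring_of_type_algebra ring_GR h_hom])

lemma h_simps:
  "h p \<in> carrier GR" "h (p + q) = h p \<oplus>\<^bsub>GR\<^esub> h q" "h (p * q) = h p \<otimes>\<^bsub>GR\<^esub> h q" "h 1 = \<one>\<^bsub>GR\<^esub>"
  "h 0 = \<zero>\<^bsub>GR\<^esub>" "h (- p) = \<ominus>\<^bsub>GR\<^esub> h p"
proof -
  interpret H: ring_hom_ring "ring_of_type_algebra :: poly6 ring" GR h by (rule ring_hom_ring_h)
  show c: "h p \<in> carrier GR" and a: "h (p + q) = h p \<oplus>\<^bsub>GR\<^esub> h q" and "h (p * q) = h p \<otimes>\<^bsub>GR\<^esub> h q" and "h 1 = \<one>\<^bsub>GR\<^esub>" for p q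
    using h_hom by (auto simp: Ring.ring_hom_def ring_of_type_simps)
  show z: "h 0 = \<zero>\<^bsub>GR\<^esub>" using H.hom_zero by (simp add: ring_of_type_simps)
  show "h (- p) = \<ominus>\<^bsub>GR\<^esub> h p"
    by (rule H.S.minus_equality[symmetric, OF _ c c]) (simp add: z flip: a)
qed

lemma h_eq_iff: "h p = h q \<longleftrightarrow> h (p - q) = \<zero>\<^bsub>GR\<^esub>"
proof -
  interpret G: ring GR by (rule ring_GR)
  have "h p = h (p - q) \<oplus>\<^bsub>GR\<^esub> h q" unfolding h_simps(2)[symmetric] by simp
  then show ?thesis using G.add.l_cancel_one[of "h q" "h (p - q)"] G.add.r_cancel_one[of "h q" "h (p - q)"] h_simps(1) by auto
qed

lemma h_mult_cong: "h p = h q \<Longrightarrow> h (p * r) = h (q * r)"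
  by (simp add: h_simps)

lemma h_Y_product:
  assumes "k \<in> {1..5}" "l \<in> {1..5}" "(k + l) mod 6 \<noteq> 0"
  shows "h (Y_var k * Y_var l) = h (Y_var ((k + l) mod 6) + Y_var ((k + l) mod 6) * Y_var 0)"
  using gen_class_mult(1)[OF assms] assms by (simp add: h_simps h_var)

lemma h_Y_opposite: "k \<in> {1..5} \<Longrightarrow> h (Y_var k * Y_var (6 - k)) = cls (P4 \<xi>)"
proof -
  assume k: "k \<in> {1..5}"
  then have "6 - k \<in> {1..5}" "(k + (6 - k)) mod 6 = 0" by auto
  from gen_class_mult(2)[OF k this] show ?thesis using k by (simp add: h_simps h_var)
qed

text \<open>
  The cubic relation follows from the quadratic ones: \<open>Y_i Y_3^2\<close> is a product of three variables two of which
  have indices that do not add up to a multiple of six. For \<open>i \<noteq> 3\<close> these are \<open>i\<close> and \<open>3\<close>; for \<open>i = 3\<close> the square of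
  \<open>Y_3\<close> is first replaced by \<open>Y_1 Y_5\<close>.
\<close>

lemma h_Y_cube:
  assumes i: "i \<in> {1..5}"
  shows "h (Y_var i * Y_var 3 ^ 2) = h (2 * Y_var i * Y_var 0 + Y_var i * Y_var 0 ^ 2 + Y_var i)"
proof -
  have step: "h (Y_var k * Y_var l * Y_var m) = h (2 * Y_var i * Y_var 0 + Y_var i * Y_var 0 ^ 2 + Y_var i)"
    if "k \<in> {1..5}" "l \<in> {1..5}" "m \<in> {1..5}" "(k + l) mod 6 \<noteq> 0" "(k + l + m) mod 6 = i" for k l m
  proof -
    let ?n = "(k + l) mod 6"
    have n: "?n \<in> {1..5}" using that(4) mod_less_divisor[of 6 "k + l"] by simp
    \<comment> \<open>Both products have two terms, and the four terms add up to the right side of the relation.\<close>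
    have nm: "(?n + m) mod 6 = i" using that(5) by (simp add: mod_simps)
    have "h (Y_var k * Y_var l * Y_var m) = h ((Y_var ?n + Y_var ?n * Y_var 0) * Y_var m)"
      by (rule h_mult_cong[OF h_Y_product[OF that(1,2,4)]])
    also have "\<dots> = h (Y_var ?n * Y_var m * (1 + Y_var 0))" by (simp add: algebra_simps)
    also have "\<dots> = h ((Y_var i + Y_var i * Y_var 0) * (1 + Y_var 0))"
      by (rule h_mult_cong) (use h_Y_product[OF n that(3)] nm i in simp)
    finally show ?thesis by (simp add: algebra_simps power2_eq_square)
  qed
  show ?thesis
  proof (cases "i = 3")
    case False
    then have "(i + 3) mod 6 \<noteq> 0" "(i + 3 + 3) mod 6 = i" using i by (simp_all, presburger)
    then show ?thesis using step[of i 3 3] i by (simp add: power2_eq_square mult.assoc)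
  next
    case True
    have "h (Y_var 3 ^ 2 * Y_var 3) = h (Y_var 1 * Y_var 5 * Y_var 3)"
      by (rule h_mult_cong) (use h_Y_opposite[of 1] h_Y_opposite[of 3] in \<open>simp add: power2_eq_square\<close>)
    then show ?thesis using step[of 3 1 5] True by (simp add: algebra_simps)
  qed
qed

lemma h_Y0_power: "h (Y_var 0 ^ a) = cls (chi (\<xi> ^ a))"
proof (induction a)
  case (Suc a)
  then show ?case using cls_chi_chi[OF xi6 root_pow] by (simp add: h_simps h_var gen_class_def)
qed (simp add: h_simps cls_one)

lemma h_J_relations:
  assumes "r \<in> J_relations"
  shows "h r = \<zero>\<^bsub>GR\<^esub>"
proof -
  note zero = h_eq_iff[THEN iffD1]
  have "h (Y_var 0 ^ 6) = h 1" unfolding h_Y0_power h_simps(4) cls_one xi6 ..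
  note Y0 = zero[OF this]
  have "h (Y_var j * Y_var (6 - j)) = h (Y_var 3 ^ 2)" if "j \<in> {1..5}" for j
    using h_Y_opposite[OF that] h_Y_opposite[of 3] by (simp add: power2_eq_square)
  note opposite = zero[OF this]
  show ?thesis
    using assms unfolding J_relations_def
    by (elim UnE CollectE exE conjE singletonE; hypsubst)
      (rule Y0, erule zero[OF h_Y_cube], erule opposite, erule (2) zero[OF h_Y_product])
qed

lemma a_kernel_h: "a_kernel ring_of_type_algebra GR h = {p. h p = \<zero>\<^bsub>GR\<^esub>}"
  unfolding a_kernel_def' ring_of_type_simps(1) by blast

lemma h_J_ideal: "p \<in> J_ideal \<Longrightarrow> h p = \<zero>\<^bsub>GR\<^esub>"
proof -
  have "J_ideal \<subseteq> {p. h p = \<zero>\<^bsub>GR\<^esub>}"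
    unfolding J_ideal_def a_kernel_h[symmetric]
  proof (rule ring.genideal_minimal[OF ring_ring_of_type_algebra ring_hom_ring.kernel_is_ideal[OF ring_hom_ring_h]])
    show "J_relations \<subseteq> a_kernel ring_of_type_algebra GR h" unfolding a_kernel_h using h_J_relations by blast
  qed
  then show "p \<in> J_ideal \<Longrightarrow> h p = \<zero>\<^bsub>GR\<^esub>" by blast
qed

lemma h_basis_monomial:
  assumes k: "k \<le> 6"
  shows "h (basis_monomial k a) = cls (standard_rep k a)"
proof -
  have V: "h (Y_var 0 ^ a * Y_var k) = cls (V2 (\<xi> ^ a) (\<xi> ^ (3 * a + k)))" if "k \<in> {1..5}" for k
    using cls_chi_V2(1)[OF root_pow power_one root_pow V2_1[OF that], of a] that
    unfolding h_simps(3) h_Y0_power mult_1_right xi_cubes unfolding power_add[symmetric] by (simp add: h_var gen_class_def)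
  consider "k = 0" | "k = 6" | "k \<in> {1..5}" using k by force
  then show ?thesis
  proof cases
    case 1
    then show ?thesis by (simp add: basis_monomial_def standard_rep_def h_Y0_power)
  next
    case 2
    have gen: "\<xi> ^ (3 * a + 3) \<noteq> \<xi> ^ a * (\<xi> ^ a * \<xi> ^ a)" unfolding generic_weight by simp
    have eq: "\<xi> ^ (3 * a + 3) * \<xi> ^ 3 = \<xi> ^ a * 1 * (\<xi> ^ a * 1 * (\<xi> ^ a * 1))"
      unfolding mult_1_right xi_cubes power_add[symmetric] xi_pow_eq_iff by presburger
    have "h (basis_monomial k a) = h (Y_var 0 ^ a * Y_var 3) \<otimes>\<^bsub>GR\<^esub> h (Y_var 3)"
      unfolding h_simps(3)[symmetric] 2 by (simp add: basis_monomial_def power2_eq_square mult.assoc)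
    also have "\<dots> = cls (V2 (\<xi> ^ a) (\<xi> ^ (3 * a + 3))) \<otimes>\<^bsub>GR\<^esub> cls (V2 1 (\<xi> ^ 3))"
      using V[of 3] by (simp add: h_var gen_class_def)
    also have "\<dots> = cls (P4 (\<xi> * (\<xi> ^ a * 1)))"
      by (rule cls_V2_V2(2)[OF root_pow root_pow power_one root_pow gen V2_1 eq]) simp
    finally show ?thesis unfolding standard_rep_def 2 by simp
  next
    case 3
    then show ?thesis using V[OF 3] by (simp add: basis_monomial_def standard_rep_def)
  qed
qed

text \<open>
  The rank of \<open>d\<close> extends to an additive function on the Green ring, hence to an additive function of
  polynomials.
\<close>

lemma normal_form_rank:
  assumes "h (normal_form c) = \<zero>\<^bsub>GR\<^esub>"
  shows "(\<Sum>k\<le>6. \<Sum>a<6. c k a * rank_of d (standard_rep k a)) = 0"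
proof -
  obtain \<Phi> where \<Phi>: "\<And>x y. x \<in> carrier GR \<Longrightarrow> y \<in> carrier GR \<Longrightarrow> \<Phi> (x \<oplus>\<^bsub>GR\<^esub> y) = \<Phi> x + \<Phi> y"
    "\<And>V. Rep V \<Longrightarrow> \<Phi> (cls V) = rank_of d V"
    using green_functional[OF rank_of_iso[of _ _ d] rank_of_direct_sum] by blast
  interpret A: Modules.additive "\<lambda>p. \<Phi> (h p)" by standard (simp add: h_simps \<Phi>)
  have nat: "\<Phi> (h (of_nat n * p)) = int n * \<Phi> (h p)" for n p
    by (induction n) (simp_all add: A.zero A.add distrib_right)
  have int: "\<Phi> (h (of_int n * p)) = n * \<Phi> (h p)" for n p
  proof (cases n rule: int_cases2)
    case (nonpos m)
    then show ?thesis using nat[of m p] by (simp add: A.minus)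
  qed (simp add: nat)
  have "0 = \<Phi> (h (normal_form c))" using assms A.zero by (simp add: h_simps)
  also have "\<dots> = (\<Sum>k\<le>6. \<Sum>a<6. c k a * rank_of d (standard_rep k a))"
    unfolding normal_form_def A.sum int by (intro sum.cong refl) (simp add: h_basis_monomial \<Phi>(2) standard_rep_module)
  finally show ?thesis ..
qed

lemma standard_rep_cases:
  "standard_rep 0 a = chi (\<xi> ^ a)" "standard_rep 6 a = P4 (\<xi> ^ (a + 1))" "k \<noteq> 0 \<Longrightarrow> k \<noteq> 6 \<Longrightarrow> standard_rep k a = V2 (\<xi> ^ a) (\<xi> ^ (3 * a + k))"
  unfolding standard_rep_def by simp_all

text \<open>
  The classes of the \<open>42\<close> standard representations are linearly independent over the integers, as the ranks of
  suitable elements show: each element \<open>V2_elem\<close> is nonzero on only one of them, and likewise each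
  \<open>P4_elem\<close>. Once the coefficients of the modules \<open>V2\<close> and \<open>P4\<close> vanish, \<open>chi_elem\<close> isolates the
  remaining ones.
\<close>

lemma normal_form_unique:
  assumes h0: "h (normal_form c) = \<zero>\<^bsub>GR\<^esub>" and k: "k \<le> 6" and a: "a < 6"
  shows "c k a = 0"
proof -
  have pick: "c k a = 0" if "k \<le> 6" "a < 6" "rank_of d (standard_rep k a) \<noteq> 0"
    "\<And>l b. l \<le> 6 \<Longrightarrow> b < 6 \<Longrightarrow> (l, b) \<noteq> (k, a) \<Longrightarrow> c l b * rank_of d (standard_rep l b) = 0" for k a d
    using normal_form_rank[OF h0, of d] sum_single_term[of "{..6}" "{..<6}" k a "\<lambda>k a. c k a * rank_of d (standard_rep k a)"] that
    by simp
  have gen: "\<xi> ^ (3 * a + k) \<noteq> \<xi> ^ a * (\<xi> ^ a * \<xi> ^ a)" if "k \<noteq> 0" "k \<noteq> 6" "k \<le> 6" for k a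
    using generic_weight[of a k] that by (metis le_neq_implies_less mod_less)
  have V: "c k a = 0" if k: "k \<noteq> 0" "k \<noteq> 6" "k \<le> 6" and a: "a < 6" for k a
  proof (rule pick[OF k(3) a, of "V2_elem (\<xi> ^ a) (\<xi> ^ (3 * a + k))"])
    show "rank_of (V2_elem (\<xi> ^ a) (\<xi> ^ (3 * a + k))) (standard_rep k a) \<noteq> 0"
      using k rank_V2(1)[OF root_pow root_pow root_pow root_pow gen[OF k] gen[OF k]] by (simp add: standard_rep_def)
    fix l b :: nat assume l: "l \<le> 6" "b < 6" "(l, b) \<noteq> (k, a)"
    have "rank_of (V2_elem (\<xi> ^ a) (\<xi> ^ (3 * a + k))) (standard_rep l b) = 0"
    proof (cases "l = 0 \<or> l = 6")
      case True
      then show ?thesis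
      proof
        assume l: "l = 0"
        show ?thesis unfolding l standard_rep_cases by (rule rank_chi(1)[OF root_pow root_pow])
      next
        assume l: "l = 6"
        show ?thesis unfolding l standard_rep_cases by (rule rank_P4(1)[OF root_pow root_pow root_pow gen[OF k]])
      qed
    next
      case False
      have "\<not> (\<xi> ^ b = \<xi> ^ a \<and> \<xi> ^ (3 * b + l) = \<xi> ^ (3 * a + k))"
      proof
        assume eq: "\<xi> ^ b = \<xi> ^ a \<and> \<xi> ^ (3 * b + l) = \<xi> ^ (3 * a + k)"
        then have "b = a" using xi_pow_inj l(2) a by blast
        with eq have "\<xi> ^ l = \<xi> ^ k" by (simp add: power_add)
        then have "l = k" using xi_pow_inj[of l k] False k l by linarith
        with \<open>b = a\<close> l(3) show False by simp
      qed
      then show ?thesis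
        using False rank_V2(1)[OF root_pow root_pow root_pow root_pow gen[of l b] gen[OF k]] l(1) by (simp add: standard_rep_def)
    qed
    then show "c l b * rank_of (V2_elem (\<xi> ^ a) (\<xi> ^ (3 * a + k))) (standard_rep l b) = 0" by simp
  qed
  have P: "c 6 a = 0" if a: "a < 6" for a
  proof (rule pick[of 6 a, OF _ a, of "P4_elem (\<xi> ^ (a + 1))"])
    have g: "\<xi> ^ (3 * b + 1) \<noteq> \<xi> ^ b * (\<xi> ^ b * \<xi> ^ b)" for b by (rule gen) simp_all
    note P4 = rank_P4(2)[OF root_pow root_pow root_pow g]
    show "rank_of (P4_elem (\<xi> ^ (a + 1))) (standard_rep 6 a) \<noteq> 0"
      unfolding standard_rep_cases P4 by simp
    fix l b :: nat assume l: "l \<le> 6" "b < 6" "(l, b) \<noteq> (6, a)"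
    have "rank_of (P4_elem (\<xi> ^ (a + 1))) (standard_rep l b) = 0" if "l = 0 \<or> l = 6"
    proof (cases "l = 0")
      case True
      show ?thesis unfolding True standard_rep_cases by (rule rank_chi(2)[OF root_pow root_pow])
    next
      case False
      then have ba: "b \<noteq> a" and l6: "l = 6" using that l(3) by auto
      have "\<xi> ^ (b + 1) \<noteq> \<xi> ^ (a + 1)" using xi_pow_inj[OF l(2) a] ba by auto
      then show ?thesis unfolding l6 standard_rep_cases P4 .
    qed
    then show "c l b * rank_of (P4_elem (\<xi> ^ (a + 1))) (standard_rep l b) = 0"
      using V[of l b] l by (cases "l = 0 \<or> l = 6") auto
  qed simp
  have C: "c 0 a = 0" if a: "a < 6" for a
  proof (rule pick[of 0 a, OF _ a, of "chi_elem (\<xi> ^ a)"])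
    show "rank_of (chi_elem (\<xi> ^ a)) (standard_rep 0 a) \<noteq> 0"
      using rank_chi(3)[OF root_pow root_pow] by (simp add: standard_rep_def)
    fix l b :: nat assume l: "l \<le> 6" "b < 6" "(l, b) \<noteq> (0, a)"
    show "c l b * rank_of (chi_elem (\<xi> ^ a)) (standard_rep l b) = 0"
    proof (cases "l = 0")
      case True
      then have "\<xi> ^ b \<noteq> \<xi> ^ a" using xi_pow_inj[OF l(2) a] l(3) by auto
      then show ?thesis using True rank_chi(3)[OF root_pow root_pow] by (simp add: standard_rep_def)
    qed (use V[of l b] P[of b] l in \<open>cases "l = 6"; simp\<close>)
  qed simp
  show ?thesis using V[of k a] P[of a] C[of a] k a by (cases "k = 0"; cases "k = 6"; simp)
qed

lemma h_eq_0_iff: "h p = \<zero>\<^bsub>GR\<^esub> \<longleftrightarrow> p \<in> J_ideal"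
proof
  assume p: "h p = \<zero>\<^bsub>GR\<^esub>"
  obtain c where c: "p - normal_form c \<in> J_ideal"
    using all_normalizable[of p] by (auto simp: normalizable_def J_cong_def)
  have "h p = h (normal_form c)" unfolding h_eq_iff by (rule h_J_ideal[OF c])
  with p have "h (normal_form c) = \<zero>\<^bsub>GR\<^esub>" by metis
  note c0 = normal_form_unique[OF this]
  have "normal_form c = 0" unfolding normal_form_def by (intro sum.neutral ballI) (simp add: c0)
  with c show "p \<in> J_ideal" by simp
qed (rule h_J_ideal)

text \<open>
  The weights \<open>(\<alpha>, \<gamma>)\<close> are pairs of powers of \<open>\<xi>\<close>, so every simple module and every \<open>P4\<close> is isomorphic to a
  standard representation.
\<close>

lemma cls_in_range:
  "\<alpha> ^ 6 = 1 \<Longrightarrow> cls (chi \<alpha>) \<in> range h"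
  "\<alpha> ^ 6 = 1 \<Longrightarrow> \<gamma> ^ 6 = 1 \<Longrightarrow> \<gamma> \<noteq> \<alpha> * (\<alpha> * \<alpha>) \<Longrightarrow> cls (V2 \<alpha> \<gamma>) \<in> range h"
  "\<alpha> ^ 6 = 1 \<Longrightarrow> cls (P4 \<alpha>) \<in> range h"
proof -
  have standard_rep: "cls (standard_rep k a) \<in> range h" if "k \<le> 6" for k a
    using h_basis_monomial[OF that, of a] by (metis rangeI)
  show "cls (chi \<alpha>) \<in> range h" if \<alpha>: "\<alpha> ^ 6 = 1"
  proof -
    obtain i where "\<alpha> = \<xi> ^ i" by (rule roots[OF \<alpha>])
    then show ?thesis using standard_rep[of 0 i] by (simp add: standard_rep_def)
  qed
  show "cls (V2 \<alpha> \<gamma>) \<in> range h" if \<alpha>: "\<alpha> ^ 6 = 1" and \<gamma>: "\<gamma> ^ 6 = 1" and ne: "\<gamma> \<noteq> \<alpha> * (\<alpha> * \<alpha>)"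
  proof -
    obtain a j where a: "\<alpha> = \<xi> ^ a" and j: "\<gamma> = \<xi> ^ j" using roots[OF \<alpha>] roots[OF \<gamma>] by metis
    \<comment> \<open>A solution of \<open>3 a + k = j\<close> modulo six, as \<open>-3 = 3\<close>.\<close>
    define k where "k = (j + 3 * a) mod 6"
    have "(3 * a + k) mod 6 = j mod 6" unfolding k_def by presburger
    then have \<gamma>k: "\<gamma> = \<xi> ^ (3 * a + k)" unfolding j xi_pow_eq_iff by simp
    have "k < 6" unfolding k_def by simp
    moreover have "k \<noteq> 0"
    proof
      assume "k = 0"
      then show False using ne unfolding \<gamma>k a xi_cubes by simp
    qed
    ultimately show ?thesis using standard_rep[of k a] by (simp add: standard_rep_def a \<gamma>k)
  qed
  show "cls (P4 \<alpha>) \<in> range h" if \<alpha>: "\<alpha> ^ 6 = 1"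
  proof -
    obtain i where i: "\<alpha> = \<xi> ^ i" by (rule roots[OF \<alpha>])
    \<comment> \<open>The standard representation with index \<open>6\<close> and exponent \<open>a\<close> is \<open>P4 (\<xi>^(a + 1))\<close>.\<close>
    have "\<alpha> = \<xi> ^ (i + 5 + 1)" unfolding i xi_pow_eq_iff by presburger
    then show ?thesis using standard_rep[of 6 "i + 5"] by (simp only: standard_rep_def) simp
  qed
qed

text \<open>
  A module of dimension zero is isomorphic to its own double.
\<close>

lemma cls_zero:
  assumes M: "Rep M" "fst M = 0"
  shows "cls M = \<zero>\<^bsub>GR\<^esub>"
proof -
  interpret G: ring GR by (rule ring_GR)
  have "Iso M (direct_sum M M)"
    by (rule Iso_of_equal_Act) (use M direct_sum_module(1)[OF M(1) M(1)] in \<open>auto intro!: eq_matI\<close>)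
  then have "cls M = cls M \<oplus>\<^bsub>GR\<^esub> cls M"
    using cls_iso[OF M(1) direct_sum_module(1)[OF M(1) M(1)]] cls_direct_sum[OF M(1) M(1)] by simp
  then show ?thesis using G.add.l_cancel_one[OF cls_closed[OF M(1)] cls_closed[OF M(1)]] by metis
qed

text \<open>
  The variables go to classes of simple modules, which gives one inclusion. The other one holds because the
  range is a subring that contains the classes of all simple modules and, by the decomposition of
  projective modules, those of all projective ones.
\<close>

lemma range_h: "range h = generate_ring GR (cls ` {V. simple_module \<xi> \<theta> V \<or> projective_module \<xi> \<theta> V})"
proof -
  let ?S = "cls ` {V. simple_module \<xi> \<theta> V \<or> projective_module \<xi> \<theta> V}"
  have range_add: "x \<oplus>\<^bsub>GR\<^esub> y \<in> range h" if "x \<in> range h" "y \<in> range h" for x y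
    using that h_simps(2) by (metis (no_types, opaque_lifting) imageE rangeI)
  have "h p \<in> generate_ring GR ?S" for p
  proof (induction p rule: poly6_induct)
    case one
    show ?case unfolding h_simps(4) by (rule generate_ring.one)
  next
    case (add p q)
    show ?case unfolding h_simps(2) by (rule generate_ring.eng_add[OF add])
  next
    case (uminus p)
    show ?case unfolding h_simps(6) by (rule generate_ring.a_inv[OF uminus])
  next
    case (var i p)
    have "i = 0 \<or> i \<in> {1..5}" using var(1) by auto
    then have "gen_class i \<in> ?S"
      using chi_simple[OF xi6] V2_simple[OF power_one root_pow V2_1, of i] unfolding gen_class_def by auto
    then show ?case unfolding h_simps(3) h_var[OF var(1)]
      by (intro generate_ring.eng_mult generate_ring.incl var(2))
  qed
  moreover have "x \<in> range h" if "x \<in> generate_ring GR ?S" for x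
    using that
  proof induction
    case one
    then show ?case using h_simps(4) by (metis rangeI)
  next
    case (incl x)
    then obtain V where V: "x = cls V" "simple_module \<xi> \<theta> V \<or> projective_module \<xi> \<theta> V" by auto
    from V(2) show ?case
    proof
      assume S: "simple_module \<xi> \<theta> V"
      then have R: "Rep V" by (simp add: simple_module_def)
      from simple_module_classification[OF S] show ?thesis
      proof (elim disjE exE conjE)
        fix \<alpha> assume *: "\<alpha> ^ 6 = 1" "Iso V (chi \<alpha>)"
        show ?thesis unfolding V(1) cls_iso[OF R chi_module(1)[OF *(1)] *(2)] by (rule cls_in_range(1)[OF *(1)])
      next
        fix \<alpha> \<gamma> assume *: "\<alpha> ^ 6 = 1" "\<gamma> ^ 6 = 1" "\<gamma> \<noteq> \<alpha> * (\<alpha> * \<alpha>)" "Iso V (V2 \<alpha> \<gamma>)"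
        show ?thesis unfolding V(1) cls_iso[OF R V2_module(1)[OF *(1,2)] *(4)] by (rule cls_in_range(2)[OF *(1-3)])
      qed
    next
      assume "projective_module \<xi> \<theta> V"
      then have "cls V \<in> range h"
      proof (induction rule: projective_module_induct)
        case (zero M)
        then show ?case using cls_zero h_simps(5) by (metis rangeI)
      next
        case (V2 M K \<alpha> \<gamma>)
        note m = V2_module(1)[OF V2(3,4)]
        have "cls M = cls (V2 \<alpha> \<gamma>) \<oplus>\<^bsub>GR\<^esub> cls K"
          using cls_iso[OF V2(1) direct_sum_module(1)[OF m V2(2)] V2(6)] cls_direct_sum[OF m V2(2)] by simp
        then show ?case using range_add[OF cls_in_range(2)[OF V2(3-5)] V2(7)] by simp
      next
        case (P4 M K \<alpha>)
        note m = P4_module(1)[OF P4(3)]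
        have "cls M = cls (P4 \<alpha>) \<oplus>\<^bsub>GR\<^esub> cls K"
          using cls_iso[OF P4(1) direct_sum_module(1)[OF m P4(2)] P4(4)] cls_direct_sum[OF m P4(2)] by simp
        then show ?case using range_add[OF cls_in_range(3)[OF P4(3)] P4(5)] by simp
      qed
      then show ?thesis using V(1) by simp
    qed
  next
    case (a_inv x)
    then show ?case using h_simps(6) by (metis (no_types, opaque_lifting) imageE rangeI)
  next
    case (eng_add x y)
    then show ?case by (intro range_add)
  next
    case (eng_mult x y)
    then show ?case using h_simps(3) by (metis (no_types, opaque_lifting) imageE rangeI)
  qed
  ultimately show ?thesis by blast
qed

lemma projective_class_ring_iso:
  "projective_class_ring \<xi> \<theta> \<simeq> (ring_of_type_algebra :: poly6 ring) Quot J_ideal"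
proof -
  have ker: "a_kernel ring_of_type_algebra GR h = J_ideal"
    unfolding a_kernel_h h_eq_0_iff by (rule Collect_mem_eq)
  have img: "GR\<lparr>carrier := h ` carrier ring_of_type_algebra\<rparr> = projective_class_ring \<xi> \<theta>"
    unfolding projective_class_ring_def ring_of_type_simps(1) range_h ..
  have "(ring_of_type_algebra :: poly6 ring) Quot J_ideal \<simeq> projective_class_ring \<xi> \<theta>"
    using ring_hom_ring.FactRing_iso_set_aux[OF ring_hom_ring_h] unfolding ker img is_ring_iso_def by blast
  then show ?thesis
    using ideal.quotient_is_ring[OF ring_hom_ring.kernel_is_ideal[OF ring_hom_ring_h]] unfolding ker
    by (rule ring_iso_sym[rotated])
qed

end

theorem theorem3p13:
  fixes \<xi> \<theta> :: "'k :: {alg_closed_field, field_char_0}"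
  assumes "\<xi> ^ 6 = 1" and "\<And>m. 0 < m \<Longrightarrow> m < 6 \<Longrightarrow> \<xi> ^ m \<noteq> 1"
    and "\<theta> ^ 2 = \<xi> ^ 2"
  shows "projective_class_ring \<xi> \<theta> \<simeq> (ring_of_type_algebra :: poly6 ring) Quot J_ideal"
proof -
  interpret double_params \<xi> \<theta> by unfold_locales (use assms in auto)
  interpret G: ring GR by (rule ring_GR)
  obtain h where h: "h \<in> Ring.ring_hom (ring_of_type_algebra :: poly6 ring) GR" "\<And>i. i < 6 \<Longrightarrow> h (Y_var i) = gen_class i"
    by (rule G.poly6_evaluation[of gen_class, OF gen_class_closed gen_class_commute]) (assumption | rule that)+
  interpret green_evaluation \<xi> \<theta> h by unfold_locales (rule h)+
  show ?thesis by (rule projective_class_ring_iso)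
qed

end
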